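(* Let $p_1,\dots,p_m$ be distinct points of $\mathbb S^2$, let $K\in C^{1,+}(\mathbb S^2)$, and let $\beta=(\beta_1,\dots,\beta_m)\in\mathcal A_m$. If the equation $$-\Delta_{\mathbb S^2}u=Ke^{2u}-2\pi\sum_{i=1}^m\beta_i\delta_{p_i}-1$$ has no solution $u\in\bigcap_{p\in[1,2)}W^{1,p}(\mathbb S^2,g_{\mathbb S^2})$, then there exists a neighbourhood $\mathscr U$ of $(K,\beta)$ in $C^{1}(\mathbb S^2)\times(-1,\infty)^{m}$ such that for every $(\tilde K,\tilde\beta)\in\mathscr U$ the equation $$-\Delta_{\mathbb S^2}u=\tilde Ke^{2u}-2\pi\sum_{i=1}^m\tilde\beta_i\delta_{p_i}-1$$ has no solution in $\bigcap_{p\in[1,2)}W^{1,p}(\mathbb S^2,g_{\mathbb S^2})$.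
   Context: $g_{\mathbb S^2}$ is the round metric of curvature $1$ on $\mathbb S^2$ and $\Delta_{\mathbb S^2}$ its Laplacian; $\delta_p$ is the Dirac measure at $p$. $C^{1,+}(\mathbb S^2)$ is the set of positive $C^1$ functions on $\mathbb S^2$; $C^1(\mathbb S^2)$ carries the $C^1$ topology. Solutions are understood in the sense of distributions, with $Ke^{2u}\in L^1(\mathbb S^2,g_{\mathbb S^2})$ (respectively $\tilde Ke^{2u}\in L^1$). For $\beta\in\mathbb R^m$ put $\chi(\mathbb S^2,\beta)=2+\sum_{i=1}^m\beta_i$ and $$\mathbb F(\beta)=\Big\{i\in\{1,\dots,m\}:\beta_i\le\tfrac12\sum_{k=1}^m\beta_k\Big\}.$$ $\mathcal A_m$ is the set of all $\beta=(\beta_1,\dots,\beta_m)\in\mathbb R^m$ such that: $\beta_i>-1$ and $\beta_i\ne0$ for all $i$; $\tfrac12\chi(\mathbb S^2,\beta)\in(0,+\infty)\setminus\mathbb N$; and for every $J\subset\mathbb F(\beta)$, $$\tfrac12\chi(\mathbb S^2,\beta)-\sum_{j\in J}\beta_j\notin\Big\{|J|,|J|+1,\dots,|J|+\big[\tfrac12\chi(\mathbb S^2,\beta)\big]\Big\},$$ where $|J|$ is the cardinality of $J$ and $[\cdot]$ denotes the integer part. *)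

theory Defs
  imports "HOL-Analysis.Analysis"
begin

abbreviation S2 :: "(real^3) set" where
  "S2 \<equiv> sphere 0 1"

text \<open>
  Area measure of the round metric, in the polar-coordinate normalisation: the area of a Borel set
  \<open>A\<close> is three times the volume of the cone \<open>{r x | 0 < r < 1, x \<in> A}\<close>. Note that
  \<open>sgn x = x / norm x\<close> on a normed space.
\<close>

definition area_S2 :: "(real^3) measure" where
  "area_S2 = scale_measure 3
     (distr (restrict_space lborel (ball 0 1 - {0})) (restrict_space borel S2) sgn)"

primrec Ck_on :: "nat \<Rightarrow> 'a::real_normed_vector set \<Rightarrow> ('a \<Rightarrow> 'b::real_normed_vector) \<Rightarrow> bool" where
  "Ck_on 0 S f \<longleftrightarrow> continuous_on S f"
| "Ck_on (Suc k) S f \<longleftrightarrow> (\<forall>x\<in>S. f differentiable at x) \<and>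
     (\<forall>v. Ck_on k S (\<lambda>x. frechet_derivative f (at x) v))"

text \<open>
  Differential calculus on the sphere is expressed through the extension \<open>f \<circ> sgn\<close>, which is constant
  along rays. As \<open>sgn\<close> is a smooth retraction (and submersion) of the punctured space onto the sphere,
  \<open>f\<close> is of class \<open>C\<^sup>k\<close> on the sphere iff \<open>f \<circ> sgn\<close> is so on the punctured space. The radial derivative
  of \<open>f \<circ> sgn\<close> vanishes, so at points of the sphere its Euclidean gradient is the Riemannian gradient
  of \<open>f\<close>, and for a tangent field \<open>X\<close> the trace of the derivative of \<open>X \<circ> sgn\<close> is the Riemannian
  divergence of \<open>X\<close>.
\<close>

definition Ck_S2 :: "nat \<Rightarrow> (real^3 \<Rightarrow> 'b::real_normed_vector) \<Rightarrow> bool" where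
  "Ck_S2 k f \<longleftrightarrow> Ck_on k (- {0}) (f \<circ> sgn)"

definition smooth_S2 :: "(real^3 \<Rightarrow> 'b::real_normed_vector) \<Rightarrow> bool" where
  "smooth_S2 f \<longleftrightarrow> (\<forall>k. Ck_S2 k f)"

definition tangent_S2 :: "(real^3 \<Rightarrow> real^3) \<Rightarrow> bool" where
  "tangent_S2 X \<longleftrightarrow> (\<forall>x\<in>S2. X x \<bullet> x = 0)"

definition grad_S2 :: "(real^3 \<Rightarrow> real) \<Rightarrow> real^3 \<Rightarrow> real^3" where
  "grad_S2 f x = (\<Sum>b\<in>Basis. frechet_derivative (f \<circ> sgn) (at x) b *\<^sub>R b)"

definition div_S2 :: "(real^3 \<Rightarrow> real^3) \<Rightarrow> real^3 \<Rightarrow> real" where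
  "div_S2 X x = (\<Sum>b\<in>Basis. frechet_derivative (X \<circ> sgn) (at x) b \<bullet> b)"

definition laplacian_S2 :: "(real^3 \<Rightarrow> real) \<Rightarrow> real^3 \<Rightarrow> real" where
  "laplacian_S2 f = div_S2 (grad_S2 f)"

text \<open>
  Elements of \<open>C\<^sup>1\<close> are taken extensional, so that each function on the sphere has exactly one
  representative and the \<open>C\<^sup>1\<close> distance separates points.
\<close>

definition C1_S2 :: "(real^3 \<Rightarrow> real) set" where
  "C1_S2 = {f \<in> extensional S2. Ck_S2 1 f}"

definition C1_pos_S2 :: "(real^3 \<Rightarrow> real) set" where
  "C1_pos_S2 = {f \<in> C1_S2. \<forall>x\<in>S2. f x > 0}"

text \<open>
  The locale \<^locale>\<open>Metric_space\<close> asks for nonnegativity off the carrier as well, where the suprema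
  need not exist.
\<close>

definition C1_dist :: "(real^3 \<Rightarrow> real) \<Rightarrow> (real^3 \<Rightarrow> real) \<Rightarrow> real" where
  "C1_dist f g = (if f \<in> C1_S2 \<and> g \<in> C1_S2
     then (SUP x\<in>S2. \<bar>f x - g x\<bar>) + (SUP x\<in>S2. norm (grad_S2 f x - grad_S2 g x)) else 0)"

lemma continuous_on_C1_S2:
  assumes "f \<in> C1_S2"
  shows "continuous_on S2 f" "continuous_on S2 (grad_S2 f)"
proof -
  have *: "Ck_on (Suc 0) (- {0}) (f \<circ> sgn)"
    using assms by (simp add: C1_S2_def Ck_S2_def)
  then have "continuous_on (- {0}) (f \<circ> sgn)"
    by (intro continuous_at_imp_continuous_on ballI differentiable_imp_continuous_within)
      (simp del: o_apply)
  then have "continuous_on S2 (f \<circ> sgn)"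
    by (rule continuous_on_subset) auto
  then show "continuous_on S2 f"
    by (rule continuous_on_eq) (simp add: sgn_div_norm)
  have "continuous_on (- {0}) (grad_S2 f)"
    unfolding grad_S2_def using * by (auto intro!: continuous_intros)
  then show "continuous_on S2 (grad_S2 f)"
    by (rule continuous_on_subset) auto
qed

lemma Metric_space_C1_S2: "Metric_space C1_S2 C1_dist"
proof -
  have bdd: "bdd_above ((\<lambda>x. norm (h x)) ` S2)" if "continuous_on S2 h"
    for h :: "real^3 \<Rightarrow> 'b::real_normed_vector"
    by (intro bounded_imp_bdd_above compact_imp_bounded compact_continuous_image
        continuous_intros that) simp
  have e1: "vec_lambda (\<lambda>i. if i = 1 then 1 else 0) \<in> S2"
    by (simp add: norm_vec_def L2_set_def if_distrib[of "\<lambda>x. x^2"] sum.delta cong: if_cong)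
  then have ne: "S2 \<noteq> {}" by blast
  have b1: "bdd_above ((\<lambda>x. \<bar>f x - g x\<bar>) ` S2)"
    and b2: "bdd_above ((\<lambda>x. norm (grad_S2 f x - grad_S2 g x)) ` S2)"
    if "f \<in> C1_S2" "g \<in> C1_S2" for f g
    using bdd[of "\<lambda>x. f x - g x"] bdd[of "\<lambda>x. grad_S2 f x - grad_S2 g x"] that
    by (simp_all add: continuous_on_C1_S2 continuous_on_diff)
  have n1: "0 \<le> (SUP x\<in>S2. \<bar>f x - g x\<bar>)"
    and n2: "0 \<le> (SUP x\<in>S2. norm (grad_S2 f x - grad_S2 g x))"
    if "f \<in> C1_S2" "g \<in> C1_S2" for f g
    by (rule cSUP_upper2[OF b1[OF that] e1], simp, rule cSUP_upper2[OF b2[OF that] e1], simp)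
  show ?thesis
  proof
    show "0 \<le> C1_dist f g" for f g
      using n1 n2 by (simp add: C1_dist_def add_nonneg_nonneg)
    show "C1_dist f g = C1_dist g f" for f g
      by (simp add: C1_dist_def abs_minus_commute norm_minus_commute conj_commute)
    show "C1_dist f g = 0 \<longleftrightarrow> f = g" if fg: "f \<in> C1_S2" "g \<in> C1_S2" for f g
    proof
      assume "C1_dist f g = 0"
      with n1[OF fg] n2[OF fg] fg have "(SUP x\<in>S2. \<bar>f x - g x\<bar>) = 0"
        by (simp add: C1_dist_def)
      then have "\<bar>f x - g x\<bar> \<le> 0" if "x \<in> S2" for x
        using cSUP_upper[OF that b1[OF fg]] by simp
      then have "f x = g x" if "x \<in> S2" for x
        using that by simp
      with fg show "f = g"
        by (auto simp: C1_S2_def intro: extensionalityI)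
    next
      assume "f = g"
      then show "C1_dist f g = 0"
        using ne by (simp add: C1_dist_def)
    qed
    show "C1_dist f h \<le> C1_dist f g + C1_dist g h"
      if fgh: "f \<in> C1_S2" "g \<in> C1_S2" "h \<in> C1_S2" for f g h
    proof -
      have "(SUP x\<in>S2. \<bar>f x - h x\<bar>) \<le> (SUP x\<in>S2. \<bar>f x - g x\<bar>) + (SUP x\<in>S2. \<bar>g x - h x\<bar>)"
      proof (rule cSUP_least[OF ne])
        fix x assume x: "x \<in> S2"
        show "\<bar>f x - h x\<bar> \<le> (SUP x\<in>S2. \<bar>f x - g x\<bar>) + (SUP x\<in>S2. \<bar>g x - h x\<bar>)"
          using cSUP_upper[OF x b1[OF fgh(1,2)]] cSUP_upper[OF x b1[OF fgh(2,3)]] by linarith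
      qed
      moreover have "(SUP x\<in>S2. norm (grad_S2 f x - grad_S2 h x))
        \<le> (SUP x\<in>S2. norm (grad_S2 f x - grad_S2 g x)) + (SUP x\<in>S2. norm (grad_S2 g x - grad_S2 h x))"
      proof (rule cSUP_least[OF ne])
        fix x assume x: "x \<in> S2"
        have "norm (grad_S2 f x - grad_S2 h x)
          \<le> norm (grad_S2 f x - grad_S2 g x) + norm (grad_S2 g x - grad_S2 h x)"
          using norm_triangle_ineq[of "grad_S2 f x - grad_S2 g x" "grad_S2 g x - grad_S2 h x"] by simp
        then show "norm (grad_S2 f x - grad_S2 h x)
          \<le> (SUP x\<in>S2. norm (grad_S2 f x - grad_S2 g x)) + (SUP x\<in>S2. norm (grad_S2 g x - grad_S2 h x))"
          using cSUP_upper[OF x b2[OF fgh(1,2)]] cSUP_upper[OF x b2[OF fgh(2,3)]] by linarith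
      qed
      ultimately show ?thesis
        using fgh by (simp add: C1_dist_def)
    qed
  qed
qed

definition C1_topology :: "(real^3 \<Rightarrow> real) topology" where
  "C1_topology = Metric_space.mtopology C1_S2 C1_dist"

text \<open>
  Functions in \<open>L\<^sup>p\<close> and \<open>W\<^bsup>1,p\<^esup>\<close> are given by Borel representatives on the sphere; their values off the
  sphere are irrelevant. The weak gradient is characterised by duality with smooth tangent fields.
\<close>

definition Lp_S2 :: "real \<Rightarrow> (real^3 \<Rightarrow> 'b::euclidean_space) set" where
  "Lp_S2 q = {f \<in> borel_measurable area_S2. integrable area_S2 (\<lambda>x. norm (f x) powr q)}"

definition weak_grad_S2 :: "(real^3 \<Rightarrow> real) \<Rightarrow> (real^3 \<Rightarrow> real^3) \<Rightarrow> bool" where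
  "weak_grad_S2 u G \<longleftrightarrow> tangent_S2 G \<and>
     (\<forall>X. smooth_S2 X \<and> tangent_S2 X \<longrightarrow>
        (\<integral>x. u x * div_S2 X x \<partial>area_S2) = - (\<integral>x. G x \<bullet> X x \<partial>area_S2))"

definition W1_S2 :: "real \<Rightarrow> (real^3 \<Rightarrow> real) set" where
  "W1_S2 q = {u \<in> Lp_S2 q. \<exists>G \<in> Lp_S2 q. weak_grad_S2 u G}"

text \<open>
  Distributional form of \<open>- \<Delta> u = K e\<^bsup>2u\<^esup> - 2 \<pi> \<Sum>i \<beta>\<^sub>i \<delta>(p\<^sub>i) - 1\<close> on the sphere.
\<close>

definition liouville_solution ::
  "('m::finite \<Rightarrow> real^3) \<Rightarrow> (real^3 \<Rightarrow> real) \<Rightarrow> real^'m \<Rightarrow> (real^3 \<Rightarrow> real) \<Rightarrow> bool" where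
  "liouville_solution p K \<beta> u \<longleftrightarrow>
     u \<in> (\<Inter>q\<in>{1..<2}. W1_S2 q) \<and>
     integrable area_S2 (\<lambda>x. K x * exp (2 * u x)) \<and>
     (\<forall>\<phi> :: real^3 \<Rightarrow> real. smooth_S2 \<phi> \<longrightarrow>
        - (\<integral>x. u x * laplacian_S2 \<phi> x \<partial>area_S2) =
          (\<integral>x. K x * exp (2 * u x) * \<phi> x \<partial>area_S2)
          - 2 * pi * (\<Sum>i\<in>UNIV. \<beta> $ i * \<phi> (p i)) - (\<integral>x. \<phi> x \<partial>area_S2))"

definition chi_S2 :: "real^'m \<Rightarrow> real" where
  "chi_S2 \<beta> = 2 + (\<Sum>i\<in>UNIV. \<beta> $ i)"

definition F_set :: "real^'m \<Rightarrow> 'm set" where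
  "F_set \<beta> = {i. \<beta> $ i \<le> (\<Sum>k\<in>UNIV. \<beta> $ k) / 2}"

definition A_set :: "(real^'m) set" where
  "A_set = {\<beta>. (\<forall>i. \<beta> $ i > -1 \<and> \<beta> $ i \<noteq> 0) \<and>
     chi_S2 \<beta> / 2 \<in> {0<..} - \<nat> \<and>
     (\<forall>J \<subseteq> F_set \<beta>. chi_S2 \<beta> / 2 - (\<Sum>j\<in>J. \<beta> $ j)
        \<notin> real ` {card J..card J + nat \<lfloor>chi_S2 \<beta> / 2\<rfloor>})}"

end

theory Submission
 imports Defs "HOL-Complex_Analysis.Great_Picard"
begin

text \<open>
 By Green's representation a solution is the same thing as a density \<open>f = \<kappa> K \<Prod>i |x - p\<^sub>i|\<^bsup>2\<beta>\<^sub>i\<^esup> e\<^bsup>2w\<^esup>\<close>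
 of mass \<open>2 \<pi> \<chi>(\<beta>)\<close>, where \<open>w\<close> is the logarithmic potential of \<open>f\<close>. If solvable data \<open>(K\<^sub>n, \<beta>\<^sub>n)\<close>
 converge to \<open>(K, \<beta>)\<close>, the densities \<open>f\<^sub>n\<close> concentrate, along a subsequence, in atoms. Pairing the
 equation with a localised conformal field (a Pohozaev identity) forces each atom \<open>x\<close> to have mass
 \<open>4 \<pi> (1 + e(x))\<close>, where \<open>e(p\<^sub>i) = \<beta>\<^sub>i\<close> and \<open>e = 0\<close> off the cone points. One atom makes \<open>\<kappa>\<^sub>n\<close> tend to
 zero, and by a Brezis--Merle estimate no mass is then left outside the atoms, so the total mass is a
 sum of such quanta; this is what \<open>\<beta> \<in> A_set\<close> excludes. Without atoms the potentials are uniformly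
 bounded and equicontinuous, and a limit of the \<open>f\<^sub>n\<close> yields a solution for \<open>(K, \<beta>)\<close>.
\<close>

text \<open>The calculus is coordinate-free: rotation invariance of the area yields the divergence
  theorem, and the law of the height \<open>a \<bullet> x\<close> yields every explicit integral.
  The constant 2 in the kernel ln (2 / |x - y|) of the potential is the diameter of the sphere;
  nonnegative densities then have nonnegative potentials, so only upper bounds are at stake.
  Singular logarithms are handled by replacing |x - y|^2 with |x - y|^2 + e^2 and letting e tend to
  0.

  The obstacle in the Pohozaev step is the factor X(x) . (x - y) / |x - y|^2, singular on the
  diagonal, where atoms live. Symmetrising in x and y turns it into (X(x) - X(y)) . (x - y) / |x -
  y|^2, which is bounded because X is Lipschitz, and close to 1 near the centre, where X is almost a
  dilation. Hence for an atom of mass m and exponent e the identity becomes (2 + 2 e) m = m^2 / (2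
  pi), with no blow-up analysis; its nonzero root is the quantum of mass.\<close>

abbreviation area_integral :: "(real^3 \<Rightarrow> 'b::{banach,second_countable_topology}) \<Rightarrow> 'b"  (binder "\<ointegral>" 10) where
 "area_integral \<equiv> integral\<^sup>L area_S2"

abbreviation area_nn_integral :: "(real^3 \<Rightarrow> ennreal) \<Rightarrow> ennreal"  (binder "\<ointegral>\<^sup>+" 10) where
 "area_nn_integral \<equiv> integral\<^sup>N area_S2"

section \<open>Area measure of the sphere: rotation invariance and integrability\<close>

lemma measurable_orthogonal:
 fixes f :: "'a::euclidean_space \<Rightarrow> 'a"
 assumes "orthogonal_transformation f"
 shows "f \<in> borel_measurable borel"
 using orthogonal_transformation_linear[OF assms]
 by (intro borel_measurable_continuous_onI) (simp add: linear_continuous_on linear_conv_bounded_linear)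

text \<open>Lebesgue measure is determined by its values on boxes. The preimage of a box is its
  image under the inverse map, again orthogonal, and such images keep their measure.\<close>

lemma distr_lborel_orthogonal:
 fixes f :: "real^'n::{finite,wellorder} \<Rightarrow> real^'n::_"
 assumes f: "orthogonal_transformation f"
 shows "distr lborel borel f = lborel"
proof (rule lborel_eqI[symmetric])
 show "sets (distr lborel borel f) = sets borel" by simp
 note mf [measurable] = measurable_orthogonal[OF f]
 have bf: "bij f" using f by (rule orthogonal_transformation_bij)
 fix l u :: "real^'n::_" assume lu: "\<And>b. b \<in> Basis \<Longrightarrow> l \<bullet> b \<le> u \<bullet> b"
 have vi: "f -` box l u = inv f ` box l u" using bf by (simp add: bij_vimage_eq_inv_image)
 have oi: "orthogonal_transformation (inv f)" using f by (rule orthogonal_transformation_inv)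
 have bm: "box l u \<in> lmeasurable" by simp
 have bo: "f -` box l u \<in> sets borel"
  using measurable_sets[OF mf, of "box l u"] by simp
 have "emeasure (distr lborel borel f) (box l u) = emeasure lborel (f -` box l u)"
  by (simp add: emeasure_distr)
 also have "... = emeasure lebesgue (inv f ` box l u)"
  using bo vi by simp
 also have "... = measure lebesgue (inv f ` box l u)"
  using measurable_orthogonal_image[OF oi bm] by (simp add: emeasure_eq_measure2 fmeasurableD2 emeasure_eq_ennreal_measure)
 also have "... = measure lebesgue (box l u)"
  using measure_orthogonal_image[OF oi bm] by simp
 also have "... = emeasure lborel (box l u)"
  using bm by (simp add: emeasure_eq_ennreal_measure fmeasurableD2)
 also have "... = (\<Prod>b\<in>Basis. (u - l) \<bullet> b)"
  using lu by simp
 finally show "emeasure (distr lborel borel f) (box l u) = ennreal (\<Prod>b\<in>Basis. (u - l) \<bullet> b)" .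
qed

lemma measurable_sgn_vec [measurable]: "(sgn :: real^3 \<Rightarrow> real^3) \<in> borel_measurable borel"
 unfolding sgn_div_norm[abs_def] by measurable

lemma measurable_sgn_S2 [measurable]:
 "sgn \<in> restrict_space lborel (ball 0 1 - {0}) \<rightarrow>\<^sub>M restrict_space borel S2"
 by (rule measurable_restrict_space2)
  (auto simp: space_restrict_space norm_sgn intro: measurable_restrict_space1)

lemma space_area [simp]: "space area_S2 = S2"
 by (simp add: area_S2_def space_scale_measure space_restrict_space)

lemma AE_area_I: "(\<And>x. x \<in> S2 \<Longrightarrow> P x) \<Longrightarrow> AE x in area_S2. P x"
 by (rule AE_I2) simp

lemma area_integral_cong:
 "(\<And>x. x \<in> S2 \<Longrightarrow> f x = g x) \<Longrightarrow> (\<ointegral>x. f x) = (\<ointegral>x. g x)"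
 by (rule Bochner_Integration.integral_cong) auto

lemma sets_area: "sets area_S2 = sets (restrict_space borel S2)"
 by (simp add: area_S2_def)

lemma measurable_area1: "f \<in> borel_measurable borel \<Longrightarrow> f \<in> borel_measurable area_S2"
 using measurable_cong_sets[OF sets_area refl] measurable_restrict_space1 by metis

lemma sets_area_borel: "A \<in> sets area_S2 \<longleftrightarrow> A \<in> sets borel \<and> A \<subseteq> S2"
 unfolding sets_area by (subst sets_restrict_space_iff) auto

lemma emeasure_area:
 assumes "A \<in> sets area_S2"
 shows "emeasure area_S2 A = 3 * emeasure lborel (sgn -` A \<inter> (ball 0 1 - {0}))"
proof -
 have "A \<in> sets (restrict_space borel S2)" using assms by (simp add: sets_area)
 then have "emeasure area_S2 A = 3 * emeasure (restrict_space lborel (ball 0 1 - {0}))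
   (sgn -` A \<inter> (ball 0 1 - {0}))"
  by (simp add: area_S2_def emeasure_distr space_restrict_space)
 also have "... = 3 * emeasure lborel (sgn -` A \<inter> (ball 0 1 - {0}))"
  by (subst emeasure_restrict_space) auto
 finally show ?thesis .
qed

lemma emeasure_area_S2: "emeasure area_S2 S2 = ennreal (4 * pi)"
proof -
 have "sgn -` S2 \<inter> (ball 0 1 - {0}) = ball 0 1 - {0 :: real^3}"
  by (auto simp: norm_sgn)
 moreover have "emeasure lborel (ball 0 1 - {0 :: real^3}) = emeasure lborel (ball 0 1 :: (real^3) set)"
  by (subst emeasure_Diff) auto
 moreover have "emeasure lborel (ball 0 1 :: (real^3) set) = ennreal (4/3 * pi)"
  by (subst emeasure_ball) (auto simp: unit_ball_vol_3)
 moreover have "S2 \<in> sets area_S2" by (simp add: sets_area_borel)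
 moreover have "3 * ennreal (4/3 * pi) = ennreal (3 * (4/3 * pi))"
  by (subst ennreal_mult) auto
 ultimately show ?thesis by (simp add: emeasure_area)
qed

lemma finite_measure_area: "finite_measure area_S2"
 by (rule finite_measureI) (simp add: emeasure_area_S2)

interpretation area: finite_measure area_S2 by (rule finite_measure_area)

lemma measure_area_S2: "measure area_S2 S2 = 4 * pi"
 by (simp add: measure_def emeasure_area_S2)

lemma measurable_area_self:
 assumes "f \<in> borel_measurable borel" "\<And>x. x \<in> S2 \<Longrightarrow> f x \<in> S2"
 shows "f \<in> area_S2 \<rightarrow>\<^sub>M area_S2"
proof -
 have "f \<in> area_S2 \<rightarrow>\<^sub>M restrict_space borel S2"
  using assms by (intro measurable_restrict_space2) (auto intro: measurable_area1)
 then show ?thesis using measurable_cong_sets[OF refl sets_area] by blast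
qed

text \<open>An orthogonal map preserves the norm and commutes with \<open>sgn\<close>, so the cone
  over a preimage is the preimage of the cone, and invariance of volume carries over to
  area.\<close>

lemma distr_area_orthogonal:
 assumes f: "orthogonal_transformation f"
 shows "distr area_S2 area_S2 f = area_S2"
proof -
 note lf = orthogonal_transformation_linear[OF f] and mf [measurable] = measurable_orthogonal[OF f]
 have nf: "norm (f x) = norm x" for x using f by (simp add: orthogonal_transformation_norm)
 have ms: "f \<in> area_S2 \<rightarrow>\<^sub>M area_S2" using mf by (rule measurable_area_self) (auto simp: nf)
 have sg: "sgn (f x) = f (sgn x)" for x
  using lf by (simp add: sgn_div_norm nf linear_scale)
 show ?thesis
 proof (rule measure_eqI)
  fix A assume "A \<in> sets (distr area_S2 area_S2 f)"
  then have A: "A \<in> sets area_S2" by simp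
  then have Ab [measurable]: "A \<in> sets borel" by (simp add: sets_area_borel)
  define B where "B = sgn -` A \<inter> (ball 0 1 - {0 :: real^3})"
  have Bb [measurable]: "B \<in> sets borel"
   unfolding B_def using measurable_sets[OF measurable_sgn_vec Ab] by auto
  have v: "f -` A \<inter> S2 \<in> sets area_S2" using measurable_sets[OF ms A] by simp
  have f0: "f x = 0 \<longleftrightarrow> x = 0" for x using nf[of x] by (metis norm_eq_zero)
  have "x \<in> sgn -` (f -` A \<inter> S2) \<inter> (ball 0 1 - {0}) \<longleftrightarrow> x \<in> f -` B" for x
   unfolding B_def vimage_def by (auto simp: nf norm_sgn f0 simp flip: sg)
  then have eq: "sgn -` (f -` A \<inter> S2) \<inter> (ball 0 1 - {0}) = f -` B"
   by blast
  have "emeasure (distr area_S2 area_S2 f) A = emeasure area_S2 (f -` A \<inter> S2)"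
   using A ms by (simp add: emeasure_distr)
  also have "... = 3 * emeasure lborel (f -` B)"
   using emeasure_area[OF v] by (simp only: eq)
  also have "emeasure lborel (f -` B) = emeasure (distr lborel borel f) B"
   by (simp add: emeasure_distr)
  also have "... = emeasure lborel B"
   by (simp add: distr_lborel_orthogonal[OF f])
  also have "3 * ... = emeasure area_S2 A"
   using A by (simp add: emeasure_area B_def)
  finally show "emeasure (distr area_S2 area_S2 f) A = emeasure area_S2 A" .
 qed simp
qed

lemma integral_area_orthogonal:
 fixes g :: "real^3 \<Rightarrow> real"
 assumes f: "orthogonal_transformation f" and g: "g \<in> borel_measurable area_S2"
 shows "(\<ointegral>x. g (f x)) = (\<ointegral>x. g x)"
proof -
 note mf [measurable] = measurable_orthogonal[OF f]
 have nf: "norm (f x) = norm x" for x using f by (simp add: orthogonal_transformation_norm)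
 have ms: "f \<in> area_S2 \<rightarrow>\<^sub>M area_S2" using mf by (rule measurable_area_self) (auto simp: nf)
 have "(\<ointegral>x. g x) = (\<integral>x. g x \<partial>distr area_S2 area_S2 f)"
  by (simp add: distr_area_orthogonal[OF f])
 also have "... = (\<ointegral>x. g (f x))"
  using ms g by (rule integral_distr)
 finally show ?thesis by simp
qed

lemma measurable_area_continuous:
 fixes g :: "real^3 \<Rightarrow> 'b::{topological_space}"
 assumes "continuous_on S2 g"
 shows "g \<in> borel_measurable area_S2"
proof -
 have "g \<in> borel_measurable (restrict_space borel S2)"
  using assms by (intro borel_measurable_continuous_on_restrict)
 then show ?thesis using measurable_cong_sets[OF sets_area refl] by blast
qed

lemma bounded_S2:
 fixes g :: "real^3 \<Rightarrow> 'b::real_normed_vector"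
 assumes "continuous_on S2 g"
 obtains B where "B \<ge> 0" "\<And>x. x \<in> S2 \<Longrightarrow> norm (g x) \<le> B"
proof -
 have "bounded (g ` S2)"
  using assms by (intro compact_imp_bounded compact_continuous_image) auto
 then obtain B where "\<And>x. x \<in> S2 \<Longrightarrow> norm (g x) \<le> B" unfolding bounded_iff by blast
 then show ?thesis using that[of "max 0 B"] by (meson max.coboundedI2 max.cobounded1)
qed

lemma integrable_area_bounded:
 fixes g :: "real^3 \<Rightarrow> 'b::{banach,second_countable_topology}"
 assumes "g \<in> borel_measurable area_S2" "\<And>x. x \<in> S2 \<Longrightarrow> norm (g x) \<le> B"
 shows "integrable area_S2 g"
 using assms by (intro area.integrable_const_bound[where B=B]) auto

lemma integrable_area_continuous:
 fixes g :: "real^3 \<Rightarrow> 'b::euclidean_space"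
 assumes "continuous_on S2 g"
 shows "integrable area_S2 g"
proof -
 obtain B where "\<And>x. x \<in> S2 \<Longrightarrow> norm (g x) \<le> B" using bounded_S2[OF assms] by blast
 then show ?thesis using measurable_area_continuous[OF assms] by (intro integrable_area_bounded)
qed

lemma integrable_times_bounded:
 fixes f g :: "real^3 \<Rightarrow> real"
 assumes f: "integrable area_S2 f" and g: "g \<in> borel_measurable area_S2" "\<And>y. y \<in> S2 \<Longrightarrow> \<bar>g y\<bar> \<le> B"
 shows "integrable area_S2 (\<lambda>y. f y * g y)"
proof (rule Bochner_Integration.integrable_bound[where f="\<lambda>y. B * f y"])
 show "AE y in area_S2. norm (f y * g y) \<le> norm (B * f y)"
 proof (rule AE_area_I)
  fix y assume "y \<in> S2"
  then have "\<bar>g y\<bar> \<le> \<bar>B\<bar>" using g(2)[of y] by (simp add: order_trans[OF _ abs_ge_self])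
  then have "\<bar>g y\<bar> * \<bar>f y\<bar> \<le> \<bar>B\<bar> * \<bar>f y\<bar>" by (rule mult_right_mono) simp
  then show "norm (f y * g y) \<le> norm (B * f y)" by (simp add: abs_mult mult.commute)
 qed
 show "(\<lambda>y. f y * g y) \<in> borel_measurable area_S2" using f g(1) by measurable
qed (use f in simp)

lemma integrable_mult_bounded_area:
 fixes f g :: "real^3 \<Rightarrow> real"
 assumes f: "integrable area_S2 f" and g: "continuous_on S2 g"
 shows "integrable area_S2 (\<lambda>x. f x * g x)"
proof -
 obtain B where "\<And>x. x \<in> S2 \<Longrightarrow> norm (g x) \<le> B" using bounded_S2[OF g] by blast
 then show ?thesis by (intro integrable_times_bounded[OF f measurable_area_continuous[OF g]]) simp
qed

lemma integrable_indicator_borel: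
 fixes f :: "real^3 \<Rightarrow> real"
 assumes f: "integrable area_S2 f" and A: "A \<in> sets borel"
 shows "integrable area_S2 (\<lambda>y. indicator A y * f y)"
 using integrable_times_bounded[OF f measurable_area1[OF borel_measurable_indicator[OF A]], of 1]
 by (simp add: mult.commute)

subsection \<open>The divergence theorem on the sphere\<close>

text \<open>Rotation by the angle \<open>t\<close> in the plane of \<open>a\<close> and
  \<open>b\<close>, written as the identity plus a correction inside that plane; this makes
  linearity and differentiability in \<open>t\<close> immediate.\<close>

definition plane_rotation :: "'a::euclidean_space \<Rightarrow> 'a \<Rightarrow> real \<Rightarrow> 'a \<Rightarrow> 'a" where
 "plane_rotation a b t x = x + ((cos t - 1) * (x \<bullet> a) - sin t * (x \<bullet> b)) *\<^sub>R a
   + (sin t * (x \<bullet> a) + (cos t - 1) * (x \<bullet> b)) *\<^sub>R b"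

lemma plane_rotation_inner:
 assumes "a \<in> Basis" "b \<in> Basis" "a \<noteq> b"
 shows "plane_rotation a b t x \<bullet> a = cos t * (x \<bullet> a) - sin t * (x \<bullet> b)"
  and "plane_rotation a b t x \<bullet> b = sin t * (x \<bullet> a) + cos t * (x \<bullet> b)"
 using assms by (simp_all add: plane_rotation_def inner_simps inner_Basis algebra_simps)

lemma orthogonal_plane_rotation:
 assumes "a \<in> Basis" "b \<in> Basis" "a \<noteq> b"
 shows "orthogonal_transformation (plane_rotation a b t)"
proof -
 have "linear (plane_rotation a b t)"
  by (rule linearI) (simp_all add: plane_rotation_def inner_simps algebra_simps)
 moreover have "plane_rotation a b t v \<bullet> plane_rotation a b t w = v \<bullet> w" for v w
 proof -
  have aa: "a \<bullet> a = 1" "b \<bullet> b = 1" "a \<bullet> b = 0" "b \<bullet> a = 0" using assms by (simp_all add: inner_Basis)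
  have [simp]: "a \<bullet> w = w \<bullet> a" "b \<bullet> w = w \<bullet> b" by (simp_all add: inner_commute)
  obtain p q where pq: "p = cos t" "q = sin t" by blast
  then have sc: "p * p + q * q = 1"
   using sin_cos_squared_add2[of t] by (simp add: power2_eq_square)
  have "plane_rotation a b t v \<bullet> plane_rotation a b t w = v \<bullet> w
   + ((v \<bullet> a) * (w \<bullet> a) + (v \<bullet> b) * (w \<bullet> b)) * (p * p + q * q - 1)"
   unfolding plane_rotation_def pq[symmetric] by (simp add: inner_simps aa) (simp add: algebra_simps)
  then show ?thesis by (simp add: sc)
 qed
 ultimately show ?thesis by (simp add: orthogonal_transformation_def)
qed

lemma plane_rotation_0 [simp]: "plane_rotation a b 0 x = x"
 by (simp add: plane_rotation_def)

lemma plane_rotation_has_vector_derivative: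
 assumes "a \<in> Basis" "b \<in> Basis" "a \<noteq> b"
 shows "((\<lambda>t. plane_rotation a b t x) has_vector_derivative
  (plane_rotation a b t x \<bullet> a) *\<^sub>R b - (plane_rotation a b t x \<bullet> b) *\<^sub>R a) (at t)"
 unfolding plane_rotation_inner[OF assms] unfolding plane_rotation_def
 by (auto intro!: derivative_eq_intros simp: algebra_simps)

text \<open>The integral of \<open>g\<close> composed with a rotation does not depend on the angle;
  its derivative at angle 0 is the integral on the left. The mean value theorem bounds the
  difference quotients by the supremum of the derivative, which allows dominated
  convergence.\<close>

lemma integral_area_rotation_field:
 fixes g :: "real^3 \<Rightarrow> real"
 assumes g: "\<And>x. x \<in> S2 \<Longrightarrow> (g has_derivative g' x) (at x)"
  and cont: "\<And>v. continuous_on S2 (\<lambda>x. g' x v)"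
  and ab: "a \<in> Basis" "b \<in> Basis" "a \<noteq> b"
 shows "(\<ointegral>x. g' x ((x \<bullet> a) *\<^sub>R b - (x \<bullet> b) *\<^sub>R a)) = 0"
proof -
 define R where "R = plane_rotation a b"
 define J where "J x = (x \<bullet> a) *\<^sub>R b - (x \<bullet> b) *\<^sub>R a" for x :: "real^3"
 define D where "D x = g' x (J x)" for x
 have oR: "orthogonal_transformation (R t)" for t
  unfolding R_def using ab by (rule orthogonal_plane_rotation)
 have RS: "R t x \<in> S2" if "x \<in> S2" for t x
  using that oR[of t] by (simp add: orthogonal_transformation_norm)
 have D_eq: "D x = (x \<bullet> a) * g' x b - (x \<bullet> b) * g' x a" if "x \<in> S2" for x
 proof -
  interpret bounded_linear "g' x" using g[OF that] by (rule has_derivative_bounded_linear)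
  show ?thesis by (simp add: D_def J_def diff scaleR)
 qed
 have contD: "continuous_on S2 D"
 proof -
  have "continuous_on S2 (\<lambda>x. (x \<bullet> a) * g' x b - (x \<bullet> b) * g' x a)"
   by (intro continuous_intros cont)
  then show ?thesis by (rule continuous_on_eq) (simp add: D_eq)
 qed
 obtain B where B: "B \<ge> 0" "\<And>x. x \<in> S2 \<Longrightarrow> norm (D x) \<le> B"
  using bounded_S2[OF contD] by blast
 have contg: "continuous_on S2 g"
  using g by (meson continuous_at_imp_continuous_on has_derivative_continuous)
 note mg = measurable_area_continuous[OF contg]
 have der: "((\<lambda>t. g (R t x)) has_real_derivative D (R t x)) (at t)" if "x \<in> S2" for t x
 proof -
  have 1: "((\<lambda>t. R t x) has_derivative (\<lambda>s. s *\<^sub>R J (R t x))) (at t)"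
   using plane_rotation_has_vector_derivative[OF ab, of x t]
   by (simp add: R_def J_def has_vector_derivative_def)
  have "((\<lambda>t. g (R t x)) has_derivative (\<lambda>s. g' (R t x) (s *\<^sub>R J (R t x)))) (at t)"
   using diff_chain_at[OF 1 g[OF RS[OF that]]] by (simp add: o_def)
  moreover have "g' (R t x) (s *\<^sub>R J (R t x)) = s * D (R t x)" for s
   using linear_scale[OF has_derivative_linear[OF g[OF RS[OF that]]]]
   by (simp add: D_def)
  ultimately show ?thesis by (simp add: has_field_derivative_def mult.commute[of _ "D (R t x)"] )
 qed
 define \<phi> where "\<phi> n x = (g (R (1 / real (Suc n)) x) - g x) * real (Suc n)" for n x
 have bd: "norm (\<phi> n x) \<le> B" if x: "x \<in> S2" for n x
 proof -
  define h where "h = 1 / real (Suc n)"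
  have h: "h > 0" by (simp add: h_def)
  obtain z where z: "0 < z" "z < h" "g (R h x) - g (R 0 x) = (h - 0) * D (R z x)"
   using MVT2[OF h, of "\<lambda>t. g (R t x)" "\<lambda>t. D (R t x)"] der[OF x] by blast
  have "\<phi> n x = (h * D (R z x)) * (1 / h)"
   using z(3) by (simp add: \<phi>_def h_def[symmetric] R_def) (simp add: h_def)
  then have "\<phi> n x = D (R z x)" using h by simp
  then show ?thesis using B(2)[OF RS[OF x]] by simp
 qed
 have lim: "(\<lambda>n. \<phi> n x) \<longlonglongrightarrow> D x" if x: "x \<in> S2" for x
 proof -
  have "((\<lambda>h. (g (R (0 + h) x) - g (R 0 x)) / h) \<longlongrightarrow> D (R 0 x)) (at 0)"
   using der[OF x, of 0] unfolding has_field_derivative_def has_derivative_at2 DERIV_def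
   by (simp add: DERIV_def[symmetric] has_field_derivative_def has_derivative_at2 der[OF x, of 0, unfolded DERIV_def, simplified])
  then have "((\<lambda>n. (g (R (0 + inverse (real (Suc n))) x) - g (R 0 x)) / inverse (real (Suc n))) \<longlongrightarrow> D (R 0 x)) sequentially"
   by (rule filterlim_compose)
    (use LIMSEQ_inverse_real_of_nat in \<open>auto simp: filterlim_at\<close>)
  then show ?thesis by (simp add: \<phi>_def R_def field_simps)
 qed
 have m\<phi>: "\<phi> n \<in> borel_measurable area_S2" for n
 proof -
  have cR: "continuous_on S2 (R t)" for t
   unfolding R_def plane_rotation_def by (intro continuous_intros)
  have "continuous_on S2 (\<phi> n)"
   unfolding \<phi>_def
   by (intro continuous_intros contg continuous_on_compose2[OF contg cR]) (auto intro: RS)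
  then show ?thesis by (rule measurable_area_continuous)
 qed
 have int: "integral\<^sup>L area_S2 (\<phi> n) = 0" for n
 proof -
  have i1: "integrable area_S2 g" using contg by (rule integrable_area_continuous)
  have cR: "continuous_on S2 (R t)" for t
   unfolding R_def plane_rotation_def by (intro continuous_intros)
  have i2: "integrable area_S2 (\<lambda>x. g (R t x))" for t
   by (intro integrable_area_continuous continuous_on_compose2[OF contg cR]) (auto intro: RS)
  have "integral\<^sup>L area_S2 (\<phi> n) = ((\<ointegral>x. g (R (1 / real (Suc n)) x)) - (\<ointegral>x. g x)) * real (Suc n)"
   unfolding \<phi>_def using i1 i2 by simp
  also have "... = 0" using integral_area_orthogonal[OF oR mg] by simp
  finally show ?thesis .
 qed
 have "(\<lambda>n. integral\<^sup>L area_S2 (\<phi> n)) \<longlonglongrightarrow> integral\<^sup>L area_S2 D"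
  by (rule integral_dominated_convergence[where w="\<lambda>_. B"])
   (use m\<phi> measurable_area_continuous[OF contD] lim bd in auto)
 then have "integral\<^sup>L area_S2 D = 0" using int by (simp add: LIMSEQ_const_iff)
 then show ?thesis by (simp add: D_def[abs_def] J_def)
qed

text \<open>Apply invariance under the rotation of the \<open>a\<close>-\<open>b\<close> plane to
  the function \<open>(x \<bullet> a) * (Z x \<bullet> b)\<close> and sum over all
  \<open>a \<noteq> b\<close>. With \<open>x\<close> of norm 1 and \<open>Z\<close> tangent, the sum
  collapses to the trace of the derivative minus its radial entry.\<close>

theorem divergence_theorem_S2:
 fixes Z :: "real^3 \<Rightarrow> real^3"
 assumes Z: "\<And>x. x \<in> S2 \<Longrightarrow> (Z has_derivative Z' x) (at x)"
  and cont: "\<And>v. continuous_on S2 (\<lambda>x. Z' x v)"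
  and tan: "tangent_S2 Z"
 shows "(\<ointegral>x. (\<Sum>b\<in>Basis. Z' x b \<bullet> b) - Z' x x \<bullet> x) = 0"
proof -
 have contZ: "continuous_on S2 Z"
  using Z by (meson continuous_at_imp_continuous_on has_derivative_continuous)
 define T where "T a b x = (x \<bullet> a) * ((x \<bullet> a) * (Z' x b \<bullet> b) - (x \<bullet> b) * (Z' x a \<bullet> b)) - (x \<bullet> b) * (Z x \<bullet> b)"
  for a b x :: "real^3"
 have contT: "continuous_on S2 (T a b)" for a b
  unfolding T_def by (intro continuous_intros cont contZ)
 have T0: "integral\<^sup>L area_S2 (T a b) = 0" if ab: "a \<in> Basis" "b \<in> Basis" "a \<noteq> b" for a b
 proof -
  define g' where "g' x v = (x \<bullet> a) * (Z' x v \<bullet> b) + (v \<bullet> a) * (Z x \<bullet> b)" for x v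
  have "((\<lambda>x. (x \<bullet> a) * (Z x \<bullet> b)) has_derivative g' x) (at x)" if "x \<in> S2" for x
   unfolding g'_def[abs_def] by (auto intro!: derivative_eq_intros Z that)
  moreover have "continuous_on S2 (\<lambda>x. g' x v)" for v
   unfolding g'_def by (intro continuous_intros cont contZ)
  ultimately have "(\<ointegral>x. g' x ((x \<bullet> a) *\<^sub>R b - (x \<bullet> b) *\<^sub>R a)) = 0"
   using ab by (intro integral_area_rotation_field[where g="\<lambda>x. (x \<bullet> a) * (Z x \<bullet> b)"]) auto
  moreover have "g' x ((x \<bullet> a) *\<^sub>R b - (x \<bullet> b) *\<^sub>R a) = T a b x" if "x \<in> S2" for x
  proof -
   interpret bounded_linear "Z' x" using Z[OF that] by (rule has_derivative_bounded_linear)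
   have "a \<bullet> a = 1" "b \<bullet> a = 0" using ab by (auto simp: inner_Basis)
   then show ?thesis unfolding g'_def T_def by (simp add: diff scaleR inner_simps algebra_simps)
  qed
  ultimately show ?thesis
   by (metis (no_types, lifting) area_integral_cong)
 qed
 have "(\<Sum>b\<in>Basis. Z' x b \<bullet> b) - Z' x x \<bullet> x = (\<Sum>a\<in>Basis. \<Sum>b\<in>Basis - {a}. T a b x)" if x: "x \<in> S2" for x
 proof -
  interpret bounded_linear "Z' x" using Z[OF x] by (rule has_derivative_bounded_linear)
  have xx: "(\<Sum>a\<in>Basis. (x \<bullet> a) * (x \<bullet> a)) = 1"
   using x by (simp add: euclidean_inner[of x x, symmetric] dot_square_norm)
  have zx: "(\<Sum>b\<in>Basis. (x \<bullet> b) * (Z x \<bullet> b)) = 0"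
   using tan x euclidean_inner[of x "Z x"] by (simp add: tangent_S2_def inner_commute)
  have e1: "(\<Sum>b\<in>Basis - {a}. T a b x)
    = (\<Sum>b\<in>Basis. (x \<bullet> a) * ((x \<bullet> a) * (Z' x b \<bullet> b) - (x \<bullet> b) * (Z' x a \<bullet> b)))
     + (x \<bullet> a) * (Z x \<bullet> a)" if "a \<in> Basis" for a
  proof -
   have "(\<Sum>b\<in>Basis - {a}. T a b x) = (\<Sum>b\<in>Basis. T a b x) - T a a x"
    using that by (simp add: sum_diff1)
   then show ?thesis using zx by (simp add: T_def sum_subtractf)
  qed
  have "(\<Sum>a\<in>Basis. \<Sum>b\<in>Basis - {a}. T a b x)
   = (\<Sum>a\<in>Basis. \<Sum>b\<in>Basis. (x \<bullet> a) * ((x \<bullet> a) * (Z' x b \<bullet> b) - (x \<bullet> b) * (Z' x a \<bullet> b)))"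
   using zx by (simp add: e1 sum.distrib cong: sum.cong)
  also have "... = (\<Sum>a\<in>Basis. (x \<bullet> a) * (x \<bullet> a)) * (\<Sum>b\<in>Basis. Z' x b \<bullet> b)
    - (\<Sum>a\<in>Basis. (x \<bullet> a) * (\<Sum>b\<in>Basis. (x \<bullet> b) * (Z' x a \<bullet> b)))"
   by (subst sum_product) (simp add: sum_subtractf right_diff_distrib sum_distrib_left mult.assoc)
  also have "(\<Sum>a\<in>Basis. (x \<bullet> a) * (\<Sum>b\<in>Basis. (x \<bullet> b) * (Z' x a \<bullet> b))) = Z' x x \<bullet> x"
  proof -
   have "Z' x x = Z' x (\<Sum>a\<in>Basis. (x \<bullet> a) *\<^sub>R a)" by (simp add: euclidean_representation)
   then have "Z' x x = (\<Sum>a\<in>Basis. (x \<bullet> a) *\<^sub>R Z' x a)"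
    by (simp add: sum scaleR)
   moreover have "(\<Sum>b\<in>Basis. (x \<bullet> b) * (v \<bullet> b)) = v \<bullet> x" for v
    by (simp add: euclidean_inner[of v x] mult.commute)
   ultimately show ?thesis by (simp add: inner_sum_left)
  qed
  finally show ?thesis using xx by simp
 qed
 then have "(\<ointegral>x. (\<Sum>b\<in>Basis. Z' x b \<bullet> b) - Z' x x \<bullet> x)
  = (\<ointegral>x. (\<Sum>a\<in>Basis. \<Sum>b\<in>Basis - {a}. T a b x))"
  by (rule area_integral_cong)
 also have "... = (\<Sum>a\<in>Basis. \<Sum>b\<in>Basis - {a}. integral\<^sup>L area_S2 (T a b))"
  by (simp add: integrable_area_continuous[OF contT] Bochner_Integration.integral_sum)
 also have "... = 0" by (intro sum.neutral ballI) (auto simp: T0)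
 finally show ?thesis .
qed

lemma sgn_S2 [simp]: "x \<in> S2 \<Longrightarrow> sgn x = (x :: real^3)"
 by (simp add: sgn_div_norm)

lemma has_derivative_sgn_S2:
 fixes x :: "real^3"
 assumes "x \<in> S2"
 shows "(sgn has_derivative (\<lambda>v. v - (x \<bullet> v) *\<^sub>R x)) (at x)"
proof -
 have "norm x = 1" "x \<noteq> 0" using assms by auto
 then have "((\<lambda>x. inverse (norm x) *\<^sub>R x) has_derivative (\<lambda>v. v - (x \<bullet> v) *\<^sub>R x)) (at x)"
  by (auto intro!: derivative_eq_intros has_derivative_norm simp: sgn_div_norm inner_commute)
 then show ?thesis by (simp add: sgn_div_norm[abs_def])
qed

lemma has_derivative_comp_sgn_S2:
 fixes x :: "real^3"
 assumes "x \<in> S2" "(F has_derivative F') (at x)"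
 shows "((F \<circ> sgn) has_derivative (\<lambda>v. F' (v - (x \<bullet> v) *\<^sub>R x))) (at x)"
 using diff_chain_at[OF has_derivative_sgn_S2[OF assms(1)]] assms by (simp add: o_def)

lemma has_derivative_comp_sgn_cong:
 fixes x :: "real^3"
 assumes x: "x \<in> S2" and F: "(F has_derivative F') (at x)"
  and eq: "\<And>x. x \<in> S2 \<Longrightarrow> f x = F x"
 shows "((f \<circ> sgn) has_derivative (\<lambda>v. F' (v - (x \<bullet> v) *\<^sub>R x))) (at x)"
 by (rule has_derivative_transform_within_open[OF has_derivative_comp_sgn_S2[OF x F], of "- {0}"])
  (use x eq in \<open>auto simp: norm_sgn open_Compl\<close>)

lemma grad_S2_eq:
 fixes x :: "real^3"
 assumes x: "x \<in> S2" and F: "(F has_derivative (\<lambda>v. G \<bullet> v)) (at x)"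
  and eq: "\<And>x. x \<in> S2 \<Longrightarrow> f x = F x"
 shows "grad_S2 f x = G - (G \<bullet> x) *\<^sub>R x"
proof -
 have "frechet_derivative (f \<circ> sgn) (at x) = (\<lambda>v. G \<bullet> (v - (x \<bullet> v) *\<^sub>R x))"
  using has_derivative_comp_sgn_cong[OF assms] by (rule frechet_derivative_at[symmetric])
 then have "grad_S2 f x = (\<Sum>b\<in>Basis. ((G - (G \<bullet> x) *\<^sub>R x) \<bullet> b) *\<^sub>R b)"
  by (simp add: grad_S2_def inner_simps mult.commute inner_commute)
 then show ?thesis by (simp only: euclidean_representation)
qed

lemma div_S2_eq:
 fixes x :: "real^3"
 assumes x: "x \<in> S2" and F: "(F has_derivative F') (at x)"
  and eq: "\<And>x. x \<in> S2 \<Longrightarrow> X x = F x"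
 shows "div_S2 X x = (\<Sum>b\<in>Basis. F' b \<bullet> b) - F' x \<bullet> x"
proof -
 interpret bounded_linear F' using F by (rule has_derivative_bounded_linear)
 have "frechet_derivative (X \<circ> sgn) (at x) = (\<lambda>v. F' (v - (x \<bullet> v) *\<^sub>R x))"
  using has_derivative_comp_sgn_cong[OF assms] by (rule frechet_derivative_at[symmetric])
 then have "div_S2 X x = (\<Sum>b\<in>Basis. F' b \<bullet> b) - (\<Sum>b\<in>Basis. (x \<bullet> b) *\<^sub>R (F' x \<bullet> b))"
  by (simp add: div_S2_def diff scaleR inner_simps sum_subtractf)
 also have "(\<Sum>b\<in>Basis. (x \<bullet> b) *\<^sub>R (F' x \<bullet> b)) = F' x \<bullet> x"
  by (simp add: euclidean_inner[of "F' x" x] mult.commute)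
 finally show ?thesis .
qed

subsection \<open>Zonal functions\<close>

lemma inner_S2_bounds:
 assumes "a \<in> S2" "x \<in> S2"
 shows "-1 \<le> a \<bullet> x" "a \<bullet> x \<le> (1::real)" "\<bar>a \<bullet> x\<bar> \<le> 1"
 using Cauchy_Schwarz_ineq2[of a x] assms by auto

lemma inner_self_S2: "x \<in> S2 \<Longrightarrow> x \<bullet> x = (1::real)"
 by (simp add: dot_square_norm)

lemma sum_Basis_inner_self: "(\<Sum>b\<in>Basis. b \<bullet> (b :: real^3)) = 3"
 by (simp add: inner_Basis)

lemma zonal_calculus:
 fixes a :: "real^3"
 assumes a: "a \<in> S2"
  and g: "\<And>t. \<bar>t\<bar> \<le> 1 \<Longrightarrow> (g has_real_derivative g' t) (at t)"
 shows grad_zonal: "\<And>x. x \<in> S2 \<Longrightarrow> grad_S2 (\<lambda>x. g (a \<bullet> x)) x = g' (a \<bullet> x) *\<^sub>R (a - (a \<bullet> x) *\<^sub>R x)"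
proof -
 fix x :: "real^3" assume x: "x \<in> S2"
 have 1: "((\<lambda>x. a \<bullet> x) has_derivative (\<lambda>v. a \<bullet> v)) (at x)" by (auto intro!: derivative_eq_intros)
 have "((\<lambda>x. g (a \<bullet> x)) has_derivative (\<lambda>v. g' (a \<bullet> x) * (a \<bullet> v))) (at x)"
  using diff_chain_at[OF 1 g[OF inner_S2_bounds(3)[OF a x], unfolded has_field_derivative_def]]
  by (simp add: o_def)
 then have "((\<lambda>x. g (a \<bullet> x)) has_derivative (\<lambda>v. (g' (a \<bullet> x) *\<^sub>R a) \<bullet> v)) (at x)" by simp
 from grad_S2_eq[OF x this refl]
 show "grad_S2 (\<lambda>x. g (a \<bullet> x)) x = g' (a \<bullet> x) *\<^sub>R (a - (a \<bullet> x) *\<^sub>R x)"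
  by (simp add: scaleR_diff_right)
qed

lemma has_derivative_zonal_grad:
 fixes a :: "real^3"
 assumes a: "a \<in> S2" and x: "x \<in> S2"
  and g: "\<And>t. \<bar>t\<bar> \<le> 1 \<Longrightarrow> (g' has_real_derivative g'' t) (at t)"
 shows "((\<lambda>x. g' (a \<bullet> x) *\<^sub>R (a - (a \<bullet> x) *\<^sub>R x)) has_derivative
   (\<lambda>v. (g'' (a \<bullet> x) * (a \<bullet> v)) *\<^sub>R (a - (a \<bullet> x) *\<^sub>R x)
    - g' (a \<bullet> x) *\<^sub>R ((a \<bullet> v) *\<^sub>R x + (a \<bullet> x) *\<^sub>R v))) (at x)"
proof -
 have 1: "((\<lambda>x. a \<bullet> x) has_derivative (\<lambda>v. a \<bullet> v)) (at x)" by (auto intro!: derivative_eq_intros)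
 have 2: "((\<lambda>x. g' (a \<bullet> x)) has_derivative (\<lambda>v. g'' (a \<bullet> x) * (a \<bullet> v))) (at x)"
  using diff_chain_at[OF 1 g[OF inner_S2_bounds(3)[OF a x], unfolded has_field_derivative_def]]
  by (simp add: o_def)
 show ?thesis
  by (auto intro!: derivative_eq_intros 2 simp: algebra_simps)
qed

lemma zonal_grad_trace:
 fixes a :: "real^3" and p q :: real
 assumes a: "a \<in> S2" and x: "x \<in> S2"
 defines "F' \<equiv> (\<lambda>v. (p * (a \<bullet> v)) *\<^sub>R (a - (a \<bullet> x) *\<^sub>R x) - q *\<^sub>R ((a \<bullet> v) *\<^sub>R x + (a \<bullet> x) *\<^sub>R v))"
 shows "(\<Sum>b\<in>Basis. F' b \<bullet> b) - F' x \<bullet> x = (1 - (a \<bullet> x)\<^sup>2) * p - 2 * (a \<bullet> x) * q"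
proof -
 have ab: "(\<Sum>b\<in>Basis. (a \<bullet> b) * (v \<bullet> b)) = a \<bullet> v" for v
  by (simp add: euclidean_inner[of a v])
 have "(\<Sum>b\<in>Basis. F' b \<bullet> b) = p * (\<Sum>b\<in>Basis. (a \<bullet> b) * (a \<bullet> b)) - p * (a \<bullet> x) * (\<Sum>b\<in>Basis. (a \<bullet> b) * (x \<bullet> b))
   - q * (\<Sum>b\<in>Basis. (a \<bullet> b) * (x \<bullet> b)) - q * (a \<bullet> x) * (\<Sum>b\<in>Basis. b \<bullet> (b :: real^3))"
  unfolding F'_def by (simp add: inner_simps sum_subtractf sum.distrib sum_distrib_left algebra_simps)
 also have "... = p * (1 - (a \<bullet> x)\<^sup>2) - 4 * q * (a \<bullet> x)"
  by (simp only: ab sum_Basis_inner_self inner_self_S2[OF a]) (simp add: algebra_simps power2_eq_square)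
 finally have 1: "(\<Sum>b\<in>Basis. F' b \<bullet> b) = p * (1 - (a \<bullet> x)\<^sup>2) - 4 * q * (a \<bullet> x)" .
 have "F' x \<bullet> x = - 2 * q * (a \<bullet> x)"
  unfolding F'_def inner_diff_left inner_scaleR_left inner_add_left inner_self_S2[OF x] by simp
 then show ?thesis unfolding 1 by (simp add: algebra_simps)
qed

text \<open>In the height \<open>t = a \<bullet> x\<close> the Laplacian becomes the Legendre
  operator; both the moments of the area and the moments of weakly harmonic functions are computed
  from it.\<close>

lemma laplacian_zonal:
 fixes a :: "real^3"
 assumes a: "a \<in> S2" and x: "x \<in> S2"
  and g: "\<And>t. \<bar>t\<bar> \<le> 1 \<Longrightarrow> (g has_real_derivative g' t) (at t)"
  and g': "\<And>t. \<bar>t\<bar> \<le> 1 \<Longrightarrow> (g' has_real_derivative g'' t) (at t)"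
 shows "laplacian_S2 (\<lambda>x. g (a \<bullet> x)) x = (1 - (a \<bullet> x)\<^sup>2) * g'' (a \<bullet> x) - 2 * (a \<bullet> x) * g' (a \<bullet> x)"
 unfolding laplacian_S2_def
 using div_S2_eq[OF x has_derivative_zonal_grad[OF a x g'] grad_zonal[OF a g]]
  zonal_grad_trace[OF a x, of "g'' (a \<bullet> x)" "g' (a \<bullet> x)"] by simp

lemma tangent_zonal_grad:
 assumes "a \<in> S2"
 shows "tangent_S2 (\<lambda>x. g (a \<bullet> x) *\<^sub>R (a - (a \<bullet> x) *\<^sub>R x))"
 by (simp add: tangent_S2_def inner_simps inner_self_S2)

lemma integral_zonal_laplacian:
 fixes a :: "real^3"
 assumes a: "a \<in> S2"
  and g': "\<And>t. \<bar>t\<bar> \<le> 1 \<Longrightarrow> (g' has_real_derivative g'' t) (at t)"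
  and cg: "continuous_on {-1..1} g''"
 shows "(\<ointegral>x. (1 - (a \<bullet> x)\<^sup>2) * g'' (a \<bullet> x) - 2 * (a \<bullet> x) * g' (a \<bullet> x)) = 0"
proof -
 have ca: "continuous_on S2 (\<lambda>x. h (a \<bullet> x))" if "continuous_on {-1..1} h" for h :: "real \<Rightarrow> real"
  by (rule continuous_on_compose2[OF that]) (auto intro!: continuous_intros inner_S2_bounds[OF a])
 have cg': "continuous_on {-1..1} g'"
  using g' by (intro continuous_at_imp_continuous_on ballI) (auto intro!: DERIV_isCont simp: abs_le_iff)
 define F where "F x v = (g'' (a \<bullet> x) * (a \<bullet> v)) *\<^sub>R (a - (a \<bullet> x) *\<^sub>R x)
   - g' (a \<bullet> x) *\<^sub>R ((a \<bullet> v) *\<^sub>R x + (a \<bullet> x) *\<^sub>R v)" for x v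
 have "(\<ointegral>x. (\<Sum>b\<in>Basis. F x b \<bullet> b) - F x x \<bullet> x) = 0"
  unfolding F_def by (rule divergence_theorem_S2[OF has_derivative_zonal_grad[OF a _ g']])
   (auto intro!: continuous_intros ca cg cg' tangent_zonal_grad[OF a])
 moreover have "(\<ointegral>x. (\<Sum>b\<in>Basis. F x b \<bullet> b) - F x x \<bullet> x)
  = (\<ointegral>x. (1 - (a \<bullet> x)\<^sup>2) * g'' (a \<bullet> x) - 2 * (a \<bullet> x) * g' (a \<bullet> x))"
  unfolding F_def by (rule area_integral_cong) (use zonal_grad_trace[OF a] in simp)
 ultimately show ?thesis by simp
qed

lemma integrable_zonal_power [simp]: "integrable area_S2 (\<lambda>x. (a \<bullet> x) ^ n)" for a :: "real^3"
 by (intro integrable_area_continuous continuous_intros)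

text \<open>The Legendre operator has mean zero; inserting \<open>g' = t ^ (n + 1)\<close> turns
  this into a two-step recursion for the moments of the height.\<close>

lemma integral_zonal_power_recursion:
 fixes a :: "real^3"
 assumes a: "a \<in> S2"
 shows "(\<ointegral>x. (a \<bullet> x)) = 0"
  and "(real n + 3) * (\<ointegral>x. (a \<bullet> x) ^ (n + 2)) = (real n + 1) * (\<ointegral>x. (a \<bullet> x) ^ n)"
proof -
 have "(\<ointegral>x. (1 - (a \<bullet> x)\<^sup>2) * 0 - 2 * (a \<bullet> x) * 1) = 0"
  by (rule integral_zonal_laplacian[OF a, where g'="\<lambda>_. 1" and g''="\<lambda>_. 0"]) auto
 then show "(\<ointegral>x. (a \<bullet> x)) = 0" by simp
 have "(\<ointegral>x. (1 - (a \<bullet> x)\<^sup>2) * ((real n + 1) * (a \<bullet> x) ^ n) - 2 * (a \<bullet> x) * (a \<bullet> x) ^ (n + 1)) = 0"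
  by (rule integral_zonal_laplacian[OF a, where g'="\<lambda>t. t ^ (n + 1)" and g''="\<lambda>t. (real n + 1) * t ^ n"])
   (use DERIV_pow[of "Suc n"] in \<open>auto intro!: continuous_intros simp: add.commute\<close>)
 also have "(\<lambda>x. (1 - (a \<bullet> x)\<^sup>2) * ((real n + 1) * (a \<bullet> x) ^ n) - 2 * (a \<bullet> x) * (a \<bullet> x) ^ (n + 1))
   = (\<lambda>x. (real n + 1) * (a \<bullet> x) ^ n - (real n + 3) * (a \<bullet> x) ^ (n + 2))"
  by (simp add: fun_eq_iff algebra_simps power2_eq_square)
 finally show "(real n + 3) * (\<ointegral>x. (a \<bullet> x) ^ (n + 2)) = (real n + 1) * (\<ointegral>x. (a \<bullet> x) ^ n)"
  by (subst (asm) Bochner_Integration.integral_diff)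
   (auto simp del: power_Suc add_2_eq_Suc')
qed

lemma integral_zonal_power:
 fixes a :: "real^3"
 assumes a: "a \<in> S2"
 shows "(\<ointegral>x. (a \<bullet> x) ^ n) = (if even n then 4 * pi / (real n + 1) else 0)"
proof (induction n rule: nat_less_induct)
 case (1 n)
 have "n = 0 \<or> n = 1 \<or> n = (n - 2) + 2" by arith
 then consider "n = 0" | "n = 1" | m where "n = m + 2" by blast
 then show ?case
 proof cases
  case 1 then show ?thesis using measure_area_S2 by simp
 next
  case 2 then show ?thesis using integral_zonal_power_recursion(1)[OF a] by simp
 next
  case 3
  have "(\<ointegral>x. (a \<bullet> x) ^ m) = (if even m then 4 * pi / (real m + 1) else 0)"
   using 1 3 by auto
  then have "(real m + 3) * (\<ointegral>x. (a \<bullet> x) ^ n) = (if even n then 4 * pi else 0)"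
   using integral_zonal_power_recursion(2)[OF a, of m] 3 by auto
  moreover have "real m + 3 > 0" by simp
  ultimately have "(\<ointegral>x. (a \<bullet> x) ^ n) = (if even n then 4 * pi else 0) / (real m + 3)"
   by (simp add: eq_divide_eq mult.commute del: power_Suc)
  moreover have "real n + 1 = real m + 3" using 3 by simp
  ultimately show ?thesis by simp
 qed
qed

section \<open>The law of the height function\<close>

lemma eq_zero_if_le_mult:
 fixes a C :: real
 assumes small: "\<And>e. e > 0 \<Longrightarrow> \<bar>a\<bar> \<le> e * C"
 shows "a = 0"
proof -
 have "\<bar>a\<bar> \<le> 0"
 proof (rule field_le_epsilon)
  fix e :: real assume e: "e > 0"
  have "\<bar>a\<bar> \<le> e / (\<bar>C\<bar> + 1) * C" using e by (intro small) (simp add: add_nonneg_pos)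
  also have "... \<le> e / (\<bar>C\<bar> + 1) * (\<bar>C\<bar> + 1)" using e by (intro mult_left_mono) auto
  finally show "\<bar>a\<bar> \<le> 0 + e" by simp
 qed
 then show ?thesis by simp
qed

text \<open>Polynomials are uniformly dense on [-1, 1], so equal moments give equal integrals of
  bounded continuous functions; ramps increasing to the indicator of a half-line then identify the
  measures.\<close>

lemma finite_measure_eqI_moments:
 fixes M N :: "real measure"
 assumes fin: "finite_measure M" "finite_measure N"
  and sets: "sets M = sets borel" "sets N = sets borel"
  and AE: "AE t in M. \<bar>t\<bar> \<le> 1" "AE t in N. \<bar>t\<bar> \<le> 1"
  and mom: "\<And>n. (\<integral>t. t ^ n \<partial>M) = (\<integral>t. t ^ n \<partial>N)"
 shows "M = N"
proof (rule measure_eqI_lessThan[OF sets])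
 interpret M: finite_measure M by fact
 interpret N: finite_measure N by fact
 have meas: "f \<in> borel_measurable M" "f \<in> borel_measurable N" if "f \<in> borel_measurable borel" for f :: "real \<Rightarrow> real"
  using that measurable_cong_sets[OF sets(1) refl] measurable_cong_sets[OF sets(2) refl] by auto
 have intp: "integrable L (\<lambda>t. t ^ n)" if "finite_measure L" "sets L = sets borel" "AE t in L. \<bar>t\<bar> \<le> 1"
  for L :: "real measure" and n :: nat
 proof -
  interpret finite_measure L by fact
  show ?thesis
  proof (rule integrable_const_bound[where B=1])
   show "AE t in L. norm (t ^ n) \<le> 1" using that(3) by eventually_elim (simp add: power_abs power_le_one)
   show "(\<lambda>t. t ^ n) \<in> borel_measurable L" by (simp add: measurable_cong_sets[OF that(2) refl])
  qed
 qed
 have pol: "(\<integral>t. g t \<partial>M) = (\<integral>t. g t \<partial>N)" "integrable M g" "integrable N g"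
  if "real_polynomial_function g" for g
 proof -
  have "\<exists>c n. g = (\<lambda>x. \<Sum>i\<le>n. c i * x ^ i)"
   using that real_polynomial_function_iff_sum[of g] by simp
  then obtain c n where g: "g = (\<lambda>x. \<Sum>i\<le>n. c i * x ^ i)" by (elim exE)
  have i: "integrable M (\<lambda>x. c i * x ^ i)" "integrable N (\<lambda>x. c i * x ^ i)" for i
   using intp[OF fin(1) sets(1) AE(1), of i] intp[OF fin(2) sets(2) AE(2), of i] by auto
  show "integrable M g" "integrable N g"
   unfolding g using i by auto
  show "(\<integral>t. g t \<partial>M) = (\<integral>t. g t \<partial>N)"
   unfolding g by (subst (1 2) Bochner_Integration.integral_sum) (use i mom in auto)
 qed
 have con: "(\<integral>t. f t \<partial>M) = (\<integral>t. f t \<partial>N)" if f: "continuous_on UNIV f" and fb: "\<And>t. \<bar>f t\<bar> \<le> 1"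
  for f :: "real \<Rightarrow> real"
 proof -
  have mf: "f \<in> borel_measurable borel" using f by (rule borel_measurable_continuous_onI)
  have fi: "integrable M f" "integrable N f"
   using fb meas[OF mf] by (auto intro!: M.integrable_const_bound[where B=1] N.integrable_const_bound[where B=1])
  have "\<bar>(\<integral>t. f t \<partial>M) - (\<integral>t. f t \<partial>N)\<bar> \<le> e * (measure M (space M) + measure N (space N))" if "e > 0" for e
  proof -
   obtain g where g: "real_polynomial_function g" "\<And>t. t \<in> {-1..1} \<Longrightarrow> \<bar>f t - g t\<bar> < e"
    using Stone_Weierstrass_real_polynomial_function[of "{-1..1}" f e] \<open>e > 0\<close> continuous_on_subset[OF f]
    by auto
   have b: "\<bar>(\<integral>t. f t \<partial>L) - (\<integral>t. g t \<partial>L)\<bar> \<le> e * measure L (space L)"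
    if L: "finite_measure L" "integrable L f" "integrable L g" "AE t in L. \<bar>t\<bar> \<le> 1" for L
   proof -
    interpret finite_measure L by fact
    have "\<bar>(\<integral>t. f t \<partial>L) - (\<integral>t. g t \<partial>L)\<bar> = \<bar>\<integral>t. f t - g t \<partial>L\<bar>" using L by simp
    also have "... \<le> (\<integral>t. \<bar>f t - g t\<bar> \<partial>L)" by (rule integral_abs_bound)
    also have "... \<le> (\<integral>t. e \<partial>L)"
    proof (rule integral_mono_AE)
     show "AE t in L. \<bar>f t - g t\<bar> \<le> e" using L(4) by eventually_elim (rule less_imp_le[OF g(2)], simp add: abs_le_iff)
    qed (use L in auto)
    finally show ?thesis by (simp add: mult.commute)
   qed
   show ?thesis
    using b[OF fin(1) fi(1) pol(2)[OF g(1)] AE(1)] b[OF fin(2) fi(2) pol(3)[OF g(1)] AE(2)] pol(1)[OF g(1)]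
    by (simp add: algebra_simps abs_le_iff)
  qed
  from eq_zero_if_le_mult[OF this] show ?thesis by simp
 qed
 show "emeasure M {x <..} < \<infinity>" for x by (simp add: M.emeasure_eq_measure)
 show "emeasure M {x<..} = emeasure N {x<..}" for x
 proof -
  define f where "f k t = min 1 (max 0 (real k * (t - x)))" for k t
  have lim: "(\<lambda>k. f k t) \<longlonglongrightarrow> indicator {x<..} t" for t
  proof (cases "t > x")
   case True
   obtain k0 :: nat where k0: "real k0 * (t - x) > 1" using True reals_Archimedean3[of "t - x"] by auto
   have "f k t = 1" if "k \<ge> k0" for k
   proof -
    have "real k * (t - x) \<ge> real k0 * (t - x)" using that True by (intro mult_right_mono) auto
    then show ?thesis using k0 by (simp add: f_def)
   qed
   then have "eventually (\<lambda>k. f k t = 1) sequentially" unfolding eventually_sequentially by blast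
   then show ?thesis using True by (simp add: tendsto_eventually)
  next
   case False
   then have "real k * (t - x) \<le> 0" for k by (simp add: mult_nonneg_nonpos)
   then have "f k t = 0" for k by (simp add: f_def)
   then show ?thesis using False by simp
  qed
  have cf: "continuous_on UNIV (f k)" for k unfolding f_def by (intro continuous_intros)
  have mf: "f k \<in> borel_measurable borel" for k using cf by (rule borel_measurable_continuous_onI)
  have bf: "\<bar>f k t\<bar> \<le> 1" for k t by (simp add: f_def)
  have lM: "(\<lambda>k. \<integral>t. f k t \<partial>L) \<longlonglongrightarrow> (\<integral>t. indicator {x<..} t \<partial>L)"
   if "finite_measure L" "sets L = sets borel" for L
  proof -
   interpret finite_measure L by fact
   show ?thesis
    by (rule integral_dominated_convergence[where w="\<lambda>_. 1"])
     (use lim bf mf that in \<open>auto simp: measurable_cong_sets[OF that(2) refl]\<close>)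
  qed
  have "(\<integral>t. indicator {x<..} t \<partial>M) = (\<integral>t. indicator {x<..} t \<partial>N :: real)"
   using LIMSEQ_unique[OF lM[OF fin(1) sets(1)]] lM[OF fin(2) sets(2)] con[OF cf bf] by simp
  then show ?thesis using sets by (simp add: M.emeasure_eq_measure N.emeasure_eq_measure)
 qed
qed

text \<open>Archimedes' hat-box theorem: heights are uniformly distributed. It holds because the
  moments found above are those of 2 pi dt on [-1, 1].\<close>

lemma distr_zonal_area:
 fixes a :: "real^3"
 assumes a: "a \<in> S2"
 shows "distr area_S2 borel (\<lambda>x. a \<bullet> x) = density lborel (\<lambda>t. ennreal (2 * pi) * indicator {-1..1} t)"
proof (rule finite_measure_eqI_moments)
 have [measurable]: "(\<lambda>x. a \<bullet> x) \<in> borel_measurable area_S2" by (rule measurable_area1) simp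
 show "finite_measure (distr area_S2 borel (\<lambda>x. a \<bullet> x))" by (rule area.finite_measure_distr) simp
 have e2: "(\<integral>\<^sup>+t. ennreal (2 * pi) * indicator {-1..1::real} t \<partial>lborel) = ennreal (2 * pi) * 2"
  by (simp add: nn_integral_cmult_indicator)
 show "finite_measure (density lborel (\<lambda>t. ennreal (2 * pi) * indicator {-1..1::real} t))"
  by (rule finite_measureI) (simp add: emeasure_density e2 ennreal_mult_eq_top_iff del: nn_integral_cmult_indicator)
 show "AE t in distr area_S2 borel (\<lambda>x. a \<bullet> x). \<bar>t\<bar> \<le> 1"
  by (subst AE_distr_iff) (auto intro!: inner_S2_bounds(3)[OF a])
 show "AE t in density lborel (\<lambda>t. ennreal (2 * pi) * indicator {-1..1}  t). \<bar>t\<bar> \<le> (1::real)"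
  by (subst AE_density) (auto simp: indicator_def abs_le_iff split: if_splits)
 show "(\<integral>t. t ^ n \<partial>distr area_S2 borel (\<lambda>x. a \<bullet> x)) = (\<integral>t. t ^ n \<partial>density lborel (\<lambda>t. ennreal (2 * pi) * indicator {-1..1} t))" for n
 proof -
  have "(\<integral>t. t ^ n \<partial>density lborel (\<lambda>t. ennreal (2 * pi) * indicator {-1..1::real} t))
    = (\<integral>t. t ^ n \<partial>density lborel (\<lambda>t. ennreal (2 * pi * indicator {-1..1} t)))"
   by (intro arg_cong2[where f="lebesgue_integral"] arg_cong2[where f=density]) (auto simp: indicator_def)
  also have "... = (\<integral>t. (2 * pi * indicator {-1..1} t) *\<^sub>R t ^ n \<partial>lborel)"
  proof (rule integral_density)
   show "(\<lambda>t::real. t ^ n) \<in> borel_measurable lborel" by measurable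
   show "(\<lambda>t::real. 2 * pi * indicator {-1..1} t) \<in> borel_measurable lborel" by measurable
  qed auto
  also have "... = 2 * pi * (\<integral>t. t ^ n * indicator {-1..1} t \<partial>lborel)"
   by (simp add: mult_ac)
  also have "(\<integral>t. t ^ n * indicator {-1..1} t \<partial>lborel) = 1 ^ (n + 1) / (n + 1) - (-1) ^ (n + 1) / real (n + 1)"
  proof (rule integral_FTC_Icc_real[where F="\<lambda>t. t ^ (n+1) / (n+1)"])
   show "((\<lambda>t. t ^ (n+1) / (n+1)) has_real_derivative x ^ n) (at x)" for x :: real
    using DERIV_cdivide[OF DERIV_pow[of "n + 1" x], where c="real (n + 1)"] by simp
  qed auto
  also have "2 * pi * (1 ^ (n + 1) / (n + 1) - (-1) ^ (n + 1) / real (n + 1))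
    = (if even n then 4 * pi / (real n + 1) else 0)" by (simp add: add.commute)
  finally have "(\<integral>t. t ^ n \<partial>density lborel (\<lambda>t. ennreal (2 * pi) * indicator {-1..1::real} t))
   = (if even n then 4 * pi / (real n + 1) else 0)" .
  moreover have "(\<integral>t. t ^ n \<partial>distr area_S2 borel (\<lambda>x. a \<bullet> x)) = (\<ointegral>x. (a \<bullet> x) ^ n)"
   by (subst integral_distr) auto
  ultimately show ?thesis using integral_zonal_power[OF a, of n] by simp
 qed
qed auto

lemma nn_integral_zonal:
 fixes a :: "real^3"
 assumes a: "a \<in> S2" and h [measurable]: "h \<in> borel_measurable borel"
 shows "(\<ointegral>\<^sup>+x. h (a \<bullet> x)) = ennreal (2 * pi) * (\<integral>\<^sup>+t. h t * indicator {-1..1} t \<partial>lborel)"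
proof -
 have [measurable]: "(\<lambda>x. a \<bullet> x) \<in> borel_measurable area_S2" by (rule measurable_area1) simp
 have "(\<ointegral>\<^sup>+x. h (a \<bullet> x)) = (\<integral>\<^sup>+t. h t \<partial>distr area_S2 borel (\<lambda>x. a \<bullet> x))"
  by (simp add: nn_integral_distr)
 also have "... = (\<integral>\<^sup>+t. (ennreal (2 * pi) * indicator {-1..1} t) * h t \<partial>lborel)"
  by (simp add: distr_zonal_area[OF a] nn_integral_density)
 also have "... = ennreal (2 * pi) * (\<integral>\<^sup>+t. h t * indicator {-1..1} t \<partial>lborel)"
  by (subst nn_integral_cmult[symmetric]) (auto simp: mult_ac)
 finally show ?thesis .
qed

section \<open>Riesz integrals on the sphere\<close>

lemma dist_S2:
 assumes "x \<in> S2" "y \<in> S2"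
 shows "(dist x y)\<^sup>2 = 2 - 2 * (x \<bullet> y)" "dist x y = sqrt (2 - 2 * (x \<bullet> y))" "dist x y \<le> 2"
proof -
 show 1: "(dist x y)\<^sup>2 = 2 - 2 * (x \<bullet> y)"
  using assms by (simp add: dist_norm power2_norm_eq_inner inner_simps inner_self_S2 inner_commute)
 then show "dist x y = sqrt (2 - 2 * (x \<bullet> y))" by (metis real_sqrt_unique zero_le_dist)
 show "dist x y \<le> 2" using assms norm_triangle_ineq4[of x y] by (simp add: dist_norm)
qed

text \<open>For \<open>s < 2\<close>, the integral of \<open>dist x y powr (- s)\<close> over the
  sphere, the same for every pole \<open>y\<close> on it: in the height variable it is 2 pi times
  the integral of (2 - 2 t)^(- s / 2) over [-1, 1].\<close>

definition riesz_const :: "real \<Rightarrow> real" where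
 "riesz_const s = 2 * pi * (2 powr (2 - s) / (2 - s))"

lemma riesz_const_pos: "s < 2 \<Longrightarrow> riesz_const s > 0"
 by (simp add: riesz_const_def)

lemma nn_integral_dist_powr:
 assumes y: "y \<in> S2" and s: "s < 2"
 shows "(\<ointegral>\<^sup>+x. ennreal (dist x y powr (- s))) = ennreal (riesz_const s)"
proof -
 have "(\<ointegral>\<^sup>+x. ennreal (dist x y powr (- s))) = (\<ointegral>\<^sup>+x. ennreal (sqrt (2 - 2 * (y \<bullet> x)) powr (- s)))"
  by (rule nn_integral_cong) (use y in \<open>auto simp: dist_S2(2) inner_commute\<close>)
 also have "... = ennreal (2 * pi) * (\<integral>\<^sup>+t. ennreal (sqrt (2 - 2 * t) powr (- s)) * indicator {-1..1} t \<partial>lborel)"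
  by (rule nn_integral_zonal[OF y, of "\<lambda>t. ennreal (sqrt (2 - 2 * t) powr (- s))"]) measurable
 also have "(\<integral>\<^sup>+t. ennreal (sqrt (2 - 2 * t) powr (- s)) * indicator {-1..1} t \<partial>lborel) = ennreal (2 powr (2 - s) / (2 - s))"
 proof (rule nn_integral_has_integral_lebesgue')
  let ?F = "\<lambda>t::real. - ((2 - 2 * t) powr (1 - s / 2)) / (2 - s)"
  have "((\<lambda>t. sqrt (2 - 2 * t) powr (- s)) has_integral (?F 1 - ?F (-1))) {-1..1}"
  proof (rule fundamental_theorem_of_calculus_interior)
   show "continuous_on {-1..1} ?F"
    using s by (intro continuous_intros continuous_on_powr') auto
   fix t :: real assume t: "t \<in> {-1<..<1}"
   have "sqrt (2 - 2 * t) powr (- s) = (2 - 2 * t) powr (- s / 2)"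
    using t by (simp add: powr_half_sqrt[symmetric] powr_powr)
   moreover have "(?F has_real_derivative (2 - 2 * t) powr (- s / 2)) (at t)"
   proof -
    have "((\<lambda>t. (2 - 2 * t) powr (1 - s / 2)) has_real_derivative
      ((1 - s / 2) * (2 - 2 * t) powr (1 - s / 2 - 1)) * (- 2)) (at t)"
     by (rule DERIV_chain2[OF has_real_derivative_powr])
      (use t in \<open>auto intro!: derivative_eq_intros\<close>)
    from DERIV_cdivide[OF DERIV_minus[OF this], of "2 - s"] show ?thesis
     by (rule DERIV_cong) (use s in \<open>simp add: field_simps\<close>)
   qed
   ultimately show "(?F has_vector_derivative sqrt (2 - 2 * t) powr (- s)) (at t)"
    by (simp add: has_real_derivative_iff_has_vector_derivative)
  qed simp
  moreover have "4 powr (1 - s / 2) = 2 powr (2 - s)"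
  proof -
   have "(4::real) = 2 powr 2" by simp
   then show ?thesis by (simp only: powr_powr) (simp add: algebra_simps)
  qed
  ultimately show "((\<lambda>t. sqrt (2 - 2 * t) powr (- s)) has_integral 2 powr (2 - s) / (2 - s)) {-1..1}"
   using s by simp
 qed simp
 also have "ennreal (2 * pi) * ... = ennreal (riesz_const s)"
  using s by (simp add: riesz_const_def ennreal_mult[symmetric])
 finally show ?thesis .
qed

lemma measurable_dist_powr [measurable]: "(\<lambda>x. dist x y powr s) \<in> borel_measurable area_S2" for y :: "real^3"
 by (rule measurable_area1) measurable

lemma integrable_dist_powr:
 assumes y: "y \<in> S2" and s: "s < 2"
 shows "integrable area_S2 (\<lambda>x. dist x y powr (- s))"
 by (rule integrableI_nonneg) (use nn_integral_dist_powr[OF assms] in auto)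

lemma integral_dist_powr:
 assumes y: "y \<in> S2" and s: "s < 2"
 shows "(\<ointegral>x. dist x y powr (- s)) = riesz_const s"
 by (subst integral_eq_nn_integral)
  (use nn_integral_dist_powr[OF assms] riesz_const_pos[OF s] in auto)

lemma emeasure_area_singleton [simp]: "emeasure area_S2 {y} = 0"
proof (cases "y \<in> S2")
 case True
 have "(\<lambda>x. y \<bullet> x) \<in> borel_measurable area_S2" by (rule measurable_area1) simp
 from measurable_sets[OF this, of "{1}"]
 have S: "{x \<in> space area_S2. y \<bullet> x \<in> {1}} \<in> sets area_S2"
  by (simp add: vimage_def Int_def conj_commute)
 have "emeasure area_S2 {y} \<le> emeasure area_S2 {x \<in> space area_S2. y \<bullet> x \<in> {1}}"
  by (rule emeasure_mono[OF _ S]) (use True in \<open>auto simp: inner_self_S2\<close>)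
 also have "... = (\<ointegral>\<^sup>+x. indicator {1} (y \<bullet> x))"
  by (subst nn_integral_indicator[OF S, symmetric])
   (auto intro!: nn_integral_cong simp: indicator_def)
 also have "... = ennreal (2 * pi) * (\<integral>\<^sup>+t. indicator {1::real} t * indicator {-1..1} t \<partial>lborel)"
  by (rule nn_integral_zonal[OF True, of "indicator {1}"]) measurable
 also have "(\<integral>\<^sup>+t. indicator {1::real} t * indicator {-1..1} t \<partial>lborel) = (\<integral>\<^sup>+t. indicator {1::real} t \<partial>lborel)"
  by (rule nn_integral_cong) (auto simp: indicator_def)
 finally show ?thesis by simp
next
 case False
 then show ?thesis by (intro emeasure_notin_sets) (auto simp: sets_area_borel)
qed

lemma AE_area_neq: "AE x in area_S2. x \<noteq> y"
 by (rule AE_I[of _ _ "{y} \<inter> S2"]) (cases "y \<in> S2"; auto simp: sets_area_borel)+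

subsection \<open>Smooth functions\<close>

lemma Ck_on_cong:
 assumes "open S" "\<And>x. x \<in> S \<Longrightarrow> f x = g x" "Ck_on k S f"
 shows "Ck_on k S g"
 using assms(2,3)
proof (induction k arbitrary: f g)
 case 0
 then show ?case using continuous_on_cong[of S S f g] by simp
next
 case (Suc k)
 have *: "(g has_derivative frechet_derivative f (at x)) (at x)" if x: "x \<in> S" for x
 proof (rule has_derivative_transform_within_open[OF _ assms(1) x])
  show "(f has_derivative frechet_derivative f (at x)) (at x)"
   using Suc.prems(2) x by (simp add: frechet_derivative_works[symmetric])
 qed (use Suc.prems(1) in simp)
 then have "g differentiable (at x)" if "x \<in> S" for x
  using that by (auto simp: differentiable_def)
 moreover have "Ck_on k S (\<lambda>x. frechet_derivative g (at x) v)" for v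
 proof (rule Suc.IH)
  show "Ck_on k S (\<lambda>x. frechet_derivative f (at x) v)" using Suc.prems by simp
  show "frechet_derivative f (at x) v = frechet_derivative g (at x) v" if "x \<in> S" for x
   using frechet_derivative_at[OF *[OF that]] by simp
 qed
 ultimately show ?case by simp
qed

lemma Ck_on_SucI:
 assumes "open S" "\<And>x. x \<in> S \<Longrightarrow> (f has_derivative f' x) (at x)" "\<And>v. Ck_on k S (\<lambda>x. f' x v)"
 shows "Ck_on (Suc k) S f"
proof -
 have "Ck_on k S (\<lambda>x. frechet_derivative f (at x) v)" for v
  by (rule Ck_on_cong[OF assms(1) _ assms(3)[of v]]) (simp add: frechet_derivative_at[OF assms(2), symmetric])
 then show ?thesis using assms(2) by (auto simp: differentiable_def)
qed

lemma Ck_on_SucD: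
 assumes "Ck_on (Suc k) S f"
 shows "Ck_on k S f"
 using assms
proof (induction k arbitrary: f)
 case 0
 then show ?case
  by (auto intro!: continuous_at_imp_continuous_on differentiable_imp_continuous_within)
next
 case (Suc k)
 then show ?case by (metis Ck_on.simps(2))
qed

lemma Ck_on_const: "open S \<Longrightarrow> Ck_on k S (\<lambda>_. c)"
proof (induction k arbitrary: c)
 case (Suc k)
 show ?case by (rule Ck_on_SucI[OF Suc.prems, where f'="\<lambda>_ _. 0"]) (auto intro: Suc)
qed simp

lemma Ck_on_linear: "open S \<Longrightarrow> bounded_linear f \<Longrightarrow> Ck_on k S f"
proof (cases k)
 case (Suc j)
 assume *: "open S" "bounded_linear f"
 show ?thesis unfolding Suc
  by (rule Ck_on_SucI[OF *(1), where f'="\<lambda>_. f"])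
   (use * in \<open>auto intro: Ck_on_const bounded_linear_imp_has_derivative\<close>)
qed (auto intro: linear_continuous_on)

lemma Ck_on_add:
 assumes "open S" "Ck_on k S f" "Ck_on k S g"
 shows "Ck_on k S (\<lambda>x. f x + g x)"
 using assms(2,3)
proof (induction k arbitrary: f g)
 case 0 then show ?case by (auto intro!: continuous_intros)
next
 case (Suc k)
 show ?case
  by (rule Ck_on_SucI[OF assms(1), where f'="\<lambda>x v. frechet_derivative f (at x) v + frechet_derivative g (at x) v"])
   (use Suc in \<open>auto intro!: has_derivative_add simp: frechet_derivative_works[symmetric]\<close>)
qed

lemma Ck_on_mult:
 fixes f g :: "'a::real_normed_vector \<Rightarrow> real"
 assumes "open S" "Ck_on k S f" "Ck_on k S g"
 shows "Ck_on k S (\<lambda>x. f x * g x)"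
 using assms(2,3)
proof (induction k arbitrary: f g)
 case 0 then show ?case by (auto intro!: continuous_intros)
next
 case (Suc k)
 show ?case
 proof (rule Ck_on_SucI[OF assms(1)])
  show "((\<lambda>x. f x * g x) has_derivative
    (\<lambda>v. f x * frechet_derivative g (at x) v + frechet_derivative f (at x) v * g x)) (at x)" if "x \<in> S" for x
   using Suc.prems that by (auto intro!: has_derivative_mult simp: frechet_derivative_works[symmetric])
  show "Ck_on k S (\<lambda>x. f x * frechet_derivative g (at x) v + frechet_derivative f (at x) v * g x)" for v
   using Suc.prems Ck_on_SucD[OF Suc.prems(1)] Ck_on_SucD[OF Suc.prems(2)]
   by (auto intro!: Ck_on_add[OF assms(1)] Suc.IH)
 qed
qed

text \<open>The derivative in direction \<open>v\<close> is minus a linear function times the cube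
  of the function itself, so closure under products carries the induction.\<close>

lemma Ck_on_inverse_norm: "Ck_on k (- {0::'a::real_inner}) (\<lambda>x. inverse (norm x))"
proof (induction k)
 case 0 then show ?case by (auto intro!: continuous_intros)
next
 case (Suc k)
 have op: "open (- {0::'a})" by (simp add: open_Compl)
 show ?case
 proof (rule Ck_on_SucI[OF op])
  show "((\<lambda>x. inverse (norm x)) has_derivative
   (\<lambda>v. (-1) * ((x \<bullet> v) * (inverse (norm x) * (inverse (norm x) * inverse (norm x)))))) (at x)"
   if "x \<in> - {0::'a}" for x
   using that by (auto intro!: derivative_eq_intros has_derivative_norm simp: sgn_div_norm inner_commute field_simps)
  show "Ck_on k (- {0}) (\<lambda>x::'a. (-1) * ((x \<bullet> v) * (inverse (norm x) * (inverse (norm x) * inverse (norm x)))))" for v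
   by (intro Ck_on_mult[OF op] Suc Ck_on_const[OF op] Ck_on_linear[OF op] bounded_linear_inner_left)
 qed
qed

text \<open>Zonal powers are the test functions that will show a weakly harmonic function to be
  constant.\<close>

lemma smooth_zonal_power: "smooth_S2 (\<lambda>x. (a \<bullet> x) ^ n)" for a :: "real^3"
proof -
 have op: "open (- {0::real^3})" by (simp add: open_Compl)
 have "Ck_on k (- {0}) (\<lambda>x. a \<bullet> sgn x)" for k
  by (rule Ck_on_cong[OF op _ Ck_on_mult[OF op Ck_on_linear[OF op bounded_linear_inner_right[of a]] Ck_on_inverse_norm]])
   (simp add: sgn_div_norm)
 then have "Ck_on k (- {0}) (\<lambda>x. (a \<bullet> sgn x) ^ n)" for k
  by (induction n) (auto intro: Ck_on_const[OF op] Ck_on_mult[OF op])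
 then show ?thesis by (simp add: smooth_S2_def Ck_S2_def o_def)
qed

lemma smooth_const: "smooth_S2 (\<lambda>_. c)"
 by (simp add: smooth_S2_def Ck_S2_def o_def Ck_on_const open_Compl)

subsection \<open>Weakly harmonic functions are constant\<close>

text \<open>Closed sets generate the Borel sets and are stable under intersection, while the sets
  over which \<open>h\<close> integrates to zero form a Dynkin system.\<close>

lemma AE_zero_if_closed_integrals_zero:
 fixes h :: "real^3 \<Rightarrow> real"
 assumes h: "integrable area_S2 h"
  and z: "\<And>C. closed C \<Longrightarrow> (\<ointegral>x. indicator C x * h x) = 0"
 shows "AE x in area_S2. h x = 0"
proof (rule density_unique_real[OF h, of "\<lambda>_. 0"])
 note ii = integrable_indicator_borel[OF h]
 have "A \<in> sets borel \<Longrightarrow> (\<ointegral>x. indicator A x * h x) = 0" for A :: "(real^3) set"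
 proof -
  assume "A \<in> sets borel"
  then have A: "A \<in> sigma_sets UNIV (Collect closed)" by (simp add: borel_eq_closed)
  have "Int_stable (Collect closed :: (real^3) set set)" by (auto simp: Int_stable_def)
  moreover have "Collect closed \<subseteq> Pow (UNIV :: (real^3) set)" by simp
  moreover note A
  ultimately show ?thesis
  proof (induction rule: sigma_sets_induct_disjoint)
   case (basic A) then show ?case using z by simp
  next
   case empty show ?case by simp
  next
   case (compl A)
   then have A: "A \<in> sets borel" by (simp add: borel_eq_closed)
   have "(\<ointegral>x. indicator (UNIV - A) x * h x) = (\<ointegral>x. indicator UNIV x * h x - indicator A x * h x)"
    by (rule area_integral_cong) (auto simp: indicator_def)
   also have "... = 0"
    by (subst Bochner_Integration.integral_diff) (use ii[OF A] ii[of UNIV] z[of UNIV] compl in auto)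
   finally show ?case .
  next
   case (union F)
   then have F: "F i \<in> sets borel" for i by (auto simp: borel_eq_closed)
   have UF: "(\<Union>i. F i) \<in> sets borel" using F by auto
   have "(\<lambda>n. \<ointegral>x. indicator (\<Union>i<n. F i) x * h x) \<longlonglongrightarrow> (\<ointegral>x. indicator (\<Union>i. F i) x * h x)"
   proof (rule integral_dominated_convergence[where w="\<lambda>x. \<bar>h x\<bar>"])
    show "AE x in area_S2. (\<lambda>n. indicator (\<Union>i<n. F i) x * h x) \<longlonglongrightarrow> indicator (\<Union>i. F i) x * h x"
     by (intro AE_I2 tendsto_mult tendsto_const LIMSEQ_indicator_UN)
    show "(\<lambda>x. indicator (\<Union>i<n. F i) x * h x) \<in> borel_measurable area_S2" for n
     using ii[of "\<Union>i<n. F i"] F by auto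
   qed (use h ii[OF UF] in \<open>auto simp: indicator_def\<close>)
   moreover have "(\<ointegral>x. indicator (\<Union>i<n. F i) x * h x) = 0" for n
   proof -
    have ind: "(indicator (\<Union>i<n. F i) x :: real) = (\<Sum>i<n. indicator (F i) x)" for x
     by (rule indicator_UN_disjoint) (use union(1) in \<open>auto simp: disjoint_family_on_def\<close>)
    have "(\<ointegral>x. indicator (\<Union>i<n. F i) x * h x) = (\<Sum>i<n. (\<ointegral>x. indicator (F i) x * h x))"
     unfolding ind sum_distrib_right by (rule Bochner_Integration.integral_sum) (use ii F in auto)
    then show ?thesis using union by simp
   qed
   ultimately show ?case by (simp add: LIMSEQ_const_iff)
  qed
 qed
 then show "(LINT x:A|area_S2. h x) = (LINT x:A|area_S2. 0)" if "A \<in> sets area_S2" for A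
  using that by (simp add: sets_area_borel set_lebesgue_integral_def)
qed simp

text \<open>The indicator of a closed set is the bounded limit of the continuous cut-offs
  \<open>max 0 (1 - real n * infdist x C)\<close>.\<close>

lemma AE_zero_if_continuous_integrals_zero:
 fixes h :: "real^3 \<Rightarrow> real"
 assumes h: "integrable area_S2 h"
  and z: "\<And>\<phi>. continuous_on S2 \<phi> \<Longrightarrow> (\<ointegral>x. \<phi> x * h x) = 0"
 shows "AE x in area_S2. h x = 0"
proof (rule AE_zero_if_closed_integrals_zero[OF h])
 fix C :: "(real^3) set" assume C: "closed C"
 show "(\<ointegral>x. indicator C x * h x) = 0"
 proof (cases "C = {}")
  case False
  define \<phi> where "\<phi> n x = max 0 (1 - real n * infdist x C)" for n x
  have c\<phi>: "continuous_on S2 (\<phi> n)" for n unfolding \<phi>_def by (intro continuous_intros)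
  have b\<phi>: "\<bar>\<phi> n x\<bar> \<le> 1" for n x by (simp add: \<phi>_def infdist_nonneg)
  have lim: "(\<lambda>n. \<phi> n x) \<longlonglongrightarrow> indicator C x" for x
  proof (cases "x \<in> C")
   case True then show ?thesis by (simp add: \<phi>_def)
  next
   case out: False
   then have d: "infdist x C > 0" using C False in_closed_iff_infdist_zero infdist_nonneg
    by (metis less_eq_real_def)
   obtain k0 :: nat where k0: "real k0 * infdist x C > 1" using d reals_Archimedean3[of "infdist x C"] by auto
   have "\<phi> k x = 0" if "k \<ge> k0" for k
   proof -
    have "real k * infdist x C \<ge> real k0 * infdist x C" using that d by (intro mult_right_mono) auto
    then show ?thesis using k0 by (simp add: \<phi>_def)
   qed
   then have "eventually (\<lambda>k. \<phi> k x = 0) sequentially" unfolding eventually_sequentially by blast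
   then show ?thesis using out by (simp add: tendsto_eventually)
  qed
  have "(\<lambda>n. \<ointegral>x. \<phi> n x * h x) \<longlonglongrightarrow> (\<ointegral>x. indicator C x * h x)"
  proof (rule integral_dominated_convergence[where w="\<lambda>x. \<bar>h x\<bar>"])
   show "AE x in area_S2. norm (\<phi> n x * h x) \<le> \<bar>h x\<bar>" for n
    using b\<phi> by (intro AE_I2) (simp add: abs_mult mult_left_le_one_le)
   show "AE x in area_S2. (\<lambda>n. \<phi> n x * h x) \<longlonglongrightarrow> indicator C x * h x"
    by (intro AE_I2 tendsto_mult lim tendsto_const)
   show "(\<lambda>x. \<phi> n x * h x) \<in> borel_measurable area_S2" for n
    using measurable_area_continuous[OF c\<phi>] h by auto
   have "(\<lambda>x. indicator C x :: real) \<in> borel_measurable area_S2"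
    using C by (intro measurable_area1) auto
   then show "(\<lambda>x. indicator C x * h x) \<in> borel_measurable area_S2" using h by auto
  qed (use h in auto)
  then show ?thesis using z[OF c\<phi>] by (simp add: LIMSEQ_const_iff)
 qed simp
qed

text \<open>Finite sums of exponentials of linear forms. Exponents add under multiplication, so this
  is an algebra separating points, and each generator is a power series in one height; it links
  zonal moments to Stone-Weierstrass.\<close>

inductive_set exp_ring :: "('a::real_inner \<Rightarrow> real) set" where
 exp_ring_base: "(\<lambda>x. c * exp (a \<bullet> x)) \<in> exp_ring"
| exp_ring_add: "f \<in> exp_ring \<Longrightarrow> g \<in> exp_ring \<Longrightarrow> (\<lambda>x. f x + g x) \<in> exp_ring"

lemma exp_ring_mult:
 assumes "f \<in> exp_ring" "g \<in> exp_ring"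
 shows "(\<lambda>x. f x * g x) \<in> exp_ring"
 using assms
proof (induction f)
 case (exp_ring_base c a)
 from exp_ring_base show ?case
 proof (induction g)
  case (exp_ring_base d b)
  have "(\<lambda>x. (c * d) * exp ((a + b) \<bullet> x)) \<in> exp_ring" by (rule exp_ring.exp_ring_base)
  then show ?case by (simp add: inner_add_left exp_add mult_ac)
 next
  case (exp_ring_add f g)
  then show ?case by (simp add: distrib_left exp_ring.exp_ring_add)
 qed
next
 case (exp_ring_add f g)
 then show ?case by (simp add: distrib_right exp_ring.exp_ring_add)
qed

text \<open>The partial sums of exp (a . x) are uniformly bounded on the sphere, so vanishing zonal
  moments kill all exponentials, and these span a uniformly dense algebra. Directions that are not
  unit vectors are reached by scaling.\<close>

lemma AE_zero_if_zonal_moments_zero: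
 fixes h :: "real^3 \<Rightarrow> real"
 assumes h: "integrable area_S2 h"
  and z: "\<And>a n. a \<in> S2 \<Longrightarrow> (\<ointegral>x. (a \<bullet> x) ^ n * h x) = 0"
 shows "AE x in area_S2. h x = 0"
proof (rule AE_zero_if_continuous_integrals_zero[OF h])
 have hmult: "integrable area_S2 (\<lambda>x. \<phi> x * h x)" if c: "continuous_on S2 \<phi>" for \<phi> :: "real^3 \<Rightarrow> real"
  using integrable_mult_bounded_area[OF h c] by (simp add: mult.commute)
 have z': "(\<ointegral>x. (a \<bullet> x) ^ n * h x) = 0" for a n
 proof (cases "a = 0")
  case True
  have "(axis 1 1 :: real^3) \<in> S2" by simp
  from z[OF this, of 0] show ?thesis using True by (cases n) auto
 next
  case False
  have "(\<ointegral>x. (a \<bullet> x) ^ n * h x) = (\<ointegral>x. norm a ^ n * ((sgn a \<bullet> x) ^ n * h x))"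
  proof (rule area_integral_cong)
   fix x
   have "a \<bullet> x = norm a * (sgn a \<bullet> x)" using False by (simp add: sgn_div_norm)
   then show "(a \<bullet> x) ^ n * h x = norm a ^ n * ((sgn a \<bullet> x) ^ n * h x)"
    by (simp only: power_mult_distrib mult.assoc)
  qed
  also have "... = norm a ^ n * (\<ointegral>x. (sgn a \<bullet> x) ^ n * h x)" by simp
  also have "... = 0" using z[of "sgn a" n] False by (simp add: norm_sgn)
  finally show ?thesis .
 qed
 have exp0: "(\<ointegral>x. exp (a \<bullet> x) * h x) = 0" for a
 proof -
  define p where "p N x = (\<Sum>n<N. (a \<bullet> x) ^ n / fact n)" for N x
  have bnd: "\<bar>a \<bullet> x\<bar> \<le> norm a" if "x \<in> S2" for x using Cauchy_Schwarz_ineq2[of a x] that by auto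
  have pb: "\<bar>p N x\<bar> \<le> exp (norm a)" if "x \<in> S2" for N x
  proof -
   have "\<bar>p N x\<bar> \<le> (\<Sum>n<N. \<bar>(a \<bullet> x) ^ n / fact n\<bar>)" unfolding p_def by (rule sum_abs)
   also have "... \<le> (\<Sum>n<N. norm a ^ n / fact n)"
    by (rule sum_mono) (auto simp: power_abs intro!: divide_right_mono power_mono bnd that)
   also have "... \<le> (\<Sum>n. norm a ^ n / fact n)"
    using exp_converges[of "norm a"] by (intro sum_le_suminf) (auto simp: sums_iff divide_inverse mult.commute)
   also have "... = exp (norm a)" using exp_converges[of "norm a"] by (simp add: sums_iff divide_inverse mult.commute)
   finally show ?thesis .
  qed
  have cp: "continuous_on S2 (p N)" for N unfolding p_def by (intro continuous_intros) auto
  have "(\<lambda>N. \<ointegral>x. p N x * h x) \<longlonglongrightarrow> (\<ointegral>x. exp (a \<bullet> x) * h x)"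
  proof (rule integral_dominated_convergence[where w="\<lambda>x. exp (norm a) * \<bar>h x\<bar>"])
   show "AE x in area_S2. (\<lambda>N. p N x * h x) \<longlonglongrightarrow> exp (a \<bullet> x) * h x"
    unfolding p_def using exp_converges[where 'a=real]
    by (intro AE_I2 tendsto_mult tendsto_const) (simp add: sums_def divide_inverse mult.commute)
   show "AE x in area_S2. norm (p N x * h x) \<le> exp (norm a) * \<bar>h x\<bar>" for N
    using pb by (intro AE_I2) (auto simp: abs_mult intro!: mult_right_mono)
   show "(\<lambda>x. p N x * h x) \<in> borel_measurable area_S2" for N
    using hmult[OF cp] by auto
   show "(\<lambda>x. exp (a \<bullet> x) * h x) \<in> borel_measurable area_S2"
    by (intro borel_measurable_integrable hmult continuous_intros)
  qed (use h in auto)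
  moreover have "(\<ointegral>x. p N x * h x) = 0" for N
  proof -
   have "(\<ointegral>x. p N x * h x) = (\<ointegral>x. (\<Sum>n<N. (1 / fact n) * ((a \<bullet> x) ^ n * h x)))"
    unfolding p_def by (simp add: sum_distrib_right)
   also have "... = (\<Sum>n<N. (1 / fact n) * (\<ointegral>x. (a \<bullet> x) ^ n * h x))"
    by (subst Bochner_Integration.integral_sum) (auto intro!: hmult continuous_intros)
   finally show ?thesis by (simp add: z')
  qed
  ultimately show ?thesis by (simp add: LIMSEQ_const_iff)
 qed
 have ring_cont: "continuous_on S g" if "g \<in> exp_ring" for g and S :: "(real^3) set"
  using that by induction (auto intro!: continuous_intros)
 have ring0: "(\<ointegral>x. g x * h x) = 0" if "g \<in> exp_ring" for g
  using that
 proof induction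
  case (exp_ring_base c a)
  then show ?case using exp0[of a] by (simp add: mult.assoc)
 next
  case (exp_ring_add f g)
  then show ?case using hmult[OF ring_cont] by (simp add: distrib_right)
 qed
 interpret function_ring_on "exp_ring :: (real^3 \<Rightarrow> real) set" S2
 proof
  show "continuous_on S2 f" if "f \<in> exp_ring" for f :: "real^3 \<Rightarrow> real" using ring_cont[OF that] .
  show "(\<lambda>_::real^3. c) \<in> exp_ring" for c using exp_ring_base[of c "0::real^3"] by simp
  show "\<exists>f\<in>exp_ring. f x \<noteq> f y" if "x \<in> S2" "y \<in> S2" "x \<noteq> y" for x y :: "real^3"
  proof (rule bexI[OF _ exp_ring_base[of 1 "x - y"]])
   have "(x - y) \<bullet> (x - y) \<noteq> 0" using that by simp
   then show "1 * exp ((x - y) \<bullet> x) \<noteq> 1 * exp ((x - y) \<bullet> y)" by (simp add: inner_diff_right)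
  qed
 qed (auto intro: exp_ring_add exp_ring_mult)
 fix \<phi> :: "real^3 \<Rightarrow> real" assume c: "continuous_on S2 \<phi>"
 show "(\<ointegral>x. \<phi> x * h x) = 0"
 proof (rule eq_zero_if_le_mult)
  fix e :: real assume "e > 0"
  from Stone_Weierstrass_basic[OF c this] obtain g where
   g: "g \<in> exp_ring" "\<And>x. x \<in> S2 \<Longrightarrow> \<bar>\<phi> x - g x\<bar> < e" by blast
  note hm = hmult[OF c] hmult[OF ring_cont[OF g(1)]]
  have "\<bar>(\<ointegral>x. \<phi> x * h x)\<bar> = \<bar>(\<ointegral>x. \<phi> x * h x - g x * h x)\<bar>"
   using hm ring0[OF g(1)] by simp
  also have "... \<le> (\<ointegral>x. \<bar>\<phi> x * h x - g x * h x\<bar>)" by (rule integral_abs_bound)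
  also have "... \<le> (\<ointegral>x. e * \<bar>h x\<bar>)"
  proof (rule integral_mono)
   show "\<bar>\<phi> x * h x - g x * h x\<bar> \<le> e * \<bar>h x\<bar>" if "x \<in> space area_S2" for x
    unfolding left_diff_distrib[symmetric] abs_mult using g(2)[of x] that by (intro mult_right_mono) auto
  qed (use hm h in auto)
  finally show "\<bar>(\<ointegral>x. \<phi> x * h x)\<bar> \<le> e * (\<ointegral>x. \<bar>h x\<bar>)" by simp
 qed
qed

text \<open>Testing with zonal powers gives the moments of \<open>w\<close> the same recursion as
  those of the constant 1. Hence \<open>w\<close> minus its mean has vanishing zonal moments in
  every direction.\<close>

theorem weakly_harmonic_AE_const:
 fixes w :: "real^3 \<Rightarrow> real"
 assumes w: "integrable area_S2 w"
  and lap: "\<And>\<phi> :: real^3 \<Rightarrow> real. smooth_S2 \<phi> \<Longrightarrow> (\<ointegral>x. w x * laplacian_S2 \<phi> x) = 0"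
 shows "\<exists>c. AE x in area_S2. w x = c"
proof -
 have iw: "integrable area_S2 (\<lambda>x. (a \<bullet> x) ^ n * w x)" for a n
  using integrable_mult_bounded_area[OF w, of "\<lambda>x. (a \<bullet> x) ^ n"] by (simp add: mult.commute continuous_intros)
 define m where "m a n = (\<ointegral>x. (a \<bullet> x) ^ n * w x)" for a n
 have rec: "(real n + 3) * m a (n + 2) = (real n + 1) * m a n" and m1: "m a 1 = 0" if a: "a \<in> S2" for a n
 proof -
  have "laplacian_S2 (\<lambda>x. (a \<bullet> x) ^ 1) x = - 2 * (a \<bullet> x)" if "x \<in> S2" for x
   by (subst laplacian_zonal[OF a that, where g'="\<lambda>_. 1" and g''="\<lambda>_. 0"]) auto
  then have "(\<ointegral>x. (-2) * ((a \<bullet> x) ^ 1 * w x)) = (\<ointegral>x. w x * laplacian_S2 (\<lambda>x. (a \<bullet> x) ^ 1) x)"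
   by (intro area_integral_cong) auto
  also have "... = 0" by (rule lap[OF smooth_zonal_power])
  finally show "m a 1 = 0" by (simp add: m_def)
  have pow: "((\<lambda>t. t ^ (k + 1)) has_real_derivative (real k + 1) * t ^ k) (at t)" for k and t :: real
   using DERIV_pow[of "Suc k" t] by (simp add: add.commute)
  have "laplacian_S2 (\<lambda>x. (a \<bullet> x) ^ (n + 2)) x
   = (real n + 2) * ((real n + 1) * (a \<bullet> x) ^ n - (real n + 3) * (a \<bullet> x) ^ (n + 2))" if "x \<in> S2" for x
  proof -
   have 1: "((\<lambda>t. t ^ (n + 2)) has_real_derivative (real n + 2) * t ^ (n + 1)) (at t)" for t :: real
    using pow[of "n + 1" t] by (simp add: add.commute)
   have 2: "((\<lambda>t. (real n + 2) * t ^ (n + 1)) has_real_derivative (real n + 2) * ((real n + 1) * t ^ n)) (at t)" for t :: real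
    by (rule DERIV_cmult[OF pow])
   show ?thesis
    by (subst laplacian_zonal[OF a that 1 2]) (simp add: algebra_simps power2_eq_square)
  qed
  then have "(\<ointegral>x. (real n + 2) * ((real n + 1) * ((a \<bullet> x) ^ n * w x) - (real n + 3) * ((a \<bullet> x) ^ (n + 2) * w x)))
   = (\<ointegral>x. w x * laplacian_S2 (\<lambda>x. (a \<bullet> x) ^ (n + 2)) x)"
   by (intro area_integral_cong) (simp only:, simp only: algebra_simps)
  also have "... = 0" by (rule lap[OF smooth_zonal_power])
  finally have "(\<ointegral>x. (real n + 1) * ((a \<bullet> x) ^ n * w x) - (real n + 3) * ((a \<bullet> x) ^ (n + 2) * w x)) = 0"
   by simp
  then show "(real n + 3) * m a (n + 2) = (real n + 1) * m a n"
   using iw[of a] unfolding m_def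
   by (subst (asm) Bochner_Integration.integral_diff) (auto simp del: power_Suc add_2_eq_Suc')
 qed
 define c where "c = (\<ointegral>x. w x) / (4 * pi)"
 have m: "m a n = c * (\<ointegral>x. (a \<bullet> x) ^ n)" if a: "a \<in> S2" for a n
 proof (induction n rule: nat_less_induct)
  case (1 n)
  have "n = 0 \<or> n = 1 \<or> n = (n - 2) + 2" by arith
  then consider "n = 0" | "n = 1" | k where "n = k + 2" by blast
  then show ?case
  proof cases
   case 1 then show ?thesis using measure_area_S2 by (simp add: m_def c_def)
  next
   case 2 then show ?thesis using integral_zonal_power_recursion(1)[OF a] m1[OF a] by simp
  next
   case 3
   have "m a k = c * (\<ointegral>x. (a \<bullet> x) ^ k)" using 1 3 by auto
   then have "(real k + 3) * m a n = (real k + 3) * (c * (\<ointegral>x. (a \<bullet> x) ^ n))"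
    using rec[OF a, of k] integral_zonal_power_recursion(2)[OF a, of k] 3
    by (simp add: mult.left_commute del: power_Suc add_2_eq_Suc')
   moreover have "real k + 3 \<noteq> 0" by simp
   ultimately show ?thesis by (metis mult_left_cancel)
  qed
 qed
 have "AE x in area_S2. w x - c = 0"
 proof (rule AE_zero_if_zonal_moments_zero)
  show "(\<ointegral>x. (a \<bullet> x) ^ n * (w x - c)) = 0" if a: "a \<in> S2" for a n
  proof -
   have "(\<ointegral>x. (a \<bullet> x) ^ n * (w x - c)) = (\<ointegral>x. (a \<bullet> x) ^ n * w x - c * (a \<bullet> x) ^ n)"
    by (simp add: algebra_simps)
   then show ?thesis using m[OF a, of n] iw[of a n] by (simp add: m_def)
  qed
 qed (use w in auto)
 then show ?thesis by (intro exI[of _ c]) auto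
qed

subsection \<open>Integration by parts\<close>

definition C1_near_S2 :: "(real^3 \<Rightarrow> 'b::real_normed_vector) \<Rightarrow> (real^3 \<Rightarrow> real^3 \<Rightarrow> 'b) \<Rightarrow> bool" where
 "C1_near_S2 f f' \<longleftrightarrow> (\<forall>x\<in>S2. (f has_derivative f' x) (at x)) \<and> (\<forall>v. continuous_on S2 (\<lambda>x. f' x v))"

text \<open>The surface divergence computed from an arbitrary differentiable extension: subtracting
  the radial entry removes the dependence on how the field leaves the sphere.\<close>

definition tangential_trace :: "(real^3 \<Rightarrow> real^3 \<Rightarrow> real^3) \<Rightarrow> real^3 \<Rightarrow> real" where
 "tangential_trace Z' x = (\<Sum>b\<in>Basis. Z' x b \<bullet> b) - Z' x x \<bullet> x"

lemma C1_near_S2_continuous: "C1_near_S2 f f' \<Longrightarrow> continuous_on S2 f"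
 unfolding C1_near_S2_def by (meson continuous_at_imp_continuous_on has_derivative_continuous)

lemma continuous_on_tangential_trace:
 assumes "C1_near_S2 Z Z'"
 shows "continuous_on S2 (tangential_trace Z')"
proof -
 have c: "continuous_on S2 (\<lambda>x. Z' x v)" for v using assms by (simp add: C1_near_S2_def)
 have "Z' x x = (\<Sum>b\<in>Basis. (x \<bullet> b) *\<^sub>R Z' x b)" if "x \<in> S2" for x
 proof -
  interpret bounded_linear "Z' x"
   using assms that has_derivative_bounded_linear by (auto simp: C1_near_S2_def)
  have "Z' x x = Z' x (\<Sum>b\<in>Basis. (x \<bullet> b) *\<^sub>R b)" by (simp add: euclidean_representation)
  then show ?thesis by (simp add: sum scaleR)
 qed
 then have "continuous_on S2 (\<lambda>x. Z' x x)"
  by (subst continuous_on_cong[OF refl]) (auto intro!: continuous_intros c)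
 then show ?thesis unfolding tangential_trace_def[abs_def]
  by (intro continuous_intros c)
qed

lemma continuous_on_C1_near_S2_apply:
 fixes N :: "real^3 \<Rightarrow> real"
 assumes "C1_near_S2 N N'" "continuous_on S2 Z"
 shows "continuous_on S2 (\<lambda>x. N' x (Z x))"
proof -
 have c: "continuous_on S2 (\<lambda>x. N' x v)" for v using assms by (simp add: C1_near_S2_def)
 have "N' x (Z x) = (\<Sum>b\<in>Basis. (Z x \<bullet> b) * N' x b)" if "x \<in> S2" for x
 proof -
  interpret bounded_linear "N' x"
   using assms that has_derivative_bounded_linear by (auto simp: C1_near_S2_def)
  have "N' x (Z x) = N' x (\<Sum>b\<in>Basis. (Z x \<bullet> b) *\<^sub>R b)" by (simp add: euclidean_representation)
  then show ?thesis by (simp add: sum scaleR)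
 qed
 then show ?thesis
  by (subst continuous_on_cong[OF refl]) (auto intro!: continuous_intros c assms(2))
qed

text \<open>This is the divergence theorem for \<open>N x *\<^sub>R Z x\<close>; the radial part of
  the derivative of \<open>N\<close> drops out because it is paired with
  \<open>Z x \<bullet> x = 0\<close>.\<close>

lemma integration_by_parts_S2:
 fixes N :: "real^3 \<Rightarrow> real"
 assumes N: "C1_near_S2 N N'" and Z: "C1_near_S2 Z Z'" and tan: "tangent_S2 Z"
 shows "(\<ointegral>x. N x * tangential_trace Z' x) = - (\<ointegral>x. N' x (Z x))"
proof -
 define W' where "W' x v = N x *\<^sub>R Z' x v + N' x v *\<^sub>R Z x" for x v
 have cN: "continuous_on S2 N" and cZ: "continuous_on S2 Z"
  using N Z by (auto dest: C1_near_S2_continuous)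
 have d: "((\<lambda>x. N x *\<^sub>R Z x) has_derivative W' x) (at x)" if "x \<in> S2" for x
  unfolding W'_def[abs_def] using N Z that by (intro has_derivative_scaleR) (auto simp: C1_near_S2_def)
 have "(\<ointegral>x. (\<Sum>b\<in>Basis. W' x b \<bullet> b) - W' x x \<bullet> x) = 0"
  by (rule divergence_theorem_S2[OF d])
   (use N Z tan cN cZ in \<open>auto simp: W'_def C1_near_S2_def tangent_S2_def intro!: continuous_intros\<close>)
 moreover have "(\<Sum>b\<in>Basis. W' x b \<bullet> b) - W' x x \<bullet> x = N x * tangential_trace Z' x + N' x (Z x)"
  if x: "x \<in> S2" for x
 proof -
  interpret bounded_linear "N' x"
   using N x has_derivative_bounded_linear by (auto simp: C1_near_S2_def)
  have "N' x (Z x) = N' x (\<Sum>b\<in>Basis. (Z x \<bullet> b) *\<^sub>R b)" by (simp add: euclidean_representation)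
  then have "N' x (Z x) = (\<Sum>b\<in>Basis. (Z x \<bullet> b) * N' x b)" by (simp add: sum scaleR)
  moreover have "Z x \<bullet> x = 0" using tan x by (simp add: tangent_S2_def)
  ultimately show ?thesis
   by (simp add: W'_def tangential_trace_def inner_simps sum.distrib sum_distrib_left right_diff_distrib mult.commute)
 qed
 ultimately have "(\<ointegral>x. N x * tangential_trace Z' x + N' x (Z x)) = 0"
  by (metis (no_types, lifting) area_integral_cong)
 moreover have "integrable area_S2 (\<lambda>x. N x * tangential_trace Z' x)" "integrable area_S2 (\<lambda>x. N' x (Z x))"
  by (intro integrable_area_continuous continuous_intros cN continuous_on_tangential_trace[OF Z]
   continuous_on_C1_near_S2_apply[OF N cZ])+
 ultimately show ?thesis by simp
qed

lemma Ck_S2_1_C1_near: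
 assumes "Ck_S2 1 X"
 shows "C1_near_S2 (X \<circ> sgn) (\<lambda>x. frechet_derivative (X \<circ> sgn) (at x))"
proof -
 have *: "Ck_on (Suc 0) (- {0}) (X \<circ> sgn)" using assms by (simp add: Ck_S2_def)
 have "((X \<circ> sgn) has_derivative frechet_derivative (X \<circ> sgn) (at x)) (at x)" if "x \<in> S2" for x
 proof -
  have "x \<noteq> 0" using that by auto
  then show ?thesis using * by (simp add: frechet_derivative_works[symmetric] del: o_apply)
 qed
 moreover have "continuous_on S2 (\<lambda>x. frechet_derivative (X \<circ> sgn) (at x) v)" for v
  by (rule continuous_on_subset[of "- {0}"]) (use * in \<open>auto simp del: o_apply\<close>)
 ultimately show ?thesis by (simp add: C1_near_S2_def)
qed

text \<open>Since \<open>X \<circ> sgn\<close> is constant along rays, its derivative factors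
  through the projection to the tangent plane.\<close>

lemma frechet_derivative_radial:
 assumes "Ck_S2 1 X" "x \<in> S2"
 shows "frechet_derivative (X \<circ> sgn) (at x) x = 0"
proof -
 let ?F = "frechet_derivative (X \<circ> sgn) (at x)"
 have d: "((X \<circ> sgn) has_derivative ?F) (at x)"
  using Ck_S2_1_C1_near[OF assms(1)] assms(2) by (simp add: C1_near_S2_def del: o_apply)
 have "((X \<circ> sgn) has_derivative (\<lambda>v. ?F (v - (x \<bullet> v) *\<^sub>R x))) (at x)"
  by (rule has_derivative_comp_sgn_cong[OF assms(2) d]) simp
 from has_derivative_unique[OF d this]
 have "?F x = ?F (x - (x \<bullet> x) *\<^sub>R x)" by metis
 also have "... = 0"
  using linear_0[OF has_derivative_linear[OF d]] by (simp add: inner_self_S2[OF assms(2)])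
 finally show ?thesis .
qed

lemma div_S2_trace:
 assumes "Ck_S2 1 X" "x \<in> S2"
 shows "div_S2 X x = tangential_trace (\<lambda>x. frechet_derivative (X \<circ> sgn) (at x)) x"
 using frechet_derivative_radial[OF assms] by (simp add: div_S2_def tangential_trace_def)

lemma Ck_S2_continuous: "Ck_S2 1 X \<Longrightarrow> continuous_on S2 X"
 by (rule continuous_on_eq[OF C1_near_S2_continuous[OF Ck_S2_1_C1_near]]) (simp_all only: o_apply sgn_S2)

lemma continuous_on_div_S2: "Ck_S2 1 X \<Longrightarrow> continuous_on S2 (div_S2 X)"
 by (rule continuous_on_eq[OF continuous_on_tangential_trace[OF Ck_S2_1_C1_near]])
  (auto simp: div_S2_trace)

lemma integration_by_parts_div_S2:
 fixes N :: "real^3 \<Rightarrow> real"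
 assumes N: "C1_near_S2 N N'" and X: "Ck_S2 1 X" "tangent_S2 X"
 shows "(\<ointegral>x. N x * div_S2 X x) = - (\<ointegral>x. N' x (X x))"
proof -
 have "(\<ointegral>x. N x * div_S2 X x)
   = (\<ointegral>x. N x * tangential_trace (\<lambda>x. frechet_derivative (X \<circ> sgn) (at x)) x)"
  by (rule area_integral_cong) (auto simp: div_S2_trace[OF X(1)])
 also have "... = - (\<ointegral>x. N' x ((X \<circ> sgn) x))"
  using X(2) by (intro integration_by_parts_S2[OF N Ck_S2_1_C1_near[OF X(1)]]) (simp add: tangent_S2_def)
 also have "(\<ointegral>x. N' x ((X \<circ> sgn) x)) = (\<ointegral>x. N' x (X x))"
  by (rule area_integral_cong) auto
 finally show ?thesis .
qed

lemma grad_S2_inner: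
 fixes \<phi> :: "real^3 \<Rightarrow> real"
 assumes "Ck_S2 1 \<phi>" "x \<in> S2"
 shows "frechet_derivative (\<phi> \<circ> sgn) (at x) v = grad_S2 \<phi> x \<bullet> v"
proof -
 have d: "((\<phi> \<circ> sgn) has_derivative frechet_derivative (\<phi> \<circ> sgn) (at x)) (at x)"
  using Ck_S2_1_C1_near[OF assms(1)] assms(2) by (simp add: C1_near_S2_def del: o_apply)
 interpret bounded_linear "frechet_derivative (\<phi> \<circ> sgn) (at x)" using d by (rule has_derivative_bounded_linear)
 have "frechet_derivative (\<phi> \<circ> sgn) (at x) v = frechet_derivative (\<phi> \<circ> sgn) (at x) (\<Sum>b\<in>Basis. (v \<bullet> b) *\<^sub>R b)"
  by (simp add: euclidean_representation)
 also have "... = (\<Sum>b\<in>Basis. (v \<bullet> b) * frechet_derivative (\<phi> \<circ> sgn) (at x) b)" by (simp add: sum scaleR)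
 finally show ?thesis by (simp only: grad_S2_def inner_sum_left inner_scaleR_left inner_commute[of v] mult.commute)
qed

lemma tangent_grad_S2:
 fixes \<phi> :: "real^3 \<Rightarrow> real"
 assumes "Ck_S2 1 \<phi>"
 shows "tangent_S2 (grad_S2 \<phi>)"
 using grad_S2_inner[OF assms] frechet_derivative_radial[OF assms] by (metis tangent_S2_def)

lemma C1_near_grad_S2:
 fixes \<phi> :: "real^3 \<Rightarrow> real"
 assumes "Ck_S2 2 \<phi>"
 shows "\<exists>G'. C1_near_S2 (grad_S2 \<phi>) G' \<and> (\<forall>x\<in>S2. laplacian_S2 \<phi> x = tangential_trace G' x)"
proof -
 define \<psi> where "\<psi> b x = frechet_derivative (\<phi> \<circ> sgn) (at x) b" for b x
 have \<psi>: "Ck_on (Suc 0) (- {0}) (\<psi> b)" for b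
  using assms by (simp add: Ck_S2_def numeral_2_eq_2 \<psi>_def[abs_def] del: o_apply)
 define G' where "G' x v = (\<Sum>b\<in>Basis. frechet_derivative (\<psi> b) (at x) v *\<^sub>R b)" for x v :: "real^3"
 have g: "grad_S2 \<phi> = (\<lambda>x. \<Sum>b\<in>Basis. \<psi> b x *\<^sub>R b)" by (simp add: grad_S2_def[abs_def] \<psi>_def)
 have d: "(grad_S2 \<phi> has_derivative G' x) (at x)" if "x \<in> S2" for x
 proof -
  have "x \<noteq> 0" using that by auto
  then have "(\<psi> b has_derivative frechet_derivative (\<psi> b) (at x)) (at x)" for b
   using \<psi>[of b] by (simp add: frechet_derivative_works[symmetric])
  then show ?thesis unfolding g G'_def[abs_def]
   by (intro has_derivative_sum has_derivative_scaleR_left)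
 qed
 moreover have "continuous_on S2 (\<lambda>x. frechet_derivative (\<psi> b) (at x) v)" for b v
  by (rule continuous_on_subset[of "- {0}"]) (use \<psi>[of b] in auto)
 then have "continuous_on S2 (\<lambda>x. G' x v)" for v unfolding G'_def
  by (intro continuous_intros)
 moreover have "laplacian_S2 \<phi> x = tangential_trace G' x" if "x \<in> S2" for x
  unfolding laplacian_S2_def tangential_trace_def by (rule div_S2_eq[OF that d[OF that] refl])
 ultimately show ?thesis by (intro exI[of _ G']) (simp add: C1_near_S2_def)
qed

lemma smooth_S2_Ck: "smooth_S2 f \<Longrightarrow> Ck_S2 k f"
 by (simp add: smooth_S2_def)

lemma continuous_on_laplacian_S2:
 fixes \<phi> :: "real^3 \<Rightarrow> real"
 assumes "smooth_S2 \<phi>"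
 shows "continuous_on S2 (laplacian_S2 \<phi>)"
proof -
 obtain G' where G': "C1_near_S2 (grad_S2 \<phi>) G'" "\<forall>x\<in>S2. laplacian_S2 \<phi> x = tangential_trace G' x"
  using C1_near_grad_S2[OF smooth_S2_Ck[OF assms]] by blast
 show ?thesis
  by (rule continuous_on_eq[OF continuous_on_tangential_trace[OF G'(1)]]) (use G'(2) in auto)
qed

lemma integration_by_parts_laplacian_S2:
 fixes N :: "real^3 \<Rightarrow> real"
 assumes N: "C1_near_S2 N N'" and \<phi>: "smooth_S2 \<phi>"
 shows "(\<ointegral>x. N x * laplacian_S2 \<phi> x) = - (\<ointegral>x. N' x (grad_S2 \<phi> x))"
proof -
 obtain G' where G': "C1_near_S2 (grad_S2 \<phi>) G'" "\<forall>x\<in>S2. laplacian_S2 \<phi> x = tangential_trace G' x"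
  using C1_near_grad_S2[OF smooth_S2_Ck[OF \<phi>]] by blast
 have "(\<ointegral>x. N x * laplacian_S2 \<phi> x) = (\<ointegral>x. N x * tangential_trace G' x)"
  by (rule area_integral_cong) (use G'(2) in auto)
 then show ?thesis
  using integration_by_parts_S2[OF N G'(1) tangent_grad_S2[OF smooth_S2_Ck[OF \<phi>]]] by simp
qed

lemma integral_laplacian_S2:
 fixes \<phi> :: "real^3 \<Rightarrow> real"
 assumes \<phi>: "smooth_S2 \<phi>"
 shows "(\<ointegral>x. laplacian_S2 \<phi> x) = 0"
 using integration_by_parts_laplacian_S2[OF _ \<phi>, of "\<lambda>_. 1" "\<lambda>_ _. 0"] by (simp add: C1_near_S2_def)

subsection \<open>The regularised logarithm\<close>

definition log_reg :: "real \<Rightarrow> real^3 \<Rightarrow> real^3 \<Rightarrow> real" where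
 "log_reg e y x = ln ((dist x y)\<^sup>2 + e\<^sup>2) / 2"

text \<open>At \<open>e = 0\<close> this is the derivative of \<open>ln (dist x y)\<close> in
  \<open>x\<close>, with value 0 at the pole by the convention for division by zero; the limits in
  \<open>e\<close> are consistent with that value.\<close>

definition log_reg_deriv :: "real \<Rightarrow> real^3 \<Rightarrow> real^3 \<Rightarrow> real^3 \<Rightarrow> real" where
 "log_reg_deriv e y x v = ((x - y) \<bullet> v) / ((dist x y)\<^sup>2 + e\<^sup>2)"

lemma has_derivative_log_reg:
 assumes "e > 0"
 shows "(log_reg e y has_derivative log_reg_deriv e y x) (at x)"
proof -
 have pos: "(norm (x - y))\<^sup>2 + e\<^sup>2 > 0" using assms by (simp add: add_nonneg_pos)
 have "((\<lambda>x. ln ((x - y) \<bullet> (x - y) + e\<^sup>2) / 2) has_derivative log_reg_deriv e y x) (at x)"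
  unfolding log_reg_deriv_def[abs_def] using pos
  by (auto intro!: derivative_eq_intros simp: dist_norm power2_norm_eq_inner inner_commute divide_simps)
 then show ?thesis by (simp add: log_reg_def[abs_def] dist_norm power2_norm_eq_inner)
qed

lemma C1_near_log_reg:
 assumes "e > 0"
 shows "C1_near_S2 (log_reg e y) (log_reg_deriv e y)"
proof -
 have "(dist x y)\<^sup>2 + e\<^sup>2 \<noteq> 0" for x using assms
  by (metis add_nonneg_pos less_irrefl zero_le_power2 zero_less_power)
 then show ?thesis unfolding C1_near_S2_def log_reg_deriv_def
  using has_derivative_log_reg[OF assms, of y, unfolded log_reg_deriv_def[abs_def]]
  by (auto intro!: continuous_intros)
qed

lemma log_reg_lower: "x \<noteq> y \<Longrightarrow> ln (dist x y) \<le> log_reg e y x"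
proof -
 assume "x \<noteq> y"
 then have d: "dist x y > 0" by simp
 have "ln (dist x y) = ln ((dist x y)\<^sup>2) / 2" using d by (simp add: ln_realpow)
 also have "... \<le> log_reg e y x" unfolding log_reg_def using d
  by (intro divide_right_mono ln_mono) (auto simp: add_pos_nonneg)
 finally show ?thesis .
qed

text \<open>The number 5 bounds \<open>(dist x y)\<^sup>2 + e\<^sup>2\<close> on a sphere of
  diameter 2 with \<open>e \<le> 1\<close>; hence the regularised logarithm never exceeds 1.\<close>

lemma ln5_le_2: "ln (5::real) \<le> 2"
proof -
 have "5 \<le> (1 + 1 + 1\<^sup>2 / 2 :: real) ^ 2" by (simp add: power2_eq_square)
 also have "... \<le> exp 1 ^ 2" using exp_lower_Taylor_quadratic[of 1] by (intro power_mono) auto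
 also have "... = exp 2" by (simp add: exp_double[symmetric])
 finally have "ln 5 \<le> ln (exp 2 :: real)" by (intro ln_mono) auto
 then show ?thesis by simp
qed

lemma log_reg_upper: "x \<in> S2 \<Longrightarrow> y \<in> S2 \<Longrightarrow> 0 < e \<Longrightarrow> e \<le> 1 \<Longrightarrow> log_reg e y x \<le> 1"
proof -
 assume a: "x \<in> S2" "y \<in> S2" "0 < e" "e \<le> 1"
 have "(dist x y)\<^sup>2 \<le> 2\<^sup>2" using dist_S2(3)[OF a(1,2)] by (intro power_mono) auto
 moreover have "e\<^sup>2 \<le> 1" using a by (simp add: power_le_one)
 ultimately have "(dist x y)\<^sup>2 + e\<^sup>2 \<le> 5" by simp
 moreover have "(dist x y)\<^sup>2 + e\<^sup>2 > 0" using a by (simp add: add_nonneg_pos)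
 ultimately have "ln ((dist x y)\<^sup>2 + e\<^sup>2) \<le> ln 5" by (intro ln_mono) auto
 then show ?thesis using ln5_le_2 by (simp add: log_reg_def)
qed

lemma abs_log_reg_le:
 assumes "x \<in> S2" "y \<in> S2" "x \<noteq> y" "0 < e" "e \<le> 1"
 shows "\<bar>log_reg e y x\<bar> \<le> \<bar>ln (dist x y)\<bar> + 1"
 using log_reg_lower[OF assms(3), of e] log_reg_upper[OF assms(1,2,4,5)] by linarith

lemma tendsto_log_reg:
 assumes "x \<noteq> y" "e \<longlonglongrightarrow> 0"
 shows "(\<lambda>n. log_reg (e n) y x) \<longlonglongrightarrow> ln (dist x y)"
proof -
 have d: "dist x y > 0" using assms by simp
 have "(\<lambda>n. ln ((dist x y)\<^sup>2 + (e n)\<^sup>2) / 2) \<longlonglongrightarrow> ln ((dist x y)\<^sup>2 + 0\<^sup>2) / 2"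
  using d by (intro tendsto_intros assms) auto
 then show ?thesis using d by (simp add: log_reg_def ln_realpow)
qed

lemma abs_ln_le_powr:
 assumes "0 < d" "d \<le> (2::real)" "0 < s"
 shows "\<bar>ln d\<bar> \<le> (1 / s + 2 powr s) * d powr (- s)"
proof (cases "d \<le> 1")
 case True
 have "\<bar>ln d\<bar> = ln (d powr (- s)) / s" using assms True by (simp add: ln_powr)
 also have "... \<le> d powr (- s) / s"
  using assms ln_bound[of "d powr (- s)"] by (intro divide_right_mono) auto
 also have "... \<le> (1 / s + 2 powr s) * d powr (- s)"
  by (simp add: distrib_right)
 finally show ?thesis .
next
 case False
 have "\<bar>ln d\<bar> \<le> 1" using False assms ln_le_minus_one[of d] by simp
 also have "1 \<le> 2 powr s * d powr (- s)"
 proof -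
  have "d powr s \<le> 2 powr s" using assms by (intro powr_mono2) auto
  then show ?thesis using assms by (simp add: powr_minus field_simps)
 qed
 also have "... \<le> (1 / s + 2 powr s) * d powr (- s)"
  using assms by (simp add: distrib_right)
 finally show ?thesis .
qed

lemma measurable_ln_dist [measurable]: "(\<lambda>x. ln (dist x y)) \<in> borel_measurable area_S2" for y :: "real^3"
 by (rule measurable_area1) measurable

lemma integrable_ln_dist:
 assumes "y \<in> S2"
 shows "integrable area_S2 (\<lambda>x. ln (dist x y))"
proof (rule Bochner_Integration.integrable_bound)
 show "integrable area_S2 (\<lambda>x. (1 / 1 + 2 powr 1) * dist x y powr (- 1))"
  using integrable_dist_powr[OF assms, of 1] by (intro integrable_mult_right) auto
 show "AE x in area_S2. norm (ln (dist x y)) \<le> norm ((1 / 1 + 2 powr 1) * dist x y powr (- 1))"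
  using AE_area_neq[of y] AE_space
  by eventually_elim (use abs_ln_le_powr[of _ 1] assms dist_S2(3) in \<open>auto simp: abs_mult\<close>)
qed measurable

lemma tendsto_integral_log_reg:
 fixes \<psi> :: "real^3 \<Rightarrow> real"
 assumes y: "y \<in> S2" and \<psi>: "continuous_on S2 \<psi>" and e: "e \<longlonglongrightarrow> 0" "\<And>n. 0 < e n" "\<And>n. e n \<le> 1"
 shows "(\<lambda>n. \<ointegral>x. log_reg (e n) y x * \<psi> x) \<longlonglongrightarrow> (\<ointegral>x. ln (dist x y) * \<psi> x)"
proof (rule integral_dominated_convergence[where w="\<lambda>x. (\<bar>ln (dist x y)\<bar> + 1) * \<bar>\<psi> x\<bar>"])
 show "integrable area_S2 (\<lambda>x. (\<bar>ln (dist x y)\<bar> + 1) * \<bar>\<psi> x\<bar>)"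
  using integrable_ln_dist[OF y] \<psi> by (intro integrable_mult_bounded_area continuous_intros) auto
 show "(\<lambda>x. log_reg (e n) y x * \<psi> x) \<in> borel_measurable area_S2" for n
  by (intro measurable_area_continuous continuous_intros \<psi> C1_near_S2_continuous[OF C1_near_log_reg] e)
 show "(\<lambda>x. ln (dist x y) * \<psi> x) \<in> borel_measurable area_S2"
  using integrable_mult_bounded_area[OF integrable_ln_dist[OF y] \<psi>] by auto
 show "AE x in area_S2. (\<lambda>n. log_reg (e n) y x * \<psi> x) \<longlonglongrightarrow> ln (dist x y) * \<psi> x"
  using AE_area_neq[of y] by eventually_elim (intro tendsto_mult tendsto_const tendsto_log_reg e)
 show "AE x in area_S2. norm (log_reg (e n) y x * \<psi> x) \<le> (\<bar>ln (dist x y)\<bar> + 1) * \<bar>\<psi> x\<bar>" for n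
  using AE_area_neq[of y] AE_space
  by eventually_elim (use abs_log_reg_le[OF _ y _ e(2,3)] in \<open>auto simp: abs_mult intro!: mult_right_mono\<close>)
qed

lemma abs_log_reg_deriv_le:
 assumes "norm v \<le> B"
 shows "\<bar>log_reg_deriv e y x v\<bar> \<le> B * dist x y powr (- 1)"
proof (cases "x = y")
 case False
 then have d: "dist x y > 0" by simp
 have "\<bar>(x - y) \<bullet> v\<bar> \<le> dist x y * B"
  using Cauchy_Schwarz_ineq2[of "x - y" v] assms d
  by (smt (verit) dist_norm mult_left_mono zero_le_dist)
 moreover have "(dist x y)\<^sup>2 \<le> (dist x y)\<^sup>2 + e\<^sup>2" by simp
 ultimately have "\<bar>log_reg_deriv e y x v\<bar> \<le> (dist x y * B) / (dist x y)\<^sup>2"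
  unfolding log_reg_deriv_def abs_divide using d
  by (intro frac_le) (auto simp: abs_of_nonneg)
 also have "... = B * dist x y powr (- 1)"
  using d by (simp add: power2_eq_square powr_minus field_simps)
 finally show ?thesis .
qed (simp add: log_reg_deriv_def)

lemma tendsto_log_reg_deriv:
 assumes "e \<longlonglongrightarrow> 0"
 shows "(\<lambda>n. log_reg_deriv (e n) y x v) \<longlonglongrightarrow> log_reg_deriv 0 y x v"
proof (cases "x = y")
 case False
 then have "(dist x y)\<^sup>2 + 0\<^sup>2 \<noteq> 0" by simp
 then show ?thesis unfolding log_reg_deriv_def by (intro tendsto_intros assms)
qed (simp add: log_reg_deriv_def)

lemma measurable_log_reg_deriv:
 assumes "continuous_on S2 X"
 shows "(\<lambda>x. log_reg_deriv e y x (X x)) \<in> borel_measurable area_S2"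
proof -
 have "(\<lambda>x. (x - y) \<bullet> X x) \<in> borel_measurable area_S2"
  by (intro measurable_area_continuous continuous_intros assms)
 moreover have "(\<lambda>x. (dist x y)\<^sup>2 + e\<^sup>2) \<in> borel_measurable area_S2"
  by (intro measurable_area_continuous continuous_intros)
 ultimately show ?thesis unfolding log_reg_deriv_def by (rule borel_measurable_divide)
qed

lemma tendsto_integral_log_reg_deriv:
 assumes y: "y \<in> S2" and X: "continuous_on S2 X" and e: "e \<longlonglongrightarrow> 0"
 shows "(\<lambda>n. \<ointegral>x. log_reg_deriv (e n) y x (X x)) \<longlonglongrightarrow> (\<ointegral>x. log_reg_deriv 0 y x (X x))"
proof -
 obtain B where B: "B \<ge> 0" "\<And>x. x \<in> S2 \<Longrightarrow> norm (X x) \<le> B" using bounded_S2[OF X] by blast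
 show ?thesis
 proof (rule integral_dominated_convergence[where w="\<lambda>x. B * dist x y powr (- 1)"])
  show "integrable area_S2 (\<lambda>x. B * dist x y powr (- 1))"
   using integrable_dist_powr[OF y, of 1] by (intro integrable_mult_right) auto
 qed (use measurable_log_reg_deriv[OF X] tendsto_log_reg_deriv[OF e] abs_log_reg_deriv_le B in auto)
qed

lemma null_seq_inverse_Suc:
 "(\<lambda>n. inverse (real (Suc n))) \<longlonglongrightarrow> 0" "\<And>n. 0 < inverse (real (Suc n))" "\<And>n. inverse (real (Suc n)) \<le> 1"
 using LIMSEQ_inverse_real_of_nat by (auto simp: inverse_le_1_iff)

text \<open>Integrate by parts with the regularised logarithm and let \<open>e\<close> tend to 0:
  its derivative is dominated by a multiple of \<open>dist x y powr (- 1)\<close>, which is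
  integrable in dimension two.\<close>

theorem weak_gradient_ln_dist:
 assumes y: "y \<in> S2" and X: "Ck_S2 1 X" "tangent_S2 X"
 shows "(\<ointegral>x. ln (dist x y) * div_S2 X x) = - (\<ointegral>x. log_reg_deriv 0 y x (X x))"
proof -
 let ?e = "\<lambda>n. inverse (real (Suc n))"
 have "(\<ointegral>x. log_reg (?e n) y x * div_S2 X x) = - (\<ointegral>x. log_reg_deriv (?e n) y x (X x))" for n
  by (rule integration_by_parts_div_S2[OF C1_near_log_reg X]) simp
 moreover have "(\<lambda>n. \<ointegral>x. log_reg (?e n) y x * div_S2 X x) \<longlonglongrightarrow> (\<ointegral>x. ln (dist x y) * div_S2 X x)"
  by (rule tendsto_integral_log_reg[OF y continuous_on_div_S2[OF X(1)] null_seq_inverse_Suc])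
 moreover have "(\<lambda>n. - (\<ointegral>x. log_reg_deriv (?e n) y x (X x))) \<longlonglongrightarrow> - (\<ointegral>x. log_reg_deriv 0 y x (X x))"
  by (intro tendsto_minus tendsto_integral_log_reg_deriv[OF y Ck_S2_continuous[OF X(1)]] null_seq_inverse_Suc)
 ultimately show ?thesis by (simp add: LIMSEQ_unique)
qed

text \<open>
 The Laplacian of the regularised logarithm is \<open>P - 1/2\<close>, where \<open>P\<close> is a positive kernel
 of mass \<open>2 \<pi>\<close> concentrating at the pole.
\<close>

definition log_kernel :: "real \<Rightarrow> real \<Rightarrow> real" where
 "log_kernel e t = ((1 + e\<^sup>2 / 2)\<^sup>2 - 1) / (2 * (1 + e\<^sup>2 / 2 - t)\<^sup>2)"

text \<open>On the sphere \<open>(dist x y)\<^sup>2 + e\<^sup>2 = 2 * (s - y \<bullet> x)\<close>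
  with \<open>s = 1 + e\<^sup>2 / 2\<close>, so the regularised logarithm is zonal with profile ln
  (2 (s - t)) / 2. The Legendre operator applied to this profile is the kernel minus 1 / 2.\<close>

lemma integral_log_kernel_mult:
 fixes \<phi> :: "real^3 \<Rightarrow> real"
 assumes y: "y \<in> S2" and e: "e > 0" and \<phi>: "C1_near_S2 \<phi> \<phi>'"
 shows "(\<ointegral>x. \<phi> x * (log_kernel e (y \<bullet> x) - 1 / 2))
   = - (\<ointegral>x. \<phi>' x ((y - (y \<bullet> x) *\<^sub>R x) /\<^sub>R (2 * (y \<bullet> x) - 2 - e\<^sup>2)))"
proof -
 define s where "s = 1 + e\<^sup>2 / 2"
 have s: "s > 1" using e by (simp add: s_def)
 define g' where "g' t = - 1 / (2 * (s - t))" for t :: real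
 define g'' where "g'' t = - 1 / (2 * (s - t)\<^sup>2)" for t :: real
 have der: "(g' has_real_derivative g'' t) (at t)" if "\<bar>t\<bar> \<le> 1" for t
  unfolding g'_def g''_def using that s
  by (auto intro!: derivative_eq_intros simp: power2_eq_square divide_simps) (simp add: algebra_simps)?
 define Z' where "Z' x v = (g'' (y \<bullet> x) * (y \<bullet> v)) *\<^sub>R (y - (y \<bullet> x) *\<^sub>R x)
    - g' (y \<bullet> x) *\<^sub>R ((y \<bullet> v) *\<^sub>R x + (y \<bullet> x) *\<^sub>R v)" for x v
 have ne: "s - y \<bullet> x \<noteq> 0" if "x \<in> S2" for x using inner_S2_bounds(2)[OF y that] s by simp
 have "C1_near_S2 (\<lambda>x. g' (y \<bullet> x) *\<^sub>R (y - (y \<bullet> x) *\<^sub>R x)) Z'"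
  unfolding C1_near_S2_def Z'_def[abs_def]
  using has_derivative_zonal_grad[OF y _ der] ne by (auto simp: g''_def g'_def intro!: continuous_intros)
 from integration_by_parts_S2[OF \<phi> this tangent_zonal_grad[OF y]]
 have "(\<ointegral>x. \<phi> x * tangential_trace Z' x) = - (\<ointegral>x. \<phi>' x (g' (y \<bullet> x) *\<^sub>R (y - (y \<bullet> x) *\<^sub>R x)))" .
 moreover have "tangential_trace Z' x = log_kernel e (y \<bullet> x) - 1 / 2" if x: "x \<in> S2" for x
 proof -
  have "tangential_trace Z' x = (1 - (y \<bullet> x)\<^sup>2) * g'' (y \<bullet> x) - 2 * (y \<bullet> x) * g' (y \<bullet> x)"
   unfolding tangential_trace_def Z'_def by (rule zonal_grad_trace[OF y x])
  also have "... = (s\<^sup>2 - 1) / (2 * (s - y \<bullet> x)\<^sup>2) - 1 / 2"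
   unfolding g'_def g''_def using ne[OF x] by (simp add: divide_simps) (simp add: power2_eq_square algebra_simps)
  finally show ?thesis by (simp add: log_kernel_def s_def)
 qed
 moreover have "g' t = inverse (2 * t - 2 - e\<^sup>2)" for t
 proof -
  have "2 * t - 2 - e\<^sup>2 = - (2 * (s - t))" by (simp add: s_def)
  then have "inverse (2 * t - 2 - e\<^sup>2) = - inverse (2 * (s - t))" by (simp only: inverse_minus_eq)
  then show ?thesis by (simp only: g'_def divide_inverse mult_minus_left mult_1)
 qed
 ultimately show ?thesis
  by (metis (no_types, lifting) area_integral_cong)
qed

lemma log_reg_deriv_zonal:
 assumes y: "y \<in> S2" and x: "x \<in> S2" and G: "G \<bullet> x = 0"
 shows "G \<bullet> ((y - (y \<bullet> x) *\<^sub>R x) /\<^sub>R (2 * (y \<bullet> x) - 2 - e\<^sup>2)) = log_reg_deriv e y x G"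
proof -
 have "G \<bullet> (y - (y \<bullet> x) *\<^sub>R x) = - ((x - y) \<bullet> G)"
  using G by (simp add: inner_simps inner_commute)
 moreover have "2 * (y \<bullet> x) - 2 - e\<^sup>2 = - ((dist x y)\<^sup>2 + e\<^sup>2)"
  using dist_S2(1)[OF x y] by (simp add: inner_commute)
 moreover have "G \<bullet> ((y - (y \<bullet> x) *\<^sub>R x) /\<^sub>R c) = (G \<bullet> (y - (y \<bullet> x) *\<^sub>R x)) / c" for c
  by (simp add: divide_inverse mult.commute)
 ultimately show ?thesis by (simp only: log_reg_deriv_def minus_divide_divide)
qed

lemma log_kernel_nonneg: "log_kernel e t \<ge> 0"
proof -
 have "(1 + e\<^sup>2 / 2)\<^sup>2 \<ge> 1" by simp
 then show ?thesis by (simp add: log_kernel_def)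
qed

lemma continuous_on_log_kernel:
 assumes "y \<in> S2" "e > 0"
 shows "continuous_on S2 (\<lambda>x. log_kernel e (y \<bullet> x))"
proof -
 have "1 + e\<^sup>2 / 2 - y \<bullet> x \<noteq> 0" if "x \<in> S2" for x
  using inner_S2_bounds(2)[OF assms(1) that] assms(2) zero_less_power[of e 2] by linarith
 then show ?thesis unfolding log_kernel_def by (auto intro!: continuous_intros)
qed

lemma integral_log_kernel:
 assumes "y \<in> S2" "e > 0"
 shows "(\<ointegral>x. log_kernel e (y \<bullet> x)) = 2 * pi"
proof -
 have "(\<ointegral>x. 1 * (log_kernel e (y \<bullet> x) - 1 / 2)) = 0"
  by (subst integral_log_kernel_mult[OF assms, of "\<lambda>_. 1" "\<lambda>_ _. 0"]) (auto simp: C1_near_S2_def)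
 then show ?thesis
  using integrable_area_continuous[OF continuous_on_log_kernel[OF assms]] measure_area_S2 by simp
qed

lemma tendsto_integral_log_kernel:
 fixes \<phi> :: "real^3 \<Rightarrow> real"
 assumes y: "y \<in> S2" and \<phi>: "continuous_on S2 \<phi>" and e: "e \<longlonglongrightarrow> 0" "\<And>n. 0 < e n"
 shows "(\<lambda>n. \<ointegral>x. \<phi> x * log_kernel (e n) (y \<bullet> x)) \<longlonglongrightarrow> 2 * pi * \<phi> y"
proof -
 have ck: "continuous_on S2 (\<lambda>x. log_kernel (e n) (y \<bullet> x))" for n by (rule continuous_on_log_kernel[OF y e(2)])
 obtain B where B: "B \<ge> 0" "\<And>x. x \<in> S2 \<Longrightarrow> norm (\<phi> x) \<le> B" using bounded_S2[OF \<phi>] by blast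
 have diff: "(\<ointegral>x. \<phi> x * log_kernel (e n) (y \<bullet> x)) - 2 * pi * \<phi> y
   = (\<ointegral>x. (\<phi> x - \<phi> y) * log_kernel (e n) (y \<bullet> x))" for n
 proof -
  have "integrable area_S2 (\<lambda>x. \<phi> x * log_kernel (e n) (y \<bullet> x))" "integrable area_S2 (\<lambda>x. \<phi> y * log_kernel (e n) (y \<bullet> x))"
   by (intro integrable_area_continuous continuous_intros \<phi> ck)+
  then show ?thesis using integral_log_kernel[OF y e(2), of n] by (simp add: left_diff_distrib)
 qed
 show ?thesis
 proof (rule LIMSEQ_I)
  fix r :: real assume r: "r > 0"
  \<comment> \<open>The kernel has mass 2 pi, so oscillation at most \<open>r'\<close> of \<phi>
    near \<open>y\<close> costs r / 2; the other half is left for the distant part.\<close>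
  define r' where "r' = r / (4 * pi)"
  have r': "r' > 0" using r by (simp add: r'_def)
  obtain d where d: "d > 0" "\<And>x. x \<in> S2 \<Longrightarrow> dist x y < d \<Longrightarrow> dist (\<phi> x) (\<phi> y) < r'"
   using \<phi> y r' unfolding continuous_on_iff by metis
  \<comment> \<open>A bound for the kernel where \<open>dist x y \<ge> d\<close>: there
    \<open>1 - y \<bullet> x \<ge> d\<^sup>2 / 2\<close>, so the denominator is at least d^4 / 2
    while the numerator tends to 0.\<close>
  define q where "q n = ((1 + (e n)\<^sup>2 / 2)\<^sup>2 - 1) * (2 / d ^ 4)" for n
  have "q \<longlonglongrightarrow> ((1 + 0\<^sup>2 / 2)\<^sup>2 - 1) * (2 / d ^ 4)" unfolding q_def by (intro tendsto_intros e) auto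
  then have "(\<lambda>n. 2 * B * q n * (4 * pi)) \<longlonglongrightarrow> 2 * B * (((1 + 0\<^sup>2 / 2)\<^sup>2 - 1) * (2 / d ^ 4)) * (4 * pi)"
   by (intro tendsto_intros)
  then have "(\<lambda>n. 2 * B * q n * (4 * pi)) \<longlonglongrightarrow> 0" by simp
  then obtain n0 where n0: "\<And>n. n \<ge> n0 \<Longrightarrow> \<bar>2 * B * q n * (4 * pi)\<bar> < r / 2"
   using r LIMSEQ_D[of _ 0 "r / 2"] by (metis diff_zero half_gt_zero real_norm_def)
  have "norm ((\<ointegral>x. \<phi> x * log_kernel (e n) (y \<bullet> x)) - 2 * pi * \<phi> y) < r" if n: "n \<ge> n0" for n
  proof -
   have qn: "q n \<ge> 0"
   proof -
    have "(1 + (e n)\<^sup>2 / 2)\<^sup>2 \<ge> 1" by simp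
    then show ?thesis by (simp add: q_def)
   qed
   have bd: "\<bar>(\<phi> x - \<phi> y) * log_kernel (e n) (y \<bullet> x)\<bar> \<le> r' * log_kernel (e n) (y \<bullet> x) + 2 * B * q n"
    if x: "x \<in> S2" for x
   proof (cases "dist x y < d")
    case True
    then have "\<bar>\<phi> x - \<phi> y\<bar> \<le> r'" using d(2)[OF x] by (simp add: dist_real_def)
    then have "\<bar>(\<phi> x - \<phi> y) * log_kernel (e n) (y \<bullet> x)\<bar> \<le> r' * log_kernel (e n) (y \<bullet> x)"
     using log_kernel_nonneg by (simp add: abs_mult mult_right_mono)
    then show ?thesis using B(1) qn by (simp add: add_increasing2)
   next
    case False
    have "(dist x y)\<^sup>2 \<ge> d\<^sup>2" using False d by (intro power_mono) auto
    then have "1 - y \<bullet> x \<ge> d\<^sup>2 / 2" using dist_S2(1)[OF x y] by (simp add: inner_commute)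
    then have "1 + (e n)\<^sup>2 / 2 - y \<bullet> x \<ge> d\<^sup>2 / 2" using zero_le_power2[of "e n"] by linarith
    then have "(1 + (e n)\<^sup>2 / 2 - y \<bullet> x)\<^sup>2 \<ge> (d\<^sup>2 / 2)\<^sup>2" using d by (intro power_mono) auto
    then have "log_kernel (e n) (y \<bullet> x) \<le> ((1 + (e n)\<^sup>2 / 2)\<^sup>2 - 1) / (2 * (d\<^sup>2 / 2)\<^sup>2)"
     unfolding log_kernel_def using d
     by (intro divide_left_mono mult_pos_pos) (auto intro: less_le_trans[of 0 "(d\<^sup>2 / 2)\<^sup>2"])
    also have "... = q n" using d by (simp add: q_def power2_eq_square power4_eq_xxxx)
    finally have k: "log_kernel (e n) (y \<bullet> x) \<le> q n" .
    have "\<bar>\<phi> x - \<phi> y\<bar> \<le> 2 * B" using B(2)[OF x] B(2)[OF y] by simp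
    then have "\<bar>(\<phi> x - \<phi> y) * log_kernel (e n) (y \<bullet> x)\<bar> \<le> 2 * B * q n"
     using k log_kernel_nonneg[of "e n" "y \<bullet> x"] B(1) by (simp add: abs_mult mult_mono)
    then show ?thesis using r' log_kernel_nonneg by (simp add: add_increasing)
   qed
   have "\<bar>(\<ointegral>x. (\<phi> x - \<phi> y) * log_kernel (e n) (y \<bullet> x))\<bar>
     \<le> (\<ointegral>x. \<bar>(\<phi> x - \<phi> y) * log_kernel (e n) (y \<bullet> x)\<bar>)" by (rule integral_abs_bound)
   also have "... \<le> (\<ointegral>x. r' * log_kernel (e n) (y \<bullet> x) + 2 * B * q n)"
    by (intro integral_mono integrable_area_continuous continuous_intros \<phi> ck) (use bd in auto)
   also have "... = r' * (2 * pi) + 2 * B * q n * (4 * pi)"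
    using integral_log_kernel[OF y e(2), of n] measure_area_S2 integrable_area_continuous[OF ck]
    by simp
   also have "... < r / 2 + r / 2" using n0[OF n] by (simp add: r'_def abs_less_iff)
   finally show ?thesis unfolding diff by simp
  qed
  then show "\<exists>no. \<forall>n\<ge>no. norm ((\<ointegral>x. \<phi> x * log_kernel (e n) (y \<bullet> x)) - 2 * pi * \<phi> y) < r" by blast
 qed
qed

text \<open>The regularised kernels concentrate to 2 pi times the Dirac mass at \<open>y\<close>.
  The constant -1 / 2 in their Laplacian balances it, having total - 2 pi over the area 4
  pi.\<close>

theorem green_identity_ln_dist:
 fixes \<phi> :: "real^3 \<Rightarrow> real"
 assumes y: "y \<in> S2" and \<phi>: "smooth_S2 \<phi>"
 shows "(\<ointegral>x. ln (dist x y) * laplacian_S2 \<phi> x) = 2 * pi * \<phi> y - (\<ointegral>x. \<phi> x) / 2"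
proof -
 let ?e = "\<lambda>n. inverse (real (Suc n))"
 have C\<phi>: "C1_near_S2 (\<phi> \<circ> sgn) (\<lambda>x. frechet_derivative (\<phi> \<circ> sgn) (at x))"
  by (rule Ck_S2_1_C1_near[OF smooth_S2_Ck[OF \<phi>]])
 have c\<phi>: "continuous_on S2 \<phi>" by (rule Ck_S2_continuous[OF smooth_S2_Ck[OF \<phi>]])
 have 1: "(\<ointegral>x. log_reg (?e n) y x * laplacian_S2 \<phi> x)
   = (\<ointegral>x. \<phi> x * log_kernel (?e n) (y \<bullet> x)) - (\<ointegral>x. \<phi> x) / 2" for n
 proof -
  have e: "?e n > 0" by simp
  have "(\<ointegral>x. log_reg (?e n) y x * laplacian_S2 \<phi> x) = - (\<ointegral>x. log_reg_deriv (?e n) y x (grad_S2 \<phi> x))"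
   by (rule integration_by_parts_laplacian_S2[OF C1_near_log_reg[OF e] \<phi>])
  also have "(\<ointegral>x. log_reg_deriv (?e n) y x (grad_S2 \<phi> x))
    = (\<ointegral>x. frechet_derivative (\<phi> \<circ> sgn) (at x) ((y - (y \<bullet> x) *\<^sub>R x) /\<^sub>R (2 * (y \<bullet> x) - 2 - (?e n)\<^sup>2)))"
  proof (rule area_integral_cong)
   fix x assume x: "x \<in> S2"
   have "grad_S2 \<phi> x \<bullet> x = 0" using tangent_grad_S2[OF smooth_S2_Ck[OF \<phi>]] x by (simp add: tangent_S2_def)
   then show "log_reg_deriv (?e n) y x (grad_S2 \<phi> x)
    = frechet_derivative (\<phi> \<circ> sgn) (at x) ((y - (y \<bullet> x) *\<^sub>R x) /\<^sub>R (2 * (y \<bullet> x) - 2 - (?e n)\<^sup>2))"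
    by (simp only: grad_S2_inner[OF smooth_S2_Ck[OF \<phi>] x] log_reg_deriv_zonal[OF y x])
  qed
  also have "- ... = (\<ointegral>x. (\<phi> \<circ> sgn) x * (log_kernel (?e n) (y \<bullet> x) - 1 / 2))"
   using integral_log_kernel_mult[OF y e C\<phi>] by simp
  also have "... = (\<ointegral>x. \<phi> x * log_kernel (?e n) (y \<bullet> x) - \<phi> x / 2)"
   by (rule area_integral_cong) (auto simp: right_diff_distrib)
  also have "... = (\<ointegral>x. \<phi> x * log_kernel (?e n) (y \<bullet> x)) - (\<ointegral>x. \<phi> x) / 2"
   by (subst Bochner_Integration.integral_diff)
    (auto intro!: integrable_area_continuous continuous_intros c\<phi> continuous_on_log_kernel y)
  finally show ?thesis .
 qed
 have "(\<lambda>n. \<ointegral>x. log_reg (?e n) y x * laplacian_S2 \<phi> x) \<longlonglongrightarrow> 2 * pi * \<phi> y - (\<ointegral>x. \<phi> x) / 2"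
  unfolding 1 by (intro tendsto_intros tendsto_integral_log_kernel[OF y c\<phi>] null_seq_inverse_Suc)
 moreover have "(\<lambda>n. \<ointegral>x. log_reg (?e n) y x * laplacian_S2 \<phi> x) \<longlonglongrightarrow> (\<ointegral>x. ln (dist x y) * laplacian_S2 \<phi> x)"
  by (rule tendsto_integral_log_reg[OF y continuous_on_laplacian_S2[OF \<phi>] null_seq_inverse_Suc])
 ultimately show ?thesis by (rule LIMSEQ_unique[rotated])
qed

subsection \<open>Singular integral kernels\<close>

interpretation area2: pair_sigma_finite area_S2 area_S2
 by unfold_locales

lemma measurable_area_ident [measurable]: "(\<lambda>x. x) \<in> borel_measurable area_S2"
 by (rule measurable_area1) simp

lemma measurable_area2 [measurable]:
 "fst \<in> borel_measurable (area_S2 \<Otimes>\<^sub>M area_S2)" "snd \<in> borel_measurable (area_S2 \<Otimes>\<^sub>M area_S2)"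
 by (rule measurable_compose[OF _ measurable_area_ident], measurable)+

text \<open>Integrate in \<open>x\<close> first: the inner integral of the singularity is
  \<open>riesz_const s\<close> for every pole, which leaves only the L1 norm of
  \<open>f\<close>.\<close>

lemma integrable_kernel:
 fixes k :: "real^3 \<Rightarrow> real^3 \<Rightarrow> 'b::euclidean_space"
 assumes f: "integrable area_S2 f" and s: "s < 2"
  and k: "(\<lambda>z. k (fst z) (snd z)) \<in> borel_measurable (area_S2 \<Otimes>\<^sub>M area_S2)"
  and bd: "\<And>x y. x \<in> S2 \<Longrightarrow> y \<in> S2 \<Longrightarrow> norm (k x y) \<le> C * dist x y powr (- s)"
 shows "integrable (area_S2 \<Otimes>\<^sub>M area_S2) (\<lambda>(x, y). f y *\<^sub>R k x y)"
proof -
 have fm [measurable]: "f \<in> borel_measurable area_S2" using f by auto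
 define g where "g z = \<bar>f (snd z)\<bar> * dist (fst z) (snd z) powr (- s)" for z
 have gm [measurable]: "g \<in> borel_measurable (area_S2 \<Otimes>\<^sub>M area_S2)" unfolding g_def by measurable
 have "(\<integral>\<^sup>+z. ennreal (g z) \<partial>(area_S2 \<Otimes>\<^sub>M area_S2)) = (\<ointegral>\<^sup>+y. (\<ointegral>\<^sup>+x. ennreal (g (x, y))))"
  by (rule area2.nn_integral_snd[symmetric]) measurable
 also have "... = (\<ointegral>\<^sup>+y. ennreal \<bar>f y\<bar> * ennreal (riesz_const s))"
 proof (rule nn_integral_cong)
  fix y assume "y \<in> space area_S2"
  then have y: "y \<in> S2" by simp
  have "(\<ointegral>\<^sup>+x. ennreal (g (x, y))) = (\<ointegral>\<^sup>+x. ennreal \<bar>f y\<bar> * ennreal (dist x y powr (- s)))"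
   by (simp add: g_def ennreal_mult)
  also have "... = ennreal \<bar>f y\<bar> * ennreal (riesz_const s)"
   by (simp add: nn_integral_cmult nn_integral_dist_powr[OF y s])
  finally show "(\<ointegral>\<^sup>+x. ennreal (g (x, y))) = ennreal \<bar>f y\<bar> * ennreal (riesz_const s)" .
 qed
 also have "... = (\<ointegral>\<^sup>+y. ennreal \<bar>f y\<bar>) * ennreal (riesz_const s)"
  by (rule nn_integral_multc) measurable
 also have "... < \<infinity>"
  using f by (simp add: integrable_iff_bounded ennreal_mult_less_top)
 finally have gi: "integrable (area_S2 \<Otimes>\<^sub>M area_S2) g"
  by (intro integrableI_nonneg gm) (auto simp: g_def)
 show ?thesis
 proof (rule Bochner_Integration.integrable_bound[where f="\<lambda>z. C * g z"])
  show "integrable (area_S2 \<Otimes>\<^sub>M area_S2) (\<lambda>z. C * g z)" using gi by simp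
  have "(\<lambda>z. f (snd z) *\<^sub>R k (fst z) (snd z)) \<in> borel_measurable (area_S2 \<Otimes>\<^sub>M area_S2)"
   using k by measurable
  then show "(\<lambda>(x, y). f y *\<^sub>R k x y) \<in> borel_measurable (area_S2 \<Otimes>\<^sub>M area_S2)"
   by (simp add: case_prod_unfold)
  show "AE z in area_S2 \<Otimes>\<^sub>M area_S2. norm (case z of (x, y) \<Rightarrow> f y *\<^sub>R k x y) \<le> norm (C * g z)"
  proof (rule AE_I2)
   fix z assume "z \<in> space (area_S2 \<Otimes>\<^sub>M area_S2)"
   then obtain x y where z: "z = (x, y)" "x \<in> S2" "y \<in> S2" by (auto simp: space_pair_measure)
   have "norm (f y *\<^sub>R k x y) \<le> \<bar>f y\<bar> * (C * dist x y powr (- s))"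
    using bd[OF z(2,3)] by (simp add: mult_left_mono)
   also have "... \<le> norm (C * g z)" by (simp add: g_def z(1) mult_ac)
   finally show "norm (case z of (x, y) \<Rightarrow> f y *\<^sub>R k x y) \<le> norm (C * g z)" by (simp add: z(1))
  qed
 qed
qed

lemma kernel_Fubini:
 fixes k :: "real^3 \<Rightarrow> real^3 \<Rightarrow> real"
 assumes f: "integrable area_S2 f" and s: "s < 2"
  and k: "(\<lambda>z. k (fst z) (snd z)) \<in> borel_measurable (area_S2 \<Otimes>\<^sub>M area_S2)"
  and bd: "\<And>x y. x \<in> S2 \<Longrightarrow> y \<in> S2 \<Longrightarrow> norm (k x y) \<le> C * dist x y powr (- s)"
 shows kernel_AE_integrable: "AE x in area_S2. integrable area_S2 (\<lambda>y. f y * k x y)"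
  and kernel_integrable: "integrable area_S2 (\<lambda>x. \<ointegral>y. f y * k x y)"
  and kernel_integral_swap: "(\<ointegral>x. (\<ointegral>y. f y * k x y)) = (\<ointegral>y. f y * (\<ointegral>x. k x y))"
proof -
 have i: "integrable (area_S2 \<Otimes>\<^sub>M area_S2) (\<lambda>(x, y). f y * k x y)"
  using integrable_kernel[OF assms] by simp
 show "AE x in area_S2. integrable area_S2 (\<lambda>y. f y * k x y)" by (rule area2.AE_integrable_fst[OF i])
 show "integrable area_S2 (\<lambda>x. \<ointegral>y. f y * k x y)" by (rule area2.integrable_fst[OF i])
 show "(\<ointegral>x. (\<ointegral>y. f y * k x y)) = (\<ointegral>y. f y * (\<ointegral>x. k x y))"
  using area2.Fubini_integral[OF i] by simp
qed

text \<open>The 2 is the diameter of the sphere and makes the kernel nonnegative. On the diagonal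
  its value is 0, by the conventions for division by zero and \<open>ln 0\<close>.\<close>

definition log_pot_kernel :: "real^3 \<Rightarrow> real^3 \<Rightarrow> real" where
 "log_pot_kernel x y = ln (2 / dist x y)"

definition log_pot :: "(real^3 \<Rightarrow> real) \<Rightarrow> real^3 \<Rightarrow> real" where
 "log_pot f x = (\<ointegral>y. f y * log_pot_kernel x y) / (2 * pi)"

lemma log_pot_kernel_nonneg:
 assumes "x \<in> S2" "y \<in> S2" shows "log_pot_kernel x y \<ge> 0"
proof (cases "x = y")
 case False
 then have "dist x y > 0" by simp
 then have "1 \<le> 2 / dist x y" using dist_S2(3)[OF assms] by simp
 then show ?thesis by (simp add: log_pot_kernel_def ln_ge_zero)
qed (simp add: log_pot_kernel_def)

lemma log_pot_kernel_ln: "x \<noteq> y \<Longrightarrow> log_pot_kernel x y = ln 2 - ln (dist x y)"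
 by (simp add: log_pot_kernel_def ln_div)

lemma log_pot_kernel_le:
 assumes "x \<in> S2" "y \<in> S2" "s > 0"
 shows "log_pot_kernel x y \<le> (2 powr s / s) * dist x y powr (- s)"
proof (cases "x = y")
 case False
 then have d: "dist x y > 0" by simp
 have "s * ln (2 / dist x y) = ln ((2 / dist x y) powr s)" using d by (simp add: ln_powr)
 also have "... \<le> (2 / dist x y) powr s" using d by (intro ln_bound) simp
 also have "... = 2 powr s * dist x y powr (- s)" using d by (simp add: powr_divide powr_minus_divide)
 finally show ?thesis using assms(3) by (simp add: log_pot_kernel_def field_simps)
qed (simp add: log_pot_kernel_def)

lemma measurable_log_pot_kernel2 [measurable]:
 "(\<lambda>z. log_pot_kernel (fst z) (snd z)) \<in> borel_measurable (area_S2 \<Otimes>\<^sub>M area_S2)"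
 unfolding log_pot_kernel_def by measurable

lemma measurable_log_pot_kernel [measurable]: "log_pot_kernel x \<in> borel_measurable area_S2"
 unfolding log_pot_kernel_def[abs_def] by (rule measurable_area1) measurable

lemma log_pot_kernel_bound:
 assumes "x \<in> S2" "y \<in> S2"
 shows "norm (log_pot_kernel x y) \<le> 2 * dist x y powr (- 1)"
 using log_pot_kernel_nonneg[OF assms] log_pot_kernel_le[OF assms, of 1] by simp

lemma log_pot_facts:
 assumes f: "integrable area_S2 f"
 shows log_pot_AE_integrable: "AE x in area_S2. integrable area_S2 (\<lambda>y. f y * log_pot_kernel x y)"
  and log_pot_integrable: "integrable area_S2 (log_pot f)"
 using kernel_Fubini[OF f _ measurable_log_pot_kernel2 log_pot_kernel_bound] by (auto simp: log_pot_def[abs_def])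

lemma log_pot_measurable:
 assumes f: "integrable area_S2 f"
 shows "log_pot f \<in> borel_measurable area_S2"
 using log_pot_integrable[OF f] by auto

lemma log_pot_nonneg:
 assumes "\<And>y. y \<in> S2 \<Longrightarrow> f y \<ge> 0" "x \<in> S2"
 shows "log_pot f x \<ge> 0"
 unfolding log_pot_def using assms log_pot_kernel_nonneg by (intro divide_nonneg_nonneg integral_nonneg_AE AE_I2) auto

text \<open>Fubini moves the integral onto the logarithm; the constant \<open>ln 2\<close> of the
  kernel disappears because \<psi> has mean zero.\<close>

lemma integral_log_pot_mult:
 fixes \<psi> :: "real^3 \<Rightarrow> real"
 assumes f: "integrable area_S2 f" and \<psi>: "continuous_on S2 \<psi>" "(\<ointegral>x. \<psi> x) = 0"
 shows "(\<ointegral>x. log_pot f x * \<psi> x) = - (\<ointegral>y. f y * (\<ointegral>x. ln (dist x y) * \<psi> x)) / (2 * pi)"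
proof -
 obtain B where B: "B \<ge> 0" "\<And>x. x \<in> S2 \<Longrightarrow> norm (\<psi> x) \<le> B" using bounded_S2[OF \<psi>(1)] by blast
 define k where "k x y = log_pot_kernel x y * \<psi> x" for x y
 have [measurable]: "\<psi> \<in> borel_measurable area_S2" by (rule measurable_area_continuous[OF \<psi>(1)])
 have km: "(\<lambda>z. k (fst z) (snd z)) \<in> borel_measurable (area_S2 \<Otimes>\<^sub>M area_S2)" unfolding k_def by measurable
 have kb: "norm (k x y) \<le> (2 * B) * dist x y powr (- 1)" if "x \<in> S2" "y \<in> S2" for x y
 proof -
  have "norm (k x y) \<le> (2 * dist x y powr (- 1)) * B"
   unfolding k_def norm_mult using log_pot_kernel_bound[OF that] B that by (intro mult_mono) auto
  then show ?thesis by (simp add: mult_ac)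
 qed
 have "(\<ointegral>x. log_pot f x * \<psi> x) = (\<ointegral>x. (\<ointegral>y. f y * k x y)) / (2 * pi)"
  unfolding log_pot_def k_def by (simp add: mult.assoc[symmetric])
 also have "(\<ointegral>x. (\<ointegral>y. f y * k x y)) = (\<ointegral>y. f y * (\<ointegral>x. k x y))"
  by (rule kernel_integral_swap[OF f _ km kb]) auto
 also have "... = (\<ointegral>y. f y * - (\<ointegral>x. ln (dist x y) * \<psi> x))"
 proof (rule area_integral_cong)
  fix y assume y: "y \<in> S2"
  have "(\<ointegral>x. k x y) = (\<ointegral>x. ln 2 * \<psi> x - ln (dist x y) * \<psi> x)"
  proof (rule integral_cong_AE)
   show "AE x in area_S2. k x y = ln 2 * \<psi> x - ln (dist x y) * \<psi> x"
    using AE_area_neq[of y] by eventually_elim (simp add: k_def log_pot_kernel_ln left_diff_distrib)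
   have "(\<lambda>x. log_pot_kernel x y) \<in> borel_measurable area_S2"
    unfolding log_pot_kernel_def by (rule measurable_area1) measurable
   then show "(\<lambda>x. k x y) \<in> borel_measurable area_S2" unfolding k_def by measurable
  qed measurable
  also have "... = - (\<ointegral>x. ln (dist x y) * \<psi> x)"
   using \<psi> integrable_mult_bounded_area[OF integrable_ln_dist[OF y] \<psi>(1)] integrable_area_continuous[OF \<psi>(1)] by simp
  finally show "f y * (\<ointegral>x. k x y) = f y * - (\<ointegral>x. ln (dist x y) * \<psi> x)" by simp
 qed
 finally show ?thesis by simp
qed

subsection \<open>The representation formula\<close>

definition total_mass :: "real^'m::finite \<Rightarrow> real" where
 "total_mass \<beta> = 4 * pi + 2 * pi * (\<Sum>i\<in>UNIV. \<beta> $ i)"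

definition green_rep :: "('m::finite \<Rightarrow> real^3) \<Rightarrow> real^'m \<Rightarrow> (real^3 \<Rightarrow> real) \<Rightarrow> real^3 \<Rightarrow> real" where
 "green_rep p \<beta> f x = (\<Sum>i\<in>UNIV. \<beta> $ i * ln (dist x (p i))) + log_pot f x"

lemma integrable_green_rep:
 assumes p: "range p \<subseteq> S2" and f: "integrable area_S2 f"
 shows "integrable area_S2 (green_rep p \<beta> f)"
 unfolding green_rep_def[abs_def]
 using log_pot_integrable[OF f] subsetD[OF p rangeI]
 by (intro Bochner_Integration.integrable_add Bochner_Integration.integrable_sum integrable_mult_right integrable_ln_dist)

text \<open>Each \<open>ln (dist x (p i))\<close> brings a constant -1 / 2 and the potential brings
  the mass of \<open>f\<close> divided by 4 pi. These add up to the constant 1 of the equation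
  because the mass is \<open>total_mass \<beta>\<close>.\<close>

lemma laplacian_green_rep:
 fixes \<phi> :: "real^3 \<Rightarrow> real"
 assumes p: "range p \<subseteq> S2" and f: "integrable area_S2 f" and m: "(\<ointegral>x. f x) = total_mass \<beta>"
  and \<phi>: "smooth_S2 \<phi>"
 shows "(\<ointegral>x. green_rep p \<beta> f x * laplacian_S2 \<phi> x)
  = 2 * pi * (\<Sum>i\<in>UNIV. \<beta> $ i * \<phi> (p i)) - (\<ointegral>x. f x * \<phi> x) + (\<ointegral>x. \<phi> x)"
proof -
 let ?I = "\<ointegral>x. \<phi> x"
 have cl: "continuous_on S2 (laplacian_S2 \<phi>)" by (rule continuous_on_laplacian_S2[OF \<phi>])
 have pS: "p i \<in> S2" for i using p by (meson rangeI subsetD)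
 have i1: "integrable area_S2 (\<lambda>x. ln (dist x (p i)) * laplacian_S2 \<phi> x)" for i
  by (rule integrable_mult_bounded_area[OF integrable_ln_dist[OF pS] cl])
 have i2: "integrable area_S2 (\<lambda>x. log_pot f x * laplacian_S2 \<phi> x)"
  by (rule integrable_mult_bounded_area[OF log_pot_integrable[OF f] cl])
 have cp: "continuous_on S2 \<phi>" by (rule Ck_S2_continuous[OF smooth_S2_Ck[OF \<phi>]])
 have "(\<ointegral>x. green_rep p \<beta> f x * laplacian_S2 \<phi> x)
  = (\<ointegral>x. (\<Sum>i\<in>UNIV. \<beta> $ i * (ln (dist x (p i)) * laplacian_S2 \<phi> x)) + log_pot f x * laplacian_S2 \<phi> x)"
  unfolding green_rep_def by (simp add: distrib_right sum_distrib_right mult.assoc)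
 also have "... = (\<Sum>i\<in>UNIV. \<beta> $ i * (\<ointegral>x. ln (dist x (p i)) * laplacian_S2 \<phi> x))
    + (\<ointegral>x. log_pot f x * laplacian_S2 \<phi> x)"
  using i1 i2 by simp
 also have "(\<ointegral>x. log_pot f x * laplacian_S2 \<phi> x)
   = - (\<ointegral>y. f y * (\<ointegral>x. ln (dist x y) * laplacian_S2 \<phi> x)) / (2 * pi)"
  by (rule integral_log_pot_mult[OF f cl integral_laplacian_S2[OF \<phi>]])
 also have "(\<ointegral>y. f y * (\<ointegral>x. ln (dist x y) * laplacian_S2 \<phi> x))
   = (\<ointegral>y. 2 * pi * (f y * \<phi> y) - ?I / 2 * f y)"
 proof (rule area_integral_cong)
  fix y assume "y \<in> S2"
  from green_identity_ln_dist[OF this \<phi>]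
  show "f y * (\<ointegral>x. ln (dist x y) * laplacian_S2 \<phi> x) = 2 * pi * (f y * \<phi> y) - ?I / 2 * f y"
   by (simp only:) (simp add: algebra_simps)
 qed
 also have "... = 2 * pi * (\<ointegral>x. f x * \<phi> x) - ?I / 2 * total_mass \<beta>"
  using f integrable_mult_bounded_area[OF f cp] m by simp
 also have "(\<Sum>i\<in>UNIV. \<beta> $ i * (\<ointegral>x. ln (dist x (p i)) * laplacian_S2 \<phi> x))
   = 2 * pi * (\<Sum>i\<in>UNIV. \<beta> $ i * \<phi> (p i)) - (\<Sum>i\<in>UNIV. \<beta> $ i) * (?I / 2)"
  by (simp only: green_identity_ln_dist[OF pS \<phi>])
   (simp add: algebra_simps sum_subtractf sum_distrib_left sum_distrib_right)
 moreover have "(2 * pi * F - ?I / 2 * total_mass \<beta>) / (2 * pi) = F - ?I - (\<Sum>i\<in>UNIV. \<beta> $ i) * (?I / 2)" for F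
  unfolding total_mass_def by (simp add: field_simps)
 ultimately show ?thesis by (simp only: minus_divide_left[symmetric])
qed

text \<open>The test function 1 fixes the mass. With that mass \<open>u\<close> and
  \<open>green_rep p \<beta> f\<close> have the same distributional Laplacian, so their difference
  is weakly harmonic, hence constant.\<close>

theorem liouville_solution_representation:
 fixes u :: "real^3 \<Rightarrow> real"
 assumes p: "range p \<subseteq> S2" and sol: "liouville_solution p K \<beta> u"
 defines "f \<equiv> \<lambda>x. K x * exp (2 * u x)"
 shows "integrable area_S2 f" "(\<ointegral>x. f x) = total_mass \<beta>"
  and "\<exists>c. AE x in area_S2. u x = c + green_rep p \<beta> f x"
proof -
 show f: "integrable area_S2 f" using sol by (simp add: liouville_solution_def f_def)
 have eq: "- (\<ointegral>x. u x * laplacian_S2 \<phi> x) = (\<ointegral>x. f x * \<phi> x)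
     - 2 * pi * (\<Sum>i\<in>UNIV. \<beta> $ i * \<phi> (p i)) - (\<ointegral>x. \<phi> x)"
  if "smooth_S2 \<phi>" for \<phi> :: "real^3 \<Rightarrow> real"
  using sol that by (simp add: liouville_solution_def f_def)
 have l0: "laplacian_S2 (\<lambda>_. 1) x = 0" if "x \<in> S2" for x
  using laplacian_zonal[of x x "\<lambda>_. 1" "\<lambda>_. 0" "\<lambda>_. 0"] that by simp
 have "(\<ointegral>x. u x * laplacian_S2 (\<lambda>_. 1) x) = (\<ointegral>x. 0)"
  by (rule area_integral_cong) (use l0 in auto)
 then show m: "(\<ointegral>x. f x) = total_mass \<beta>"
  using eq[OF smooth_const, of 1] measure_area_S2 by (simp add: total_mass_def)
 have "u \<in> W1_S2 1" using sol by (auto simp: liouville_solution_def)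
 then have "u \<in> borel_measurable area_S2" "integrable area_S2 (\<lambda>x. \<bar>u x\<bar>)"
  by (auto simp: W1_S2_def Lp_S2_def)
 then have u: "integrable area_S2 u" using integrable_abs_cancel by blast
 have gr: "integrable area_S2 (green_rep p \<beta> f)" by (rule integrable_green_rep[OF p f])
 have "\<exists>c. AE x in area_S2. u x - green_rep p \<beta> f x = c"
 proof (rule weakly_harmonic_AE_const)
  show "integrable area_S2 (\<lambda>x. u x - green_rep p \<beta> f x)" using u gr by simp
  fix \<phi> :: "real^3 \<Rightarrow> real" assume \<phi>: "smooth_S2 \<phi>"
  note cl = continuous_on_laplacian_S2[OF \<phi>]
  show "(\<ointegral>x. (u x - green_rep p \<beta> f x) * laplacian_S2 \<phi> x) = 0"
   using integrable_mult_bounded_area[OF u cl] integrable_mult_bounded_area[OF gr cl]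
    laplacian_green_rep[OF p f m \<phi>] eq[OF \<phi>] by (simp add: left_diff_distrib)
 qed
 then obtain c where c: "AE x in area_S2. u x - green_rep p \<beta> f x = c" by blast
 have "AE x in area_S2. u x = c + green_rep p \<beta> f x" using c by eventually_elim simp
 then show "\<exists>c. AE x in area_S2. u x = c + green_rep p \<beta> f x" ..
qed

section \<open>Sobolev regularity of Green potentials\<close>

lemma add_powr_le:
 fixes a b q :: real
 assumes "a \<ge> 0" "b \<ge> 0" "q \<ge> 0"
 shows "(a + b) powr q \<le> 2 powr q * (a powr q + b powr q)"
proof -
 have "(a + b) powr q \<le> (2 * max a b) powr q" using assms by (intro powr_mono2) auto
 also have "... = 2 powr q * max a b powr q" using assms by (simp add: powr_mult)
 also have "... \<le> 2 powr q * (a powr q + b powr q)" by (intro mult_left_mono) (auto simp: max_def)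
 finally show ?thesis .
qed

lemma Lp_S2_bound:
 fixes g :: "real^3 \<Rightarrow> 'b::euclidean_space"
 assumes g: "g \<in> borel_measurable area_S2" and h: "integrable area_S2 (\<lambda>x. h x powr q)" and q: "q \<ge> 0"
  and bd: "AE x in area_S2. norm (g x) \<le> h x"
 shows "g \<in> Lp_S2 q"
proof -
 have "integrable area_S2 (\<lambda>x. norm (g x) powr q)"
 proof (rule Bochner_Integration.integrable_bound[OF h])
  show "(\<lambda>x. norm (g x) powr q) \<in> borel_measurable area_S2" using g by measurable
  show "AE x in area_S2. norm (norm (g x) powr q) \<le> norm (h x powr q)"
   using bd by eventually_elim (use q in \<open>auto intro!: powr_mono2\<close>)
 qed
 then show ?thesis using g by (simp add: Lp_S2_def)
qed

lemma Lp_S2_add: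
 fixes f g :: "real^3 \<Rightarrow> 'b::euclidean_space"
 assumes f: "f \<in> Lp_S2 q" and g: "g \<in> Lp_S2 q" and q: "q \<ge> 0"
 shows "(\<lambda>x. f x + g x) \<in> Lp_S2 q"
proof -
 have [measurable]: "f \<in> borel_measurable area_S2" "g \<in> borel_measurable area_S2"
  using f g by (auto simp: Lp_S2_def)
 have "integrable area_S2 (\<lambda>x. norm (f x + g x) powr q)"
 proof (rule Bochner_Integration.integrable_bound[where f="\<lambda>x. 2 powr q * (norm (f x) powr q + norm (g x) powr q)"])
  show "integrable area_S2 (\<lambda>x. 2 powr q * (norm (f x) powr q + norm (g x) powr q))"
   using f g by (simp add: Lp_S2_def)
  have "norm (f x + g x) powr q \<le> (norm (f x) + norm (g x)) powr q" for x
   using q by (intro powr_mono2 norm_triangle_ineq) auto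
  then have "norm (f x + g x) powr q \<le> 2 powr q * (norm (f x) powr q + norm (g x) powr q)" for x
   using add_powr_le[of "norm (f x)" "norm (g x)" q] q by (meson norm_ge_zero order_trans)
  then show "AE x in area_S2. norm (norm (f x + g x) powr q) \<le> norm (2 powr q * (norm (f x) powr q + norm (g x) powr q))"
   by (intro AE_I2) (simp add: order_trans[OF _ abs_ge_self])
 qed measurable
 then show ?thesis by (simp add: Lp_S2_def)
qed

lemma Lp_S2_scale:
 fixes f :: "real^3 \<Rightarrow> 'b::euclidean_space"
 assumes f: "f \<in> Lp_S2 q"
 shows "(\<lambda>x. c *\<^sub>R f x) \<in> Lp_S2 q"
 using f by (auto simp: Lp_S2_def powr_mult)

lemma Lp_S2_sum:
 fixes f :: "'i \<Rightarrow> real^3 \<Rightarrow> 'b::euclidean_space"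
 assumes "finite I" "\<And>i. i \<in> I \<Longrightarrow> f i \<in> Lp_S2 q" "q \<ge> 0"
 shows "(\<lambda>x. \<Sum>i\<in>I. f i x) \<in> Lp_S2 q"
 using assms(1,2)
proof (induction I rule: finite_induct)
 case empty then show ?case by (simp add: Lp_S2_def)
next
 case (insert i I)
 then show ?case using Lp_S2_add[of "f i" q "\<lambda>x. \<Sum>i\<in>I. f i x"] assms(3) by simp
qed

definition grad_ln_dist :: "real^3 \<Rightarrow> real^3 \<Rightarrow> real^3" where
 "grad_ln_dist x y = ((x - y) - ((x - y) \<bullet> x) *\<^sub>R x) /\<^sub>R (dist x y)\<^sup>2"

lemma grad_ln_dist_tangent: "x \<in> S2 \<Longrightarrow> grad_ln_dist x y \<bullet> x = 0"
 by (simp add: grad_ln_dist_def inner_simps inner_self_S2)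

lemma grad_ln_dist_inner: "X \<bullet> x = 0 \<Longrightarrow> grad_ln_dist x y \<bullet> X = log_reg_deriv 0 y x X"
 by (simp add: grad_ln_dist_def log_reg_deriv_def inner_simps inner_commute divide_inverse)

lemma norm_grad_ln_dist:
 assumes "x \<in> S2"
 shows "norm (grad_ln_dist x y) \<le> dist x y powr (- 1)"
proof -
 let ?g = "grad_ln_dist x y"
 have "(norm ?g)\<^sup>2 = ?g \<bullet> ?g" by (simp add: power2_norm_eq_inner)
 also have "... = log_reg_deriv 0 y x ?g" by (rule grad_ln_dist_inner[OF grad_ln_dist_tangent[OF assms]])
 also have "... \<le> norm ?g * dist x y powr (- 1)"
  using abs_log_reg_deriv_le[of ?g "norm ?g" 0 y x] by simp
 finally have "norm ?g * norm ?g \<le> norm ?g * dist x y powr (- 1)" by (simp only: power2_eq_square)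
 then show ?thesis by (cases "norm ?g = 0") (simp, simp only: mult_le_cancel_left_pos zero_less_norm_iff norm_eq_zero not_False_eq_True)
qed

lemma measurable_grad_ln_dist2:
 "(\<lambda>z. grad_ln_dist (fst z) (snd z)) \<in> borel_measurable (area_S2 \<Otimes>\<^sub>M area_S2)"
 unfolding grad_ln_dist_def by measurable

lemma measurable_grad_ln_dist: "(\<lambda>x. grad_ln_dist x y) \<in> borel_measurable area_S2"
 unfolding grad_ln_dist_def by measurable

lemma Lp_grad_ln_dist:
 assumes y: "y \<in> S2" and q: "0 \<le> q" "q < 2"
 shows "(\<lambda>x. grad_ln_dist x y) \<in> Lp_S2 q"
proof (rule Lp_S2_bound[OF measurable_grad_ln_dist _ q(1)])
 show "AE x in area_S2. norm (grad_ln_dist x y) \<le> dist x y powr (- 1)"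
  using norm_grad_ln_dist by (intro AE_I2) auto
 show "integrable area_S2 (\<lambda>x. (dist x y powr (- 1)) powr q)"
  using integrable_dist_powr[OF y q(2)] by (simp only: powr_powr mult_minus1)
qed

lemma Lp_ln_dist:
 assumes y: "y \<in> S2" and q: "1 \<le> q" "q < 2"
 shows "(\<lambda>x. ln (dist x y)) \<in> Lp_S2 q"
proof (rule Lp_S2_bound)
 show "AE x in area_S2. norm (ln (dist x y)) \<le> (1 / 1 + 2 powr 1) * dist x y powr (- 1)"
  using AE_area_neq[of y] AE_space
  by eventually_elim (use abs_ln_le_powr[of _ 1] assms dist_S2(3) in auto)
 show "integrable area_S2 (\<lambda>x. ((1 / 1 + 2 powr 1) * dist x y powr (- 1)) powr q)"
  using integrable_mult_right[OF integrable_dist_powr[OF y q(2)], of "(1 / 1 + 2 powr 1) powr q"]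
  by (simp only: powr_mult powr_powr mult_minus1)
qed (use q in auto)

text \<open>
 Splitting \<open>z \<le> t z\<^sup>q t\<^bsup>-q\<^esup> + t\<close> with \<open>t\<close> proportional to the mean of \<open>z\<close> gives the \<open>L\<^sup>q\<close> Jensen
 inequality up to a constant.
\<close>

lemma integral_powr_le:
 fixes z f :: "'a \<Rightarrow> real"
 assumes f: "integrable M f" "\<And>x. x \<in> space M \<Longrightarrow> f x \<ge> 0"
  and z: "\<And>x. x \<in> space M \<Longrightarrow> z x \<ge> 0" and q: "q \<ge> 1"
  and zf: "integrable M (\<lambda>x. f x * z x)" and zqf: "integrable M (\<lambda>x. f x * z x powr q)"
 shows "(\<integral>x. f x * z x \<partial>M) powr q \<le> 2 powr q * (\<integral>x. f x \<partial>M) powr (q - 1) * (\<integral>x. f x * z x powr q \<partial>M)"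
proof -
 define T where "T = (\<integral>x. f x * z x \<partial>M)"
 define m where "m = (\<integral>x. f x \<partial>M)"
 define I where "I = (\<integral>x. f x * z x powr q \<partial>M)"
 have T0: "T \<ge> 0" and m0: "m \<ge> 0" and I0: "I \<ge> 0"
  unfolding T_def m_def I_def using f z by (auto intro!: integral_nonneg_AE)
 show ?thesis
 proof (cases "T = 0 \<or> m = 0")
  case True
  have "T = 0"
  proof (cases "m = 0")
   case True
   then have "AE x in M. f x = 0"
    using f integral_nonneg_eq_0_iff_AE[OF f(1)] by (auto simp: m_def)
   then have "AE x in M. f x * z x = 0" by eventually_elim simp
   then show ?thesis unfolding T_def by (rule integral_eq_zero_AE)
  qed (use True in auto)
  then show ?thesis using I0 by (simp add: T_def[symmetric] I_def[symmetric])
 next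
  case False
  then have T: "T > 0" and m: "m > 0" using T0 m0 by auto
  define t where "t = T / (2 * m)"
  have t: "t > 0" using T m by (simp add: t_def)
  have pw: "z x \<le> t powr (1 - q) * z x powr q + t" if "x \<in> space M" for x
  proof (cases "z x \<le> t")
   case True then show ?thesis by (simp add: add_increasing)
  next
   case False
   then have "z x > 0" using t by simp
   then have "z x = z x powr (1 - q) * z x powr q" by (simp add: powr_add[symmetric])
   also have "... \<le> t powr (1 - q) * z x powr q"
    using False t q by (intro mult_right_mono powr_mono2') auto
   finally show ?thesis using t by simp
  qed
  have "T \<le> (\<integral>x. t powr (1 - q) * (f x * z x powr q) + t * f x \<partial>M)"
   unfolding T_def
  proof (rule integral_mono)
   show "f x * z x \<le> t powr (1 - q) * (f x * z x powr q) + t * f x" if "x \<in> space M" for x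
    using mult_left_mono[OF pw[OF that] f(2)[OF that]] by (simp add: algebra_simps)
  qed (use zf zqf f in auto)
  also have "... = t powr (1 - q) * I + t * m" using zqf f by (simp add: I_def m_def)
  also have "t * m = T / 2" using m by (simp add: t_def)
  finally have "T \<le> 2 * (t powr (1 - q) * I)" by simp
  then have "T * t powr (q - 1) \<le> 2 * (t powr (1 - q) * I) * t powr (q - 1)"
   by (intro mult_right_mono) auto
  also have "... = 2 * I * (t powr (1 - q) * t powr (q - 1))" by simp
  also have "t powr (1 - q) * t powr (q - 1) = 1" using t by (simp add: powr_add[symmetric])
  finally have "T * t powr (q - 1) \<le> 2 * I" by simp
  moreover have "T * t powr (q - 1) = T powr q / (2 * m) powr (q - 1)"
   using T m by (simp add: t_def powr_divide powr_diff)
  ultimately have "T powr q \<le> 2 * I * (2 * m) powr (q - 1)"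
   using m by (simp add: divide_le_eq)
  also have "... = 2 powr q * m powr (q - 1) * I"
   using m by (simp add: powr_mult powr_diff)
  finally show ?thesis by (simp add: T_def m_def I_def)
 qed
qed

text \<open>The norm of the gradient is at most the average \<open>T\<close> of
  \<open>dist x y powr (- 1)\<close> against \<open>f\<close>. By the Jensen-type inequality its
  \<open>q\<close>-th power is controlled by the average of \<open>dist x y powr (- q)\<close>,
  which is integrable for \<open>q < 2\<close>.\<close>

lemma Lp_grad_log_pot:
 assumes f: "integrable area_S2 f" "\<And>x. x \<in> S2 \<Longrightarrow> f x \<ge> 0" and q: "1 \<le> q" "q < 2"
 shows "(\<lambda>x. \<ointegral>y. f y *\<^sub>R grad_ln_dist x y) \<in> Lp_S2 q"
proof -
 have i: "integrable (area_S2 \<Otimes>\<^sub>M area_S2) (\<lambda>(x, y). f y *\<^sub>R grad_ln_dist x y)"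
  by (rule integrable_kernel[OF f(1) _ measurable_grad_ln_dist2, of 1 1]) (use norm_grad_ln_dist in auto)
 have m: "(\<lambda>x. \<ointegral>y. f y *\<^sub>R grad_ln_dist x y) \<in> borel_measurable area_S2"
  using area2.integrable_fst[OF i] by auto
 have km: "(\<lambda>z. dist (fst z) (snd z) powr (- s)) \<in> borel_measurable (area_S2 \<Otimes>\<^sub>M area_S2)" for s by measurable
 note K = kernel_Fubini[OF f(1) _ km, where C=1]
 define T where "T x = (\<ointegral>y. f y * dist x y powr (- 1))" for x
 define I where "I x = (\<ointegral>y. f y * dist x y powr (- q))" for x
 have K1: "AE x in area_S2. integrable area_S2 (\<lambda>y. f y * dist x y powr (- 1))" by (rule K(1)[of 1]) auto
 have Kq: "AE x in area_S2. integrable area_S2 (\<lambda>y. f y * dist x y powr (- q))" by (rule K(1)[of q]) (use q in auto)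
 have I: "integrable area_S2 I" unfolding I_def by (rule K(2)[of q]) (use q in auto)
 have T: "integrable area_S2 T" unfolding T_def by (rule K(2)[of 1]) auto
 show ?thesis
 proof (rule Lp_S2_bound[OF m])
  show "AE x in area_S2. norm (\<ointegral>y. f y *\<^sub>R grad_ln_dist x y) \<le> T x"
   using K1 area2.AE_integrable_fst[OF i] AE_space
  proof eventually_elim
   case (elim x)
   have "norm (\<ointegral>y. f y *\<^sub>R grad_ln_dist x y) \<le> (\<ointegral>y. norm (f y *\<^sub>R grad_ln_dist x y))"
    by (rule integral_norm_bound)
   also have "... \<le> T x" unfolding T_def
   proof (rule integral_mono[OF integrable_norm[OF elim(2)] elim(1)])
    fix y assume "y \<in> space area_S2"
    then have "f y \<ge> 0" using f by simp
    with mult_left_mono[OF norm_grad_ln_dist this, of x y] elim(3)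
    show "norm (f y *\<^sub>R grad_ln_dist x y) \<le> f y * dist x y powr (- 1)" by simp
   qed
   finally show ?case .
  qed
  show "integrable area_S2 (\<lambda>x. T x powr q)"
  proof (rule Bochner_Integration.integrable_bound)
   let ?c = "2 powr q * (\<ointegral>x. f x) powr (q - 1)"
   show "integrable area_S2 (\<lambda>x. ?c * I x)" using I by simp
   show "(\<lambda>x. T x powr q) \<in> borel_measurable area_S2" using T by measurable
   show "AE x in area_S2. norm (T x powr q) \<le> norm (?c * I x)"
    using K1 Kq AE_space
   proof eventually_elim
    case (elim x)
    have "T x powr q \<le> ?c * (\<ointegral>y. f y * (dist x y powr (- 1)) powr q)"
     unfolding T_def
    proof (rule integral_powr_le[OF f(1) _ _ q(1) elim(1)])
     show "integrable area_S2 (\<lambda>y. f y * (dist x y powr (- 1)) powr q)"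
      using elim(2) by (simp only: powr_powr mult_minus1)
    qed (use f in auto)
    also have "(\<ointegral>y. f y * (dist x y powr (- 1)) powr q) = I x"
     by (simp only: I_def powr_powr mult_minus1)
    finally show ?case by (simp add: order_trans[OF _ abs_ge_self])
   qed
  qed
 qed (use q in auto)
qed

text \<open>The weak gradient is written down explicitly as \<open>G\<close>: the tangential
  gradients of the logarithms at the cone points, minus their average against \<open>f\<close>
  divided by 2 pi. Fubini and the weak gradient of \<open>ln (dist x y)\<close> verify it; the
  singularity of order 1 restricts membership in \<open>W1_S2 q\<close> to
  \<open>q < 2\<close>.\<close>

theorem liouville_solution_from_potential:
 fixes f :: "real^3 \<Rightarrow> real"
 assumes p: "range p \<subseteq> S2"
  and f: "integrable area_S2 f" "\<And>x. x \<in> S2 \<Longrightarrow> f x \<ge> 0" "(\<ointegral>x. f x) = total_mass \<beta>"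
  and u: "\<And>x. x \<in> S2 \<Longrightarrow> u x = c + green_rep p \<beta> f x"
  and um: "u \<in> borel_measurable area_S2"
  and fu: "AE x in area_S2. f x = K x * exp (2 * u x)" and K: "K \<in> borel_measurable area_S2"
  and bd: "\<And>x. x \<in> S2 \<Longrightarrow> \<bar>log_pot f x\<bar> \<le> W"
 shows "liouville_solution p K \<beta> u"
 unfolding liouville_solution_def
proof (intro conjI allI impI)
 have pS: "p i \<in> S2" for i using p by (meson rangeI subsetD)
 have fm: "(\<lambda>x. K x * exp (2 * u x)) \<in> borel_measurable area_S2" using K um by measurable
 show "integrable area_S2 (\<lambda>x. K x * exp (2 * u x))"
  using f(1) fu fm integrable_cong_AE[OF borel_measurable_integrable[OF f(1)] fm fu] by simp
 fix \<phi> :: "real^3 \<Rightarrow> real" assume \<phi>: "smooth_S2 \<phi>"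
 note cl = continuous_on_laplacian_S2[OF \<phi>]
 have c\<phi>: "continuous_on S2 \<phi>" by (rule Ck_S2_continuous[OF smooth_S2_Ck[OF \<phi>]])
 have \<phi>m [measurable]: "\<phi> \<in> borel_measurable area_S2" by (rule measurable_area_continuous[OF c\<phi>])
 have "(\<ointegral>x. K x * exp (2 * u x) * \<phi> x) = (\<ointegral>x. f x * \<phi> x)"
 proof (rule integral_cong_AE)
  show "AE x in area_S2. K x * exp (2 * u x) * \<phi> x = f x * \<phi> x" using fu by eventually_elim simp
  show "(\<lambda>x. K x * exp (2 * u x) * \<phi> x) \<in> borel_measurable area_S2" using fm by measurable
  show "(\<lambda>x. f x * \<phi> x) \<in> borel_measurable area_S2" using f(1) by measurable
 qed
 moreover have "(\<ointegral>x. u x * laplacian_S2 \<phi> x)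
   = (\<ointegral>x. c * laplacian_S2 \<phi> x + green_rep p \<beta> f x * laplacian_S2 \<phi> x)"
  by (rule area_integral_cong) (auto simp: u distrib_right)
 moreover have "... = 0 + (\<ointegral>x. green_rep p \<beta> f x * laplacian_S2 \<phi> x)"
  using integrable_area_continuous[OF cl] integrable_mult_bounded_area[OF integrable_green_rep[OF p f(1)] cl]
  by (simp add: integral_laplacian_S2[OF \<phi>])
 ultimately show "- (\<ointegral>x. u x * laplacian_S2 \<phi> x) =
     (\<ointegral>x. K x * exp (2 * u x) * \<phi> x)
     - 2 * pi * (\<Sum>i\<in>UNIV. \<beta> $ i * \<phi> (p i)) - (\<ointegral>x. \<phi> x)"
  using laplacian_green_rep[OF p f(1,3) \<phi>] by simp
next
 have pS: "p i \<in> S2" for i using p by (meson rangeI subsetD)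
 define G0 where "G0 x = (\<ointegral>y. f y *\<^sub>R grad_ln_dist x y)" for x
 define G where "G x = (\<Sum>i\<in>UNIV. \<beta> $ i *\<^sub>R grad_ln_dist x (p i)) + (- 1 / (2 * pi)) *\<^sub>R G0 x" for x
 have i0: "integrable (area_S2 \<Otimes>\<^sub>M area_S2) (\<lambda>(x, y). f y *\<^sub>R grad_ln_dist x y)"
  by (rule integrable_kernel[OF f(1) _ measurable_grad_ln_dist2, of 1 1]) (use norm_grad_ln_dist in auto)
 have tan0: "G0 x \<bullet> x = 0" if x: "x \<in> S2" for x
 proof (cases "integrable area_S2 (\<lambda>y. f y *\<^sub>R grad_ln_dist x y)")
  case True
  have "G0 x \<bullet> x = (\<ointegral>y. (f y *\<^sub>R grad_ln_dist x y) \<bullet> x)"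
   unfolding G0_def by (rule integral_inner_left[symmetric]) (use True in simp)
  also have "... = 0" using grad_ln_dist_tangent[OF x] by simp
  finally show ?thesis .
 next
  \<comment> \<open>Where the integral does not exist its default value 0 is tangent too, so
    \<open>G\<close> is tangent at every point and not only almost everywhere.\<close>
  case False then show ?thesis by (simp add: G0_def not_integrable_integral_eq)
 qed
 have tan: "tangent_S2 G"
  unfolding tangent_S2_def G_def using tan0 grad_ln_dist_tangent by (auto simp: inner_simps inner_sum_left)
 have weak: "weak_grad_S2 u G"
  unfolding weak_grad_S2_def
 proof (intro conjI allI impI tan)
  fix X :: "real^3 \<Rightarrow> real^3" assume "smooth_S2 X \<and> tangent_S2 X"
  then have X: "Ck_S2 1 X" "tangent_S2 X" by (auto simp: smooth_S2_def)
  have Xx: "X x \<bullet> x = 0" if "x \<in> S2" for x using X(2) that by (simp add: tangent_S2_def)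
  note cd = continuous_on_div_S2[OF X(1)] and cX = Ck_S2_continuous[OF X(1)]
  obtain B where B: "B \<ge> 0" "\<And>x. x \<in> S2 \<Longrightarrow> norm (X x) \<le> B" using bounded_S2[OF cX] by blast
  have d0: "(\<ointegral>x. div_S2 X x) = 0"
   using integration_by_parts_div_S2[OF _ X, of "\<lambda>_. 1" "\<lambda>_ _. 0"] by (simp add: C1_near_S2_def)
  define k where "k x y = log_reg_deriv 0 y x (X x)" for x y
  have kb: "norm (k x y) \<le> B * dist x y powr (- 1)" if "x \<in> S2" "y \<in> S2" for x y
   unfolding k_def using abs_log_reg_deriv_le[OF B(2)[OF that(1)]] by simp
  have km: "(\<lambda>z. k (fst z) (snd z)) \<in> borel_measurable (area_S2 \<Otimes>\<^sub>M area_S2)"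
  proof -
   have [measurable]: "X \<in> borel_measurable area_S2" by (rule measurable_area_continuous[OF cX])
   show ?thesis unfolding k_def log_reg_deriv_def by measurable
  qed
  have ki: "integrable area_S2 (\<lambda>x. k x y)" if y: "y \<in> S2" for y
  proof (rule Bochner_Integration.integrable_bound[where f="\<lambda>x. B * dist x y powr (- 1)"])
   show "integrable area_S2 (\<lambda>x. B * dist x y powr (- 1))"
    using integrable_dist_powr[OF y, of 1] by (intro integrable_mult_right) auto
   show "(\<lambda>x. k x y) \<in> borel_measurable area_S2" unfolding k_def by (rule measurable_log_reg_deriv[OF cX])
   show "AE x in area_S2. norm (k x y) \<le> norm (B * dist x y powr - 1)"
    using kb[OF _ y] B by (intro AE_I2) auto
  qed
  have pot: "(\<ointegral>x. log_pot f x * div_S2 X x) = (\<ointegral>y. f y * (\<ointegral>x. k x y)) / (2 * pi)"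
  proof -
   have "(\<ointegral>y. f y * (\<ointegral>x. ln (dist x y) * div_S2 X x))
     = (\<ointegral>y. - (f y * (\<ointegral>x. k x y)))"
    by (rule area_integral_cong) (auto simp: weak_gradient_ln_dist[OF _ X] k_def)
   then show ?thesis using integral_log_pot_mult[OF f(1) cd d0] by simp
  qed
  have G0X: "(\<ointegral>x. G0 x \<bullet> X x) = (\<ointegral>y. f y * (\<ointegral>x. k x y))"
   and G0Xi: "integrable area_S2 (\<lambda>x. G0 x \<bullet> X x)"
  proof -
   have ae: "AE x in area_S2. G0 x \<bullet> X x = (\<ointegral>y. f y * k x y)"
    using area2.AE_integrable_fst[OF i0] AE_space
   proof eventually_elim
    case (elim x)
    have "G0 x \<bullet> X x = (\<ointegral>y. (f y *\<^sub>R grad_ln_dist x y) \<bullet> X x)"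
     unfolding G0_def by (rule integral_inner_left[symmetric]) (use elim in simp)
    also have "... = (\<ointegral>y. f y * k x y)"
     using elim by (simp add: k_def grad_ln_dist_inner Xx)
    finally show ?case .
   qed
   have "G0 \<in> borel_measurable area_S2"
    using area2.integrable_fst[OF i0] by (auto simp: G0_def[abs_def])
   moreover have "X \<in> borel_measurable area_S2" by (rule measurable_area_continuous[OF cX])
   ultimately have m1: "(\<lambda>x. G0 x \<bullet> X x) \<in> borel_measurable area_S2" by measurable
   have ii: "integrable area_S2 (\<lambda>x. \<ointegral>y. f y * k x y)"
    by (rule kernel_integrable[OF f(1) _ km kb]) auto
   show "integrable area_S2 (\<lambda>x. G0 x \<bullet> X x)"
    using integrable_cong_AE[OF m1 borel_measurable_integrable[OF ii] ae] ii by simp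
   have "(\<ointegral>x. G0 x \<bullet> X x) = (\<ointegral>x. (\<ointegral>y. f y * k x y))"
    by (rule integral_cong_AE[OF m1 borel_measurable_integrable[OF ii] ae])
   also have "... = (\<ointegral>y. f y * (\<ointegral>x. k x y))"
    by (rule kernel_integral_swap[OF f(1) _ km kb]) auto
   finally show "(\<ointegral>x. G0 x \<bullet> X x) = (\<ointegral>y. f y * (\<ointegral>x. k x y))" .
  qed
  have "(\<ointegral>x. u x * div_S2 X x)
    = (\<ointegral>x. c * div_S2 X x + ((\<Sum>i\<in>UNIV. \<beta> $ i * (ln (dist x (p i)) * div_S2 X x)) + log_pot f x * div_S2 X x))"
   by (rule area_integral_cong)
    (auto simp: u green_rep_def distrib_right sum_distrib_right mult.assoc)
  also have "... = (\<Sum>i\<in>UNIV. \<beta> $ i * (\<ointegral>x. ln (dist x (p i)) * div_S2 X x))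
    + (\<ointegral>x. log_pot f x * div_S2 X x)"
   using integrable_area_continuous[OF cd] integrable_mult_bounded_area[OF integrable_ln_dist[OF pS] cd]
    integrable_mult_bounded_area[OF log_pot_integrable[OF f(1)] cd] d0 by simp
  also have "... = - (\<Sum>i\<in>UNIV. \<beta> $ i * (\<ointegral>x. k x (p i))) + (\<ointegral>x. G0 x \<bullet> X x) / (2 * pi)"
   unfolding weak_gradient_ln_dist[OF pS X] pot G0X by (simp add: k_def sum_negf)
  also have "... = - (\<ointegral>x. (\<Sum>i\<in>UNIV. \<beta> $ i * k x (p i)) + (- 1 / (2 * pi)) * (G0 x \<bullet> X x))"
   using ki[OF pS] G0Xi by simp
  also have "(\<ointegral>x. (\<Sum>i\<in>UNIV. \<beta> $ i * k x (p i)) + (- 1 / (2 * pi)) * (G0 x \<bullet> X x))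
    = (\<ointegral>x. G x \<bullet> X x)"
   by (rule area_integral_cong)
    (auto simp: G_def inner_simps inner_sum_left grad_ln_dist_inner Xx k_def)
  finally show "(\<ointegral>x. u x * div_S2 X x) = - (\<ointegral>x. G x \<bullet> X x)" .
 qed
 show "u \<in> (\<Inter>q\<in>{1..<2}. W1_S2 q)"
 proof
  fix q :: real assume "q \<in> {1..<2}"
  then have q: "1 \<le> q" "q < 2" "0 \<le> q" by auto
  have "G \<in> Lp_S2 q"
   unfolding G_def[abs_def] G0_def
   by (intro Lp_S2_add Lp_S2_sum Lp_S2_scale Lp_grad_ln_dist pS Lp_grad_log_pot f q) (use q in auto)
  moreover have "u \<in> Lp_S2 q"
  proof -
   have "integrable area_S2 (\<lambda>x. (\<bar>c\<bar> + \<bar>W\<bar>) powr q)" by simp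
   then have A: "(\<lambda>x. c + log_pot f x) \<in> Lp_S2 q"
   proof (rule Lp_S2_bound[rotated])
    show "AE x in area_S2. norm (c + log_pot f x) \<le> \<bar>c\<bar> + \<bar>W\<bar>"
     using bd by (intro AE_I2) (smt (verit) real_norm_def space_area)
    show "(\<lambda>x. c + log_pot f x) \<in> borel_measurable area_S2"
     using log_pot_measurable[OF f(1)] by measurable
   qed (use q in auto)
   have "(\<lambda>x. ((\<Sum>i\<in>UNIV. \<beta> $ i *\<^sub>R ln (dist x (p i))) + (c + log_pot f x))) \<in> Lp_S2 q"
    by (rule Lp_S2_add[OF Lp_S2_sum A q(3)]) (auto intro!: Lp_S2_scale Lp_ln_dist pS q simp del: real_scaleR_def)
   then have "integrable area_S2 (\<lambda>x. norm ((\<Sum>i\<in>UNIV. \<beta> $ i *\<^sub>R ln (dist x (p i))) + (c + log_pot f x)) powr q)"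
    by (simp add: Lp_S2_def)
   moreover have "integrable area_S2 (\<lambda>x. norm ((\<Sum>i\<in>UNIV. \<beta> $ i *\<^sub>R ln (dist x (p i))) + (c + log_pot f x)) powr q)
    \<longleftrightarrow> integrable area_S2 (\<lambda>x. norm (u x) powr q)"
    by (rule Bochner_Integration.integrable_cong) (auto simp: u green_rep_def algebra_simps)
   ultimately show ?thesis using um by (simp add: Lp_S2_def)
  qed
  ultimately show "u \<in> W1_S2 q" using weak by (auto simp: W1_S2_def)
 qed
qed

subsection \<open>Potential form of the equation\<close>

text \<open>At a cone point \<open>powr\<close> makes this 0 whatever the sign of the exponent; away
  from the cone points it is the exponential of twice the logarithmic terms of
  \<open>green_rep\<close>.\<close>

definition conic_weight :: "('m::finite \<Rightarrow> real^3) \<Rightarrow> real^'m \<Rightarrow> real^3 \<Rightarrow> real" where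
 "conic_weight p \<beta> x = (\<Prod>i\<in>UNIV. dist x (p i) powr (2 * \<beta> $ i))"

text \<open>The equation as a pointwise fixed-point relation for the density. The factor \<kappa> is
  exp (2 c), where c is the additive constant that Green's representation leaves undetermined.
  Demanding equality at every point of the sphere keeps null sets out of the estimates.\<close>

definition potential_form ::
 "('m::finite \<Rightarrow> real^3) \<Rightarrow> (real^3 \<Rightarrow> real) \<Rightarrow> real^'m \<Rightarrow> real \<Rightarrow> (real^3 \<Rightarrow> real) \<Rightarrow> bool" where
 "potential_form p K \<beta> \<kappa> f \<longleftrightarrow> 0 < \<kappa> \<and> integrable area_S2 f \<and> (\<ointegral>x. f x) = total_mass \<beta> \<and>
   (\<forall>x\<in>S2. f x = \<kappa> * K x * conic_weight p \<beta> x * exp (2 * log_pot f x))"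

lemma conic_weight_nonneg: "conic_weight p \<beta> x \<ge> 0"
 by (simp add: conic_weight_def prod_nonneg)

lemma measurable_conic_weight [measurable]: "conic_weight p \<beta> \<in> borel_measurable area_S2"
 unfolding conic_weight_def[abs_def] by measurable

lemma AE_area_notin_range: "AE x in area_S2. \<forall>i::'m::finite. x \<noteq> p i"
 by (subst AE_all_countable) (simp add: AE_area_neq)

lemma conic_weight_exp:
 assumes "\<forall>i. x \<noteq> p i"
 shows "conic_weight p \<beta> x = exp (2 * (\<Sum>i\<in>UNIV. \<beta> $ i * ln (dist x (p i))))"
 using assms by (simp add: conic_weight_def powr_def exp_sum sum_distrib_left mult_ac)

lemma C1_pos_measurable: "K \<in> C1_pos_S2 \<Longrightarrow> K \<in> borel_measurable area_S2"
 using continuous_on_C1_S2(1) measurable_area_continuous by (auto simp: C1_pos_S2_def)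

lemma potential_form_nonneg:
 assumes "potential_form p K \<beta> \<kappa> f" "\<And>x. x \<in> S2 \<Longrightarrow> K x > 0" "x \<in> S2"
 shows "f x \<ge> 0"
 using assms conic_weight_nonneg[of p \<beta> x] by (simp add: potential_form_def less_imp_le)

theorem potential_form_of_solution:
 assumes p: "range p \<subseteq> S2" and K: "K \<in> borel_measurable area_S2" and sol: "liouville_solution p K \<beta> u"
 shows "\<exists>\<kappa> f. potential_form p K \<beta> \<kappa> f"
proof -
 define f where "f x = K x * exp (2 * u x)" for x
 note R = liouville_solution_representation[OF p sol, folded f_def]
 obtain c where c: "AE x in area_S2. u x = c + green_rep p \<beta> f x" using R(3) by blast
 \<comment> \<open>The density \<open>f\<close> equals this product only almost everywhere. Taking
   the product itself as the density gives equality at every point, and the potential does not see a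
   change on a null set.\<close>
 define g where "g x = exp (2 * c) * K x * conic_weight p \<beta> x * exp (2 * log_pot f x)" for x
 have ae: "AE x in area_S2. f x = g x"
  using c AE_area_notin_range[of p]
  by eventually_elim (simp add: f_def g_def conic_weight_exp green_rep_def distrib_left exp_add mult_ac)
 have [measurable]: "log_pot f \<in> borel_measurable area_S2" by (rule log_pot_measurable[OF R(1)])
 note fm = borel_measurable_integrable[OF R(1)]
 have gm: "g \<in> borel_measurable area_S2" unfolding g_def using K by measurable
 have gi: "integrable area_S2 g" using integrable_cong_AE[OF fm gm ae] R(1) by simp
 have gI: "(\<ointegral>x. g x) = total_mass \<beta>" using integral_cong_AE[OF fm gm ae] R(2) by simp
 have "log_pot g x = log_pot f x" for x
 proof -
  have "(\<ointegral>y. g y * log_pot_kernel x y) = (\<ointegral>y. f y * log_pot_kernel x y)"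
  proof (rule integral_cong_AE)
   show "AE y in area_S2. g y * log_pot_kernel x y = f y * log_pot_kernel x y"
    using ae by eventually_elim simp
  qed (use fm gm in measurable)
  then show ?thesis by (simp add: log_pot_def)
 qed
 then have "potential_form p K \<beta> (exp (2 * c)) g"
  using gi gI by (simp add: potential_form_def g_def)
 then show ?thesis by blast
qed

theorem solution_of_potential_form:
 assumes p: "range p \<subseteq> S2" and K: "K \<in> borel_measurable area_S2" "\<And>x. x \<in> S2 \<Longrightarrow> K x > 0"
  and pf: "potential_form p K \<beta> \<kappa> f"
  and bd: "\<And>x. x \<in> S2 \<Longrightarrow> \<bar>log_pot f x\<bar> \<le> W"
 shows "\<exists>u. liouville_solution p K \<beta> u"
proof
 have f: "integrable area_S2 f" "\<And>x. x \<in> S2 \<Longrightarrow> f x \<ge> 0" "(\<ointegral>x. f x) = total_mass \<beta>"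
  using pf potential_form_nonneg[OF pf K(2)] by (auto simp: potential_form_def)
 have \<kappa>: "\<kappa> > 0" using pf by (simp add: potential_form_def)
 let ?u = "\<lambda>x. ln \<kappa> / 2 + green_rep p \<beta> f x"
 show "liouville_solution p K \<beta> ?u"
 proof (rule liouville_solution_from_potential[OF p f refl _ _ K(1) bd])
  show "?u \<in> borel_measurable area_S2" using integrable_green_rep[OF p f(1), of \<beta>] by auto
  show "AE x in area_S2. f x = K x * exp (2 * ?u x)"
   using AE_area_notin_range[of p] AE_space
  proof eventually_elim
   case (elim x)
   then have "f x = \<kappa> * K x * conic_weight p \<beta> x * exp (2 * log_pot f x)"
    using pf by (simp add: potential_form_def)
   moreover have "exp (2 * ?u x) = \<kappa> * conic_weight p \<beta> x * exp (2 * log_pot f x)"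
    using elim \<kappa> by (simp add: conic_weight_exp green_rep_def distrib_left exp_add mult_ac)
   ultimately show ?case by simp
  qed
 qed
qed

text \<open>Summing over the fibre of \<open>p\<close> makes the exponent a total function of the
  point, so cone points and regular points, where it is 0, are treated together. For injective
  \<open>p\<close> the sum has at most one term.\<close>

definition cone_exponent :: "('m::finite \<Rightarrow> real^3) \<Rightarrow> real^'m \<Rightarrow> real^3 \<Rightarrow> real" where
 "cone_exponent p \<beta> x = (\<Sum>i | p i = x. \<beta> $ i)"

lemma cone_exponent_at:
 assumes "inj p" shows "cone_exponent p \<beta> (p i) = \<beta> $ i"
proof -
 have "{j. p j = p i} = {i}" using assms by (auto simp: inj_def)
 then show ?thesis by (simp add: cone_exponent_def)
qed

lemma cone_exponent_off: "x \<notin> range p \<Longrightarrow> cone_exponent p \<beta> x = 0"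
 by (auto simp: cone_exponent_def intro!: sum.neutral)

lemma cone_exponent_gt:
 assumes "inj p" "\<And>i. \<beta> $ i > -1"
 shows "cone_exponent p \<beta> x > -1"
proof (cases "x \<in> range p")
 case True then show ?thesis using assms by (auto simp: cone_exponent_at)
qed (simp add: cone_exponent_off)

lemma abs_cone_exponent_le:
 assumes "inj p" "\<And>i. \<bar>\<beta> $ i\<bar> \<le> B" "B \<ge> 0" shows "\<bar>cone_exponent p \<beta> x\<bar> \<le> B"
proof (cases "x \<in> range p")
 case True then show ?thesis using assms by (auto simp: cone_exponent_at)
qed (use assms in \<open>simp add: cone_exponent_off\<close>)

lemma tendsto_cone_exponent:
 fixes b :: "nat \<Rightarrow> real^'m::finite"
 assumes "b \<longlonglongrightarrow> \<beta>"
 shows "(\<lambda>k. cone_exponent p (b k) x) \<longlonglongrightarrow> cone_exponent p \<beta> x"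
 unfolding cone_exponent_def by (intro tendsto_intros tendsto_vec_nth assms)

section \<open>Local bounds for the conic weight\<close>

lemma powr_le_abs:
 assumes "0 < r" "r \<le> 1" "r \<le> d" "d \<le> (2::real)" "\<bar>e\<bar> \<le> E"
 shows "d powr e \<le> (2 / r) powr E"
proof (cases "e \<ge> 0")
 case True
 have "2 \<le> 2 / r" using assms by (simp add: field_simps)
 then have "d powr e \<le> (2 / r) powr e" using assms True by (intro powr_mono2) auto
 also have "... \<le> (2 / r) powr E" using assms by (intro powr_mono) (auto simp: field_simps)
 finally show ?thesis .
next
 case False
 have "d powr e = (1 / d) powr (- e)" using assms by (simp add: powr_divide powr_minus_divide)
 also have "... \<le> (2 / r) powr (- e)" using assms False by (intro powr_mono2) (auto simp: field_simps)
 also have "... \<le> (2 / r) powr E" using assms by (intro powr_mono) (auto simp: field_simps)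
 finally show ?thesis .
qed

text \<open>The factor 2 keeps every point within \<open>r\<close> of \<open>x0\<close> at distance
  at least \<open>r\<close> from all other cone points.\<close>

lemma isolating_radius:
 fixes p :: "'m::finite \<Rightarrow> real^3"
 obtains r where "0 < r" "r \<le> 1" "\<And>i. p i \<noteq> x0 \<Longrightarrow> 2 * r \<le> dist (p i) x0"
proof -
 define D where "D = insert 1 ((\<lambda>i. dist (p i) x0 / 2) ` {i. p i \<noteq> x0})"
 have D: "finite D" "D \<noteq> {}" "\<And>d. d \<in> D \<Longrightarrow> d > 0" by (auto simp: D_def)
 show ?thesis
 proof (rule that[of "Min D"])
  show "0 < Min D" using D by (metis Min_in)
  show "Min D \<le> 1" using D(1) by (auto simp: D_def)
  show "2 * Min D \<le> dist (p i) x0" if "p i \<noteq> x0" for i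
  proof -
   have "Min D \<le> dist (p i) x0 / 2" using D(1) that by (intro Min_le) (auto simp: D_def)
   then show ?thesis by simp
  qed
 qed
qed

lemma conic_weight_local_eq:
 fixes p :: "'m::finite \<Rightarrow> real^3"
 assumes "inj p" "x \<noteq> x0"
 shows "conic_weight p \<beta> x = dist x x0 powr (2 * cone_exponent p \<beta> x0) * (\<Prod>i | p i \<noteq> x0. dist x (p i) powr (2 * \<beta> $ i))"
proof -
 have "conic_weight p \<beta> x = (\<Prod>i | p i = x0. dist x (p i) powr (2 * \<beta> $ i)) * (\<Prod>i | p i \<noteq> x0. dist x (p i) powr (2 * \<beta> $ i))"
  unfolding conic_weight_def
  by (subst prod.union_disjoint[symmetric]) (auto intro!: prod.cong)
 also have "(\<Prod>i | p i = x0. dist x (p i) powr (2 * \<beta> $ i)) = dist x x0 powr (2 * cone_exponent p \<beta> x0)"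
 proof (cases "x0 \<in> range p")
  case True
  then obtain j where "x0 = p j" by blast
  then have "{i. p i = x0} = {j}" using assms(1) by (auto simp: inj_def)
  then show ?thesis by (simp add: cone_exponent_def \<open>x0 = p j\<close>)
 next
  case False
  then have "{i. p i = x0} = {}" by auto
  then show ?thesis using assms(2) by (simp add: cone_exponent_def)
 qed
 finally show ?thesis .
qed

text \<open>Near \<open>x0\<close> the factors of the other cone points are at most a fixed power of
  \<open>2 / r\<close>; only the factor of \<open>x0\<close> can be singular, of order at most
  \<open>a\<close>. The constant is uniform in \<beta>, as needed for sequences of data.\<close>

lemma conic_weight_local_bound:
 fixes p :: "'m::finite \<Rightarrow> real^3"
 assumes p: "inj p" "range p \<subseteq> S2" and x0: "x0 \<in> S2" and a: "a \<ge> 0"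
  and r: "0 < r" "r \<le> 1" "\<And>i. p i \<noteq> x0 \<Longrightarrow> 2 * r \<le> dist (p i) x0"
 shows "\<exists>C>0. \<forall>\<beta> x. (\<forall>i. \<bar>\<beta> $ i\<bar> \<le> B) \<and> - a \<le> 2 * cone_exponent p \<beta> x0 \<and> x \<in> S2 \<and> x \<noteq> x0 \<and> dist x x0 < r
   \<longrightarrow> conic_weight p \<beta> x \<le> C * dist x x0 powr (- a)"
proof -
 have B0: "B \<ge> 0" if "\<forall>i. \<bar>\<beta> $ i\<bar> \<le> B" for \<beta> :: "real^'m" using that by (meson abs_ge_zero order_trans)
 define c where "c = max 1 ((2 / r) powr (2 * B))"
 have c: "c \<ge> 1" "(2 / r) powr (2 * B) \<le> c" by (auto simp: c_def)
 define C where "C = 2 powr (2 * B + a) * c ^ CARD('m)"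
 have C: "C > 0" using c(1) by (simp add: C_def)
 moreover have "conic_weight p \<beta> x \<le> C * dist x x0 powr (- a)"
  if \<beta>: "\<forall>i. \<bar>\<beta> $ i\<bar> \<le> B" "- a \<le> 2 * cone_exponent p \<beta> x0" and x: "x \<in> S2" "x \<noteq> x0" "dist x x0 < r" for \<beta> x
 proof -
  have d: "0 < dist x x0" "dist x x0 \<le> 2" using x dist_S2(3)[OF x(1) x0] by auto
  have f: "dist x (p i) powr (2 * \<beta> $ i) \<le> c" if "p i \<noteq> x0" for i
  proof -
   have "dist x (p i) \<ge> r" using r(3)[OF that] x(3) dist_triangle[of "p i" x0 x] by (simp add: dist_commute)
   moreover have "dist x (p i) \<le> 2" by (rule dist_S2(3)[OF x(1) subsetD[OF p(2) rangeI]])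
   moreover have "\<bar>2 * \<beta> $ i\<bar> \<le> 2 * B" using \<beta>(1) by (simp add: abs_mult)
   ultimately have "dist x (p i) powr (2 * \<beta> $ i) \<le> (2 / r) powr (2 * B)"
    using r by (intro powr_le_abs) auto
   then show ?thesis using c(2) by simp
  qed
  have "(\<Prod>i | p i \<noteq> x0. dist x (p i) powr (2 * \<beta> $ i)) \<le> (\<Prod>i | p i \<noteq> x0. c)"
   using f by (intro prod_mono) auto
  also have "... \<le> c ^ CARD('m)"
   using c(1) by (simp add: power_increasing card_mono)
  finally have P: "(\<Prod>i | p i \<noteq> x0. dist x (p i) powr (2 * \<beta> $ i)) \<le> c ^ CARD('m)" .
  have ce: "2 * cone_exponent p \<beta> x0 \<le> 2 * B"
   using abs_cone_exponent_le[OF p(1) _ B0[OF \<beta>(1)], of \<beta> x0] \<beta>(1) by (simp add: abs_le_iff)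
  have "dist x x0 powr (2 * cone_exponent p \<beta> x0) = dist x x0 powr (2 * cone_exponent p \<beta> x0 + a) * dist x x0 powr (- a)"
   using d by (simp add: powr_add[symmetric])
  also have "... \<le> 2 powr (2 * B + a) * dist x x0 powr (- a)"
  proof (rule mult_right_mono)
   have "dist x x0 powr (2 * cone_exponent p \<beta> x0 + a) \<le> 2 powr (2 * cone_exponent p \<beta> x0 + a)"
    using d \<beta>(2) by (intro powr_mono2) auto
   also have "... \<le> 2 powr (2 * B + a)" using ce by (intro powr_mono) auto
   finally show "dist x x0 powr (2 * cone_exponent p \<beta> x0 + a) \<le> 2 powr (2 * B + a)" .
  qed simp
  finally have Q: "dist x x0 powr (2 * cone_exponent p \<beta> x0) \<le> 2 powr (2 * B + a) * dist x x0 powr (- a)" .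
  have "conic_weight p \<beta> x \<le> (2 powr (2 * B + a) * dist x x0 powr (- a)) * c ^ CARD('m)"
   unfolding conic_weight_local_eq[OF p(1) x(2)] using P Q by (intro mult_mono) (auto intro: prod_nonneg)
  then show ?thesis by (simp add: C_def mult_ac)
 qed
 ultimately show ?thesis by blast
qed

subsection \<open>Brezis--Merle estimates\<close>

text \<open>Whichever point is nearer dominates both factors. A product of two singularities is thus
  split into a sum, integrable as soon as \<open>a + b < 2\<close>.\<close>

lemma powr_mult_le_add:
 fixes d e :: real
 assumes "a \<ge> 0" "b \<ge> 0" "d \<ge> 0" "e \<ge> 0"
 shows "d powr (- a) * e powr (- b) \<le> d powr (- (a + b)) + e powr (- (a + b))"
proof (cases "d = 0 \<or> e = 0")
 case False
 then have de: "d > 0" "e > 0" using assms by auto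
 show ?thesis
 proof (cases "d \<le> e")
  case True
  have "e powr (- b) \<le> d powr (- b)" using de True assms by (intro powr_mono2') auto
  then have "d powr (- a) * e powr (- b) \<le> d powr (- a) * d powr (- b)" by (intro mult_left_mono) auto
  also have "... = d powr (- (a + b))" by (simp add: powr_add[symmetric])
  finally show ?thesis by (simp add: add_increasing2)
 next
  case False
  have "d powr (- a) \<le> e powr (- a)" using de False assms by (intro powr_mono2') auto
  then have "d powr (- a) * e powr (- b) \<le> e powr (- a) * e powr (- b)" by (intro mult_right_mono) auto
  also have "... = e powr (- (a + b))" by (simp add: powr_add[symmetric])
  finally show ?thesis by (simp add: add_increasing)
 qed
qed auto

text \<open>The bound comes from the tangent of the exponential at the mean.\<close>

lemma exp_average_le:
 fixes f v :: "'a \<Rightarrow> real"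
 assumes f: "integrable M f" "\<And>x. x \<in> space M \<Longrightarrow> f x \<ge> 0"
  and fv: "integrable M (\<lambda>x. f x * v x)" and fe: "integrable M (\<lambda>x. f x * exp (m * v x))"
  and m: "m = c * (\<integral>x. f x \<partial>M)"
 shows "(\<integral>x. f x \<partial>M) * exp (c * (\<integral>x. f x * v x \<partial>M)) \<le> (\<integral>x. f x * exp (m * v x) \<partial>M)"
proof -
 define t where "t = c * (\<integral>x. f x * v x \<partial>M)"
 define F where "F = (\<integral>x. f x \<partial>M)"
 have "exp t * (1 + (m * v x - t)) \<le> exp (m * v x)" for x
 proof -
  have "1 + (m * v x - t) \<le> exp (m * v x - t)" by (rule exp_ge_add_one_self)
  then have "exp t * (1 + (m * v x - t)) \<le> exp t * exp (m * v x - t)" by (intro mult_left_mono) auto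
  then show ?thesis by (simp add: exp_diff)
 qed
 then have "f x * (exp t * (1 + (m * v x - t))) \<le> f x * exp (m * v x)" if "x \<in> space M" for x
  using f(2)[OF that] by (intro mult_left_mono) auto
 then have "(\<integral>x. (exp t * (1 - t)) * f x + (exp t * m) * (f x * v x) \<partial>M) \<le> (\<integral>x. f x * exp (m * v x) \<partial>M)"
  using f(1) fv fe by (intro integral_mono) (auto simp: algebra_simps)
 also have "(\<integral>x. (exp t * (1 - t)) * f x + (exp t * m) * (f x * v x) \<partial>M)
   = (exp t * (1 - t)) * F + (exp t * m) * (\<integral>x. f x * v x \<partial>M)"
  using f(1) fv by (simp add: F_def)
 also have "... = F * exp t"
 proof -
  have "m * (\<integral>x. f x * v x \<partial>M) = F * t" by (simp add: m t_def F_def)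
  then have "(exp t * m) * (\<integral>x. f x * v x \<partial>M) = exp t * (F * t)" by (simp add: mult.assoc)
  then show ?thesis by (simp add: algebra_simps)
 qed
 finally show ?thesis by (simp add: F_def t_def)
qed

text \<open>Mass outside the ball of radius \<open>2 * r\<close> is at distance at least
  \<open>r\<close> from \<open>x\<close> and contributes at most \<open>ln (2 / r)\<close> per unit.
  For the mass inside, convexity moves the exponential under the average, and
  \<open>m \<le> s\<close> bounds the order of the resulting singularity by
  \<open>q * s / pi\<close>.\<close>

lemma exp_log_pot_le:
 fixes f :: "real^3 \<Rightarrow> real"
 assumes f: "integrable area_S2 f" "\<And>x. x \<in> S2 \<Longrightarrow> f x \<ge> 0" "(\<ointegral>x. f x) \<le> M"
  and r: "0 < r" "r \<le> 1"
  and s: "s > 0" "(\<ointegral>y. indicator (ball x0 (2 * r)) y * f y) \<le> s"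
  and q: "q > 0" "q * s / pi < 2"
  and m: "m = (\<ointegral>y. indicator (ball x0 (2 * r)) y * f y)"
 shows "AE x in area_S2. dist x x0 < r \<longrightarrow> exp (2 * q * log_pot f x) \<le> exp (q / pi * (M * ln (2 / r))) *
   (1 + (\<ointegral>y. indicator (ball x0 (2 * r)) y * f y * (2 powr (q * s / pi) * dist x y powr (- (q * s / pi)))) / m)"
proof -
 define g where "g y = indicator (ball x0 (2 * r)) y * f y" for y
 define t where "t = q * s / pi"
 have [measurable]: "f \<in> borel_measurable area_S2" using f by auto
 have bm: "(\<lambda>y. indicator (ball x0 (2 * r)) y :: real) \<in> borel_measurable area_S2" by (intro measurable_area1 borel_measurable_indicator) simp
 have gm [measurable]: "g \<in> borel_measurable area_S2" unfolding g_def[abs_def] using bm by measurable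
 have gi: "integrable area_S2 g"
  by (rule Bochner_Integration.integrable_bound[OF f(1) gm]) (auto simp: g_def indicator_def)
 have g0: "g y \<ge> 0" if "y \<in> S2" for y using f(2)[OF that] by (simp add: g_def)
 have gf: "g y \<le> f y" if "y \<in> S2" for y using f(2)[OF that] by (simp add: g_def indicator_def)
 have m_eq: "m = (\<ointegral>y. g y)" by (simp add: m g_def)
 have m0: "m \<ge> 0" unfolding m_eq using g0 by (intro integral_nonneg_AE AE_I2) auto
 have ms: "m \<le> s" using s(2) m by simp
 have t: "t > 0" "t < 2" using q s pi_gt_zero by (auto simp: t_def)
 have km: "(\<lambda>z. dist (fst z) (snd z) powr (- t)) \<in> borel_measurable (area_S2 \<Otimes>\<^sub>M area_S2)" by measurable
 have kt: "AE x in area_S2. integrable area_S2 (\<lambda>y. g y * dist x y powr (- t))"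
  by (rule kernel_AE_integrable[OF gi t(2) km, of 1]) auto
 show ?thesis
  using kt log_pot_AE_integrable[OF f(1)] log_pot_AE_integrable[OF gi] AE_space
 proof eventually_elim
  case (elim x)
  then have x: "x \<in> S2" by simp
  show ?case
  proof
   assume xr: "dist x x0 < r"
   define J where "J = (\<ointegral>y. g y * log_pot_kernel x y)"
   define A where "A = (\<ointegral>y. g y * (2 powr t * dist x y powr (- t)))"
   have L0: "ln (2 / r) \<ge> 0" using r by (intro ln_ge_zero) (simp add: field_simps)
   have far: "f y * log_pot_kernel x y \<le> g y * log_pot_kernel x y + f y * ln (2 / r)" if y: "y \<in> S2" for y
   proof (cases "y \<in> ball x0 (2 * r)")
    case True
    then show ?thesis using f(2)[OF y] L0 by (simp add: g_def)
   next
    case False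
    then have "dist x y \<ge> r" using xr dist_triangle[of x0 y x] by (simp add: dist_commute)
    then have "log_pot_kernel x y \<le> ln (2 / r)"
     unfolding log_pot_kernel_def using r by (intro ln_mono divide_left_mono mult_pos_pos) auto
    then show ?thesis using f(2)[OF y] False by (simp add: g_def mult_left_mono)
   qed
   have "2 * pi * log_pot f x = (\<ointegral>y. f y * log_pot_kernel x y)"
    by (simp add: log_pot_def)
   also have "... \<le> (\<ointegral>y. g y * log_pot_kernel x y + f y * ln (2 / r))"
    using elim f(1) far by (intro integral_mono) auto
   also have "... = J + (\<ointegral>y. f y) * ln (2 / r)" using elim f(1) by (simp add: J_def)
   also have "... \<le> J + M * ln (2 / r)" using f(3) L0 by (intro add_left_mono mult_right_mono)
   finally have "log_pot f x \<le> (J + M * ln (2 / r)) / (2 * pi)" by (simp add: field_simps)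
   then have "2 * q * log_pot f x \<le> 2 * q * ((J + M * ln (2 / r)) / (2 * pi))" using q by (intro mult_left_mono) auto
   also have "... = q / pi * J + q / pi * (M * ln (2 / r))" by (simp add: field_simps)
   finally have "exp (2 * q * log_pot f x) \<le> exp (q / pi * (M * ln (2 / r))) * exp (q / pi * J)"
    by (simp add: exp_add[symmetric] add.commute)
   also have "... \<le> exp (q / pi * (M * ln (2 / r))) * (1 + A / m)"
   proof (rule mult_left_mono)
    show "exp (q / pi * J) \<le> 1 + A / m"
    \<comment> \<open>Without nearby mass the average is undefined, but then \<open>J = 0\<close>;
      the summand 1 on the right is there for this case, as \<open>A / m\<close> is then 0.\<close>
    proof (cases "m = 0")
     case True
     then have "AE y in area_S2. g y = 0"
      using integral_nonneg_eq_0_iff_AE[OF gi AE_I2] g0 by (auto simp: m_eq)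
     then have "AE y in area_S2. g y * log_pot_kernel x y = 0" by eventually_elim simp
     then have "J = 0" unfolding J_def by (rule integral_eq_zero_AE)
     then show ?thesis using True by simp
    next
     case False
     then have mp: "m > 0" using m0 by simp
     have A0: "A \<ge> 0" unfolding A_def using g0 by (intro integral_nonneg_AE AE_I2) auto
     define c where "c = q / pi"
     have cm: "c * m \<le> t" unfolding c_def t_def using ms q by (simp add: divide_right_mono mult_left_mono)
     have ce: "exp (c * m * log_pot_kernel x y) \<le> 2 powr t * dist x y powr (- t)" if "y \<in> S2" "y \<noteq> x" for y
     proof -
      have "exp (c * m * log_pot_kernel x y) \<le> exp (t * log_pot_kernel x y)"
       using cm log_pot_kernel_nonneg[OF x that(1)] by (simp add: mult_right_mono)
      also have "... = (2 / dist x y) powr t" using that by (simp add: powr_def log_pot_kernel_def)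
      also have "... = 2 powr t * dist x y powr (- t)" using that by (simp add: powr_divide powr_minus_divide)
      finally show ?thesis .
     qed
     have gA: "integrable area_S2 (\<lambda>y. g y * (2 powr t * dist x y powr (- t)))"
     proof -
      have "integrable area_S2 (\<lambda>y. 2 powr t * (g y * dist x y powr (- t)))" using elim by simp
      then show ?thesis by (simp add: mult_ac)
     qed
     have aele: "AE y in area_S2. g y * exp (c * m * log_pot_kernel x y) \<le> g y * (2 powr t * dist x y powr (- t))"
      using AE_area_neq[of x] AE_space by eventually_elim (use ce g0 in \<open>auto intro!: mult_left_mono\<close>)
     have gE: "integrable area_S2 (\<lambda>y. g y * exp (c * m * log_pot_kernel x y))"
     proof (rule Bochner_Integration.integrable_bound[OF gA])
      show "AE y in area_S2. norm (g y * exp (c * m * log_pot_kernel x y)) \<le> norm (g y * (2 powr t * dist x y powr (- t)))"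
       using aele AE_space by eventually_elim (use g0 in \<open>auto simp: abs_mult\<close>)
     qed measurable
     have "m * exp (c * J) \<le> (\<ointegral>y. g y * exp (c * m * log_pot_kernel x y))"
      unfolding m_eq J_def
      by (rule exp_average_le) (use gi g0 elim gE in \<open>auto simp: m_eq\<close>)
     also have "... \<le> A" unfolding A_def by (rule integral_mono_AE[OF gE gA aele])
     finally have "exp (c * J) \<le> A / m" using mp by (simp add: field_simps)
     then show ?thesis by (simp add: c_def)
    qed
   qed simp
   finally show "exp (2 * q * log_pot f x) \<le> exp (q / pi * (M * ln (2 / r))) *
     (1 + (\<ointegral>y. indicator (ball x0 (2 * r)) y * f y * (2 powr (q * s / pi) * dist x y powr (- (q * s / pi)))) / m)"
    by (simp add: A_def g_def t_def)
  qed
 qed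
qed

text \<open>The exponential collects the distant mass. The second Riesz constant occurs twice
  because the product of the singularities at \<open>x0\<close> and at \<open>y\<close> is split
  into a sum of two of the combined order.\<close>

definition bm_const :: "real \<Rightarrow> real \<Rightarrow> real \<Rightarrow> real \<Rightarrow> real \<Rightarrow> real" where
 "bm_const M r s q a = exp (q / pi * (M * ln (2 / r))) *
   (riesz_const (q * a) + 2 * 2 powr (q * s / pi) * riesz_const (q * a + q * s / pi))"

text \<open>A local mass \<open>s\<close> produces in the \<open>q\<close>-th power of exp (2 *
  potential) a singularity of order \<open>q * s / pi\<close>, and the weight one of order
  \<open>q * a\<close>. The hypothesis keeps their sum below the dimension 2.\<close>

theorem brezis_merle:
 fixes f :: "real^3 \<Rightarrow> real"
 assumes f: "integrable area_S2 f" "\<And>x. x \<in> S2 \<Longrightarrow> f x \<ge> 0" "(\<ointegral>x. f x) \<le> M"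
  and r: "0 < r" "r \<le> 1" and x0: "x0 \<in> S2"
  and s: "s > 0" "(\<ointegral>y. indicator (ball x0 (2 * r)) y * f y) \<le> s"
  and q: "q > 0" "a \<ge> 0" "q * a + q * s / pi < 2"
 shows "(\<ointegral>\<^sup>+x. indicator (ball x0 r) x * ennreal ((dist x x0 powr (- a) * exp (2 * log_pot f x)) powr q))
  \<le> ennreal (bm_const M r s q a)"
proof -
 define g where "g y = indicator (ball x0 (2 * r)) y * f y" for y
 define t where "t = q * s / pi"
 define A where "A = q * a"
 define E where "E = exp (q / pi * (M * ln (2 / r)))"
 define m where "m = (\<ointegral>y. g y)"
 have A0: "A \<ge> 0" using q by (simp add: A_def)
 have t: "t > 0" "A + t < 2" using q s pi_gt_zero by (auto simp: t_def A_def)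
 then have A2: "A < 2" by simp
 have fm [measurable]: "f \<in> borel_measurable area_S2" using f by auto
 have bm [measurable]: "(\<lambda>y. indicator (ball x0 (2 * r)) y :: real) \<in> borel_measurable area_S2" by (intro measurable_area1 borel_measurable_indicator) simp
 have gm [measurable]: "g \<in> borel_measurable area_S2" unfolding g_def[abs_def] using bm by measurable
 have gi: "integrable area_S2 g"
  by (rule Bochner_Integration.integrable_bound[OF f(1) gm]) (auto simp: g_def indicator_def)
 have g0: "g y \<ge> 0" if "y \<in> S2" for y using f(2)[OF that] by (simp add: g_def)
 have m0: "m \<ge> 0" unfolding m_def using g0 by (intro integral_nonneg_AE AE_I2) auto
 define h where "h x y = dist x x0 powr (- A) * (g y * (2 powr t * dist x y powr (- t)))" for x y
 have hm: "(\<lambda>z. ennreal (h (fst z) (snd z))) \<in> borel_measurable (area_S2 \<Otimes>\<^sub>M area_S2)"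
  unfolding h_def by measurable
 have AEb: "AE x in area_S2. indicator (ball x0 r) x * ennreal ((dist x x0 powr (- a) * exp (2 * log_pot f x)) powr q)
   \<le> ennreal (E * dist x x0 powr (- A)) + ennreal (E / m) * (\<ointegral>\<^sup>+y. ennreal (h x y))"
 proof -
  have km: "(\<lambda>z. dist (fst z) (snd z) powr (- t)) \<in> borel_measurable (area_S2 \<Otimes>\<^sub>M area_S2)" by measurable
  have kt: "AE x in area_S2. integrable area_S2 (\<lambda>y. g y * dist x y powr (- t))"
   by (rule kernel_AE_integrable[OF gi _ km, where s=t and C=1]) (use t A0 in auto)
  have ex: "AE x in area_S2. dist x x0 < r \<longrightarrow> exp (2 * q * log_pot f x) \<le> E * (1 + (\<ointegral>y. g y * (2 powr t * dist x y powr (- t))) / m)"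
   using exp_log_pot_le[OF f r s, of q m] q A0 t unfolding E_def g_def t_def A_def m_def by simp
  show ?thesis using ex kt AE_space
  proof eventually_elim
   case (elim x)
   show ?case
   proof (cases "dist x x0 < r")
    case True
    define I where "I = (\<ointegral>y. g y * (2 powr t * dist x y powr (- t)))"
    have I0: "I \<ge> 0" unfolding I_def using g0 by (intro integral_nonneg_AE AE_I2) auto
    have gA: "integrable area_S2 (\<lambda>y. g y * (2 powr t * dist x y powr (- t)))"
    proof -
     have "integrable area_S2 (\<lambda>y. 2 powr t * (g y * dist x y powr (- t)))" using elim by simp
     then show ?thesis by (simp add: mult_ac)
    qed
    have hI: "(\<ointegral>\<^sup>+y. ennreal (h x y)) = ennreal (dist x x0 powr (- A) * I)"
     unfolding h_def I_def
     by (subst nn_integral_eq_integral) (use gA g0 in \<open>auto intro!: integrable_mult_right\<close>)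
    have "(dist x x0 powr (- a) * exp (2 * log_pot f x)) powr q = dist x x0 powr (- A) * exp (2 * q * log_pot f x)"
     by (simp add: powr_mult powr_powr A_def exp_powr_real mult_ac)
    also have "... \<le> dist x x0 powr (- A) * (E * (1 + I / m))"
     using elim True by (intro mult_left_mono) (auto simp: I_def)
    also have "... = E * dist x x0 powr (- A) + (E / m) * (dist x x0 powr (- A) * I)"
     by (simp add: algebra_simps)
    finally have "ennreal ((dist x x0 powr (- a) * exp (2 * log_pot f x)) powr q)
     \<le> ennreal (E * dist x x0 powr (- A) + (E / m) * (dist x x0 powr (- A) * I))" by (rule ennreal_leI)
    also have "... = ennreal (E * dist x x0 powr (- A)) + ennreal (E / m) * (\<ointegral>\<^sup>+y. ennreal (h x y))"
     unfolding hI using m0 I0 by (simp add: ennreal_plus ennreal_mult'' E_def del: ennreal_plus)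
      (subst ennreal_plus, auto simp: ennreal_mult[symmetric])
    finally show ?thesis using True by (simp add: dist_commute)
   qed (simp add: dist_commute)
  qed
 qed
 have hI: "(\<ointegral>\<^sup>+x. (\<ointegral>\<^sup>+y. ennreal (h x y))) \<le> ennreal (m * (2 powr t * (2 * riesz_const (A + t))))"
 proof -
  have "(\<ointegral>\<^sup>+x. (\<ointegral>\<^sup>+y. ennreal (h x y))) = (\<ointegral>\<^sup>+y. (\<ointegral>\<^sup>+x. ennreal (h x y)))"
   using hm by (intro area2.Fubini'[symmetric]) (simp add: case_prod_unfold)
  also have "... \<le> (\<ointegral>\<^sup>+y. ennreal (g y) * ennreal (2 powr t * (2 * riesz_const (A + t))))"
  proof (rule nn_integral_mono)
   fix y assume "y \<in> space area_S2"
   then have y: "y \<in> S2" by simp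
   have "(\<ointegral>\<^sup>+x. ennreal (h x y))
    \<le> (\<ointegral>\<^sup>+x. ennreal (g y * 2 powr t) * (ennreal (dist x x0 powr (- (A + t))) + ennreal (dist x y powr (- (A + t)))))"
   proof (rule nn_integral_mono)
    fix x
    have "h x y = g y * 2 powr t * (dist x x0 powr (- A) * dist x y powr (- t))" by (simp add: h_def)
    also have "... \<le> g y * 2 powr t * (dist x x0 powr (- (A + t)) + dist x y powr (- (A + t)))"
     using g0[OF y] A0 t by (intro mult_left_mono powr_mult_le_add) auto
    finally have "ennreal (h x y) \<le> ennreal (g y * 2 powr t * (dist x x0 powr (- (A + t)) + dist x y powr (- (A + t))))"
     by (rule ennreal_leI)
    also have "... = ennreal (g y * 2 powr t) * (ennreal (dist x x0 powr (- (A + t))) + ennreal (dist x y powr (- (A + t))))"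
     using g0[OF y] by (subst ennreal_mult) auto
    finally show "ennreal (h x y) \<le> ennreal (g y * 2 powr t) * (ennreal (dist x x0 powr (- (A + t))) + ennreal (dist x y powr (- (A + t))))" .
   qed
   also have "... = ennreal (g y * 2 powr t) * (ennreal (riesz_const (A + t)) + ennreal (riesz_const (A + t)))"
    by (subst nn_integral_cmult, measurable, subst nn_integral_add, measurable)
     (simp only: nn_integral_dist_powr[OF y t(2)] nn_integral_dist_powr[OF x0 t(2)])
   also have "... = ennreal (g y) * ennreal (2 powr t * (2 * riesz_const (A + t)))"
    using g0[OF y] riesz_const_pos[OF t(2)] by (simp add: ennreal_mult[symmetric] ennreal_plus[symmetric] mult_ac del: ennreal_plus)
   finally show "(\<ointegral>\<^sup>+x. ennreal (h x y)) \<le> ennreal (g y) * ennreal (2 powr t * (2 * riesz_const (A + t)))" .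
  qed
  also have "... = (\<ointegral>\<^sup>+y. ennreal (g y)) * ennreal (2 powr t * (2 * riesz_const (A + t)))"
   by (rule nn_integral_multc) measurable
  also have "(\<ointegral>\<^sup>+y. ennreal (g y)) = ennreal m"
   unfolding m_def using gi g0 by (intro nn_integral_eq_integral) auto
  also have "ennreal m * ennreal (2 powr t * (2 * riesz_const (A + t))) = ennreal (m * (2 powr t * (2 * riesz_const (A + t))))"
   using m0 riesz_const_pos[OF t(2)] by (simp add: ennreal_mult)
  finally show ?thesis .
 qed
 have "(\<ointegral>\<^sup>+x. indicator (ball x0 r) x * ennreal ((dist x x0 powr (- a) * exp (2 * log_pot f x)) powr q))
  \<le> (\<ointegral>\<^sup>+x. ennreal (E * dist x x0 powr (- A)) + ennreal (E / m) * (\<ointegral>\<^sup>+y. ennreal (h x y)))"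
  by (rule nn_integral_mono_AE[OF AEb])
 also have "... = ennreal E * (\<ointegral>\<^sup>+x. ennreal (dist x x0 powr (- A)))
   + ennreal (E / m) * (\<ointegral>\<^sup>+x. (\<ointegral>\<^sup>+y. ennreal (h x y)))"
 proof -
  have [measurable]: "(\<lambda>x. \<ointegral>\<^sup>+y. ennreal (h x y)) \<in> borel_measurable area_S2"
   using hm by (intro area.borel_measurable_nn_integral) (simp add: case_prod_unfold)
  show ?thesis
   by (subst nn_integral_add) (auto simp: nn_integral_cmult[symmetric] ennreal_mult E_def)
 qed
 also have "... \<le> ennreal E * ennreal (riesz_const A) + ennreal (E / m) * ennreal (m * (2 powr t * (2 * riesz_const (A + t))))"
  by (intro add_mono mult_left_mono hI) (auto simp: nn_integral_dist_powr[OF x0 A2])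
 also have "... = ennreal (E * riesz_const A + (E / m) * (m * (2 powr t * (2 * riesz_const (A + t)))))"
  using m0 riesz_const_pos[OF t(2)] riesz_const_pos[OF A2]
  by (simp add: E_def ennreal_mult[symmetric] ennreal_plus[symmetric] del: ennreal_plus)
 also have "... \<le> ennreal (bm_const M r s q a)"
 proof (rule ennreal_leI)
  have "(E / m) * (m * (2 powr t * (2 * riesz_const (A + t)))) \<le> E * (2 powr t * (2 * riesz_const (A + t)))"
   using riesz_const_pos[OF t(2)] by (cases "m = 0") (auto simp: E_def)
  then show "E * riesz_const A + (E / m) * (m * (2 powr t * (2 * riesz_const (A + t)))) \<le> bm_const M r s q a"
   by (simp add: bm_const_def E_def t_def A_def algebra_simps)
 qed
 finally show ?thesis .
qed

subsection \<open>Sequences of solutions\<close>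

lemma S2_nonempty: "S2 \<noteq> {}"
proof -
 have "(axis 1 1 :: real^3) \<in> S2" by simp
 then show ?thesis by blast
qed

lemma C1_dist_upper:
 assumes "f \<in> C1_S2" "g \<in> C1_S2" "x \<in> S2"
 shows "\<bar>f x - g x\<bar> \<le> C1_dist f g" "norm (grad_S2 f x - grad_S2 g x) \<le> C1_dist f g"
proof -
 have bdd: "bdd_above ((\<lambda>x. norm (h x)) ` S2)" if "continuous_on S2 h"
  for h :: "real^3 \<Rightarrow> 'b::real_normed_vector"
  by (intro bounded_imp_bdd_above compact_imp_bounded compact_continuous_image
    continuous_intros that) simp
 have b: "bdd_above ((\<lambda>x. \<bar>f x - g x\<bar>) ` S2)"
  "bdd_above ((\<lambda>x. norm (grad_S2 f x - grad_S2 g x)) ` S2)"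
  using bdd[of "\<lambda>x. f x - g x"] bdd[of "\<lambda>x. grad_S2 f x - grad_S2 g x"] assms
  by (simp_all add: continuous_on_C1_S2 continuous_on_diff)
 have u: "\<bar>f x - g x\<bar> \<le> (SUP x\<in>S2. \<bar>f x - g x\<bar>)"
  "norm (grad_S2 f x - grad_S2 g x) \<le> (SUP x\<in>S2. norm (grad_S2 f x - grad_S2 g x))"
  by (rule cSUP_upper[OF assms(3) b(1)], rule cSUP_upper[OF assms(3) b(2)])
 have n: "0 \<le> (SUP x\<in>S2. \<bar>f x - g x\<bar>)" "0 \<le> (SUP x\<in>S2. norm (grad_S2 f x - grad_S2 g x))"
  using u by (meson abs_ge_zero norm_ge_zero order_trans)+
 show "\<bar>f x - g x\<bar> \<le> C1_dist f g" "norm (grad_S2 f x - grad_S2 g x) \<le> C1_dist f g"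
  using u n assms by (auto simp: C1_dist_def)
qed

section \<open>From local integrability to bounded potentials\<close>

lemma integral_indicator_mono:
 fixes f :: "real^3 \<Rightarrow> real"
 assumes f: "integrable area_S2 f" "\<And>x. x \<in> S2 \<Longrightarrow> f x \<ge> 0" and A: "A \<in> sets borel" "B \<in> sets borel" "A \<subseteq> B"
 shows "(\<ointegral>z. indicator A z * f z) \<le> (\<ointegral>z. indicator B z * f z)"
 using A f(2) by (intro integral_mono integrable_indicator_borel f) (auto simp: indicator_def)

lemmas integrable_indicator_ball = integrable_indicator_borel[OF _ borel_open[OF open_ball]]

abbreviation ball_mass :: "(real^3 \<Rightarrow> real) \<Rightarrow> real^3 \<Rightarrow> real \<Rightarrow> real" where
 "ball_mass f x r \<equiv> \<ointegral>y. indicator (ball x r) y * f y"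

text \<open>Compactness leaves finitely many balls, and the least of their exponents works
  everywhere, since z^q is at most 1 + z^Q for \<open>q \<le> Q\<close> and nonnegative z.\<close>

lemma Lq_bound_from_cover:
 fixes f :: "nat \<Rightarrow> real^3 \<Rightarrow> real"
 assumes m: "\<And>k. f k \<in> borel_measurable area_S2" and f0: "\<And>k x. x \<in> S2 \<Longrightarrow> f k x \<ge> 0"
  and loc: "\<And>x0. x0 \<in> S2 \<Longrightarrow> \<exists>r>0. \<exists>q>1. \<exists>C\<ge>0. \<forall>\<^sub>F k in sequentially.
    (\<ointegral>\<^sup>+x. indicator (ball x0 r) x * ennreal (f k x powr q)) \<le> ennreal C"
 shows "\<exists>q>1. \<exists>C\<ge>0. \<forall>\<^sub>F k in sequentially. (\<ointegral>\<^sup>+x. ennreal (f k x powr q)) \<le> ennreal C"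
proof -
 define P where "P x0 r q C \<longleftrightarrow> r > 0 \<and> q > 1 \<and> C \<ge> (0::real) \<and> (\<forall>\<^sub>F k in sequentially.
    (\<ointegral>\<^sup>+x. indicator (ball x0 r) x * ennreal (f k x powr q)) \<le> ennreal C)" for x0 r q C
 have "\<exists>r q C. P x0 r q C" if "x0 \<in> S2" for x0
  using loc[OF that] unfolding P_def by blast
 then obtain R Q C where "\<And>x0. x0 \<in> S2 \<Longrightarrow> P x0 (R x0) (Q x0) (C x0)" by metis
 note RQC = this[unfolded P_def]
 have "compact S2" by simp
 moreover have "S2 \<subseteq> (\<Union>x0\<in>S2. ball x0 (R x0))" using RQC by auto
 ultimately obtain T where T: "T \<subseteq> S2" "finite T" "S2 \<subseteq> (\<Union>x0\<in>T. ball x0 (R x0))"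
  using compactE_image[of S2 S2 "\<lambda>x0. ball x0 (R x0)"] by (metis open_ball)
 have Tne: "T \<noteq> {}" using T(3) S2_nonempty by auto
 define q where "q = Min (Q ` T)"
 have q: "q > 1" "\<And>x0. x0 \<in> T \<Longrightarrow> q \<le> Q x0"
  using T Tne RQC unfolding q_def by auto
 have ev: "\<forall>\<^sub>F k in sequentially. \<forall>x0\<in>T.
   (\<ointegral>\<^sup>+x. indicator (ball x0 (R x0)) x * ennreal (f k x powr (Q x0))) \<le> ennreal (C x0)"
  using T RQC by (intro eventually_ball_finite) auto
 have "\<forall>\<^sub>F k in sequentially. (\<ointegral>\<^sup>+x. ennreal (f k x powr q)) \<le> ennreal (4 * pi + (\<Sum>x0\<in>T. C x0))"
  using ev
 proof eventually_elim
  case (elim k)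
  have [measurable]: "f k \<in> borel_measurable area_S2" by (rule m)
  have im [measurable]: "(\<lambda>x. indicator (ball x0 (R x0)) x :: ennreal) \<in> borel_measurable area_S2" for x0
   by (intro measurable_area1 borel_measurable_indicator) simp
  have "(\<ointegral>\<^sup>+x. ennreal (f k x powr q))
   \<le> (\<ointegral>\<^sup>+x. 1 + (\<Sum>x0\<in>T. indicator (ball x0 (R x0)) x * ennreal (f k x powr (Q x0))))"
  proof (rule nn_integral_mono)
   fix x assume "x \<in> space area_S2"
   then have x: "x \<in> S2" by simp
   then obtain x0 where x0: "x0 \<in> T" "x \<in> ball x0 (R x0)" using T(3) by blast
   have "f k x powr q \<le> 1 + f k x powr (Q x0)"
   proof (cases "f k x \<le> 1")
    case True
    then have "f k x powr q \<le> 1" using q f0[OF x] by (intro powr_le1) auto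
    then show ?thesis by (simp add: add_increasing2)
   next
    case False
    then have "f k x powr q \<le> f k x powr (Q x0)" using q(2)[OF x0(1)] by (intro powr_mono) auto
    then show ?thesis by simp
   qed
   then have "ennreal (f k x powr q) \<le> ennreal (1 + f k x powr (Q x0))" by (rule ennreal_leI)
   also have "... = 1 + indicator (ball x0 (R x0)) x * ennreal (f k x powr (Q x0))"
    using x0(2) by (simp add: ennreal_plus)
   also have "... \<le> 1 + (\<Sum>x0\<in>T. indicator (ball x0 (R x0)) x * ennreal (f k x powr (Q x0)))"
    using T(2) x0(1) by (intro add_left_mono member_le_sum[where f="\<lambda>x0. indicator (ball x0 (R x0)) x * ennreal (f k x powr (Q x0))"]) auto
   finally show "ennreal (f k x powr q) \<le> 1 + (\<Sum>x0\<in>T. indicator (ball x0 (R x0)) x * ennreal (f k x powr (Q x0)))" .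
  qed
  also have "... = ennreal (4 * pi) + (\<Sum>x0\<in>T. \<ointegral>\<^sup>+x. indicator (ball x0 (R x0)) x * ennreal (f k x powr (Q x0)))"
   by (subst nn_integral_add) (auto simp: nn_integral_sum emeasure_area_S2)
  also have "... \<le> ennreal (4 * pi) + (\<Sum>x0\<in>T. ennreal (C x0))"
   using elim by (intro add_left_mono sum_mono) auto
  also have "(\<Sum>x0\<in>T. ennreal (C x0)) = ennreal (\<Sum>x0\<in>T. C x0)"
   using T(1) RQC by (intro sum_ennreal) auto
  also have "ennreal (4 * pi) + ennreal (\<Sum>x0\<in>T. C x0) = ennreal (4 * pi + (\<Sum>x0\<in>T. C x0))"
   using T(1) RQC by (intro ennreal_plus[symmetric] sum_nonneg) auto
  finally show ?case .
 qed
 moreover have "0 \<le> 4 * pi + (\<Sum>x0\<in>T. C x0)"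
  using T(1) RQC by (intro add_nonneg_nonneg sum_nonneg) auto
 ultimately show ?thesis using q(1) by blast
qed

text \<open>Young's inequality in a crude form: according to whether the kernel is below
  \<open>f y powr (q - 1)\<close>, the product is at most \<open>f y powr q\<close> or the
  \<open>q'\<close>-th power of the kernel. The latter is bounded by a multiple of
  \<open>dist y x powr (- 1)\<close>, whose integral is the same for every \<open>x\<close>.\<close>

lemma log_pot_bound_of_Lq:
 fixes f :: "real^3 \<Rightarrow> real"
 assumes fm: "f \<in> borel_measurable area_S2" and f0: "\<And>x. x \<in> S2 \<Longrightarrow> f x \<ge> 0"
  and q: "q > 1" and C: "C \<ge> 0" "(\<ointegral>\<^sup>+x. ennreal (f x powr q)) \<le> ennreal C" and x: "x \<in> S2"
 defines "q' \<equiv> q / (q - 1)"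
 shows "integrable area_S2 (\<lambda>y. f y * log_pot_kernel x y)"
  and "log_pot f x \<le> ((2 powr (1 / q') / (1 / q')) powr q' * riesz_const 1 + C) / (2 * pi)"
proof -
 define c where "c = (2 powr (1 / q') / (1 / q')) powr q'"
 have q': "q' > 0" "q' = 1 + 1 / (q - 1)" using q by (auto simp: q'_def field_simps)
 have c0: "c \<ge> 0" by (simp add: c_def)
 have rz: "riesz_const 1 \<ge> 0" using riesz_const_pos[of 1] by simp
 have rz1: "(\<ointegral>\<^sup>+y. ennreal (dist y x powr (- 1))) = ennreal (riesz_const 1)"
  by (rule nn_integral_dist_powr[OF x]) simp
 have pw: "f y * log_pot_kernel x y \<le> c * dist y x powr (- 1) + f y powr q" if y: "y \<in> S2" for y
 proof -
  let ?L = "log_pot_kernel x y"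
  have L0: "?L \<ge> 0" by (rule log_pot_kernel_nonneg[OF x y])
  have F0: "f y \<ge> 0" by (rule f0[OF y])
  have L: "?L powr q' \<le> c * dist y x powr (- 1)"
  proof -
   have "?L powr q' \<le> ((2 powr (1 / q') / (1 / q')) * dist x y powr (- (1 / q'))) powr q'"
    using log_pot_kernel_le[OF x y, of "1 / q'"] q' L0 by (intro powr_mono2) auto
   also have "... = c * dist y x powr (- 1)"
    using q' unfolding c_def by (subst powr_mult) (simp_all add: powr_powr dist_commute)
   finally show ?thesis .
  qed
  show ?thesis
  proof (cases "?L \<le> f y powr (q - 1)")
   case True
   have "f y * ?L \<le> f y * f y powr (q - 1)" using True F0 by (intro mult_left_mono)
   also have "... = f y powr q" using F0 by (cases "f y = 0") (auto simp: powr_diff)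
   finally show ?thesis using c0 by (simp add: add_increasing)
  next
   case False
   have "f y = (f y powr (q - 1)) powr (1 / (q - 1))" using F0 q by (simp add: powr_powr)
   also have "... \<le> ?L powr (1 / (q - 1))" using False q by (intro powr_mono2) auto
   finally have "f y * ?L \<le> ?L powr (1 / (q - 1)) * ?L" using L0 by (intro mult_right_mono)
   also have "... = ?L powr q'" using L0 q q' by (cases "?L = 0") (auto simp: powr_add)
   also note L
   finally show ?thesis by (simp add: add_increasing2)
  qed
 qed
 have le: "(\<ointegral>\<^sup>+y. ennreal (f y * log_pot_kernel x y)) \<le> ennreal (c * riesz_const 1 + C)"
 proof -
  have "(\<ointegral>\<^sup>+y. ennreal (f y * log_pot_kernel x y))
   \<le> (\<ointegral>\<^sup>+y. ennreal c * ennreal (dist y x powr (- 1)) + ennreal (f y powr q))"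
  proof (rule nn_integral_mono)
   fix y assume "y \<in> space area_S2"
   then have "ennreal (f y * log_pot_kernel x y) \<le> ennreal (c * dist y x powr (- 1) + f y powr q)"
    by (intro ennreal_leI pw) simp
   also have "... = ennreal c * ennreal (dist y x powr (- 1)) + ennreal (f y powr q)"
    using c0 by (simp only: ennreal_plus mult_nonneg_nonneg powr_ge_zero ennreal_mult)
   finally show "ennreal (f y * log_pot_kernel x y) \<le> ennreal c * ennreal (dist y x powr (- 1)) + ennreal (f y powr q)" .
  qed
  also have "... = ennreal c * (\<ointegral>\<^sup>+y. ennreal (dist y x powr (- 1))) + (\<ointegral>\<^sup>+y. ennreal (f y powr q))"
   using fm by (subst nn_integral_add, measurable, subst nn_integral_cmult, measurable)
  also have "... \<le> ennreal c * ennreal (riesz_const 1) + ennreal C"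
   using C(2) unfolding rz1 by (intro add_mono) auto
  also have "... = ennreal (c * riesz_const 1 + C)"
   using c0 C(1) rz by (simp add: ennreal_mult ennreal_plus)
  finally show ?thesis .
 qed
 have m: "(\<lambda>y. f y * log_pot_kernel x y) \<in> borel_measurable area_S2" using fm by measurable
 have nn: "AE y in area_S2. 0 \<le> f y * log_pot_kernel x y"
  using f0 log_pot_kernel_nonneg[OF x] by (intro AE_I2) auto
 show i: "integrable area_S2 (\<lambda>y. f y * log_pot_kernel x y)"
  by (rule integrableI_nonneg[OF m nn]) (use le in \<open>auto simp: less_top[symmetric] top_unique\<close>)
 have "(\<ointegral>y. f y * log_pot_kernel x y) \<le> c * riesz_const 1 + C"
  using le nn_integral_eq_integral[OF i nn] c0 rz C(1) by (simp del: ennreal_plus)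
 then show "log_pot f x \<le> ((2 powr (1 / q') / (1 / q')) powr q' * riesz_const 1 + C) / (2 * pi)"
  unfolding log_pot_def c_def by (simp add: divide_right_mono)
qed

text \<open>Solutions in potential form for data converging to \<open>(K0, b0)\<close>. A constant
  sequence is allowed, so the estimates apply to a single solution as well.\<close>

locale liouville_sequence =
 fixes p :: "'m::finite \<Rightarrow> real^3" and K :: "nat \<Rightarrow> real^3 \<Rightarrow> real" and b :: "nat \<Rightarrow> real^'m"
  and \<kappa> :: "nat \<Rightarrow> real" and f :: "nat \<Rightarrow> real^3 \<Rightarrow> real"
  and K0 :: "real^3 \<Rightarrow> real" and b0 :: "real^'m"
 assumes inj_p: "inj p" and range_p: "range p \<subseteq> S2"
  and K_C1: "K k \<in> C1_pos_S2" and K0_C1: "K0 \<in> C1_pos_S2"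
  and K_lim: "(\<lambda>k. C1_dist (K k) K0) \<longlonglongrightarrow> 0"
  and b_lim: "b \<longlonglongrightarrow> b0" and b_gt: "b k $ i > -1" and b0_gt: "b0 $ i > -1"
  and pot: "potential_form p (K k) (b k) (\<kappa> k) (f k)"
begin

lemma p_S2: "p i \<in> S2"
 using range_p by (meson rangeI subsetD)

lemma K_pos: "x \<in> S2 \<Longrightarrow> K k x > 0"
 using K_C1[of k] by (simp add: C1_pos_S2_def)

lemma K_in_C1: "K k \<in> C1_S2" "K0 \<in> C1_S2"
 using K_C1[of k] K0_C1 by (simp_all add: C1_pos_S2_def)

lemma \<kappa>_pos: "\<kappa> k > 0"
 using pot[of k] by (simp add: potential_form_def)

lemma f_integrable: "integrable area_S2 (f k)"
 using pot[of k] by (simp add: potential_form_def)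

lemma f_measurable [measurable]: "f k \<in> borel_measurable area_S2"
 using f_integrable by auto

lemma f_mass: "(\<ointegral>x. f k x) = total_mass (b k)"
 using pot[of k] by (simp add: potential_form_def)

lemma f_eq: "x \<in> S2 \<Longrightarrow> f k x = \<kappa> k * K k x * conic_weight p (b k) x * exp (2 * log_pot (f k) x)"
 using pot[of k] by (simp add: potential_form_def)

lemma f_nonneg: "x \<in> S2 \<Longrightarrow> f k x \<ge> 0"
 using potential_form_nonneg[OF pot K_pos] .

lemma pot_nonneg: "x \<in> S2 \<Longrightarrow> log_pot (f k) x \<ge> 0"
 using log_pot_nonneg f_nonneg by blast

lemma mass_tendsto: "(\<lambda>k. total_mass (b k)) \<longlonglongrightarrow> total_mass b0"
 unfolding total_mass_def by (intro tendsto_intros tendsto_vec_nth b_lim)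

lemma eventually_mass: "\<forall>\<^sub>F k in sequentially. (\<ointegral>x. f k x) \<le> \<bar>total_mass b0\<bar> + 1"
proof -
 have "\<forall>\<^sub>F k in sequentially. total_mass (b k) < \<bar>total_mass b0\<bar> + 1"
  using mass_tendsto by (rule order_tendstoD) simp
 then show ?thesis by eventually_elim (simp add: f_mass)
qed

lemma eventually_b_bounded: "\<exists>B\<ge>0. \<forall>\<^sub>F k in sequentially. \<forall>i. \<bar>b k $ i\<bar> \<le> B"
proof (intro exI conjI)
 show "norm b0 + 1 \<ge> 0" by simp
 have "(\<lambda>k. norm (b k)) \<longlonglongrightarrow> norm b0" by (intro tendsto_norm b_lim)
 then have "\<forall>\<^sub>F k in sequentially. norm (b k) < norm b0 + 1" by (rule order_tendstoD) simp
 then show "\<forall>\<^sub>F k in sequentially. \<forall>i. \<bar>b k $ i\<bar> \<le> norm b0 + 1"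
  by eventually_elim (meson component_le_norm_cart less_imp_le order_trans)
qed

lemma eventually_K_bounded:
 "\<exists>c C. 0 < c \<and> 0 < C \<and> (\<forall>\<^sub>F k in sequentially. \<forall>x\<in>S2. c \<le> K k x \<and> K k x \<le> C \<and> norm (grad_S2 (K k) x) \<le> C)"
proof -
 note c0 = continuous_on_C1_S2[OF K_in_C1(2)]
 obtain x1 where x1: "x1 \<in> S2" "\<And>x. x \<in> S2 \<Longrightarrow> K0 x1 \<le> K0 x"
  using continuous_attains_inf[OF _ S2_nonempty c0(1)] by auto
 have m: "K0 x1 > 0" using K0_C1 x1 by (simp add: C1_pos_S2_def)
 obtain B1 where B1: "B1 \<ge> 0" "\<And>x. x \<in> S2 \<Longrightarrow> norm (K0 x) \<le> B1" using bounded_S2[OF c0(1)] by blast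
 obtain B2 where B2: "B2 \<ge> 0" "\<And>x. x \<in> S2 \<Longrightarrow> norm (grad_S2 K0 x) \<le> B2" using bounded_S2[OF c0(2)] by blast
 have "\<forall>\<^sub>F k in sequentially. C1_dist (K k) K0 < min 1 (K0 x1 / 2)"
  using K_lim by (rule order_tendstoD) (use m in simp)
 then have "\<forall>\<^sub>F k in sequentially. \<forall>x\<in>S2. K0 x1 / 2 \<le> K k x \<and> K k x \<le> B1 + B2 + 1 \<and> norm (grad_S2 (K k) x) \<le> B1 + B2 + 1"
 proof eventually_elim
  case (elim k)
  show ?case
  proof
   fix x assume x: "x \<in> S2"
   have 1: "\<bar>K k x - K0 x\<bar> < 1" "\<bar>K k x - K0 x\<bar> < K0 x1 / 2" "norm (grad_S2 (K k) x - grad_S2 K0 x) < 1"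
    using C1_dist_upper[OF K_in_C1 x, of k] elim by auto
   have "norm (grad_S2 (K k) x) \<le> norm (grad_S2 K0 x) + norm (grad_S2 (K k) x - grad_S2 K0 x)"
    by (rule norm_triangle_sub)
   then show "K0 x1 / 2 \<le> K k x \<and> K k x \<le> B1 + B2 + 1 \<and> norm (grad_S2 (K k) x) \<le> B1 + B2 + 1"
    using 1 x1(2)[OF x] B1(1) B1(2)[OF x] B2(1) B2(2)[OF x] unfolding real_norm_def by linarith
  qed
 qed
 moreover have "0 < K0 x1 / 2" "0 < B1 + B2 + 1" using m B1(1) B2(1) by auto
 ultimately show ?thesis by blast
qed

text \<open>Potentials are nonnegative, so \<open>f k\<close> is at least \<open>\<kappa> k\<close>
  times \<open>K k\<close> times the conic weight. These have lower bounds independent of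
  \<open>k\<close>, and the bounded total mass limits \<open>\<kappa> k\<close>.\<close>

lemma \<kappa>_bounded: "\<exists>C>0. \<forall>\<^sub>F k in sequentially. \<kappa> k \<le> C"
proof -
 obtain B where B: "B \<ge> 0" "\<forall>\<^sub>F k in sequentially. \<forall>i. \<bar>b k $ i\<bar> \<le> B" using eventually_b_bounded by blast
 obtain c C where cC: "0 < c" "\<forall>\<^sub>F k in sequentially. \<forall>x\<in>S2. c \<le> K k x \<and> K k x \<le> C \<and> norm (grad_S2 (K k) x) \<le> C"
  using eventually_K_bounded by blast
 \<comment> \<open>A common minorant of the weights with exponents in [-B, B]: since
   \<open>dist x (p i) / 2 \<le> 1\<close>, raising its exponent to \<open>2 * B\<close> only lowers
   it, and \<open>2 powr (- (2 * B))\<close> covers the remaining power of 2.\<close>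
 define \<omega> where "\<omega> x = (\<Prod>i\<in>UNIV. 2 powr (- (2 * B)) * (dist x (p i) / 2) powr (2 * B))" for x
 have \<omega>m: "\<omega> \<in> borel_measurable area_S2" unfolding \<omega>_def[abs_def] by measurable
 have \<omega>0: "\<omega> x \<ge> 0" for x unfolding \<omega>_def by (intro prod_nonneg) auto
 have \<omega>1: "\<omega> x \<le> 1" if x: "x \<in> S2" for x
  unfolding \<omega>_def
 proof (intro prod_le_1 conjI)
  fix i
  have "(dist x (p i) / 2) powr (2 * B) \<le> 1" using dist_S2(3)[OF x p_S2] B(1) by (intro powr_le1) auto
  moreover have "2 powr (- (2 * B)) \<le> (2::real) powr 0" using B(1) by (intro powr_mono) auto
  ultimately show "2 powr (- (2 * B)) * (dist x (p i) / 2) powr (2 * B) \<le> 1"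
   by (intro mult_le_one) auto
 qed auto
 have \<omega>i: "integrable area_S2 \<omega>" by (rule integrable_area_bounded[OF \<omega>m, of 1]) (use \<omega>0 \<omega>1 in auto)
 define I where "I = (\<ointegral>x. \<omega> x)"
 have "I \<noteq> 0"
 proof
  assume "I = 0"
  then have "AE x in area_S2. \<omega> x = 0"
   using integral_nonneg_eq_0_iff_AE[OF \<omega>i AE_I2] \<omega>0 by (auto simp: I_def)
  with AE_area_notin_range[of p] have "AE x in area_S2. False"
   by eventually_elim (auto simp: \<omega>_def)
  then obtain N where N: "{x \<in> space area_S2. \<not> False} \<subseteq> N" "emeasure area_S2 N = 0" "N \<in> sets area_S2"
   by (rule AE_E)
  have "emeasure area_S2 S2 \<le> emeasure area_S2 N" using N by (intro emeasure_mono) auto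
  then show False using emeasure_area_S2 N(2) by simp
 qed
 moreover have "I \<ge> 0" unfolding I_def using \<omega>0 by (intro integral_nonneg_AE AE_I2) auto
 ultimately have I: "I > 0" by simp
 have "\<forall>\<^sub>F k in sequentially. \<kappa> k \<le> (\<bar>total_mass b0\<bar> + 1) / (c * I)"
  using eventually_mass B(2) cC(2)
 proof eventually_elim
  case (elim k)
  have low: "\<omega> x \<le> conic_weight p (b k) x" if x: "x \<in> S2" for x
   unfolding \<omega>_def conic_weight_def
  proof (intro prod_mono conjI)
   fix i
   let ?d = "dist x (p i)"
   have "\<bar>b k $ i\<bar> \<le> B" using elim(2) by blast
   then have bi: "- B \<le> b k $ i" "b k $ i \<le> B" by linarith+
   have "2 powr (- (2 * B)) * (?d / 2) powr (2 * B) \<le> 2 powr (2 * b k $ i) * (?d / 2) powr (2 * b k $ i)"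
   proof (rule mult_mono)
    show "2 powr (- (2 * B)) \<le> (2::real) powr (2 * b k $ i)" using bi by (intro powr_mono) auto
    show "(?d / 2) powr (2 * B) \<le> (?d / 2) powr (2 * b k $ i)"
     using bi dist_S2(3)[OF x p_S2] by (intro powr_mono') auto
   qed auto
   also have "... = ?d powr (2 * b k $ i)" by (simp add: powr_divide)
   finally show "2 powr (- (2 * B)) * (?d / 2) powr (2 * B) \<le> ?d powr (2 * b k $ i)" .
  qed auto
  have "\<kappa> k * c * \<omega> x \<le> f k x" if x: "x \<in> S2" for x
  proof -
   have "\<kappa> k * c * \<omega> x * 1 \<le> \<kappa> k * K k x * conic_weight p (b k) x * exp (2 * log_pot (f k) x)"
    using \<kappa>_pos[of k] K_pos[OF x, of k] cC(1) elim(3) x low[OF x] \<omega>0[of x] pot_nonneg[OF x, of k] conic_weight_nonneg[of p "b k" x]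
    by (intro mult_mono) (auto intro!: mult_nonneg_nonneg simp: less_imp_le)
   then show ?thesis using f_eq[OF x] by simp
  qed
  then have "(\<ointegral>x. \<kappa> k * c * \<omega> x) \<le> (\<ointegral>x. f k x)"
   using \<omega>i f_integrable by (intro integral_mono) auto
  then have "\<kappa> k * (c * I) \<le> \<bar>total_mass b0\<bar> + 1" using elim(1) by (simp add: I_def mult.assoc)
  then show ?case using I cC(1) by (simp add: pos_le_divide_eq)
 qed
 moreover have "(\<bar>total_mass b0\<bar> + 1) / (c * I) > 0" using I cC(1) by simp
 ultimately show ?thesis by blast
qed

text \<open>Small local mass makes the Brezis-Merle exponent admissible with some
  \<open>q > 1\<close>. The bound concerns \<open>f k / \<kappa> k\<close>: it gives boundedness
  when \<open>\<kappa> k\<close> is bounded and vanishing of the mass when \<open>\<kappa> k\<close>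
  tends to 0.\<close>

lemma local_Lq_bound:
 assumes x0: "x0 \<in> S2"
  and small: "\<And>s. s > 0 \<Longrightarrow> \<exists>r>0. \<forall>\<^sub>F k in sequentially. ball_mass (f k) x0 r \<le> s"
 shows "\<exists>r>0. \<exists>q>1. \<exists>C\<ge>0. \<forall>\<^sub>F k in sequentially.
   (\<ointegral>\<^sup>+x. indicator (ball x0 r) x * ennreal ((f k x / \<kappa> k) powr q)) \<le> ennreal C"
proof -
 obtain B where B: "B \<ge> 0" "\<forall>\<^sub>F k in sequentially. \<forall>i. \<bar>b k $ i\<bar> \<le> B" using eventually_b_bounded by blast
 obtain c C where cC: "0 < C" "\<forall>\<^sub>F k in sequentially. \<forall>x\<in>S2. c \<le> K k x \<and> K k x \<le> C \<and> norm (grad_S2 (K k) x) \<le> C"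
  using eventually_K_bounded by blast
 define e where "e = cone_exponent p b0 x0"
 have e: "e > -1" unfolding e_def by (rule cone_exponent_gt[OF inj_p b0_gt])
 \<comment> \<open>The number \<open>1 - e\<close> is the midpoint between \<open>- 2 * e\<close>,
   the singular order of the limit weight, and the threshold 2. It leaves room for the exponents of
   \<open>b k\<close> to differ from their limits.\<close>
 define a where "a = max 0 (1 - e)"
 have a: "a \<ge> 0" "a < 2" "- a < 2 * e" using e by (auto simp: a_def)
 define s where "s = pi * (2 - a) / 4"
 have s: "s > 0" using a by (simp add: s_def)
 \<comment> \<open>With \<open>s / pi = (2 - a) / 4\<close> the condition reads
   \<open>q * (3 * a + 2) < 8\<close>; this \<open>q\<close> is the midpoint between 1 and the
   critical value.\<close>
 define q where "q = (1 + 8 / (3 * a + 2)) / 2"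
 have q: "q > 1" "q * a + q * s / pi < 2"
 proof -
  have 1: "8 / (3 * a + 2) > 1" using a by (simp add: field_simps)
  then show "q > 1" by (simp add: q_def)
  have "q < 8 / (3 * a + 2)" using 1 by (simp add: q_def)
  then have "q * (3 * a + 2) < 8" using a by (simp add: pos_less_divide_eq)
  moreover have Y: "q * s / pi = q * ((2 - a) / 4)" by (simp add: s_def)
  have "q * a + q * s / pi = q * (3 * a + 2) / 4" unfolding Y by (simp add: field_simps)
  ultimately show "q * a + q * s / pi < 2" by linarith
 qed
 obtain r1 where r1: "r1 > 0" "\<forall>\<^sub>F k in sequentially. ball_mass (f k) x0 r1 \<le> s"
  using small[OF s] by blast
 obtain r2 where r2: "0 < r2" "r2 \<le> 1" "\<And>i. p i \<noteq> x0 \<Longrightarrow> 2 * r2 \<le> dist (p i) x0"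
  using isolating_radius[of p x0] by blast
 define r where "r = min (r1 / 2) r2"
 have r: "0 < r" "r \<le> 1" "2 * r \<le> r1" "\<And>i. p i \<noteq> x0 \<Longrightarrow> 2 * r \<le> dist (p i) x0"
  using r1 r2 by (auto simp: r_def min_def) (use r2(3) in \<open>force\<close>)
 obtain D where D: "D > 0" "\<And>\<beta> x. (\<forall>i. \<bar>\<beta> $ i\<bar> \<le> B) \<Longrightarrow> - a \<le> 2 * cone_exponent p \<beta> x0 \<Longrightarrow> x \<in> S2 \<Longrightarrow> x \<noteq> x0 \<Longrightarrow> dist x x0 < r
   \<Longrightarrow> conic_weight p \<beta> x \<le> D * dist x x0 powr (- a)"
  using conic_weight_local_bound[OF inj_p range_p x0 a(1) r(1,2,4)] by blast
 have "(\<lambda>k. 2 * cone_exponent p (b k) x0) \<longlonglongrightarrow> 2 * e"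
  unfolding e_def by (intro tendsto_mult tendsto_const tendsto_cone_exponent b_lim)
 then have ev: "\<forall>\<^sub>F k in sequentially. - a < 2 * cone_exponent p (b k) x0"
  using a(3) by (rule order_tendstoD)
 define M where "M = \<bar>total_mass b0\<bar> + 1"
 define C' where "C' = (C * D) powr q * \<bar>bm_const M r s q a\<bar>"
 have "\<forall>\<^sub>F k in sequentially.
   (\<ointegral>\<^sup>+x. indicator (ball x0 r) x * ennreal ((f k x / \<kappa> k) powr q)) \<le> ennreal C'"
  using eventually_mass B(2) cC(2) r1(2) ev
 proof eventually_elim
  case (elim k)
  have sm: "ball_mass (f k) x0 (2 * r) \<le> s"
  proof (rule order_trans[OF _ elim(4)])
   show "ball_mass (f k) x0 (2 * r) \<le> ball_mass (f k) x0 r1"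
    using r(3) by (intro integral_indicator_mono f_integrable f_nonneg subset_ball) auto
  qed
  have lp [measurable]: "log_pot (f k) \<in> borel_measurable area_S2" by (rule log_pot_measurable[OF f_integrable])
  have im [measurable]: "(\<lambda>x. indicator (ball x0 r) x :: ennreal) \<in> borel_measurable area_S2"
   by (intro measurable_area1 borel_measurable_indicator) simp
  let ?g = "\<lambda>x. (dist x x0 powr (- a) * exp (2 * log_pot (f k) x)) powr q"
  have "(\<ointegral>\<^sup>+x. indicator (ball x0 r) x * ennreal ((f k x / \<kappa> k) powr q))
   \<le> (\<ointegral>\<^sup>+x. ennreal ((C * D) powr q) * (indicator (ball x0 r) x * ennreal (?g x)))"
  proof (rule nn_integral_mono_AE)
   show "AE x in area_S2. indicator (ball x0 r) x * ennreal ((f k x / \<kappa> k) powr q)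
     \<le> ennreal ((C * D) powr q) * (indicator (ball x0 r) x * ennreal (?g x))"
    using AE_area_neq[of x0] AE_space
   proof eventually_elim
    fix x assume ne: "x \<noteq> x0" and "x \<in> space area_S2"
    then have x: "x \<in> S2" by simp
    show "indicator (ball x0 r) x * ennreal ((f k x / \<kappa> k) powr q)
     \<le> ennreal ((C * D) powr q) * (indicator (ball x0 r) x * ennreal (?g x))"
    proof (cases "dist x x0 < r")
     case True
     have w: "conic_weight p (b k) x \<le> D * dist x x0 powr (- a)"
      by (rule D(2)[OF elim(2) less_imp_le[OF elim(5)] x ne True])
     have "f k x / \<kappa> k = K k x * conic_weight p (b k) x * exp (2 * log_pot (f k) x)"
      using \<kappa>_pos[of k] by (simp add: f_eq[OF x])
     also have "... \<le> C * (D * dist x x0 powr (- a)) * exp (2 * log_pot (f k) x)"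
      using elim(3) x w conic_weight_nonneg[of p "b k" x] cC(1) by (intro mult_right_mono mult_mono) auto
     finally have "f k x / \<kappa> k \<le> (C * D) * (dist x x0 powr (- a) * exp (2 * log_pot (f k) x))"
      by (simp add: mult_ac)
     moreover have "f k x / \<kappa> k \<ge> 0" using f_nonneg[OF x] \<kappa>_pos[of k] by (simp add: less_imp_le)
     ultimately have "(f k x / \<kappa> k) powr q \<le> ((C * D) * (dist x x0 powr (- a) * exp (2 * log_pot (f k) x))) powr q"
      using q by (intro powr_mono2) auto
     also have "... = (C * D) powr q * ?g x" using cC(1) D(1) by (subst powr_mult) auto
     finally have "ennreal ((f k x / \<kappa> k) powr q) \<le> ennreal ((C * D) powr q * ?g x)" by (rule ennreal_leI)
     also have "... = ennreal ((C * D) powr q) * ennreal (?g x)" by (rule ennreal_mult) auto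
     finally show ?thesis using True by (simp add: dist_commute)
    qed (simp add: dist_commute)
   qed
  qed
  also have "... = ennreal ((C * D) powr q) * (\<ointegral>\<^sup>+x. indicator (ball x0 r) x * ennreal (?g x))"
   by (rule nn_integral_cmult) measurable
  also have "... \<le> ennreal ((C * D) powr q) * ennreal (bm_const M r s q a)"
   using elim(1) q by (intro mult_left_mono brezis_merle f_integrable f_nonneg r x0 s sm a) (auto simp: M_def)
  also have "... \<le> ennreal ((C * D) powr q) * ennreal \<bar>bm_const M r s q a\<bar>"
   by (intro mult_left_mono ennreal_leI) auto
  also have "... = ennreal C'" unfolding C'_def by (rule ennreal_mult[symmetric]) auto
  finally show ?case .
 qed
 moreover have "C' \<ge> 0" by (simp add: C'_def)
 ultimately show ?thesis using r(1) q(1) by blast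
qed

theorem log_pot_bounded:
 assumes small: "\<And>x s. x \<in> S2 \<Longrightarrow> s > 0 \<Longrightarrow> \<exists>r>0. \<forall>\<^sub>F k in sequentially. ball_mass (f k) x r \<le> s"
 shows "\<exists>W. \<forall>\<^sub>F k in sequentially. \<forall>x\<in>S2. integrable area_S2 (\<lambda>y. f k y * log_pot_kernel x y) \<and> log_pot (f k) x \<le> W"
proof -
 obtain A where A: "A > 0" "\<forall>\<^sub>F k in sequentially. \<kappa> k \<le> A" using \<kappa>_bounded by blast
 have "\<exists>q>1. \<exists>C\<ge>0. \<forall>\<^sub>F k in sequentially. (\<ointegral>\<^sup>+x. ennreal ((f k x / \<kappa> k) powr q)) \<le> ennreal C"
  by (rule Lq_bound_from_cover[OF _ _ local_Lq_bound[OF _ small]])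
   (use f_nonneg \<kappa>_pos in \<open>auto simp: less_imp_le\<close>)
 then obtain q C where q: "q > 1" "C \<ge> 0" and ev: "\<forall>\<^sub>F k in sequentially. (\<ointegral>\<^sup>+x. ennreal ((f k x / \<kappa> k) powr q)) \<le> ennreal C"
  by blast
 have "\<forall>\<^sub>F k in sequentially. (\<ointegral>\<^sup>+x. ennreal (f k x powr q)) \<le> ennreal (A powr q * C)"
  using ev A(2)
 proof eventually_elim
  case (elim k)
  have "(\<ointegral>\<^sup>+x. ennreal (f k x powr q)) \<le> (\<ointegral>\<^sup>+x. ennreal (A powr q) * ennreal ((f k x / \<kappa> k) powr q))"
  proof (rule nn_integral_mono)
   fix x assume "x \<in> space area_S2"
   then have x: "x \<in> S2" by simp
   have h: "f k x / \<kappa> k \<ge> 0" using f_nonneg[OF x] \<kappa>_pos[of k] by (simp add: less_imp_le)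
   have "f k x = \<kappa> k * (f k x / \<kappa> k)" using \<kappa>_pos[of k] by simp
   also have "... \<le> A * (f k x / \<kappa> k)" using elim(2) h by (rule mult_right_mono)
   finally have "f k x powr q \<le> (A * (f k x / \<kappa> k)) powr q"
    using q f_nonneg[OF x] by (intro powr_mono2) auto
   also have "... = A powr q * (f k x / \<kappa> k) powr q" using A(1) h by (subst powr_mult) auto
   finally show "ennreal (f k x powr q) \<le> ennreal (A powr q) * ennreal ((f k x / \<kappa> k) powr q)"
    by (simp add: ennreal_mult[symmetric] ennreal_leI)
  qed
  also have "... = ennreal (A powr q) * (\<ointegral>\<^sup>+x. ennreal ((f k x / \<kappa> k) powr q))"
   by (rule nn_integral_cmult) measurable
  also have "... \<le> ennreal (A powr q) * ennreal C" by (rule mult_left_mono[OF elim(1)]) simp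
  also have "... = ennreal (A powr q * C)" using q by (simp add: ennreal_mult)
  finally show ?case .
 qed
 then have "\<forall>\<^sub>F k in sequentially. \<forall>x\<in>S2. integrable area_S2 (\<lambda>y. f k y * log_pot_kernel x y) \<and>
   log_pot (f k) x \<le> ((2 powr (1 / (q / (q - 1))) / (1 / (q / (q - 1)))) powr (q / (q - 1)) * riesz_const 1 + A powr q * C) / (2 * pi)"
 proof eventually_elim
  case (elim k)
  show ?case
   using log_pot_bound_of_Lq[OF f_measurable f_nonneg q(1) _ elim] q(2) by simp
 qed
 then show ?thesis by blast
qed

end

text \<open>A single solution is a constant sequence, and the masses of shrinking balls tend to 0 by
  dominated convergence; so there are no atoms and the bound for sequences applies.\<close>

lemma potential_form_log_pot_bounded:
 fixes p :: "'m::finite \<Rightarrow> real^3"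
 assumes p: "inj p" "range p \<subseteq> S2" and K: "K \<in> C1_pos_S2" and b: "\<And>i. b $ i > -1"
  and pf: "potential_form p K b \<kappa> f"
 shows "\<exists>W. \<forall>x\<in>S2. integrable area_S2 (\<lambda>y. f y * log_pot_kernel x y) \<and> log_pot f x \<le> W"
proof -
 have KC: "K \<in> C1_S2" using K by (simp add: C1_pos_S2_def)
 have "C1_dist K K = 0" using Metric_space.mdist_zero[OF Metric_space_C1_S2 KC] .
 then interpret liouville_sequence p "\<lambda>_. K" "\<lambda>_. b" "\<lambda>_. \<kappa>" "\<lambda>_. f" K b
  by unfold_locales (use assms in auto)
 have small: "\<exists>r>0. \<forall>\<^sub>F k::nat in sequentially. ball_mass f x r \<le> s"
  if x: "x \<in> S2" and s: "s > 0" for x s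
 proof -
  have "(\<lambda>n. \<ointegral>y. indicator (ball x (inverse (real (Suc n)))) y * f y) \<longlonglongrightarrow> (\<ointegral>y. 0)"
  proof (rule integral_dominated_convergence[where w="\<lambda>y. \<bar>f y\<bar>"])
   show "AE y in area_S2. (\<lambda>n. indicator (ball x (inverse (real (Suc n)))) y * f y) \<longlonglongrightarrow> 0"
    using AE_area_neq[of x]
   proof eventually_elim
    case (elim y)
    then have d: "dist x y > 0" by simp
    have "\<forall>\<^sub>F n in sequentially. inverse (real (Suc n)) < dist x y"
     using LIMSEQ_inverse_real_of_nat d by (rule order_tendstoD)
    then have "\<forall>\<^sub>F n in sequentially. indicator (ball x (inverse (real (Suc n)))) y * f y = 0"
     by eventually_elim (simp add: indicator_def)
    then show ?case by (rule tendsto_eventually)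
   qed
  qed (use f_integrable in \<open>auto simp: indicator_def\<close>)
  then have "\<forall>\<^sub>F n in sequentially. (\<ointegral>y. indicator (ball x (inverse (real (Suc n)))) y * f y) < s"
   using order_tendstoD(2)[of _ "\<ointegral>y. 0" sequentially s] s by auto
  then obtain n where "(\<ointegral>y. indicator (ball x (inverse (real (Suc n)))) y * f y) < s"
   by (meson eventually_sequentially order_refl)
  then show ?thesis by (intro exI[of _ "inverse (real (Suc n))"]) auto
 qed
 from log_pot_bounded[OF small] show ?thesis by simp
qed

subsection \<open>A localised conformal field\<close>

text \<open>The square of a positive part is continuously differentiable, so a truncated quadratic
  can serve as cut-off for the vector field.\<close>

lemma DERIV_max_0_square: "((\<lambda>a::real. (max 0 a)\<^sup>2) has_real_derivative 2 * max 0 a) (at a)"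
proof -
 consider "a > 0" | "a < 0" | "a = 0" by linarith
 then show ?thesis
 proof cases
  case 1
  have "((\<lambda>a::real. a\<^sup>2) has_real_derivative 2 * max 0 a) (at a)"
   using 1 by (auto intro!: derivative_eq_intros)
  then show ?thesis
   by (rule has_field_derivative_transform_within_open[of _ _ _ "{0<..}"]) (use 1 in auto)
 next
  case 2
  have "((\<lambda>a::real. 0) has_real_derivative 2 * max 0 a) (at a)"
   using 2 by (auto intro!: derivative_eq_intros)
  then show ?thesis
   by (rule has_field_derivative_transform_within_open[of _ _ _ "{..<0}"]) (use 2 in auto)
 next
  case 3
  have "((\<lambda>h::real. (max 0 h)\<^sup>2 / h) \<longlongrightarrow> 0) (at 0)"
  proof (rule Lim_null_comparison[where g="\<lambda>h. \<bar>h\<bar>"])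
   have "norm ((max 0 h)\<^sup>2 / h) \<le> \<bar>h\<bar>" for h :: real
    by (cases "h > 0") (auto simp: power2_eq_square max_def)
   then show "\<forall>\<^sub>F h in at (0::real). norm ((max 0 h)\<^sup>2 / h) \<le> \<bar>h\<bar>" by simp
   show "((\<lambda>h::real. \<bar>h\<bar>) \<longlongrightarrow> 0) (at 0)" by (intro tendsto_eq_intros) auto
  qed
  then show ?thesis using 3 by (simp add: DERIV_def)
 qed
qed

text \<open>Only its square enters the field. This quadratic profile keeps the error terms explicit
  in \<open>dist x x0\<close> and \<open>r\<close>.\<close>

definition bump :: "real^3 \<Rightarrow> real \<Rightarrow> real^3 \<Rightarrow> real" where
 "bump x0 r x = max 0 (1 - ((x - x0) \<bullet> (x - x0)) / r\<^sup>2)"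

text \<open>The field \<open>x \<mapsto> (x0 \<bullet> x) x - x0\<close> is the gradient of \<open>dist x x0\<^sup>2 / 2\<close> on the sphere.\<close>

definition bump_field :: "real^3 \<Rightarrow> real \<Rightarrow> real^3 \<Rightarrow> real^3" where
 "bump_field x0 r x = (bump x0 r x)\<^sup>2 *\<^sub>R ((x0 \<bullet> x) *\<^sub>R x - x0)"

definition bump_field_deriv :: "real^3 \<Rightarrow> real \<Rightarrow> real^3 \<Rightarrow> real^3 \<Rightarrow> real^3" where
 "bump_field_deriv x0 r x v = (2 * bump x0 r x * (- (2 * ((x - x0) \<bullet> v)) / r\<^sup>2)) *\<^sub>R ((x0 \<bullet> x) *\<^sub>R x - x0)
   + (bump x0 r x)\<^sup>2 *\<^sub>R ((x0 \<bullet> v) *\<^sub>R x + (x0 \<bullet> x) *\<^sub>R v)"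

lemma bump_dist: "bump x0 r x = max 0 (1 - (dist x x0)\<^sup>2 / r\<^sup>2)"
 by (simp add: bump_def dist_norm power2_norm_eq_inner)

lemma C1_near_bump_field: "C1_near_S2 (bump_field x0 r) (bump_field_deriv x0 r)"
 unfolding C1_near_S2_def
proof (intro conjI ballI allI)
 fix x :: "real^3"
 have 1: "((\<lambda>x. 1 - ((x - x0) \<bullet> (x - x0)) / r\<^sup>2) has_derivative (\<lambda>v. - (2 * ((x - x0) \<bullet> v)) / r\<^sup>2)) (at x)"
  unfolding divide_inverse by (auto intro!: derivative_eq_intros simp: inner_commute)
 have "((\<lambda>x. (bump x0 r x)\<^sup>2) has_derivative (\<lambda>v. 2 * bump x0 r x * (- (2 * ((x - x0) \<bullet> v)) / r\<^sup>2))) (at x)"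
  unfolding bump_def
  using diff_chain_at[OF 1 DERIV_max_0_square[unfolded has_field_derivative_def]] by (simp add: o_def)
 moreover have "((\<lambda>x. (x0 \<bullet> x) *\<^sub>R x - x0) has_derivative (\<lambda>v. (x0 \<bullet> v) *\<^sub>R x + (x0 \<bullet> x) *\<^sub>R v)) (at x)"
  by (auto intro!: derivative_eq_intros simp: add.commute)
 ultimately have "((\<lambda>x. (bump x0 r x)\<^sup>2 *\<^sub>R ((x0 \<bullet> x) *\<^sub>R x - x0)) has_derivative
   (\<lambda>v. (bump x0 r x)\<^sup>2 *\<^sub>R ((x0 \<bullet> v) *\<^sub>R x + (x0 \<bullet> x) *\<^sub>R v)
    + (2 * bump x0 r x * (- (2 * ((x - x0) \<bullet> v)) / r\<^sup>2)) *\<^sub>R ((x0 \<bullet> x) *\<^sub>R x - x0))) (at x)"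
  by (rule has_derivative_scaleR)
 then show "(bump_field x0 r has_derivative bump_field_deriv x0 r x) (at x)"
  by (simp add: bump_field_def[abs_def] bump_field_deriv_def[abs_def] add.commute)
 show "continuous_on S2 (\<lambda>x. bump_field_deriv x0 r x v)" for v
  unfolding bump_field_deriv_def bump_def divide_inverse by (intro continuous_intros)
qed

lemma tangent_bump_field: "tangent_S2 (bump_field x0 r)"
 by (simp add: tangent_S2_def bump_field_def inner_simps inner_self_S2)

context
 fixes x0 :: "real^3" and r :: real
 assumes x0: "x0 \<in> S2" and r: "0 < r" "r \<le> 1"
begin

abbreviation (input) "bsq x \<equiv> (bump x0 r x)\<^sup>2"
abbreviation (input) "BX \<equiv> bump_field x0 r"
abbreviation (input) "RY x \<equiv> (x0 \<bullet> x) *\<^sub>R x - x0"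

lemma bump_bounds:
 "0 \<le> bump x0 r x" "bump x0 r x \<le> 1" "1 - (dist x x0)\<^sup>2 / r\<^sup>2 \<le> bump x0 r x"
 "dist x x0 \<ge> r \<Longrightarrow> bump x0 r x = 0"
proof -
 show "0 \<le> bump x0 r x" "bump x0 r x \<le> 1" "1 - (dist x x0)\<^sup>2 / r\<^sup>2 \<le> bump x0 r x"
  by (auto simp: bump_dist)
 assume "dist x x0 \<ge> r"
 then have "(dist x x0)\<^sup>2 \<ge> r\<^sup>2" using r by (intro power_mono) auto
 then have "(dist x x0)\<^sup>2 / r\<^sup>2 \<ge> 1" using r by (simp add: pos_le_divide_eq)
 then show "bump x0 r x = 0" by (simp add: bump_dist)
qed

lemma bump_square_lower: "1 - 2 * ((dist x x0)\<^sup>2 / r\<^sup>2) \<le> bsq x"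
proof -
 define s where "s = (dist x x0)\<^sup>2 / r\<^sup>2"
 have "s \<ge> 0" by (simp add: s_def)
 show ?thesis
 proof (cases "s \<le> 1")
  case True
  have "1 - 2 * s \<le> (1 - s)\<^sup>2" by (simp add: power2_eq_square algebra_simps)
  also have "... \<le> bsq x" using True bump_bounds(3)[of x] by (intro power_mono) (auto simp: s_def)
  finally show ?thesis by (simp add: s_def)
 next
  case False
  then have "1 - 2 * s \<le> 0" by simp
  then show ?thesis using zero_le_power2[of "bump x0 r x"] by (simp only: s_def[symmetric])
 qed
qed

lemma radial_product:
 assumes x: "x \<in> S2"
 shows "(x - x0) \<bullet> RY x = (dist x x0)\<^sup>2 * (1 - (dist x x0)\<^sup>2 / 4)"
  and "norm (RY x) \<le> dist x x0"
  and "x0 \<bullet> x = 1 - (dist x x0)\<^sup>2 / 2"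
proof -
 show t: "x0 \<bullet> x = 1 - (dist x x0)\<^sup>2 / 2"
  using dist_S2(1)[OF x x0, unfolded inner_commute[of x x0]] by linarith
 have e: "(x - x0) \<bullet> RY x = 1 - (x0 \<bullet> x)\<^sup>2"
  using inner_self_S2[OF x] inner_self_S2[OF x0]
  by (simp add: inner_simps inner_commute[of x x0] power2_eq_square algebra_simps)
 also have "... = (dist x x0)\<^sup>2 * (1 - (dist x x0)\<^sup>2 / 4)" unfolding t by (simp add: power2_eq_square algebra_simps)
 finally show "(x - x0) \<bullet> RY x = (dist x x0)\<^sup>2 * (1 - (dist x x0)\<^sup>2 / 4)" .
 have "(norm (RY x))\<^sup>2 = 1 - (x0 \<bullet> x)\<^sup>2"
  unfolding power2_norm_eq_inner using inner_self_S2[OF x] inner_self_S2[OF x0]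
  by (simp add: inner_simps inner_commute[of x x0] power2_eq_square algebra_simps)
 also have "... = (dist x x0)\<^sup>2 * (1 - (dist x x0)\<^sup>2 / 4)" unfolding t by (simp add: power2_eq_square algebra_simps)
 also have "... \<le> (dist x x0)\<^sup>2 * 1" by (intro mult_left_mono) auto
 finally show "norm (RY x) \<le> dist x x0" by (simp add: power2_le_iff_abs_le)
qed

lemma norm_bump_field_le:
 assumes x: "x \<in> S2"
 shows "norm (BX x) \<le> dist x x0" "dist x x0 \<ge> r \<Longrightarrow> BX x = 0"
  "norm (BX x) \<le> r"
proof -
 have "norm (BX x) \<le> 1 * dist x x0"
  unfolding bump_field_def norm_scaleR
  using bump_bounds(1,2)[of x] radial_product(2)[OF x] by (intro mult_mono) (auto simp: power_le_one)
 then show 1: "norm (BX x) \<le> dist x x0" by simp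
 show 2: "dist x x0 \<ge> r \<Longrightarrow> BX x = 0" by (simp add: bump_field_def bump_bounds(4))
 show "norm (BX x) \<le> r" using 1 2 r by (cases "dist x x0 \<ge> r") auto
qed

lemma tangential_trace_bump_field:
 assumes x: "x \<in> S2"
 shows "tangential_trace (bump_field_deriv x0 r) x = 2 * (1 - (dist x x0)\<^sup>2 / 2) * bsq x
   - 4 * bump x0 r x * ((dist x x0)\<^sup>2 / r\<^sup>2) * (1 - (dist x x0)\<^sup>2 / 4)"
proof -
 let ?m = "bump x0 r x"
 have ab: "(\<Sum>b\<in>Basis. (v \<bullet> b) * (w \<bullet> b)) = v \<bullet> w" for v w :: "real^3"
  by (simp add: euclidean_inner[of v w])
 have "(\<Sum>b\<in>Basis. bump_field_deriv x0 r x b \<bullet> b)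
  = (- 4 * ?m / r\<^sup>2) * (\<Sum>b\<in>Basis. ((x - x0) \<bullet> b) * (RY x \<bullet> b))
   + ?m\<^sup>2 * ((\<Sum>b\<in>Basis. (x0 \<bullet> b) * (x \<bullet> b)) + (x0 \<bullet> x) * (\<Sum>b\<in>Basis. b \<bullet> (b :: real^3)))"
  unfolding bump_field_deriv_def
  by (simp only: inner_add_left inner_scaleR_left sum.distrib sum_distrib_left distrib_left)
   (simp add: algebra_simps add_divide_distrib diff_divide_distrib)
 also have "... = (- 4 * ?m / r\<^sup>2) * ((x - x0) \<bullet> RY x) + ?m\<^sup>2 * (4 * (x0 \<bullet> x))"
  by (simp only: ab sum_Basis_inner_self) (simp add: algebra_simps)
 finally have 1: "(\<Sum>b\<in>Basis. bump_field_deriv x0 r x b \<bullet> b) = (- 4 * ?m / r\<^sup>2) * ((x - x0) \<bullet> RY x) + ?m\<^sup>2 * (4 * (x0 \<bullet> x))" .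
 have "RY x \<bullet> x = 0" using inner_self_S2[OF x] by (simp add: inner_simps)
 then have 2: "bump_field_deriv x0 r x x \<bullet> x = ?m\<^sup>2 * (2 * (x0 \<bullet> x))"
  unfolding bump_field_deriv_def inner_add_left inner_scaleR_left inner_self_S2[OF x] by simp
 show ?thesis
  unfolding tangential_trace_def 1 2 radial_product(1)[OF x] unfolding radial_product(3)[OF x]
  by (simp add: algebra_simps add_divide_distrib diff_divide_distrib)
qed

text \<open>At the centre the field acts as a dilation of the tangent plane, whose divergence is 2;
  the deviation is of second order in the distance. This 2 is the constant term of the factor 2 + 2
  e in the quadratic equation.\<close>

lemma tangential_trace_bump_bounds:
 assumes x: "x \<in> S2"
 shows "\<bar>tangential_trace (bump_field_deriv x0 r) x\<bar> \<le> 6"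
  and "dist x x0 \<ge> r \<Longrightarrow> tangential_trace (bump_field_deriv x0 r) x = 0"
  and "\<bar>tangential_trace (bump_field_deriv x0 r) x - 2\<bar> \<le> 9 * ((dist x x0)\<^sup>2 / r\<^sup>2)"
proof -
 define d where "d = (dist x x0)\<^sup>2"
 define m where "m = bump x0 r x"
 have d: "0 \<le> d" "d \<le> 4"
  using power_mono[OF dist_S2(3)[OF x x0], of 2] by (auto simp: d_def)
 have m: "0 \<le> m" "m \<le> 1" "1 - 2 * (d / r\<^sup>2) \<le> m\<^sup>2" "m\<^sup>2 \<le> 1"
  using bump_bounds(1,2)[of x] bump_square_lower[of x] by (auto simp: m_def d_def power_le_one)
 have T: "tangential_trace (bump_field_deriv x0 r) x = 2 * (1 - d / 2) * m\<^sup>2 - 4 * m * (d / r\<^sup>2) * (1 - d / 4)"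
  using tangential_trace_bump_field[OF x] by (simp add: d_def m_def)
 have dr: "d \<le> d / r\<^sup>2" using d r by (simp add: pos_le_divide_eq mult_left_le power_le_one)
 show "dist x x0 \<ge> r \<Longrightarrow> tangential_trace (bump_field_deriv x0 r) x = 0"
  unfolding T m_def by (simp add: bump_bounds(4))
 have q0: "0 \<le> m * (1 - d / 4)" "m * (1 - d / 4) \<le> 1" using m d by (auto intro!: mult_le_one)
 have q1: "0 \<le> 4 * m * (d / r\<^sup>2) * (1 - d / 4)" using m d by (intro mult_nonneg_nonneg) auto
 have q2: "4 * m * (d / r\<^sup>2) * (1 - d / 4) \<le> 4 * (d / r\<^sup>2)"
  using mult_left_mono[OF q0(2), of "4 * (d / r\<^sup>2)"] d by (simp add: algebra_simps)
 have q3: "4 * m * (d / r\<^sup>2) * (1 - d / 4) \<le> 4"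
 proof (cases "dist x x0 \<ge> r")
  case True then show ?thesis by (simp add: m_def bump_bounds(4))
 next
  case False
  then have "d \<le> r\<^sup>2" unfolding d_def by (intro power_mono) auto
  then have "d / r\<^sup>2 \<le> 1" using r by (simp add: pos_divide_le_eq)
  then show ?thesis using q2 by simp
 qed
 have p1: "\<bar>2 * (1 - d / 2) * m\<^sup>2\<bar> \<le> 2"
 proof -
  have "\<bar>2 - d\<bar> * m\<^sup>2 \<le> 2 * 1" using d m by (intro mult_mono) auto
  moreover have "2 * (1 - d / 2) * m\<^sup>2 = (2 - d) * m\<^sup>2" by (simp add: algebra_simps)
  ultimately show ?thesis by (simp only: abs_mult) simp
 qed
 show "\<bar>tangential_trace (bump_field_deriv x0 r) x\<bar> \<le> 6"
  unfolding T using p1 q1 q3 by linarith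
 have p2: "\<bar>2 * (1 - d / 2) * m\<^sup>2 - 2\<bar> \<le> 5 * (d / r\<^sup>2)"
 proof -
  have "2 * (1 - d / 2) * m\<^sup>2 - 2 = 2 * (m\<^sup>2 - 1) - d * m\<^sup>2" by (simp add: algebra_simps)
  moreover have "0 \<le> d * m\<^sup>2" "d * m\<^sup>2 \<le> d" using d m by (auto simp: mult_left_le)
  moreover have "- (4 * (d / r\<^sup>2)) \<le> 2 * (m\<^sup>2 - 1)" "2 * (m\<^sup>2 - 1) \<le> 0" using m by auto
  ultimately show ?thesis using dr by (simp only: abs_le_iff) linarith
 qed
 show "\<bar>tangential_trace (bump_field_deriv x0 r) x - 2\<bar> \<le> 9 * ((dist x x0)\<^sup>2 / r\<^sup>2)"
 proof -
  have "\<bar>a - 2\<bar> \<le> 5 * s \<Longrightarrow> 0 \<le> b \<Longrightarrow> b \<le> 4 * s \<Longrightarrow> \<bar>a - b - 2\<bar> \<le> 9 * s" for a b s :: real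
   by linarith
  then show ?thesis unfolding T d_def[symmetric] using p2 q1 q2 by blast
 qed
qed

text \<open>Near the centre the field is the radial dilation, along which
  \<open>ln (dist x x0)\<close> has derivative 1. In the virial identity this produces the
  contribution of the cone exponent at \<open>x0\<close>.\<close>

lemma radial_bump_field:
 assumes x: "x \<in> S2" "x \<noteq> x0"
 shows "\<bar>log_reg_deriv 0 x0 x (BX x)\<bar> \<le> 1"
  and "\<bar>log_reg_deriv 0 x0 x (BX x) - 1\<bar> \<le> 3 * ((dist x x0)\<^sup>2 / r\<^sup>2)"
proof -
 define d where "d = (dist x x0)\<^sup>2"
 define m where "m = bump x0 r x"
 have d: "0 < d" "d \<le> 4"
  using power_mono[OF dist_S2(3)[OF x(1) x0], of 2] x(2) by (auto simp: d_def)
 have m: "1 - 2 * (d / r\<^sup>2) \<le> m\<^sup>2" "m\<^sup>2 \<le> 1" "0 \<le> m\<^sup>2"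
  using bump_bounds(1,2)[of x] bump_square_lower[of x] by (auto simp: m_def d_def power_le_one)
 have e: "log_reg_deriv 0 x0 x (BX x) = m\<^sup>2 * (1 - d / 4)"
  using d radial_product(1)[OF x(1)]
  by (simp add: log_reg_deriv_def bump_field_def m_def d_def[symmetric])
 have dr: "d \<le> d / r\<^sup>2" using d r by (simp add: pos_le_divide_eq mult_left_le power_le_one)
 have "m\<^sup>2 * (1 - d / 4) \<le> 1 * 1" using m d by (intro mult_mono) auto
 moreover have "0 \<le> m\<^sup>2 * (1 - d / 4)" using m d by (intro mult_nonneg_nonneg) auto
 ultimately show "\<bar>log_reg_deriv 0 x0 x (BX x)\<bar> \<le> 1" unfolding e by simp
 have "m\<^sup>2 * (1 - d / 4) = m\<^sup>2 - m\<^sup>2 * d / 4" by (simp add: algebra_simps)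
 moreover have "0 \<le> m\<^sup>2 * d" "m\<^sup>2 * d \<le> d" using d m by (auto simp: mult_left_le_one_le)
 ultimately show "\<bar>log_reg_deriv 0 x0 x (BX x) - 1\<bar> \<le> 3 * ((dist x x0)\<^sup>2 / r\<^sup>2)"
  unfolding e d_def[symmetric] using m dr by linarith
qed

lemma radial_field_lipschitz:
 assumes "x \<in> S2" "y \<in> S2"
 shows "norm (RY x - RY y) \<le> 2 * dist x y"
proof -
 have "RY x - RY y = (x0 \<bullet> x) *\<^sub>R (x - y) + (x0 \<bullet> (x - y)) *\<^sub>R y"
  by (simp add: algebra_simps inner_simps)
 then have "norm (RY x - RY y)
   \<le> \<bar>x0 \<bullet> x\<bar> * norm (x - y) + \<bar>x0 \<bullet> (x - y)\<bar> * norm y"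
  using norm_triangle_ineq[of "(x0 \<bullet> x) *\<^sub>R (x - y)" "(x0 \<bullet> (x - y)) *\<^sub>R y"] by simp
 also have "... \<le> 1 * norm (x - y) + norm (x - y) * 1"
  using inner_S2_bounds(3)[OF x0 assms(1)] Cauchy_Schwarz_ineq2[of x0 "x - y"] x0 assms
  by (intro add_mono mult_right_mono mult_mono) auto
 finally show ?thesis by (simp add: dist_norm)
qed

lemma bump_square_diff:
 assumes "s = dist x x0 + dist y x0"
 shows "\<bar>bsq x - bsq y\<bar> \<le> 2 * s * dist x y / r\<^sup>2"
proof -
 have "\<bar>bump x0 r x - bump x0 r y\<bar> \<le> \<bar>(dist x x0)\<^sup>2 / r\<^sup>2 - (dist y x0)\<^sup>2 / r\<^sup>2\<bar>"
  unfolding bump_dist by linarith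
 also have "... = \<bar>dist x x0 - dist y x0\<bar> * s / r\<^sup>2"
 proof -
  have "(dist x x0)\<^sup>2 / r\<^sup>2 - (dist y x0)\<^sup>2 / r\<^sup>2 = (dist x x0 - dist y x0) * s / r\<^sup>2"
   unfolding assms by (simp add: power2_eq_square algebra_simps diff_divide_distrib)
  then show ?thesis using assms by (simp add: abs_mult)
 qed
 also have "... \<le> dist x y * s / r\<^sup>2"
  using abs_dist_diff_le[of x x0 y] assms
  by (intro divide_right_mono mult_right_mono) (auto simp: dist_commute[of x0 y])
 finally have 1: "\<bar>bump x0 r x - bump x0 r y\<bar> \<le> dist x y * s / r\<^sup>2" .
 have "\<bar>bsq x - bsq y\<bar> = \<bar>bump x0 r x + bump x0 r y\<bar> * \<bar>bump x0 r x - bump x0 r y\<bar>"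
  by (simp add: abs_mult[symmetric] power2_eq_square algebra_simps)
 also have "... \<le> 2 * (dist x y * s / r\<^sup>2)"
  using 1 bump_bounds(1,2)[of x] bump_bounds(1,2)[of y] by (intro mult_mono) auto
 finally show ?thesis by (simp add: mult_ac)
qed

text \<open>The constant is independent of \<open>r\<close>: the cut-off varies at rate 1 / r, but
  multiplies a field of size at most \<open>r\<close>. With \<open>y\<close> the nearer point to the
  centre, either both values vanish, or \<open>x\<close> is within \<open>2 * r\<close> and the
  product rule applies, or \<open>dist x y \<ge> r\<close> exceeds the size of the field.\<close>

lemma bump_field_lipschitz:
 assumes x: "x \<in> S2" and y: "y \<in> S2"
 shows "norm (BX x - BX y) \<le> 8 * dist x y"
proof -
 have main: "norm (BX x - BX y) \<le> 8 * dist x y"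
  if x: "x \<in> S2" and y: "y \<in> S2" and le: "dist y x0 \<le> dist x x0" for x y
 proof (cases "dist y x0 \<ge> r")
  case True
  then show ?thesis using norm_bump_field_le(2)[OF x] norm_bump_field_le(2)[OF y] le by simp
 next
  case False
  show ?thesis
  proof (cases "dist x x0 \<le> 2 * r")
   case True
   have "BX x - BX y
    = bsq x *\<^sub>R (RY x - RY y) + (bsq x - bsq y) *\<^sub>R RY y"
    unfolding bump_field_def scaleR_diff_right[of _ "RY x"] scaleR_diff_left by simp
   then have "norm (BX x - BX y)
    \<le> bsq x * norm (RY x - RY y) + \<bar>bsq x - bsq y\<bar> * norm (RY y)"
    using norm_triangle_ineq[of "bsq x *\<^sub>R (RY x - RY y)" "(bsq x - bsq y) *\<^sub>R RY y"] by simp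
   also have "... \<le> 1 * (2 * dist x y) + (2 * (dist x x0 + dist y x0) * dist x y / r\<^sup>2) * dist y x0"
   proof (intro add_mono mult_mono)
    show "bsq x \<le> 1" using bump_bounds(1,2)[of x] by (simp add: power_le_one)
    show "norm (RY x - RY y) \<le> 2 * dist x y" by (rule radial_field_lipschitz[OF x y])
    show "\<bar>bsq x - bsq y\<bar> \<le> 2 * (dist x x0 + dist y x0) * dist x y / r\<^sup>2"
     by (rule bump_square_diff[OF refl])
    show "norm (RY y) \<le> dist y x0" by (rule radial_product(2)[OF y])
   qed auto
   also have "(2 * (dist x x0 + dist y x0) * dist x y / r\<^sup>2) * dist y x0 \<le> 6 * dist x y"
   proof -
    have "(dist x x0 + dist y x0) * dist y x0 \<le> (3 * r) * r"
     using True False r by (intro mult_mono) auto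
    then have "(dist x x0 + dist y x0) * dist y x0 / r\<^sup>2 \<le> 3"
     using r by (simp add: pos_divide_le_eq power2_eq_square)
    then have "2 * dist x y * ((dist x x0 + dist y x0) * dist y x0 / r\<^sup>2) \<le> 2 * dist x y * 3"
     by (intro mult_left_mono) auto
    then show ?thesis by (simp add: algebra_simps)
   qed
   finally show ?thesis by simp
  next
   case far: False
   then have "BX x = 0" using norm_bump_field_le(2)[OF x] r by simp
   then have "norm (BX x - BX y) \<le> r" using norm_bump_field_le(3)[OF y] by simp
   also have "r \<le> dist x y" using far False dist_triangle[of x x0 y] by (simp add: dist_commute)
   also have "... \<le> 8 * dist x y" by simp
   finally show ?thesis .
  qed
 qed
 show ?thesis
 proof (cases "dist y x0 \<le> dist x x0")
  case True then show ?thesis using main x y by blast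
 next
  case False
  then have "norm (BX y - BX x) \<le> 8 * dist y x" using main x y by simp
  then show ?thesis by (simp add: norm_minus_commute dist_commute)
 qed
qed

text \<open>The difference from the identity has three sources, the cut-off not being 1, the
  variation of the cut-off, and the curvature of the sphere; each is of relative size
  \<open>d / r\<^sup>2\<close>.\<close>

lemma bump_field_near_dilation:
 assumes x: "x \<in> S2" and y: "y \<in> S2" and d: "dist x x0 \<le> d" "dist y x0 \<le> d" "d \<le> 1"
 shows "norm ((BX x - BX y) - (x - y)) \<le> 12 * (d / r\<^sup>2) * dist x y"
proof -
 have d0: "d \<ge> 0" using d(1) by (meson zero_le_dist order_trans)
 have r2: "r\<^sup>2 > 0" "r\<^sup>2 \<le> 1" using r by (auto simp: power_le_one)
 have tx: "x0 \<bullet> x = 1 - (dist x x0)\<^sup>2 / 2" and ty: "x0 \<bullet> y = 1 - (dist y x0)\<^sup>2 / 2"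
  using radial_product(3) x y by auto
 have "(BX x - BX y) - (x - y)
  = (bsq x - 1) *\<^sub>R (RY x - RY y) + (bsq x - bsq y) *\<^sub>R RY y
   + ((x0 \<bullet> x - 1) *\<^sub>R (x - y) + (x0 \<bullet> (x - y)) *\<^sub>R y)"
  unfolding bump_field_def inner_diff_right by (simp add: algebra_simps)
 then have "norm ((BX x - BX y) - (x - y))
   \<le> norm ((bsq x - 1) *\<^sub>R (RY x - RY y)) + norm ((bsq x - bsq y) *\<^sub>R RY y)
   + (norm ((x0 \<bullet> x - 1) *\<^sub>R (x - y)) + norm ((x0 \<bullet> (x - y)) *\<^sub>R y))"
  by (metis (no_types, lifting) norm_triangle_ineq norm_triangle_mono order_refl add_mono)
 also have "... \<le> 4 * (d / r\<^sup>2) * dist x y + 4 * (d / r\<^sup>2) * dist x y + (d / r\<^sup>2 * dist x y + d / r\<^sup>2 * dist x y)"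
 proof (intro add_mono)
  have dd: "(dist x x0)\<^sup>2 \<le> d" "(dist y x0)\<^sup>2 \<le> d" "d * d \<le> d"
  proof -
   have "(dist x x0)\<^sup>2 \<le> d * d" "(dist y x0)\<^sup>2 \<le> d * d" unfolding power2_eq_square using d d0 by (auto intro!: mult_mono)
   moreover show "d * d \<le> d" using d d0 by (simp add: mult_left_le)
   ultimately show "(dist x x0)\<^sup>2 \<le> d" "(dist y x0)\<^sup>2 \<le> d" by auto
  qed
  have ddr: "d \<le> d / r\<^sup>2" using d0 r2 by (simp add: pos_le_divide_eq mult_left_le)
  have "\<bar>bsq x - 1\<bar> \<le> 2 * (d / r\<^sup>2)"
  proof -
   have "bsq x \<le> 1" using bump_bounds(1,2)[of x] by (simp add: power_le_one)
   moreover have "(dist x x0)\<^sup>2 / r\<^sup>2 \<le> d / r\<^sup>2" using dd r2 by (intro divide_right_mono) auto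
   ultimately show ?thesis using bump_square_lower[of x] by linarith
  qed
  then have "\<bar>bsq x - 1\<bar> * norm (RY x - RY y) \<le> 2 * (d / r\<^sup>2) * (2 * dist x y)"
   using radial_field_lipschitz[OF x y] d0 r2 by (intro mult_mono) auto
  then show "norm ((bsq x - 1) *\<^sub>R (RY x - RY y)) \<le> 4 * (d / r\<^sup>2) * dist x y" by simp
  have "\<bar>bsq x - bsq y\<bar> * norm (RY y) \<le> (2 * (d + d) * dist x y / r\<^sup>2) * 1"
  proof (rule mult_mono)
   have "2 * (dist x x0 + dist y x0) * dist x y / r\<^sup>2 \<le> 2 * (d + d) * dist x y / r\<^sup>2"
    using d by (intro divide_right_mono mult_right_mono mult_left_mono add_mono) auto
   then show "\<bar>bsq x - bsq y\<bar> \<le> 2 * (d + d) * dist x y / r\<^sup>2"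
    using bump_square_diff[OF refl, of x y] by linarith
   show "norm (RY y) \<le> 1" using radial_product(2)[OF y] d by linarith
  qed (use d0 r2 in auto)
  then show "norm ((bsq x - bsq y) *\<^sub>R RY y) \<le> 4 * (d / r\<^sup>2) * dist x y" by simp
  have "\<bar>x0 \<bullet> x - 1\<bar> \<le> d / r\<^sup>2" unfolding tx using dd(1) ddr zero_le_power2[of "dist x x0"] by linarith
  then show "norm ((x0 \<bullet> x - 1) *\<^sub>R (x - y)) \<le> d / r\<^sup>2 * dist x y"
   by (simp only: norm_scaleR dist_norm real_norm_def, intro mult_right_mono) auto
  have "x0 \<bullet> (x - y) = ((dist y x0)\<^sup>2 - (dist x x0)\<^sup>2) / 2"
   unfolding inner_diff_right tx ty by (simp add: algebra_simps)
  also have "... = (dist y x0 - dist x x0) * ((dist y x0 + dist x x0) / 2)"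
   by (simp add: power2_eq_square algebra_simps)
  finally have "\<bar>x0 \<bullet> (x - y)\<bar> = \<bar>dist y x0 - dist x x0\<bar> * \<bar>(dist y x0 + dist x x0) / 2\<bar>"
   by (simp only: abs_mult)
  also have "\<bar>(dist y x0 + dist x x0) / 2\<bar> = (dist y x0 + dist x x0) / 2" by simp
  finally have "\<bar>x0 \<bullet> (x - y)\<bar> = \<bar>dist y x0 - dist x x0\<bar> * ((dist y x0 + dist x x0) / 2)" .
  also have "... \<le> dist x y * d"
   using abs_dist_diff_le[of y x0 x] d by (intro mult_mono) (auto simp: dist_commute)
  also have "... = d * dist x y" by (rule mult.commute)
  also have "... \<le> d / r\<^sup>2 * dist x y" by (rule mult_right_mono[OF ddr]) simp
  finally show "norm ((x0 \<bullet> (x - y)) *\<^sub>R y) \<le> d / r\<^sup>2 * dist x y" using y by simp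
 qed
 also have "... = 10 * ((d / r\<^sup>2) * dist x y)" by (simp add: algebra_simps)
 also have "... \<le> 12 * ((d / r\<^sup>2) * dist x y)" using d0 r2 by (intro mult_right_mono) auto
 also have "... = 12 * (d / r\<^sup>2) * dist x y" by (rule mult.assoc[symmetric])
 finally show ?thesis .
qed

text \<open>The sum of the singular force kernels for the pairs (x, y) and (y, x). The differences
  of the field and of the points compensate the denominator, and on the diagonal the value is
  0.\<close>

definition bump_kernel :: "real^3 \<Rightarrow> real^3 \<Rightarrow> real" where
 "bump_kernel x y = ((BX x - BX y) \<bullet> (x - y)) / (dist x y)\<^sup>2"

lemma bump_kernel_bounds:
 assumes x: "x \<in> S2" and y: "y \<in> S2"
 shows "\<bar>bump_kernel x y\<bar> \<le> 8"
  and "x \<noteq> y \<Longrightarrow> dist x x0 \<le> d \<Longrightarrow> dist y x0 \<le> d \<Longrightarrow> d \<le> 1 \<Longrightarrow> \<bar>bump_kernel x y - 1\<bar> \<le> 12 * (d / r\<^sup>2)"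
  and "dist x x0 \<ge> r \<Longrightarrow> dist y x0 \<ge> r \<Longrightarrow> bump_kernel x y = 0"
  and "dist x x0 \<le> d \<Longrightarrow> dist y x0 \<ge> r \<Longrightarrow> 2 * d \<le> r \<Longrightarrow> \<bar>bump_kernel x y\<bar> \<le> 2 * d / r"
proof -
 have cs: "\<bar>(v \<bullet> (x - y)) / (dist x y)\<^sup>2\<bar> \<le> c" if "norm v \<le> c * dist x y" "x \<noteq> y" for v c
 proof -
  have dp: "dist x y > 0" using that by simp
  have "\<bar>v \<bullet> (x - y)\<bar> \<le> norm v * norm (x - y)" by (rule Cauchy_Schwarz_ineq2)
  also have "... \<le> (c * dist x y) * dist x y" using that by (simp add: dist_norm mult_right_mono)
  finally show ?thesis using dp by (simp add: pos_divide_le_eq power2_eq_square mult.assoc)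
 qed
 show "\<bar>bump_kernel x y\<bar> \<le> 8"
 proof (cases "x = y")
  case False then show ?thesis unfolding bump_kernel_def by (rule cs[OF bump_field_lipschitz[OF x y]])
 qed (simp add: bump_kernel_def)
 show "\<bar>bump_kernel x y - 1\<bar> \<le> 12 * (d / r\<^sup>2)" if "x \<noteq> y" "dist x x0 \<le> d" "dist y x0 \<le> d" "d \<le> 1"
 proof -
  have "(x - y) \<bullet> (x - y) / (dist x y)\<^sup>2 = 1" using that by (simp add: dist_norm power2_norm_eq_inner)
  then have "bump_kernel x y - 1 = (((BX x - BX y) - (x - y)) \<bullet> (x - y)) / (dist x y)\<^sup>2"
   unfolding bump_kernel_def inner_diff_left[of _ "x - y"] diff_divide_distrib by simp
  then show ?thesis using cs[OF bump_field_near_dilation[OF x y that(2,3,4)] that(1)] by simp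
 qed
 show "dist x x0 \<ge> r \<Longrightarrow> dist y x0 \<ge> r \<Longrightarrow> bump_kernel x y = 0"
  using norm_bump_field_le(2)[OF x] norm_bump_field_le(2)[OF y] by (simp add: bump_kernel_def)
 show "\<bar>bump_kernel x y\<bar> \<le> 2 * d / r" if "dist x x0 \<le> d" "dist y x0 \<ge> r" "2 * d \<le> r"
 proof -
  have dxy: "dist x y \<ge> r / 2" using that dist_triangle[of y x0 x] by (simp add: dist_commute)
  then have ne: "x \<noteq> y" using r by auto
  have d0: "d \<ge> 0" using that(1) by (meson zero_le_dist order_trans)
  have "norm (BX x - BX y) \<le> d"
   using norm_bump_field_le(1)[OF x] norm_bump_field_le(2)[OF y that(2)] that(1) by simp
  also have "d \<le> 2 * d / r * dist x y"
   using mult_left_mono[OF dxy, of "2 * d / r"] d0 r by simp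
  finally show ?thesis unfolding bump_kernel_def by (rule cs[OF _ ne])
 qed
qed

end

subsection \<open>The virial identity\<close>

lemma has_derivative_quadratic_remainder:
 fixes F :: "'a::real_normed_vector \<Rightarrow> real"
 assumes bl: "bounded_linear F'" and \<delta>: "\<delta> > 0"
  and rem: "\<And>v. norm v < \<delta> \<Longrightarrow> \<bar>F (x + v) - F x - F' v\<bar> \<le> C * (norm v)\<^sup>2"
 shows "(F has_derivative F') (at x)"
 unfolding has_derivative_at
proof (intro conjI bl)
 show "(\<lambda>h. norm (F (x + h) - F x - F' h) / norm h) \<midarrow>0\<rightarrow> 0"
 proof (rule Lim_null_comparison[where g="\<lambda>h. C * norm h"])
  show "\<forall>\<^sub>F h in at 0. norm (norm (F (x + h) - F x - F' h) / norm h) \<le> C * norm h"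
   unfolding eventually_at
  proof (intro exI[of _ \<delta>] conjI \<delta> ballI impI)
   fix h :: 'a assume h: "h \<noteq> 0 \<and> dist h 0 < \<delta>"
   then have "\<bar>F (x + h) - F x - F' h\<bar> \<le> C * (norm h)\<^sup>2" by (intro rem) simp
   then show "norm (norm (F (x + h) - F x - F' h) / norm h) \<le> C * norm h"
    using h by (simp add: pos_divide_le_eq power2_eq_square mult.assoc)
  qed
  show "((\<lambda>h. C * norm h) \<longlongrightarrow> 0) (at 0)" by (intro tendsto_eq_intros) auto
 qed
qed

text \<open>If c is the relative increment of \<open>(dist x y)\<^sup>2 + e\<^sup>2\<close>, then
  |c| is at most \<open>5 * norm v / e\<^sup>2\<close>, hence at most 1 / 2, and ln (1 + c) - c is
  quadratic in c. The first constant comes from c^2, the second from the quadratic part of the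
  increment. Uniformity in \<open>y\<close> permits differentiation under the integral.\<close>

lemma log_reg_taylor:
 assumes x: "x \<in> S2" and y: "y \<in> S2" and e: "0 < e" "e \<le> 1" and v: "norm v < e\<^sup>2 / 10"
 shows "\<bar>log_reg e y (x + v) - log_reg e y x - log_reg_deriv e y x v\<bar> \<le> (25 / e ^ 4 + 1 / (2 * e\<^sup>2)) * (norm v)\<^sup>2"
proof -
 define q where "q = (dist x y)\<^sup>2 + e\<^sup>2"
 define c where "c = (2 * ((x - y) \<bullet> v) + (norm v)\<^sup>2) / q"
 have e2: "0 < e\<^sup>2" "e\<^sup>2 \<le> 1" using e by (auto simp: power_le_one)
 have q: "q \<ge> e\<^sup>2" "q > 0" using e2 by (auto simp: q_def add_nonneg_pos)
 have v1: "norm v \<le> 1" using v e2 by linarith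
 have "\<bar>2 * ((x - y) \<bullet> v) + (norm v)\<^sup>2\<bar> \<le> 5 * norm v"
 proof -
  have "\<bar>(x - y) \<bullet> v\<bar> \<le> dist x y * norm v" using Cauchy_Schwarz_ineq2[of "x - y" v] by (simp add: dist_norm)
  also have "... \<le> 2 * norm v" using dist_S2(3)[OF x y] by (intro mult_right_mono) auto
  finally have "\<bar>(x - y) \<bullet> v\<bar> \<le> 2 * norm v" .
  moreover have "(norm v)\<^sup>2 \<le> norm v" using v1 by (simp add: power2_eq_square mult_left_le)
  ultimately show ?thesis using zero_le_power2[of "norm v"] by linarith
 qed
 then have "\<bar>c\<bar> \<le> 5 * norm v / q" unfolding c_def abs_divide using q by (simp add: divide_right_mono)
 also have "... \<le> 5 * norm v / e\<^sup>2" by (intro divide_left_mono mult_pos_pos q e2) simp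
 finally have c: "\<bar>c\<bar> \<le> 5 * norm v / e\<^sup>2" .
 also have "... \<le> 1 / 2" using v e2 by (simp add: pos_divide_le_eq)
 finally have c2: "\<bar>c\<bar> \<le> 1 / 2" .
 have "(dist (x + v) y)\<^sup>2 = (x - y + v) \<bullet> (x - y + v)" by (simp add: dist_norm power2_norm_eq_inner algebra_simps)
 also have "... = (dist x y)\<^sup>2 + 2 * ((x - y) \<bullet> v) + (norm v)\<^sup>2"
  by (simp add: dist_norm power2_norm_eq_inner inner_simps inner_commute)
 finally have "(dist (x + v) y)\<^sup>2 + e\<^sup>2 = q + (2 * ((x - y) \<bullet> v) + (norm v)\<^sup>2)" by (simp add: q_def)
 also have "2 * ((x - y) \<bullet> v) + (norm v)\<^sup>2 = q * c" using q(2) by (simp add: c_def)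
 also have "q + q * c = q * (1 + c)" by (simp add: distrib_left)
 finally have "(dist (x + v) y)\<^sup>2 + e\<^sup>2 = q * (1 + c)" .
 moreover have "1 + c > 0" using c2 by linarith
 ultimately have "log_reg e y (x + v) = ln q / 2 + ln (1 + c) / 2"
  using q by (simp add: log_reg_def ln_mult add_divide_distrib)
 then have "log_reg e y (x + v) - log_reg e y x - log_reg_deriv e y x v = (ln (1 + c) - c) / 2 + (norm v)\<^sup>2 / (2 * q)"
  by (simp add: log_reg_def log_reg_deriv_def q_def[symmetric] c_def add_divide_distrib diff_divide_distrib)
 moreover have "\<bar>ln (1 + c) - c\<bar> \<le> 2 * c\<^sup>2" using c2 by (rule abs_ln_one_plus_x_minus_x_bound)
 moreover have "(norm v)\<^sup>2 / (2 * q) \<le> (norm v)\<^sup>2 / (2 * e\<^sup>2)" using q(1) mult_pos_pos[OF q(2) e2(1)] by (intro divide_left_mono) (auto simp: mult_ac)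
 moreover have "0 \<le> (norm v)\<^sup>2 / (2 * q)" using q by simp
 moreover have "c\<^sup>2 \<le> 25 / e ^ 4 * (norm v)\<^sup>2"
 proof -
  have "c\<^sup>2 \<le> (5 * norm v / e\<^sup>2)\<^sup>2" using power_mono[OF c, of 2] by simp
  then show ?thesis by (simp add: power_divide power_mult_distrib)
 qed
 moreover have "\<bar>A\<bar> \<le> 2 * B \<Longrightarrow> t \<le> T \<Longrightarrow> 0 \<le> t \<Longrightarrow> B \<le> U \<Longrightarrow> \<bar>A / 2 + t\<bar> \<le> U + T" for A B t T U :: real
  by linarith
 ultimately have "\<bar>log_reg e y (x + v) - log_reg e y x - log_reg_deriv e y x v\<bar>
   \<le> 25 / e ^ 4 * (norm v)\<^sup>2 + (norm v)\<^sup>2 / (2 * e\<^sup>2)" by metis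
 then show ?thesis by (simp add: distrib_right)
qed

lemma abs_log_reg_deriv_le_const:
 assumes "x \<in> S2" "y \<in> S2" "e > 0"
 shows "\<bar>log_reg_deriv e y x v\<bar> \<le> 2 / e\<^sup>2 * norm v"
proof -
 have q: "e\<^sup>2 \<le> (dist x y)\<^sup>2 + e\<^sup>2" "e\<^sup>2 > 0" using assms(3) by auto
 have "\<bar>(x - y) \<bullet> v\<bar> \<le> 2 * norm v"
  using Cauchy_Schwarz_ineq2[of "x - y" v] mult_right_mono[OF dist_S2(3)[OF assms(1,2)], of "norm v"]
  by (simp add: dist_norm)
 then have "\<bar>log_reg_deriv e y x v\<bar> \<le> (2 * norm v) / e\<^sup>2"
  unfolding log_reg_deriv_def abs_divide using q by (intro frac_le) auto
 then show ?thesis by simp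
qed

lemma abs_log_reg_le_const:
 assumes "x \<in> S2" "y \<in> S2" "0 < e" "e \<le> 1"
 shows "\<bar>log_reg e y x\<bar> \<le> 1 - ln e"
proof -
 have "ln (e\<^sup>2) / 2 \<le> log_reg e y x" unfolding log_reg_def using assms(3)
  by (intro divide_right_mono ln_mono) auto
 then have "ln e \<le> log_reg e y x" using assms(3) by (simp add: ln_realpow)
 moreover have "ln e \<le> 0" using assms by simp
 ultimately show ?thesis using log_reg_upper[OF assms] by linarith
qed

lemma measurable_log_reg_right [measurable]: "(\<lambda>y. log_reg e y x) \<in> borel_measurable area_S2"
 unfolding log_reg_def by (rule measurable_area1) measurable

lemma measurable_log_reg_deriv_right [measurable]: "(\<lambda>y. log_reg_deriv e y x v) \<in> borel_measurable area_S2"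
 unfolding log_reg_deriv_def by (rule measurable_area1) measurable

lemma C1_near_regularised_potential:
 assumes f: "integrable area_S2 f" and e: "0 < e" "e \<le> 1"
 shows "C1_near_S2 (\<lambda>x. \<ointegral>y. f y * log_reg e y x) (\<lambda>x v. \<ointegral>y. f y * log_reg_deriv e y x v)"
 unfolding C1_near_S2_def
proof (intro conjI ballI allI)
 have fm [measurable]: "f \<in> borel_measurable area_S2" using f by auto
 have di: "integrable area_S2 (\<lambda>y. f y * log_reg_deriv e y x v)" if "x \<in> S2" for x v
  by (rule integrable_times_bounded[OF f]) (use abs_log_reg_deriv_le_const[OF that _ e(1)] in auto)
 define M where "M = (\<ointegral>y. \<bar>f y\<bar>)"
 show "((\<lambda>x. \<ointegral>y. f y * log_reg e y x) has_derivative (\<lambda>v. \<ointegral>y. f y * log_reg_deriv e y x v)) (at x)"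
  if x: "x \<in> S2" for x
 proof (rule has_derivative_quadratic_remainder)
  show "bounded_linear (\<lambda>v. \<ointegral>y. f y * log_reg_deriv e y x v)"
  proof (rule bounded_linear_intro[where K="M * (2 / e\<^sup>2)"])
   fix v w :: "real^3" and c :: real
   have "(\<ointegral>y. f y * log_reg_deriv e y x (v + w))
     = (\<ointegral>y. f y * log_reg_deriv e y x v + f y * log_reg_deriv e y x w)"
    by (simp add: log_reg_deriv_def inner_add_right add_divide_distrib distrib_left)
   then show "(\<ointegral>y. f y * log_reg_deriv e y x (v + w))
     = (\<ointegral>y. f y * log_reg_deriv e y x v) + (\<ointegral>y. f y * log_reg_deriv e y x w)"
    using di[OF x] by simp
   have "(\<ointegral>y. f y * log_reg_deriv e y x (c *\<^sub>R v)) = (\<ointegral>y. c * (f y * log_reg_deriv e y x v))"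
    by (simp add: log_reg_deriv_def mult_ac)
   then show "(\<ointegral>y. f y * log_reg_deriv e y x (c *\<^sub>R v)) = c *\<^sub>R (\<ointegral>y. f y * log_reg_deriv e y x v)"
    by simp
   have "\<bar>(\<ointegral>y. f y * log_reg_deriv e y x v)\<bar> \<le> (\<ointegral>y. \<bar>f y * log_reg_deriv e y x v\<bar>)"
    by (rule integral_abs_bound)
   also have "... \<le> (\<ointegral>y. \<bar>f y\<bar> * (2 / e\<^sup>2 * norm v))"
   proof (rule integral_mono)
    show "\<bar>f y * log_reg_deriv e y x v\<bar> \<le> \<bar>f y\<bar> * (2 / e\<^sup>2 * norm v)" if "y \<in> space area_S2" for y
     unfolding abs_mult using abs_log_reg_deriv_le_const[OF x _ e(1), of y v] that by (intro mult_left_mono) auto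
   qed (use di[OF x, of v] f in auto)
   also have "... = norm v * (M * (2 / e\<^sup>2))" by (simp add: M_def)
   finally show "norm (\<ointegral>y. f y * log_reg_deriv e y x v) \<le> norm v * (M * (2 / e\<^sup>2))" by simp
  qed
  show "e\<^sup>2 / 10 > 0" using e by simp
  fix v :: "real^3" assume v: "norm v < e\<^sup>2 / 10"
  let ?C = "25 / e ^ 4 + 1 / (2 * e\<^sup>2)"
  let ?R = "\<lambda>y. log_reg e y (x + v) - log_reg e y x - log_reg_deriv e y x v"
  have i1: "integrable area_S2 (\<lambda>y. f y * log_reg e y x)"
   by (rule integrable_times_bounded[OF f _ abs_log_reg_le_const[OF x _ e]]) auto
  have iR: "integrable area_S2 (\<lambda>y. f y * ?R y)"
   by (rule integrable_times_bounded[OF f _ log_reg_taylor[OF x _ e v]]) auto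
  have "integrable area_S2 (\<lambda>y. f y * ?R y + f y * log_reg e y x + f y * log_reg_deriv e y x v)"
   using i1 iR di[OF x, of v] by simp
  then have i2: "integrable area_S2 (\<lambda>y. f y * log_reg e y (x + v))" by (simp add: algebra_simps)
  have "(\<ointegral>y. f y * log_reg e y (x + v)) - (\<ointegral>y. f y * log_reg e y x) - (\<ointegral>y. f y * log_reg_deriv e y x v)
    = (\<ointegral>y. f y * ?R y)"
   using i1 i2 di[OF x, of v] by (simp add: right_diff_distrib)
  also have "\<bar>...\<bar> \<le> (\<ointegral>y. \<bar>f y * ?R y\<bar>)" by (rule integral_abs_bound)
  also have "... \<le> (\<ointegral>y. \<bar>f y\<bar> * (?C * (norm v)\<^sup>2))"
  proof (rule integral_mono)
   show "\<bar>f y * ?R y\<bar> \<le> \<bar>f y\<bar> * (?C * (norm v)\<^sup>2)" if "y \<in> space area_S2" for y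
    unfolding abs_mult using log_reg_taylor[OF x _ e v, of y] that by (intro mult_left_mono) auto
  qed (use iR f in auto)
  also have "... = M * ?C * (norm v)\<^sup>2" by (simp add: M_def)
  finally show "\<bar>(\<ointegral>y. f y * log_reg e y (x + v)) - (\<ointegral>y. f y * log_reg e y x)
    - (\<ointegral>y. f y * log_reg_deriv e y x v)\<bar> \<le> M * ?C * (norm v)\<^sup>2" .
 qed
 show "continuous_on S2 (\<lambda>x. \<ointegral>y. f y * log_reg_deriv e y x v)" for v
 proof (rule continuous_on_sequentiallyI)
  fix u :: "nat \<Rightarrow> real^3" and a assume u: "\<forall>n. u n \<in> S2" "a \<in> S2" "u \<longlonglongrightarrow> a"
  show "(\<lambda>n. \<ointegral>y. f y * log_reg_deriv e y (u n) v) \<longlonglongrightarrow> (\<ointegral>y. f y * log_reg_deriv e y a v)"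
  proof (rule integral_dominated_convergence[where w="\<lambda>y. \<bar>f y\<bar> * (2 / e\<^sup>2 * norm v)"])
   show "AE y in area_S2. (\<lambda>n. f y * log_reg_deriv e y (u n) v) \<longlonglongrightarrow> f y * log_reg_deriv e y a v"
   proof (rule AE_I2)
    fix y
    have "(dist a y)\<^sup>2 + e\<^sup>2 \<noteq> 0" using e by (metis add_nonneg_pos less_irrefl zero_le_power2 zero_less_power)
    then show "(\<lambda>n. f y * log_reg_deriv e y (u n) v) \<longlonglongrightarrow> f y * log_reg_deriv e y a v"
     unfolding log_reg_deriv_def by (intro tendsto_intros u(3))
   qed
   show "AE y in area_S2. norm (f y * log_reg_deriv e y (u n) v) \<le> \<bar>f y\<bar> * (2 / e\<^sup>2 * norm v)" for n
    using abs_log_reg_deriv_le_const[OF _ _ e(1)] u(1)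
    by (intro AE_I2) (auto simp only: real_norm_def abs_mult space_area intro!: mult_left_mono)
  qed (use f in auto)
 qed
qed

lemma integrable_product_area:
 fixes f g :: "real^3 \<Rightarrow> real"
 assumes "integrable area_S2 g" "integrable area_S2 f"
 shows "integrable (area_S2 \<Otimes>\<^sub>M area_S2) (\<lambda>(x, y). g x * f y)"
proof -
 have [measurable]: "f \<in> borel_measurable area_S2" "g \<in> borel_measurable area_S2" using assms by auto
 show ?thesis
  by (rule area2.Fubini_integrable) (use assms in \<open>auto simp: abs_mult\<close>)
qed

context
 fixes p :: "'m::finite \<Rightarrow> real^3" and K :: "real^3 \<Rightarrow> real" and b :: "real^'m" and \<kappa> :: real
  and f :: "real^3 \<Rightarrow> real" and x0 :: "real^3" and r :: real
 assumes p: "inj p" "range p \<subseteq> S2" and K: "K \<in> C1_pos_S2" and b: "\<And>i. b $ i > -1"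
  and pf: "potential_form p K b \<kappa> f"
  and x0: "x0 \<in> S2" and r: "0 < r" "r \<le> 1" "\<And>i. p i \<noteq> x0 \<Longrightarrow> 2 * r \<le> dist (p i) x0"
begin

abbreviation (input) "X \<equiv> bump_field x0 r"

text \<open>The divergence of \<open>X\<close> plus the logarithmic derivative along
  \<open>X\<close> of \<open>K\<close> times the conic weight, with each logarithm regularised by
  \<open>e\<close>; at \<open>e = 0\<close> the weight is the actual one.\<close>

definition virial_density :: "real \<Rightarrow> real^3 \<Rightarrow> real" where
 "virial_density e x = tangential_trace (bump_field_deriv x0 r) x + grad_S2 K x \<bullet> X x / K x
   + 2 * (\<Sum>i\<in>UNIV. b $ i * log_reg_deriv e (p i) x (X x))"

definition reg_pot :: "real \<Rightarrow> real^3 \<Rightarrow> real" where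
 "reg_pot e x = (ln 2 * (\<ointegral>y. f y) - (\<ointegral>y. f y * log_reg e y x)) / (2 * pi)"

text \<open>A regularisation of \<open>f / \<kappa>\<close>. Composing \<open>K\<close> with
  \<open>sgn\<close> gives the extension off the sphere whose derivative along tangent vectors is
  the pairing with \<open>grad_S2 K\<close>.\<close>

definition reg_weight :: "real \<Rightarrow> real^3 \<Rightarrow> real" where
 "reg_weight e x = K (sgn x) * exp (2 * (\<Sum>i\<in>UNIV. b $ i * log_reg e (p i) x) + 2 * reg_pot e x)"

definition force :: "real \<Rightarrow> real^3 \<Rightarrow> real" where
 "force e x = (\<ointegral>y. f y * log_reg_deriv e y x (X x))"

lemma pS: "p i \<in> S2" using p(2) by (meson rangeI subsetD)
lemma Kpos: "x \<in> S2 \<Longrightarrow> K x > 0" using K by (simp add: C1_pos_S2_def)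
lemma KC1: "K \<in> C1_S2" using K by (simp add: C1_pos_S2_def)
lemma fi: "integrable area_S2 f" using pf by (simp add: potential_form_def)
lemma fm [measurable]: "f \<in> borel_measurable area_S2" using fi by auto
lemma f0: "x \<in> S2 \<Longrightarrow> f x \<ge> 0" by (rule potential_form_nonneg[OF pf Kpos])
lemma \<kappa>0: "\<kappa> > 0" using pf by (simp add: potential_form_def)
lemma KCk: "Ck_S2 1 K" using KC1 by (simp add: C1_S2_def)
lemma cX: "continuous_on S2 X" by (rule C1_near_S2_continuous[OF C1_near_bump_field])

lemma integrable_f_ln:
 assumes x: "x \<in> S2" shows "integrable area_S2 (\<lambda>y. f y * ln (dist x y))"
proof -
 have "integrable area_S2 (\<lambda>y. f y * log_pot_kernel x y)"
  using potential_form_log_pot_bounded[OF p K b pf] x by blast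
 then have i: "integrable area_S2 (\<lambda>y. ln 2 * f y - f y * log_pot_kernel x y)" using fi by simp
 have "(\<lambda>y. ln (dist x y)) \<in> borel_measurable area_S2" by (rule measurable_area1) measurable
 then have m: "(\<lambda>y. f y * ln (dist x y)) \<in> borel_measurable area_S2" by measurable
 have "AE y in area_S2. ln 2 * f y - f y * log_pot_kernel x y = f y * ln (dist x y)"
  using AE_area_neq[of x] by eventually_elim (simp add: log_pot_kernel_ln algebra_simps)
 from integrable_cong_AE[OF borel_measurable_integrable[OF i] m this] i show ?thesis by simp
qed

lemma integrable_f_log_reg:
 assumes "x \<in> S2" "0 < e" "e \<le> 1" shows "integrable area_S2 (\<lambda>y. f y * log_reg e y x)"
 by (rule integrable_times_bounded[OF fi _ abs_log_reg_le_const[OF assms(1) _ assms(2,3)]]) auto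

lemma reg_pot_eq:
 assumes "x \<in> S2" "0 < e" "e \<le> 1"
 shows "reg_pot e x = (\<ointegral>y. f y * (ln 2 - log_reg e y x)) / (2 * pi)"
proof -
 have "(\<ointegral>y. f y * (ln 2 - log_reg e y x)) = (\<ointegral>y. ln 2 * f y - f y * log_reg e y x)"
  by (simp add: algebra_simps)
 also have "... = ln 2 * (\<ointegral>y. f y) - (\<ointegral>y. f y * log_reg e y x)"
  using fi integrable_f_log_reg[OF assms] by simp
 finally show ?thesis by (simp add: reg_pot_def)
qed

text \<open>Regularising raises the logarithm and so lowers the potential; the bound on
  \<open>log_pot f\<close> therefore holds for all \<open>reg_pot e\<close> at once.\<close>

lemma reg_pot_le:
 assumes x: "x \<in> S2" and e: "0 < e" "e \<le> 1"
 shows "reg_pot e x \<le> log_pot f x"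
proof -
 have "(\<ointegral>y. f y * (ln 2 - log_reg e y x)) \<le> (\<ointegral>y. f y * log_pot_kernel x y)"
 proof (rule integral_mono_AE)
  have "integrable area_S2 (\<lambda>y. ln 2 * f y - f y * log_reg e y x)" using fi integrable_f_log_reg[OF assms] by simp
  then show "integrable area_S2 (\<lambda>y. f y * (ln 2 - log_reg e y x))" by (simp add: algebra_simps)
  show "integrable area_S2 (\<lambda>y. f y * log_pot_kernel x y)"
   using potential_form_log_pot_bounded[OF p K b pf] x by blast
  show "AE y in area_S2. f y * (ln 2 - log_reg e y x) \<le> f y * log_pot_kernel x y"
   using AE_area_neq[of x] AE_space
   by eventually_elim (auto simp: log_pot_kernel_ln intro!: mult_left_mono f0 log_reg_lower)
 qed
 then show ?thesis unfolding reg_pot_eq[OF assms] log_pot_def by (simp add: divide_right_mono)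
qed

lemma reg_pot_tendsto:
 assumes x: "x \<in> S2"
 shows "(\<lambda>n. reg_pot (inverse (real (Suc n))) x) \<longlonglongrightarrow> log_pot f x"
 unfolding reg_pot_eq[OF x null_seq_inverse_Suc(2,3)] log_pot_def
proof (intro tendsto_divide tendsto_const)
 let ?e = "\<lambda>n. inverse (real (Suc n))"
 show "(\<lambda>n. \<ointegral>y. f y * (ln 2 - log_reg (?e n) y x)) \<longlonglongrightarrow> (\<ointegral>y. f y * log_pot_kernel x y)"
 proof (rule integral_dominated_convergence[where w="\<lambda>y. f y * \<bar>ln (dist x y)\<bar> + 2 * f y"])
  have "integrable area_S2 (\<lambda>y. \<bar>f y * ln (dist x y)\<bar> + 2 * f y)" using integrable_f_ln[OF x] fi by simp
  then show "integrable area_S2 (\<lambda>y. f y * \<bar>ln (dist x y)\<bar> + 2 * f y)"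
   by (rule Bochner_Integration.integrable_cong[THEN iffD1, OF refl, rotated]) (use f0 in \<open>auto simp: abs_mult\<close>)
  show "AE y in area_S2. (\<lambda>n. f y * (ln 2 - log_reg (?e n) y x)) \<longlonglongrightarrow> f y * log_pot_kernel x y"
   using AE_area_neq[of x]
  proof eventually_elim
   case (elim y)
   then show ?case unfolding log_pot_kernel_ln[OF elim[symmetric]]
    by (intro tendsto_intros tendsto_log_reg null_seq_inverse_Suc) auto
  qed
  show "AE y in area_S2. norm (f y * (ln 2 - log_reg (?e n) y x)) \<le> f y * \<bar>ln (dist x y)\<bar> + 2 * f y" for n
   using AE_area_neq[of x] AE_space
  proof eventually_elim
   case (elim y)
   then have y: "y \<in> S2" "x \<noteq> y" by auto
   have "\<bar>ln 2 - log_reg (?e n) y x\<bar> \<le> \<bar>ln (dist x y)\<bar> + 2"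
    using abs_log_reg_le[OF x y null_seq_inverse_Suc(2,3), of n] ln_2_less_1 ln_gt_zero[of 2] by linarith
   from mult_left_mono[OF this f0[OF y(1)]] show ?case using f0[OF y(1)] by (simp add: abs_mult distrib_left)
  qed
 qed measurable
qed simp

lemma C1_near_reg_weight:
 assumes e: "0 < e" "e \<le> 1"
 defines "E \<equiv> \<lambda>x. exp (2 * (\<Sum>i\<in>UNIV. b $ i * log_reg e (p i) x) + 2 * reg_pot e x)"
 shows "C1_near_S2 (reg_weight e) (\<lambda>x v. frechet_derivative (K \<circ> sgn) (at x) v * E x
   + K (sgn x) * (E x * (2 * (\<Sum>i\<in>UNIV. b $ i * log_reg_deriv e (p i) x v)
    - (\<ointegral>y. f y * log_reg_deriv e y x v) / pi)))" (is "C1_near_S2 _ ?S")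
proof -
 have CK: "C1_near_S2 (K \<circ> sgn) (\<lambda>x. frechet_derivative (K \<circ> sgn) (at x))" by (rule Ck_S2_1_C1_near[OF KCk])
 note CR = C1_near_regularised_potential[OF fi e]
 note CL = C1_near_log_reg[OF e(1)]
 have dR: "(reg_pot e has_derivative (\<lambda>v. - (\<ointegral>y. f y * log_reg_deriv e y x v) / (2 * pi))) (at x)"
  if "x \<in> S2" for x
 proof -
  have 1: "((\<lambda>x. \<ointegral>y. f y * log_reg e y x) has_derivative (\<lambda>v. \<ointegral>y. f y * log_reg_deriv e y x v)) (at x)"
   using CR that by (simp add: C1_near_S2_def)
  show ?thesis unfolding reg_pot_def[abs_def] divide_inverse
   by (rule derivative_eq_intros 1 refl)+ simp
 qed
 have dL: "((\<lambda>x. \<Sum>i\<in>UNIV. b $ i * log_reg e (p i) x) has_derivative (\<lambda>v. \<Sum>i\<in>UNIV. b $ i * log_reg_deriv e (p i) x v)) (at x)" for x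
  by (intro has_derivative_sum has_derivative_mult_right has_derivative_log_reg e)
 have dE: "(E has_derivative (\<lambda>v. E x * (2 * (\<Sum>i\<in>UNIV. b $ i * log_reg_deriv e (p i) x v)
    - (\<ointegral>y. f y * log_reg_deriv e y x v) / pi))) (at x)" if "x \<in> S2" for x
 proof -
  have "((\<lambda>x. 2 * (\<Sum>i\<in>UNIV. b $ i * log_reg e (p i) x) + 2 * reg_pot e x) has_derivative
   (\<lambda>v. 2 * (\<Sum>i\<in>UNIV. b $ i * log_reg_deriv e (p i) x v) + 2 * (- (\<ointegral>y. f y * log_reg_deriv e y x v) / (2 * pi)))) (at x)"
   by (intro has_derivative_add has_derivative_mult_right dL dR that)
  from has_derivative_exp[OF this] show ?thesis unfolding E_def by (simp add: algebra_simps)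
 qed
 have cR: "continuous_on S2 (reg_pot e)"
  using dR by (meson continuous_at_imp_continuous_on has_derivative_continuous)
 have cL: "continuous_on S2 (log_reg e y)" for y by (rule C1_near_S2_continuous[OF CL])
 have cE: "continuous_on S2 E" unfolding E_def by (intro continuous_intros cL cR)
 have cK: "continuous_on S2 (\<lambda>x. K (sgn x))"
  using C1_near_S2_continuous[OF CK] by (simp add: o_def)
 show ?thesis unfolding C1_near_S2_def
 proof (intro conjI ballI allI)
  fix x assume x: "x \<in> S2"
  have "((K \<circ> sgn) has_derivative frechet_derivative (K \<circ> sgn) (at x)) (at x)"
   using CK x by (simp add: C1_near_S2_def del: o_apply)
  from has_derivative_mult[OF this dE[OF x]]
  show "(reg_weight e has_derivative ?S x) (at x)"
   by (simp add: reg_weight_def[abs_def] E_def add.commute)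
 next
  fix v
  have "continuous_on S2 (\<lambda>x. frechet_derivative (K \<circ> sgn) (at x) v)"
   "continuous_on S2 (\<lambda>x. log_reg_deriv e y x v)"
   "continuous_on S2 (\<lambda>x. \<ointegral>y. f y * log_reg_deriv e y x v)" for y
   using CK CL CR by (auto simp: C1_near_S2_def simp del: o_apply)
  then show "continuous_on S2 (\<lambda>x. ?S x v)"
   by (intro continuous_intros cE cK) auto
 qed
qed

lemma reg_weight_eq:
 assumes "x \<in> S2"
 shows "reg_weight e x = K x * exp (2 * (\<Sum>i\<in>UNIV. b $ i * log_reg e (p i) x)) * exp (2 * reg_pot e x)"
 using assms by (simp add: reg_weight_def exp_add)

text \<open>The divergence of \<open>reg_weight e\<close> times \<open>X\<close> has integral zero,
  and the divergence of \<open>X\<close> plus the logarithmic derivative of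
  \<open>reg_weight e\<close> along \<open>X\<close> is \<open>virial_density e\<close> minus
  \<open>force e / pi\<close>.\<close>

lemma regularised_virial:
 assumes e: "0 < e" "e \<le> 1"
 shows "(\<ointegral>x. reg_weight e x * virial_density e x) = (\<ointegral>x. reg_weight e x * force e x) / pi"
  and "integrable area_S2 (\<lambda>x. reg_weight e x * force e x)"
proof -
 let ?E = "\<lambda>x. exp (2 * (\<Sum>i\<in>UNIV. b $ i * log_reg e (p i) x) + 2 * reg_pot e x)"
 define S' where "S' x v = frechet_derivative (K \<circ> sgn) (at x) v * ?E x
   + K (sgn x) * (?E x * (2 * (\<Sum>i\<in>UNIV. b $ i * log_reg_deriv e (p i) x v)
    - (\<ointegral>y. f y * log_reg_deriv e y x v) / pi))" for x v
 have CS: "C1_near_S2 (reg_weight e) S'"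
  using C1_near_reg_weight[OF e] by (simp add: S'_def[abs_def])
 have ibp: "(\<ointegral>x. reg_weight e x * tangential_trace (bump_field_deriv x0 r) x) = - (\<ointegral>x. S' x (X x))"
  by (rule integration_by_parts_S2[OF CS C1_near_bump_field tangent_bump_field])
 have cS: "continuous_on S2 (reg_weight e)" by (rule C1_near_S2_continuous[OF CS])
 have cT: "continuous_on S2 (tangential_trace (bump_field_deriv x0 r))"
  by (rule continuous_on_tangential_trace[OF C1_near_bump_field])
 have cS': "continuous_on S2 (\<lambda>x. S' x (X x))" by (rule continuous_on_C1_near_S2_apply[OF CS cX])
 have cF: "continuous_on S2 (force e)"
  unfolding force_def[abs_def]
  by (rule continuous_on_C1_near_S2_apply[OF C1_near_regularised_potential[OF fi e] cX])
 have eq: "reg_weight e x * tangential_trace (bump_field_deriv x0 r) x + S' x (X x)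
   = reg_weight e x * virial_density e x - reg_weight e x * force e x / pi" if x: "x \<in> S2" for x
 proof -
  have "S' x (X x) = reg_weight e x * (grad_S2 K x \<bullet> X x / K x
    + 2 * (\<Sum>i\<in>UNIV. b $ i * log_reg_deriv e (p i) x (X x)) - force e x / pi)"
   unfolding S'_def reg_weight_def force_def grad_S2_inner[OF KCk x] sgn_S2[OF x]
   using Kpos[OF x] by (simp add: field_simps)
  then show ?thesis by (simp add: virial_density_def algebra_simps)
 qed
 show i: "integrable area_S2 (\<lambda>x. reg_weight e x * force e x)"
  by (intro integrable_area_continuous continuous_intros cS cF)
 have "continuous_on S2 (\<lambda>x. reg_weight e x * tangential_trace (bump_field_deriv x0 r) x + S' x (X x) + reg_weight e x * force e x / pi)"
  by (intro continuous_intros cS cT cS' cF) auto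
 then have "continuous_on S2 (\<lambda>x. reg_weight e x * virial_density e x)"
  by (rule continuous_on_eq) (simp add: eq)
 then have i2: "integrable area_S2 (\<lambda>x. reg_weight e x * virial_density e x)" by (rule integrable_area_continuous)
 have "integrable area_S2 (\<lambda>x. reg_weight e x * tangential_trace (bump_field_deriv x0 r) x)" "integrable area_S2 (\<lambda>x. S' x (X x))"
  by (intro integrable_area_continuous continuous_intros cS cT cS')+
 then have "0 = (\<ointegral>x. reg_weight e x * tangential_trace (bump_field_deriv x0 r) x + S' x (X x))"
  using ibp by simp
 also have "... = (\<ointegral>x. reg_weight e x * virial_density e x - reg_weight e x * force e x / pi)"
  by (rule area_integral_cong) (auto simp: eq)
 also have "... = (\<ointegral>x. reg_weight e x * virial_density e x) - (\<ointegral>x. reg_weight e x * force e x) / pi"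
  using i i2 by simp
 finally show "(\<ointegral>x. reg_weight e x * virial_density e x) = (\<ointegral>x. reg_weight e x * force e x) / pi" by simp
qed

lemma off_range: "x \<in> S2 \<Longrightarrow> x \<noteq> x0 \<Longrightarrow> dist x x0 < r \<Longrightarrow> x \<noteq> p i"
 using r(1) r(3)[of i] by (cases "p i = x0") auto

lemma reg_weight_tendsto:
 assumes x: "x \<in> S2" "\<And>i. x \<noteq> p i"
 shows "(\<lambda>n. reg_weight (inverse (real (Suc n))) x) \<longlonglongrightarrow> f x / \<kappa>"
proof -
 let ?e = "\<lambda>n. inverse (real (Suc n))"
 have "(\<lambda>n. K x * exp (2 * (\<Sum>i\<in>UNIV. b $ i * log_reg (?e n) (p i) x)) * exp (2 * reg_pot (?e n) x)) \<longlonglongrightarrow>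
   K x * exp (2 * (\<Sum>i\<in>UNIV. b $ i * ln (dist x (p i)))) * exp (2 * log_pot f x)"
  by (intro tendsto_intros tendsto_log_reg x null_seq_inverse_Suc reg_pot_tendsto)
 moreover have "K x * exp (2 * (\<Sum>i\<in>UNIV. b $ i * ln (dist x (p i)))) * exp (2 * log_pot f x) = f x / \<kappa>"
  using pf x \<kappa>0 by (simp add: potential_form_def conic_weight_exp)
 ultimately show ?thesis by (simp add: reg_weight_eq[OF x(1)])
qed

text \<open>Uniform in \<open>e\<close>, for opposite reasons according to sign: a nonnegative
  exponent meets \<open>log_reg \<le> 1\<close>, a negative one meets
  \<open>log_reg \<ge> ln dist\<close>.\<close>

lemma reg_weight_bound:
 "\<exists>a C. 1 \<le> a \<and> a < 2 \<and> 0 \<le> C \<and> (\<forall>e x. 0 < e \<longrightarrow> e \<le> 1 \<longrightarrow> x \<in> S2 \<longrightarrow> x \<noteq> x0 \<longrightarrow> dist x x0 < r \<longrightarrow>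
   \<bar>reg_weight e x\<bar> \<le> C * dist x x0 powr (- a))"
proof -
 obtain W where W: "\<And>x. x \<in> S2 \<Longrightarrow> log_pot f x \<le> W"
  using potential_form_log_pot_bounded[OF p K b pf] by blast
 obtain B where B: "B \<ge> 0" "\<And>x. x \<in> S2 \<Longrightarrow> norm (K x) \<le> B"
  using bounded_S2[OF continuous_on_C1_S2(1)[OF KC1]] by blast
 \<comment> \<open>The negative parts of the exponents; they lie in (-1, 0], so the local bound
   applies with size bound 1.\<close>
 define b' where "b' = (\<chi> i. min (b $ i) 0)"
 have b': "\<And>i. b' $ i > -1" using b by (simp add: b'_def)
 \<comment> \<open>At least 1, so that multiplying by one power of \<open>dist x x0\<close>, the
   size of the field, leaves a singularity of nonnegative order \<open>a - 1\<close>.\<close>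
 define a where "a = max 1 (- 2 * cone_exponent p b' x0)"
 have a: "1 \<le> a" "a < 2" "- a \<le> 2 * cone_exponent p b' x0"
  using cone_exponent_gt[OF p(1) b', of x0] by (auto simp: a_def)
 obtain C where C: "C > 0" "\<And>x. x \<in> S2 \<Longrightarrow> x \<noteq> x0 \<Longrightarrow> dist x x0 < r \<Longrightarrow> conic_weight p b' x \<le> C * dist x x0 powr (- a)"
 proof -
  have "\<bar>b' $ i\<bar> \<le> 1" for i using b'[of i] by (simp add: b'_def)
  then show thesis using conic_weight_local_bound[OF p x0 _ r, of a 1] a that by auto
 qed
 define c where "c = exp (2 * (\<Sum>i\<in>UNIV. \<bar>b $ i\<bar>))"
 have main: "exp (2 * (\<Sum>i\<in>UNIV. b $ i * log_reg e (p i) x)) \<le> c * conic_weight p b' x"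
  if e: "0 < e" "e \<le> 1" and x: "x \<in> S2" "x \<noteq> x0" "dist x x0 < r" for e x
 proof -
  have "b $ i * log_reg e (p i) x \<le> \<bar>b $ i\<bar> + b' $ i * ln (dist x (p i))" for i
  proof (cases "b $ i \<ge> 0")
   case True
   then show ?thesis using mult_left_mono[OF log_reg_upper[OF x(1) pS[of i] e], of "b $ i"] by (simp add: b'_def)
  next
   case False
   then have "b $ i * log_reg e (p i) x \<le> b $ i * ln (dist x (p i))"
    by (intro mult_left_mono_neg log_reg_lower off_range[OF x]) simp
   moreover have "b' $ i = b $ i" using False by (simp add: b'_def)
   ultimately show ?thesis by (simp only: add_increasing abs_ge_zero)
  qed
  then have "(\<Sum>i\<in>UNIV. b $ i * log_reg e (p i) x) \<le> (\<Sum>i\<in>UNIV. \<bar>b $ i\<bar> + b' $ i * ln (dist x (p i)))"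
   by (intro sum_mono)
  then show ?thesis using off_range[OF x]
   by (simp add: c_def conic_weight_exp exp_add[symmetric] sum.distrib)
 qed
 have "\<bar>reg_weight e x\<bar> \<le> (B * (c * C) * exp (2 * W)) * dist x x0 powr (- a)"
  if e: "0 < e" "e \<le> 1" and x: "x \<in> S2" "x \<noteq> x0" "dist x x0 < r" for e x
 proof -
  have "\<bar>reg_weight e x\<bar> = norm (K x) * exp (2 * (\<Sum>i\<in>UNIV. b $ i * log_reg e (p i) x)) * exp (2 * reg_pot e x)"
   by (simp add: reg_weight_eq[OF x(1)] abs_mult)
  also have "... \<le> B * (c * (C * dist x x0 powr (- a))) * exp (2 * W)"
   using B(2)[OF x(1)] order_trans[OF main[OF e x] mult_left_mono[OF C(2)[OF x]]] reg_pot_le[OF x(1) e] W[OF x(1)] B(1) C(1)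
   by (intro mult_mono) (auto simp: c_def)
  finally show ?thesis by (simp add: mult_ac)
 qed
 moreover have "0 \<le> B * (c * C) * exp (2 * W)" using B(1) C(1) by (simp add: c_def)
 ultimately show ?thesis using a by blast
qed

lemma virial_density_bound:
 "\<exists>B\<ge>0. \<forall>e x. x \<in> S2 \<longrightarrow> x \<noteq> x0 \<longrightarrow> dist x x0 < r \<longrightarrow> \<bar>virial_density e x\<bar> \<le> B"
proof -
 have cK: "continuous_on S2 K" "continuous_on S2 (grad_S2 K)" by (rule continuous_on_C1_S2[OF KC1])+
 have "continuous_on S2 (\<lambda>x. grad_S2 K x \<bullet> X x / K x)"
  using Kpos by (intro continuous_intros cK cX) (auto simp: less_imp_neq[symmetric] dest: less_imp_neq)
 then obtain B where B: "B \<ge> 0" "\<And>x. x \<in> S2 \<Longrightarrow> norm (grad_S2 K x \<bullet> X x / K x) \<le> B"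
  using bounded_S2 by blast
 have "\<bar>virial_density e x\<bar> \<le> 6 + B + 2 * (\<Sum>i\<in>UNIV. \<bar>b $ i\<bar>)"
  if x: "x \<in> S2" "x \<noteq> x0" "dist x x0 < r" for e x
 proof -
  have l: "\<bar>log_reg_deriv e (p i) x (X x)\<bar> \<le> 1" for i
  proof (cases "p i = x0")
   case True
   have "\<bar>log_reg_deriv e (p i) x (X x)\<bar> \<le> dist x x0 * dist x (p i) powr (- 1)"
    by (rule abs_log_reg_deriv_le[OF norm_bump_field_le(1)[OF x0 r(1,2) x(1)]])
   also have "... = 1" using x True by (simp add: powr_minus)
   finally show ?thesis .
  next
   case False
   have dr: "r \<le> dist x (p i)" using r(3)[OF False] x(3) dist_triangle[of "p i" x0 x] by (simp add: dist_commute)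
   have "\<bar>log_reg_deriv e (p i) x (X x)\<bar> \<le> r * dist x (p i) powr (- 1)"
    by (rule abs_log_reg_deriv_le[OF norm_bump_field_le(3)[OF x0 r(1,2) x(1)]])
   also have "... \<le> 1" using dr r(1) by (simp add: powr_minus divide_simps)
   finally show ?thesis .
  qed
  have "\<bar>\<Sum>i\<in>UNIV. b $ i * log_reg_deriv e (p i) x (X x)\<bar> \<le> (\<Sum>i\<in>UNIV. \<bar>b $ i * log_reg_deriv e (p i) x (X x)\<bar>)"
   by (rule sum_abs)
  also have "... \<le> (\<Sum>i\<in>UNIV. \<bar>b $ i\<bar>)"
   using l by (intro sum_mono) (simp add: abs_mult mult_left_le)
  finally show ?thesis
   using tangential_trace_bump_bounds(1)[OF x0 r(1,2) x(1)] B(2)[OF x(1)]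
   unfolding virial_density_def real_norm_def by linarith
 qed
 moreover have "0 \<le> 6 + B + 2 * (\<Sum>i\<in>UNIV. \<bar>b $ i\<bar>)" using B(1) by (simp add: sum_nonneg add_nonneg_nonneg)
 ultimately show ?thesis by blast
qed

lemma outside_zero:
 assumes "x \<in> S2" "\<not> dist x x0 < r"
 shows "virial_density e x = 0" "force e x = 0" "X x = 0"
proof -
 show X: "X x = 0" using norm_bump_field_le(2)[OF x0 r(1,2) assms(1)] assms(2) by simp
 then show "force e x = 0" by (simp add: force_def log_reg_deriv_def)
 show "virial_density e x = 0"
  using X tangential_trace_bump_bounds(2)[OF x0 r(1,2) assms(1)] assms(2)
  by (simp add: virial_density_def log_reg_deriv_def)
qed

lemma virial_density_tendsto:
 "(\<lambda>n. virial_density (inverse (real (Suc n))) x) \<longlonglongrightarrow> virial_density 0 x"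
 unfolding virial_density_def by (intro tendsto_intros tendsto_log_reg_deriv null_seq_inverse_Suc)

lemma AE_integrable_dist_powr:
 assumes "s < 2"
 shows "AE x in area_S2. integrable area_S2 (\<lambda>y. f y * dist x y powr (- s))"
  and "integrable area_S2 (\<lambda>x. \<ointegral>y. f y * dist x y powr (- s))"
proof -
 have km: "(\<lambda>z. dist (fst z) (snd z) powr (- s)) \<in> borel_measurable (area_S2 \<Otimes>\<^sub>M area_S2)" by measurable
 show "AE x in area_S2. integrable area_S2 (\<lambda>y. f y * dist x y powr (- s))"
  by (rule kernel_AE_integrable[OF fi assms km, where C=1]) auto
 show "integrable area_S2 (\<lambda>x. \<ointegral>y. f y * dist x y powr (- s))"
  by (rule kernel_integrable[OF fi assms km, where C=1]) auto
qed

lemma AE_integrable_dist_inverse: "AE x in area_S2. integrable area_S2 (\<lambda>y. f y * dist x y powr (- 1))"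
 by (rule AE_integrable_dist_powr(1)) simp

lemma force_tendsto:
 "AE x in area_S2. (\<lambda>n. force (inverse (real (Suc n))) x) \<longlonglongrightarrow> force 0 x"
 using AE_integrable_dist_inverse AE_space
proof eventually_elim
 case (elim x)
 have i: "integrable area_S2 (\<lambda>y. f y * (norm (X x) * dist x y powr (- 1)))"
  using integrable_mult_right[OF elim(1), of "norm (X x)"] by (simp add: mult_ac powr_minus divide_inverse)
 show ?case unfolding force_def
 proof (rule integral_dominated_convergence[OF _ _ i])
  show "AE y in area_S2. (\<lambda>n. f y * log_reg_deriv (inverse (real (Suc n))) y x (X x)) \<longlonglongrightarrow> f y * log_reg_deriv 0 y x (X x)"
   by (intro AE_I2 tendsto_mult tendsto_const tendsto_log_reg_deriv null_seq_inverse_Suc)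
  show "AE y in area_S2. norm (f y * log_reg_deriv (inverse (real (Suc n))) y x (X x)) \<le> f y * (norm (X x) * dist x y powr (- 1))" for n
  proof (rule AE_I2)
   fix y assume "y \<in> space area_S2"
   then have "f y \<ge> 0" by (simp add: f0)
   then show "norm (f y * log_reg_deriv (inverse (real (Suc n))) y x (X x)) \<le> f y * (norm (X x) * dist x y powr (- 1))"
    using abs_log_reg_deriv_le[OF order_refl, of "inverse (real (Suc n))" y x "X x"]
    by (simp only: real_norm_def abs_mult abs_of_nonneg mult_left_mono)
  qed
 qed measurable
qed

text \<open>The field gains one power of \<open>dist x x0\<close>, so the singular orders to be
  split are \<open>a - 1\<close> and 1, with sum \<open>a\<close> below 2. The bound does not depend
  on \<open>e\<close> and dominates the limit.\<close>

lemma abs_force_le: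
 assumes "1 \<le> a" "a < 2"
 shows "AE x in area_S2. \<forall>e. dist x x0 powr (- a) * \<bar>force e x\<bar> \<le>
  dist x x0 powr (- a) * (\<ointegral>y. f y) + (\<ointegral>y. f y * dist x y powr (- a))"
 using AE_integrable_dist_inverse AE_integrable_dist_powr(1)[OF assms(2)] AE_area_neq[of x0] AE_space
proof eventually_elim
 case (elim x)
 then have i1: "integrable area_S2 (\<lambda>y. f y * dist x y powr (- 1))" and x: "x \<in> S2" by auto
 let ?\<rho> = "dist x x0"
 have \<rho>: "?\<rho> > 0" using elim(3) by simp
 show ?case
 proof
  fix e
  have mi: "integrable area_S2 (\<lambda>y. f y * (?\<rho> * dist x y powr (- 1)))"
   using integrable_mult_right[OF i1, of ?\<rho>] by (simp only: mult.left_commute)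
  have bd: "\<bar>f y * log_reg_deriv e y x (X x)\<bar> \<le> f y * (?\<rho> * dist x y powr (- 1))" if y: "y \<in> S2" for y
   unfolding abs_mult abs_of_nonneg[OF f0[OF y]]
   by (intro mult_left_mono abs_log_reg_deriv_le norm_bump_field_le(1)[OF x0 r(1,2) x] f0[OF y])
  have ii: "integrable area_S2 (\<lambda>y. f y * log_reg_deriv e y x (X x))"
  proof (rule Bochner_Integration.integrable_bound[OF mi])
   show "AE y in area_S2. norm (f y * log_reg_deriv e y x (X x)) \<le> norm (f y * (?\<rho> * dist x y powr (- 1)))"
   proof (rule AE_area_I)
    fix y assume "y \<in> S2"
    from order_trans[OF bd[OF this] abs_ge_self]
    show "norm (f y * log_reg_deriv e y x (X x)) \<le> norm (f y * (?\<rho> * dist x y powr (- 1)))"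
     by (simp only: real_norm_def)
   qed
  qed measurable
  have "?\<rho> powr (- a) * \<bar>force e x\<bar> \<le> ?\<rho> powr (- a) * (\<ointegral>y. f y * (?\<rho> * dist x y powr (- 1)))"
  proof (rule mult_left_mono)
   have "\<bar>force e x\<bar> \<le> (\<ointegral>y. \<bar>f y * log_reg_deriv e y x (X x)\<bar>)" unfolding force_def by (rule integral_abs_bound)
   also have "... \<le> (\<ointegral>y. f y * (?\<rho> * dist x y powr (- 1)))"
    by (rule integral_mono) (use ii mi bd in auto)
   finally show "\<bar>force e x\<bar> \<le> (\<ointegral>y. f y * (?\<rho> * dist x y powr (- 1)))" .
  qed simp
  also have "... = (\<ointegral>y. ?\<rho> powr (- a) * (f y * (?\<rho> * dist x y powr (- 1))))"
   by (rule Bochner_Integration.integral_mult_right_zero[symmetric])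
  also have "... \<le> (\<ointegral>y. ?\<rho> powr (- a) * f y + f y * dist x y powr (- a))"
  proof (rule integral_mono)
   fix y assume "y \<in> space area_S2"
   then have y: "y \<in> S2" by simp
   have "?\<rho> powr (- a) * ?\<rho> = ?\<rho> powr (- (a - 1))" using \<rho> by (simp add: powr_diff powr_minus field_simps)
   then have "?\<rho> powr (- a) * (f y * (?\<rho> * dist x y powr (- 1))) = f y * (?\<rho> powr (- (a - 1)) * dist x y powr (- 1))"
    by (metis mult.assoc mult.left_commute)
   also have "... \<le> f y * (?\<rho> powr (- ((a - 1) + 1)) + dist x y powr (- ((a - 1) + 1)))"
    using assms by (intro mult_left_mono f0[OF y] powr_mult_le_add) auto
   also have "... = ?\<rho> powr (- a) * f y + f y * dist x y powr (- a)" by (simp add: algebra_simps)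
   finally show "?\<rho> powr (- a) * (f y * (?\<rho> * dist x y powr (- 1))) \<le> ?\<rho> powr (- a) * f y + f y * dist x y powr (- a)" .
  next
   show "integrable area_S2 (\<lambda>y. ?\<rho> powr (- a) * (f y * (?\<rho> * dist x y powr (- 1))))"
    by (rule integrable_mult_right[OF mi])
  qed (use fi elim(2) in auto)
  also have "... = ?\<rho> powr (- a) * (\<ointegral>y. f y) + (\<ointegral>y. f y * dist x y powr (- a))"
   using fi elim(2) by simp
  finally show "?\<rho> powr (- a) * \<bar>force e x\<bar> \<le>
   ?\<rho> powr (- a) * (\<ointegral>y. f y) + (\<ointegral>y. f y * dist x y powr (- a))" .
 qed
qed

lemma f_bound:
 "\<exists>a C. 1 \<le> a \<and> a < 2 \<and> 0 \<le> C \<and> (\<forall>x\<in>S2. x \<noteq> x0 \<longrightarrow> dist x x0 < r \<longrightarrow> f x \<le> C * dist x x0 powr (- a))"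
proof -
 obtain a C where aC: "1 \<le> a" "a < 2" "0 \<le> C" and
  bd: "\<And>e x. 0 < e \<Longrightarrow> e \<le> 1 \<Longrightarrow> x \<in> S2 \<Longrightarrow> x \<noteq> x0 \<Longrightarrow> dist x x0 < r \<Longrightarrow> \<bar>reg_weight e x\<bar> \<le> C * dist x x0 powr (- a)"
  using reg_weight_bound by blast
 have "f x \<le> (\<kappa> * C) * dist x x0 powr (- a)" if x: "x \<in> S2" "x \<noteq> x0" "dist x x0 < r" for x
 proof -
  have "f x / \<kappa> \<le> C * dist x x0 powr (- a)"
  proof (rule LIMSEQ_le_const2[OF reg_weight_tendsto[OF x(1) off_range[OF x]]])
   have "reg_weight (inverse (real (Suc n))) x \<le> C * dist x x0 powr (- a)" for n
    using bd[OF null_seq_inverse_Suc(2,3) x, of n] by linarith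
   then show "\<exists>N. \<forall>n\<ge>N. reg_weight (inverse (real (Suc n))) x \<le> C * dist x x0 powr (- a)" by blast
  qed
  then show ?thesis using \<kappa>0 by (simp add: pos_divide_le_eq mult_ac)
 qed
 moreover have "0 \<le> \<kappa> * C" using \<kappa>0 aC by simp
 ultimately show ?thesis using aC by blast
qed

lemma measurable_force: "force e \<in> borel_measurable area_S2"
proof -
 have [measurable]: "X \<in> borel_measurable area_S2" by (rule measurable_area_continuous[OF cX])
 have "(\<lambda>z. f (snd z) * log_reg_deriv e (snd z) (fst z) (X (fst z))) \<in> borel_measurable (area_S2 \<Otimes>\<^sub>M area_S2)"
  unfolding log_reg_deriv_def by measurable
 then show ?thesis unfolding force_def[abs_def]
  by (intro area.borel_measurable_lebesgue_integral) (simp add: case_prod_unfold)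
qed

lemma limit_virial:
 "(\<ointegral>x. f x * virial_density 0 x) = (\<ointegral>x. f x * force 0 x) / pi"
proof -
 let ?e = "\<lambda>n. inverse (real (Suc n))"
 obtain a C where aC: "1 \<le> a" "a < 2" "0 \<le> C" and
  bd: "\<And>e x. 0 < e \<Longrightarrow> e \<le> 1 \<Longrightarrow> x \<in> S2 \<Longrightarrow> x \<noteq> x0 \<Longrightarrow> dist x x0 < r \<Longrightarrow> \<bar>reg_weight e x\<bar> \<le> C * dist x x0 powr (- a)"
  using reg_weight_bound by blast
 obtain B where B: "B \<ge> 0" "\<And>e x. x \<in> S2 \<Longrightarrow> x \<noteq> x0 \<Longrightarrow> dist x x0 < r \<Longrightarrow> \<bar>virial_density e x\<bar> \<le> B"
  using virial_density_bound by blast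
 have mw: "reg_weight (?e n) \<in> borel_measurable area_S2" for n
  by (rule measurable_area_continuous[OF C1_near_S2_continuous[OF C1_near_reg_weight]]) (rule null_seq_inverse_Suc)+
 have mv: "virial_density e \<in> borel_measurable area_S2" for e
 proof -
  have "continuous_on S2 (\<lambda>x. tangential_trace (bump_field_deriv x0 r) x)"
   by (rule continuous_on_tangential_trace[OF C1_near_bump_field])
  then have 1: "(\<lambda>x. tangential_trace (bump_field_deriv x0 r) x) \<in> borel_measurable area_S2" by (rule measurable_area_continuous)
  have "continuous_on S2 (\<lambda>x. grad_S2 K x \<bullet> X x)"
   by (intro continuous_intros continuous_on_C1_S2(2)[OF KC1] cX)
  then have 2: "(\<lambda>x. grad_S2 K x \<bullet> X x) \<in> borel_measurable area_S2" by (rule measurable_area_continuous)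
  have 3: "K \<in> borel_measurable area_S2" by (rule C1_pos_measurable[OF K])
  have 4: "(\<lambda>x. log_reg_deriv e (p i) x (X x)) \<in> borel_measurable area_S2" for i by (rule measurable_log_reg_deriv[OF cX])
  show ?thesis unfolding virial_density_def[abs_def] using 1 2 3 4 by measurable
 qed
 have ae: "AE x in area_S2. (\<lambda>n. reg_weight (?e n) x) \<longlonglongrightarrow> f x / \<kappa>"
  using AE_area_notin_range[of p] AE_space by eventually_elim (rule reg_weight_tendsto, auto)
 have L1: "(\<lambda>n. \<ointegral>x. reg_weight (?e n) x * virial_density (?e n) x) \<longlonglongrightarrow> (\<ointegral>x. f x / \<kappa> * virial_density 0 x)"
 proof (rule integral_dominated_convergence[where w="\<lambda>x. C * B * dist x x0 powr (- a)"])
  show "integrable area_S2 (\<lambda>x. C * B * dist x x0 powr (- a))" using integrable_dist_powr[OF x0 aC(2)] by simp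
  show "AE x in area_S2. (\<lambda>n. reg_weight (?e n) x * virial_density (?e n) x) \<longlonglongrightarrow> f x / \<kappa> * virial_density 0 x"
   using ae by eventually_elim (intro tendsto_mult virial_density_tendsto)
  show "AE x in area_S2. norm (reg_weight (?e n) x * virial_density (?e n) x) \<le> C * B * dist x x0 powr (- a)" for n
   using AE_area_neq[of x0] AE_space
  proof eventually_elim
   case (elim x)
   then have x: "x \<in> S2" "x \<noteq> x0" by auto
   show ?case
   proof (cases "dist x x0 < r")
    case True
    have "\<bar>reg_weight (?e n) x\<bar> * \<bar>virial_density (?e n) x\<bar> \<le> (C * dist x x0 powr (- a)) * B"
     by (intro mult_mono bd B(2) null_seq_inverse_Suc x True) (use aC in auto)
    then show ?thesis by (simp add: abs_mult mult_ac)
   next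
    case False
    then show ?thesis using outside_zero(1)[OF x(1) False] aC B by simp
   qed
  qed
 qed (use mw mv in measurable)
 define G where "G x = C * (dist x x0 powr (- a) * (\<ointegral>y. f y) + (\<ointegral>y. f y * dist x y powr (- a)))" for x
 have L2: "(\<lambda>n. \<ointegral>x. reg_weight (?e n) x * force (?e n) x) \<longlonglongrightarrow> (\<ointegral>x. f x / \<kappa> * force 0 x)"
 proof (rule integral_dominated_convergence[where w="\<lambda>x. \<bar>G x\<bar>"])
  have "integrable area_S2 G" unfolding G_def
   using integrable_dist_powr[OF x0 aC(2)] AE_integrable_dist_powr(2)[OF aC(2)] by simp
  then show "integrable area_S2 (\<lambda>x. \<bar>G x\<bar>)" by simp
  show "AE x in area_S2. (\<lambda>n. reg_weight (?e n) x * force (?e n) x) \<longlonglongrightarrow> f x / \<kappa> * force 0 x"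
   using ae force_tendsto by eventually_elim (rule tendsto_mult)
  show "AE x in area_S2. norm (reg_weight (?e n) x * force (?e n) x) \<le> \<bar>G x\<bar>" for n
   using AE_area_neq[of x0] AE_space abs_force_le[OF aC(1,2)]
  proof eventually_elim
   case (elim x)
   then have x: "x \<in> S2" "x \<noteq> x0" by auto
   show ?case
   proof (cases "dist x x0 < r")
    case True
    have "\<bar>reg_weight (?e n) x\<bar> * \<bar>force (?e n) x\<bar> \<le> (C * dist x x0 powr (- a)) * \<bar>force (?e n) x\<bar>"
     by (intro mult_right_mono bd null_seq_inverse_Suc x True) auto
    also have "... = C * (dist x x0 powr (- a) * \<bar>force (?e n) x\<bar>)" by (rule mult.assoc)
    also have "... \<le> G x" unfolding G_def using elim(3) aC by (intro mult_left_mono) auto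
    finally show ?thesis by (simp add: abs_mult)
   next
    case False
    then show ?thesis using outside_zero(2)[OF x(1) False] by simp
   qed
  qed
 qed (use mw measurable_force in measurable)
 have "(\<lambda>n. \<ointegral>x. reg_weight (?e n) x * virial_density (?e n) x) \<longlonglongrightarrow> (\<ointegral>x. f x / \<kappa> * force 0 x) / pi"
  unfolding regularised_virial(1)[OF null_seq_inverse_Suc(2,3)] by (intro tendsto_divide L2 tendsto_const) simp
 from LIMSEQ_unique[OF L1 this]
 have "(\<ointegral>x. f x * virial_density 0 x) / \<kappa> = (\<ointegral>x. f x * force 0 x) / \<kappa> / pi"
  by simp
 then show ?thesis using \<kappa>0 by (simp add: field_simps)
qed

text \<open>The force term is a double integral; averaging it with its copy under exchange of
  \<open>x\<close> and \<open>y\<close> replaces the singular factor by \<open>bump_kernel\<close>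
  and turns 1 / pi into 1 / (2 * pi). The exchange is legitimate because the bound on
  \<open>f\<close> near \<open>x0\<close> makes the unsymmetrised integrand integrable.\<close>

theorem virial_identity:
 shows "(\<ointegral>x. f x * virial_density 0 x) = (\<ointegral>x. (\<ointegral>y. f x * f y * bump_kernel x0 r x y)) / (2 * pi)"
  and "integrable area_S2 (\<lambda>x. f x * virial_density 0 x)"
  and "integrable (area_S2 \<Otimes>\<^sub>M area_S2) (\<lambda>(x, y). f x * f y * bump_kernel x0 r x y)"
proof -
 obtain a C where aC: "1 \<le> a" "a < 2" "0 \<le> C" and
  bd: "\<And>x. x \<in> S2 \<Longrightarrow> x \<noteq> x0 \<Longrightarrow> dist x x0 < r \<Longrightarrow> f x \<le> C * dist x x0 powr (- a)"
  using f_bound by blast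
 have [measurable]: "X \<in> borel_measurable area_S2" by (rule measurable_area_continuous[OF cX])
 define F where "F x y = f x * f y * log_reg_deriv 0 y x (X x)" for x y
 have mF: "(\<lambda>z. F (fst z) (snd z)) \<in> borel_measurable (area_S2 \<Otimes>\<^sub>M area_S2)"
  unfolding F_def log_reg_deriv_def by measurable
 have iF: "integrable (area_S2 \<Otimes>\<^sub>M area_S2) (\<lambda>(x, y). F x y)"
 proof (rule Bochner_Integration.integrable_bound)
  have i1: "integrable (area_S2 \<Otimes>\<^sub>M area_S2) (\<lambda>(x, y). dist x x0 powr (- a) * f y)"
   by (rule integrable_product_area[OF integrable_dist_powr[OF x0 aC(2)] fi])
  have i2: "integrable (area_S2 \<Otimes>\<^sub>M area_S2) (\<lambda>(x, y). f y *\<^sub>R (dist x y powr (- a)))"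
   by (rule integrable_kernel[OF fi aC(2), where C=1]) auto
  show "integrable (area_S2 \<Otimes>\<^sub>M area_S2) (\<lambda>z. C * ((\<lambda>(x, y). dist x x0 powr (- a) * f y) z + (\<lambda>(x, y). f y *\<^sub>R (dist x y powr (- a))) z))"
   by (intro integrable_mult_right Bochner_Integration.integrable_add i1 i2)
  show "(\<lambda>(x, y). F x y) \<in> borel_measurable (area_S2 \<Otimes>\<^sub>M area_S2)" using mF by (simp add: case_prod_unfold)
  show "AE z in area_S2 \<Otimes>\<^sub>M area_S2. norm ((\<lambda>(x, y). F x y) z)
   \<le> norm (C * ((\<lambda>(x, y). dist x x0 powr (- a) * f y) z + (\<lambda>(x, y). f y *\<^sub>R (dist x y powr (- a))) z))"
  proof (rule AE_I2)
   fix z assume "z \<in> space (area_S2 \<Otimes>\<^sub>M area_S2)"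
   then obtain x y where z: "z = (x, y)" "x \<in> S2" "y \<in> S2" by (auto simp: space_pair_measure)
   let ?\<rho> = "dist x x0"
   have R: "0 \<le> C * (?\<rho> powr (- a) * f y + f y * dist x y powr (- a))" using aC f0[OF z(3)] by simp
   have "\<bar>F x y\<bar> \<le> C * (?\<rho> powr (- a) * f y + f y * dist x y powr (- a))"
   proof (cases "x \<noteq> x0 \<and> ?\<rho> < r")
    case True
    then have \<rho>: "?\<rho> > 0" by simp
    have "\<bar>F x y\<bar> = f x * f y * \<bar>log_reg_deriv 0 y x (X x)\<bar>"
     using f0[OF z(2)] f0[OF z(3)] by (simp add: F_def abs_mult)
    also have "... \<le> (C * ?\<rho> powr (- a)) * f y * (?\<rho> * dist x y powr (- 1))"
     using True f0[OF z(2)] f0[OF z(3)] aC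
     by (intro mult_mono abs_log_reg_deriv_le norm_bump_field_le(1)[OF x0 r(1,2) z(2)] bd z(2)) auto
    also have "... = C * f y * ((?\<rho> powr (- a) * ?\<rho>) * dist x y powr (- 1))" by (simp only: mult_ac)
    also have "?\<rho> powr (- a) * ?\<rho> = ?\<rho> powr (- (a - 1))" using \<rho> by (simp add: powr_diff powr_minus field_simps)
    also have "C * f y * (?\<rho> powr (- (a - 1)) * dist x y powr (- 1)) \<le>
      C * f y * (?\<rho> powr (- ((a - 1) + 1)) + dist x y powr (- ((a - 1) + 1)))"
     using aC f0[OF z(3)] by (intro mult_left_mono powr_mult_le_add) auto
    also have "... = C * (?\<rho> powr (- a) * f y + f y * dist x y powr (- a))" by (simp add: algebra_simps)
    finally show ?thesis .
   next
    case False
    have "X x = 0"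
    proof (cases "x = x0")
     case True
     then show ?thesis using norm_bump_field_le(1)[OF x0 r(1,2) z(2)] by simp
    next
     case ne: False
     then show ?thesis using False outside_zero(3)[OF z(2)] by simp
    qed
    then show ?thesis using R by (simp add: F_def log_reg_deriv_def)
   qed
   then show "norm ((\<lambda>(x, y). F x y) z)
    \<le> norm (C * ((\<lambda>(x, y). dist x x0 powr (- a) * f y) z + (\<lambda>(x, y). f y *\<^sub>R (dist x y powr (- a))) z))"
    using R by (simp add: z(1))
  qed
 qed
 have iF': "integrable (area_S2 \<Otimes>\<^sub>M area_S2) (\<lambda>(x, y). F y x)"
  using area2.integrable_product_swap[OF iF] by simp
 have sym: "F x y + F y x = f x * f y * bump_kernel x0 r x y" for x y
 proof -
  have "log_reg_deriv 0 y x (X x) + log_reg_deriv 0 x y (X y) = bump_kernel x0 r x y"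
   by (simp add: log_reg_deriv_def bump_kernel_def[OF x0 r(1,2)] dist_commute[of y x] add_divide_distrib[symmetric] inner_simps inner_commute)
  then show ?thesis by (simp add: F_def algebra_simps flip: distrib_left)
 qed
 show ib: "integrable (area_S2 \<Otimes>\<^sub>M area_S2) (\<lambda>(x, y). f x * f y * bump_kernel x0 r x y)"
  using Bochner_Integration.integrable_add[OF iF iF'] by (simp add: case_prod_unfold sym)
 have "(\<ointegral>x. f x * force 0 x) = (\<ointegral>x. (\<ointegral>y. F x y))"
  by (simp add: force_def F_def mult.assoc)
 moreover have "(\<ointegral>x. (\<ointegral>y. F x y)) = (\<ointegral>x. (\<ointegral>y. F y x))"
  using area2.Fubini_integral[OF iF] by simp
 moreover have "(\<ointegral>x. (\<ointegral>y. F x y)) + (\<ointegral>x. (\<ointegral>y. F y x))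
   = (\<ointegral>x. (\<ointegral>y. f x * f y * bump_kernel x0 r x y))"
 proof -
  have "(\<ointegral>x. (\<ointegral>y. f x * f y * bump_kernel x0 r x y))
   = integral\<^sup>L (area_S2 \<Otimes>\<^sub>M area_S2) (\<lambda>z. (\<lambda>(x, y). F x y) z + (\<lambda>(x, y). F y x) z)"
   using area2.integral_fst[OF ib] by (simp add: case_prod_unfold sym)
  also have "... = (\<ointegral>x. (\<ointegral>y. F x y)) + (\<ointegral>x. (\<ointegral>y. F y x))"
   using area2.integral_fst[OF iF] area2.integral_fst[OF iF'] Bochner_Integration.integral_add[OF iF iF'] by simp
  finally show ?thesis by simp
 qed
 ultimately have "2 * (\<ointegral>x. f x * force 0 x) = (\<ointegral>x. (\<ointegral>y. f x * f y * bump_kernel x0 r x y))"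
  by simp
 then show "(\<ointegral>x. f x * virial_density 0 x) = (\<ointegral>x. (\<ointegral>y. f x * f y * bump_kernel x0 r x y)) / (2 * pi)"
  unfolding limit_virial by (simp add: field_simps)
 obtain B where B: "B \<ge> 0" "\<And>e x. x \<in> S2 \<Longrightarrow> x \<noteq> x0 \<Longrightarrow> dist x x0 < r \<Longrightarrow> \<bar>virial_density e x\<bar> \<le> B"
  using virial_density_bound by blast
 show "integrable area_S2 (\<lambda>x. f x * virial_density 0 x)"
 proof (rule Bochner_Integration.integrable_bound[where f="\<lambda>x. B * f x"])
  have cT: "(\<lambda>x. tangential_trace (bump_field_deriv x0 r) x) \<in> borel_measurable area_S2"
   by (rule measurable_area_continuous[OF continuous_on_tangential_trace[OF C1_near_bump_field]])
  have "continuous_on S2 (\<lambda>x. grad_S2 K x \<bullet> X x)"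
   by (intro continuous_intros continuous_on_C1_S2(2)[OF KC1] cX)
  then have cG: "(\<lambda>x. grad_S2 K x \<bullet> X x) \<in> borel_measurable area_S2" by (rule measurable_area_continuous)
  have cL: "(\<lambda>x. log_reg_deriv 0 (p i) x (X x)) \<in> borel_measurable area_S2" for i by (rule measurable_log_reg_deriv[OF cX])
  show "(\<lambda>x. f x * virial_density 0 x) \<in> borel_measurable area_S2"
   unfolding virial_density_def using cT cG cL C1_pos_measurable[OF K] by measurable
  show "AE x in area_S2. norm (f x * virial_density 0 x) \<le> norm (B * f x)"
   using AE_area_neq[of x0] AE_space
  proof eventually_elim
   case (elim x)
   then have x: "x \<in> S2" "x \<noteq> x0" by auto
   have "\<bar>virial_density 0 x\<bar> \<le> B"
    using B(2)[OF x] outside_zero(1)[OF x(1)] B(1) by (cases "dist x x0 < r") auto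
   from mult_left_mono[OF this f0[OF x(1)]] show ?case
    using f0[OF x(1)] B(1) by (simp add: abs_mult mult.commute)
  qed
 qed (use fi in simp)
qed

end

subsection \<open>Concentration of mass\<close>

text \<open>The mass that the sequence carries into the point \<open>x\<close>: the index goes to
  infinity before the radius goes to 0. Convergence of the ball masses at a fixed radius is not
  demanded.\<close>

definition concentrates :: "(nat \<Rightarrow> real^3 \<Rightarrow> real) \<Rightarrow> real^3 \<Rightarrow> real \<Rightarrow> bool" where
 "concentrates f x \<sigma> \<longleftrightarrow> (\<forall>\<epsilon>>0. \<exists>R>0. \<forall>r. 0 < r \<and> r < R \<longrightarrow>
   (\<forall>\<^sub>F k in sequentially. \<bar>ball_mass (f k) x r - \<sigma>\<bar> < \<epsilon>))"

text \<open>The shell corresponds to heights between \<open>1 - 2 * d\<^sup>2\<close> and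
  \<open>1 - d\<^sup>2 / 2\<close>, an interval of length \<open>3 / 2 * d\<^sup>2\<close>, and
  heights have density 2 pi.\<close>

lemma measure_spherical_shell:
 assumes x0: "x0 \<in> S2" and d: "0 < d" "d \<le> 1"
 shows "(\<ointegral>x. indicator {x. d \<le> dist x x0 \<and> dist x x0 < 2 * d} x) = 3 * pi * d\<^sup>2"
proof -
 let ?T = "{t::real. 1 - 2 * d\<^sup>2 < t \<and> t \<le> 1 - d\<^sup>2 / 2}"
 have T: "?T = {1 - 2 * d\<^sup>2 <.. 1 - d\<^sup>2 / 2}" by auto
 have d2: "d\<^sup>2 \<le> 1" "0 < d\<^sup>2" using d by (auto simp: power_le_one)
 have eq: "indicator {x. d \<le> dist x x0 \<and> dist x x0 < 2 * d} x = (indicator ?T (x0 \<bullet> x) :: ennreal)" if x: "x \<in> S2" for x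
 proof -
  have D: "(dist x x0)\<^sup>2 = 2 - 2 * (x0 \<bullet> x)" using dist_S2(1)[OF x x0] by (simp add: inner_commute)
  have "d \<le> dist x x0 \<longleftrightarrow> d\<^sup>2 \<le> (dist x x0)\<^sup>2" using d abs_le_square_iff[of d "dist x x0"] by simp
  moreover have "dist x x0 < 2 * d \<longleftrightarrow> (dist x x0)\<^sup>2 < (2 * d)\<^sup>2" using d abs_le_square_iff[of "2 * d" "dist x x0"] by (metis abs_of_nonneg less_imp_le linorder_not_le mult_nonneg_nonneg zero_le_dist zero_le_numeral)
  ultimately show ?thesis unfolding D by (auto simp: indicator_def power_mult_distrib)
 qed
 have "(\<ointegral>\<^sup>+x. indicator {x. d \<le> dist x x0 \<and> dist x x0 < 2 * d} x) = (\<ointegral>\<^sup>+x. indicator ?T (x0 \<bullet> x))"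
  by (rule nn_integral_cong) (use eq in simp)
 also have "... = ennreal (2 * pi) * (\<integral>\<^sup>+t. indicator ?T t * indicator {-1..1} t \<partial>lborel)"
  by (rule nn_integral_zonal[OF x0]) (simp add: T)
 also have "(\<integral>\<^sup>+t. indicator ?T t * indicator {-1..1} t \<partial>lborel) = (\<integral>\<^sup>+t. indicator {1 - 2 * d\<^sup>2 <.. 1 - d\<^sup>2 / 2} t \<partial>lborel)"
  by (rule nn_integral_cong) (use d2 in \<open>auto simp: indicator_def\<close>)
 also have "... = ennreal (3 / 2 * d\<^sup>2)" using d2 by (simp add: algebra_simps)
 also have "ennreal (2 * pi) * ... = ennreal (3 * pi * d\<^sup>2)" by (simp add: ennreal_mult[symmetric])
 finally have nn: "(\<ointegral>\<^sup>+x. indicator {x. d \<le> dist x x0 \<and> dist x x0 < 2 * d} x) = ennreal (3 * pi * d\<^sup>2)" .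
 have m: "(\<lambda>x. indicator {x. d \<le> dist x x0 \<and> dist x x0 < 2 * d} x :: real) \<in> borel_measurable area_S2"
  by (intro measurable_area1 borel_measurable_indicator) measurable
 show ?thesis
  by (subst integral_eq_nn_integral) (use m nn in \<open>auto simp: ennreal_indicator\<close>)
qed

context liouville_sequence
begin

lemma subsequence:
 assumes s: "strict_mono s"
 shows "liouville_sequence p (\<lambda>k. K (s k)) (\<lambda>k. b (s k)) (\<lambda>k. \<kappa> (s k)) (\<lambda>k. f (s k)) K0 b0"
 using inj_p range_p K_C1 K0_C1 b_gt b0_gt pot LIMSEQ_subseq_LIMSEQ[OF K_lim s] LIMSEQ_subseq_LIMSEQ[OF b_lim s]
 by unfold_locales (auto simp: o_def)

text \<open>Along a diagonal subsequence the masses of all sets of a countable base converge. The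
  atom at \<open>x\<close> is the infimum of these limits over the base sets containing
  \<open>x\<close>; monotonicity squeezes small balls between two base sets.\<close>

lemma subsequence_concentrates:
 "\<exists>s. strict_mono s \<and> (\<forall>x. \<exists>\<sigma>\<ge>0. concentrates (\<lambda>k. f (s k)) x \<sigma>)"
proof -
 obtain \<B> :: "(real^3) set set" where \<B>: "countable \<B>" "\<And>C. C \<in> \<B> \<Longrightarrow> open C"
  and basis: "\<And>S. open S \<Longrightarrow> \<exists>U. U \<subseteq> \<B> \<and> S = \<Union>U"
  using univ_second_countable by metis
 define \<mu> where "\<mu> k A = (\<ointegral>y. indicator A y * f k y)" for k A
 have "Bseq (\<lambda>k. total_mass (b k))" using mass_tendsto by (intro convergent_imp_Bseq convergentI)
 then obtain M where M: "\<And>k. \<bar>total_mass (b k)\<bar> \<le> M" unfolding Bseq_def by auto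
 have \<mu>0: "0 \<le> \<mu> k A" for k A
  unfolding \<mu>_def using f_nonneg by (intro integral_nonneg_AE AE_I2) auto
 have \<mu>_mono: "\<mu> k A \<le> \<mu> k B" if "A \<subseteq> B" "open A" "open B" for k A B
  unfolding \<mu>_def using that by (intro integral_indicator_mono f_integrable f_nonneg) auto
 have \<mu>M: "\<mu> k A \<le> M" if "open A" for k A
 proof -
  have "\<mu> k A \<le> \<mu> k UNIV" using that by (intro \<mu>_mono) auto
  also have "... = total_mass (b k)" by (simp add: \<mu>_def f_mass)
  finally show ?thesis using M[of k] by linarith
 qed
 obtain s where s: "strict_mono (s :: nat \<Rightarrow> nat)" "\<And>A. A \<in> \<B> \<Longrightarrow> \<exists>l. (\<lambda>n. \<mu> (s n) A) \<longlonglongrightarrow> l"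
 proof (rule function_convergent_subsequence[OF \<B>(1), of \<mu> M])
  show "norm (\<mu> n A) \<le> M" if "A \<in> \<B>" for n A using \<mu>0[of n A] \<mu>M[OF \<B>(2)[OF that], of n] by simp
 qed blast
 then obtain L where L: "\<And>A. A \<in> \<B> \<Longrightarrow> (\<lambda>n. \<mu> (s n) A) \<longlonglongrightarrow> L A" by metis
 have L0: "L A \<ge> 0" if "A \<in> \<B>" for A
  by (rule LIMSEQ_le_const[OF L[OF that]]) (use \<mu>0 in auto)
 have "\<exists>\<sigma>\<ge>0. concentrates (\<lambda>k. f (s k)) x \<sigma>" for x
 proof -
  define Q where "Q = L ` {A \<in> \<B>. x \<in> A}"
  have ex: "\<exists>A\<in>\<B>. x \<in> A \<and> A \<subseteq> U" if "open U" "x \<in> U" for U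
   using basis[OF that(1)] that(2) by blast
  have Qne: "Q \<noteq> {}" using ex[OF open_UNIV] by (auto simp: Q_def)
  have Qb: "bdd_below Q" using L0 by (intro bdd_belowI[of _ 0]) (auto simp: Q_def)
  define \<sigma> where "\<sigma> = Inf Q"
  have "\<sigma> \<ge> 0" unfolding \<sigma>_def using Qne L0 by (intro cInf_greatest) (auto simp: Q_def)
  moreover have "concentrates (\<lambda>k. f (s k)) x \<sigma>"
   unfolding concentrates_def
  proof (intro allI impI)
   fix e :: real assume e: "e > 0"
   have "\<exists>q\<in>Q. q < \<sigma> + e" using e Qne Qb cInf_lessD[of Q "\<sigma> + e"] by (auto simp: \<sigma>_def)
   then obtain A where A: "A \<in> \<B>" "x \<in> A" "L A < \<sigma> + e" by (auto simp: Q_def)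
   obtain R where R: "R > 0" "ball x R \<subseteq> A" using \<B>(2)[OF A(1)] A(2) open_contains_ball by blast
   have evA: "\<forall>\<^sub>F k in sequentially. \<mu> (s k) A < \<sigma> + e" using L[OF A(1)] A(3) by (rule order_tendstoD)
   show "\<exists>R>0. \<forall>r. 0 < r \<and> r < R \<longrightarrow> (\<forall>\<^sub>F k in sequentially.
     \<bar>ball_mass (f (s k)) x r - \<sigma>\<bar> < e)"
   proof (intro exI[of _ R] conjI R allI impI)
    fix r assume r: "0 < r \<and> r < R"
    then obtain C where C: "C \<in> \<B>" "x \<in> C" "C \<subseteq> ball x r" using ex[OF open_ball, of x r] by auto
    have "\<sigma> \<le> L C" unfolding \<sigma>_def using C Qb by (intro cInf_lower) (auto simp: Q_def)
    then have "\<sigma> - e < L C" using e by simp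
    then have "\<forall>\<^sub>F k in sequentially. \<sigma> - e < \<mu> (s k) C" using L[OF C(1)] by (intro order_tendstoD(1)) auto
    with evA show "\<forall>\<^sub>F k in sequentially. \<bar>ball_mass (f (s k)) x r - \<sigma>\<bar> < e"
    proof eventually_elim
     case (elim k)
     have "\<mu> (s k) C \<le> \<mu> (s k) (ball x r)" using C \<B>(2) by (intro \<mu>_mono) auto
     moreover have "\<mu> (s k) (ball x r) \<le> \<mu> (s k) A"
      using R(2) r \<B>(2)[OF A(1)] by (intro \<mu>_mono order_trans[OF _ R(2)] subset_ball) auto
     ultimately show ?case using elim by (simp add: \<mu>_def[symmetric] abs_less_iff)
    qed
   qed
  qed
  ultimately show ?thesis by blast
 qed
 then show ?thesis using s(1) by blast
qed

text \<open>Pohozaev: letting the scale of the field tend to zero in the virial identity leaves a quadratic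
 equation for the concentrated mass.\<close>

lemma virial_estimate:
 assumes x0: "x0 \<in> S2" and r: "0 < r" "r \<le> 1" "\<And>i. p i \<noteq> x0 \<Longrightarrow> 2 * r \<le> dist (p i) x0"
  and d: "0 < d" "2 * d \<le> r"
  and Kb: "\<And>x. x \<in> S2 \<Longrightarrow> c \<le> K k x" "\<And>x. x \<in> S2 \<Longrightarrow> norm (grad_S2 (K k) x) \<le> C" and c: "0 < c"
  and Bb: "\<And>i. \<bar>b k $ i\<bar> \<le> B" and B: "B \<ge> 0"
  and m: "total_mass (b k) \<le> M"
  and e0: "\<bar>cone_exponent p (b k) x0 - e0\<bar> \<le> \<epsilon>"
  and ann: "ball_mass (f k) x0 r - ball_mass (f k) x0 d \<le> 2 * \<epsilon>"
  and small: "9 * (d\<^sup>2 / r\<^sup>2) + C / c * d + 6 * B * (d\<^sup>2 / r\<^sup>2) + 2 * B * real CARD('m) * (d / r) + 12 * (d / r\<^sup>2) + 2 * d / r \<le> \<epsilon>"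
 defines "a \<equiv> ball_mass (f k) x0 d"
 shows "\<bar>(2 + 2 * e0) * a - a\<^sup>2 / (2 * pi)\<bar> \<le> \<epsilon> * (3 * M + 2 * (8 + C / c + 2 * B * real CARD('m) + 2 * B) + M\<^sup>2 + 32 * M)"
proof -
 define V where "V = virial_density p (K k) (b k) x0 r 0"
 define k2 where "k2 = bump_kernel x0 r"
 define N where "N = real CARD('m)"
 define D where "D x = (indicator (ball x0 d) x :: real)" for x
 \<comment> \<open>The annulus between the inner ball \<open>D\<close> and the edge of the support.
   Integrands are controlled there only up to constants, but its mass is at most
   \<open>2 * \<epsilon>\<close> because both ball masses are close to the atom.\<close>
 define A where "A x = (indicator (ball x0 r - ball x0 d) x :: real)" for x
 have e_nonneg: "\<epsilon> \<ge> 0" using e0 by linarith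
 have dr: "d \<le> r" "d \<le> 1" using d r by auto
 have C0: "C \<ge> 0" using Kb(2)[OF x0] by (meson norm_ge_zero order_trans)
 have CN: "N \<ge> 0" by (simp add: N_def)
 note vi = virial_identity[OF inj_p range_p K_C1[of k] b_gt[of k] pot[of k] x0 r]
 have vd: "virial_density p (K k) (b k) x0 r e x = tangential_trace (bump_field_deriv x0 r) x
   + grad_S2 (K k) x \<bullet> bump_field x0 r x / K k x + 2 * (\<Sum>i\<in>UNIV. b k $ i * log_reg_deriv e (p i) x (bump_field x0 r x))" for e x
  by (subst virial_density_def[OF inj_p range_p K_C1[of k] b_gt[of k] pot[of k] x0 r]) auto
 note fi = f_integrable[of k] and f0 = f_nonneg[of _ k]
 have M0: "(\<ointegral>x. f k x) \<le> M" using m by (simp add: f_mass)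
 have Mn: "M \<ge> 0" using M0 integral_nonneg_AE[OF AE_I2, of area_S2 "f k"] f0 by (metis order_trans space_area)
 have iD: "integrable area_S2 (\<lambda>x. D x * f k x)" unfolding D_def by (rule integrable_indicator_borel[OF fi]) simp
 have iA: "integrable area_S2 (\<lambda>x. A x * f k x)" unfolding A_def by (rule integrable_indicator_borel[OF fi]) simp
 have aD: "a = (\<ointegral>x. D x * f k x)" by (simp add: a_def D_def)
 have AA: "(\<ointegral>x. A x * f k x) \<le> 2 * \<epsilon>"
 proof -
  have "A x = indicator (ball x0 r) x - D x" for x
   using dr by (auto simp: A_def D_def indicator_def)
  then have "(\<ointegral>x. A x * f k x) = (\<ointegral>x. indicator (ball x0 r) x * f k x - D x * f k x)"
   by (simp add: left_diff_distrib)
  also have "... = ball_mass (f k) x0 r - a"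
   using iD integrable_indicator_ball[OF fi] by (simp add: aD)
  finally show ?thesis using ann by (simp add: a_def)
 qed
 have Ann: "(\<ointegral>x. A x * f k x) \<ge> 0" using f0 by (intro integral_nonneg_AE AE_I2) (auto simp: A_def)
 have a0: "a \<ge> 0" unfolding aD using f0 by (intro integral_nonneg_AE AE_I2) (auto simp: D_def)
 have aM: "a \<le> M"
 proof -
  have "a \<le> (\<ointegral>x. f k x)" unfolding aD
   using f0 by (intro integral_mono iD fi) (auto simp: D_def indicator_def)
  then show ?thesis using M0 by simp
 qed
 define V0 where "V0 = 8 + C / c + 2 * B * N + 2 * B"
 have pos: "0 \<le> C / c" "0 \<le> 2 * B * N" using C0 c B CN by auto
 have smalls: "9 * (d\<^sup>2 / r\<^sup>2) + C / c * d + 6 * B * (d\<^sup>2 / r\<^sup>2) + 2 * B * N * (d / r) \<le> \<epsilon>"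
  "12 * (d / r\<^sup>2) \<le> \<epsilon>" "2 * d / r \<le> \<epsilon>"
 proof -
  have nn: "0 \<le> 9 * (d\<^sup>2 / r\<^sup>2)" "0 \<le> C / c * d" "0 \<le> 6 * B * (d\<^sup>2 / r\<^sup>2)" "0 \<le> 2 * B * N * (d / r)" "0 \<le> 12 * (d / r\<^sup>2)" "0 \<le> 2 * d / r"
   using C0 c B CN d r by auto
  show "9 * (d\<^sup>2 / r\<^sup>2) + C / c * d + 6 * B * (d\<^sup>2 / r\<^sup>2) + 2 * B * N * (d / r) \<le> \<epsilon>"
   "12 * (d / r\<^sup>2) \<le> \<epsilon>" "2 * d / r \<le> \<epsilon>"
   using small nn unfolding N_def[symmetric] by linarith+
 qed
 \<comment> \<open>On the inner ball the divergence contributes 2 and the logarithm at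
   \<open>x0\<close> contributes \<open>2 * e0\<close>, all other terms being of the order of powers
   of \<open>d\<close>; on the annulus \<open>V0\<close> is a crude bound, and farther out the field
   vanishes.\<close>
 have Vb: "\<bar>V x - (2 + 2 * e0) * D x\<bar> \<le> 3 * \<epsilon> + V0 * A x" if x: "x \<in> S2" "x \<noteq> x0" for x
 proof -
  let ?X = "bump_field x0 r x" and ?\<rho> = "dist x x0"
  let ?l = "\<lambda>i. log_reg_deriv 0 (p i) x ?X"
  have split: "(\<Sum>i\<in>UNIV. b k $ i * ?l i) = cone_exponent p (b k) x0 * log_reg_deriv 0 x0 x ?X + (\<Sum>i | p i \<noteq> x0. b k $ i * ?l i)"
  proof -
   have "(\<Sum>i\<in>UNIV. b k $ i * ?l i) = (\<Sum>i | p i = x0. b k $ i * ?l i) + (\<Sum>i | p i \<noteq> x0. b k $ i * ?l i)"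
    by (subst sum.union_disjoint[symmetric]) (auto intro!: sum.cong)
   also have "(\<Sum>i | p i = x0. b k $ i * ?l i) = cone_exponent p (b k) x0 * log_reg_deriv 0 x0 x ?X"
    unfolding cone_exponent_def sum_distrib_right by (rule sum.cong) auto
   finally show ?thesis .
  qed
  have ceB: "\<bar>cone_exponent p (b k) x0\<bar> \<le> B" by (rule abs_cone_exponent_le[OF inj_p Bb B])
  have gK: "\<bar>grad_S2 (K k) x \<bullet> ?X / K k x\<bar> \<le> C / c * norm ?X"
  proof -
   have "\<bar>grad_S2 (K k) x \<bullet> ?X\<bar> \<le> C * norm ?X"
    using Cauchy_Schwarz_ineq2[of "grad_S2 (K k) x" ?X] mult_right_mono[OF Kb(2)[OF x(1)], of "norm ?X"] by simp
   then have "\<bar>grad_S2 (K k) x \<bullet> ?X\<bar> / \<bar>K k x\<bar> \<le> (C * norm ?X) / c"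
    using Kb(1)[OF x(1)] c C0 by (intro frac_le) auto
   then show ?thesis by (simp add: abs_divide)
  qed
  have far: "\<bar>\<Sum>i | p i \<noteq> x0. b k $ i * ?l i\<bar> \<le> B * N * (norm ?X / r)" if "?\<rho> < r"
  proof -
   have "\<bar>b k $ i * ?l i\<bar> \<le> B * (norm ?X / r)" if i: "p i \<noteq> x0" for i
   proof -
    have "r \<le> dist x (p i)" using r(3)[OF i] \<open>?\<rho> < r\<close> dist_triangle[of "p i" x0 x] by (simp add: dist_commute)
    moreover have "\<bar>?l i\<bar> \<le> norm ?X * dist x (p i) powr (- 1)" by (rule abs_log_reg_deriv_le[OF order_refl])
    moreover have "dist x (p i) powr (- 1) \<le> r powr (- 1)" using calculation(1) r(1) by (intro powr_mono2') auto
    ultimately have "\<bar>?l i\<bar> \<le> norm ?X * r powr (- 1)" by (meson mult_left_mono norm_ge_zero order_trans)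
    then have "\<bar>?l i\<bar> \<le> norm ?X / r" using r(1) by (simp add: powr_minus divide_inverse)
    then show ?thesis unfolding abs_mult using Bb[of i] B r(1) by (intro mult_mono) auto
   qed
   then have "\<bar>\<Sum>i | p i \<noteq> x0. b k $ i * ?l i\<bar> \<le> (\<Sum>i | p i \<noteq> x0. B * (norm ?X / r))"
    by (intro order_trans[OF sum_abs] sum_mono) auto
   also have "... = real (card {i. p i \<noteq> x0}) * (B * (norm ?X / r))" by simp
   also have "... \<le> N * (B * (norm ?X / r))"
    unfolding N_def using B r(1) by (intro mult_right_mono) (auto intro!: card_mono)
   finally show ?thesis by (simp add: mult_ac)
  qed
  have Ve: "V x = tangential_trace (bump_field_deriv x0 r) x + grad_S2 (K k) x \<bullet> ?X / K k x
    + 2 * (cone_exponent p (b k) x0 * log_reg_deriv 0 x0 x ?X + (\<Sum>i | p i \<noteq> x0. b k $ i * ?l i))"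
   unfolding V_def vd split by (rule refl)
  consider "?\<rho> < d" | "d \<le> ?\<rho>" "?\<rho> < r" | "r \<le> ?\<rho>" by linarith
  then show ?thesis
  proof cases
   case 1
   have \<rho>r: "?\<rho> < r" using 1 dr by simp
   have D1: "D x = 1" "A x = 0" using 1 by (auto simp: D_def A_def dist_commute)
   have X: "norm ?X \<le> d" using norm_bump_field_le(1)[OF x0 r(1,2) x(1)] 1 by simp
   have q: "?\<rho>\<^sup>2 / r\<^sup>2 \<le> d\<^sup>2 / r\<^sup>2" using 1 by (intro divide_right_mono power_mono) auto
   have t1: "\<bar>tangential_trace (bump_field_deriv x0 r) x - 2\<bar> \<le> 9 * (d\<^sup>2 / r\<^sup>2)"
    using tangential_trace_bump_bounds(3)[OF x0 r(1,2) x(1)] q by linarith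
   have t2: "\<bar>grad_S2 (K k) x \<bullet> ?X / K k x\<bar> \<le> C / c * d"
    using gK mult_left_mono[OF X pos(1)] by linarith
   have t3: "\<bar>cone_exponent p (b k) x0 * log_reg_deriv 0 x0 x ?X - e0\<bar> \<le> 3 * B * (d\<^sup>2 / r\<^sup>2) + \<epsilon>"
   proof -
    have "\<bar>log_reg_deriv 0 x0 x ?X - 1\<bar> \<le> 3 * (d\<^sup>2 / r\<^sup>2)"
     using radial_bump_field(2)[OF x0 r(1,2) x] q by linarith
    then have "\<bar>cone_exponent p (b k) x0\<bar> * \<bar>log_reg_deriv 0 x0 x ?X - 1\<bar> \<le> B * (3 * (d\<^sup>2 / r\<^sup>2))"
     using ceB B by (intro mult_mono) auto
    then have "\<bar>cone_exponent p (b k) x0 * log_reg_deriv 0 x0 x ?X - cone_exponent p (b k) x0\<bar> \<le> 3 * B * (d\<^sup>2 / r\<^sup>2)"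
     by (simp add: abs_mult[symmetric] right_diff_distrib mult_ac)
    then show ?thesis using e0 by linarith
   qed
   have t4: "\<bar>\<Sum>i | p i \<noteq> x0. b k $ i * ?l i\<bar> \<le> B * N * (d / r)"
   proof -
    have "B * N * (norm ?X / r) \<le> B * N * (d / r)"
     using X r(1) B CN by (intro mult_left_mono divide_right_mono) auto
    then show ?thesis using far[OF \<rho>r] by linarith
   qed
   have "\<bar>V x - (2 + 2 * e0)\<bar> \<le> 9 * (d\<^sup>2 / r\<^sup>2) + C / c * d + 2 * (3 * B * (d\<^sup>2 / r\<^sup>2) + \<epsilon>) + 2 * (B * N * (d / r))"
   proof -
    have "\<bar>T - 2\<bar> \<le> u1 \<Longrightarrow> \<bar>G\<bar> \<le> u2 \<Longrightarrow> \<bar>E - e0\<bar> \<le> u3 \<Longrightarrow> \<bar>S\<bar> \<le> u4 \<Longrightarrow> \<bar>(T + G + 2 * (E + S)) - (2 + 2 * e0)\<bar> \<le> u1 + u2 + 2 * u3 + 2 * u4"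
     for T G E S u1 u2 u3 u4 :: real by (smt (verit))
    from this[OF t1 t2 t3 t4] show ?thesis unfolding Ve .
   qed
   also have "... \<le> 3 * \<epsilon>"
   proof -
    have "u1 + u2 + u3 + u4 \<le> \<epsilon> \<Longrightarrow> u3 = 2 * v3 \<Longrightarrow> u4 = 2 * v4 \<Longrightarrow> u1 + u2 + 2 * (v3 + \<epsilon>) + 2 * v4 \<le> 3 * \<epsilon>"
     for u1 u2 u3 u4 v3 v4 :: real by (smt (verit))
    from this[OF smalls(1), of "3 * B * (d\<^sup>2 / r\<^sup>2)" "B * N * (d / r)"] show ?thesis by simp
   qed
   finally show ?thesis by (simp add: D1)
  next
   case 2
   have D2: "D x = 0" "A x = 1" using 2 by (auto simp: D_def A_def dist_commute)
   have X: "norm ?X \<le> r" "norm ?X \<le> 1" using norm_bump_field_le(3)[OF x0 r(1,2) x(1)] r(2) by auto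
   have t1: "\<bar>tangential_trace (bump_field_deriv x0 r) x\<bar> \<le> 6"
    by (rule tangential_trace_bump_bounds(1)[OF x0 r(1,2) x(1)])
   have t2: "\<bar>grad_S2 (K k) x \<bullet> ?X / K k x\<bar> \<le> C / c"
    using gK mult_left_mono[OF X(2) pos(1)] by simp
   have t3: "\<bar>cone_exponent p (b k) x0 * log_reg_deriv 0 x0 x ?X\<bar> \<le> B"
    using mult_mono[OF ceB radial_bump_field(1)[OF x0 r(1,2) x]] B by (simp add: abs_mult)
   have t4: "\<bar>\<Sum>i | p i \<noteq> x0. b k $ i * ?l i\<bar> \<le> B * N"
   proof -
    have "B * N * (norm ?X / r) \<le> B * N * 1"
     using X r(1) B CN by (intro mult_left_mono) auto
    then show ?thesis using far[OF 2(2)] by simp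
   qed
   have "\<bar>T\<bar> \<le> 6 \<Longrightarrow> \<bar>G\<bar> \<le> u2 \<Longrightarrow> \<bar>E\<bar> \<le> u3 \<Longrightarrow> \<bar>S\<bar> \<le> u4 \<Longrightarrow> \<bar>T + G + 2 * (E + S)\<bar> \<le> 8 + u2 + 2 * u4 + 2 * u3"
    for T G E S u2 u3 u4 :: real by (smt (verit))
   from this[OF t1 t2 t3 t4] have "\<bar>V x\<bar> \<le> V0" unfolding Ve V0_def by simp
   then show ?thesis using e_nonneg by (simp add: D2)
  next
   case 3
   have "?X = 0" by (rule norm_bump_field_le(2)[OF x0 r(1,2) x(1) 3])
   moreover have "tangential_trace (bump_field_deriv x0 r) x = 0"
    by (rule tangential_trace_bump_bounds(2)[OF x0 r(1,2) x(1) 3])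
   ultimately have "V x = 0" unfolding V_def vd by (simp add: log_reg_deriv_def)
   moreover have "D x = 0" "A x = 0" using 3 dr by (auto simp: D_def A_def dist_commute)
   ultimately show ?thesis using e_nonneg by simp
  qed
 qed
 have L: "\<bar>(\<ointegral>x. f k x * V x) - (2 + 2 * e0) * a\<bar> \<le> 3 * \<epsilon> * M + V0 * (2 * \<epsilon>)"
 proof -
  have iV: "integrable area_S2 (\<lambda>x. f k x * V x)" unfolding V_def by (rule vi(2))
  have "(\<ointegral>x. f k x * V x) - (2 + 2 * e0) * a = (\<ointegral>x. f k x * V x - (2 + 2 * e0) * (D x * f k x))"
   using iV iD by (simp add: aD)
  also have "\<bar>...\<bar> \<le> (\<ointegral>x. \<bar>f k x * V x - (2 + 2 * e0) * (D x * f k x)\<bar>)" by (rule integral_abs_bound)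
  also have "... \<le> (\<ointegral>x. 3 * \<epsilon> * f k x + V0 * (A x * f k x))"
  proof (rule integral_mono_AE)
   show "AE x in area_S2. \<bar>f k x * V x - (2 + 2 * e0) * (D x * f k x)\<bar> \<le> 3 * \<epsilon> * f k x + V0 * (A x * f k x)"
    using AE_area_neq[of x0] AE_space
   proof eventually_elim
    case (elim x)
    then have x: "x \<in> S2" "x \<noteq> x0" by auto
    have "f k x * V x - (2 + 2 * e0) * (D x * f k x) = f k x * (V x - (2 + 2 * e0) * D x)" by (simp add: algebra_simps)
    then have "\<bar>f k x * V x - (2 + 2 * e0) * (D x * f k x)\<bar> = f k x * \<bar>V x - (2 + 2 * e0) * D x\<bar>"
     using f0[OF x(1)] by (simp add: abs_mult)
    also have "... \<le> f k x * (3 * \<epsilon> + V0 * A x)" by (rule mult_left_mono[OF Vb[OF x] f0[OF x(1)]])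
    finally show ?case by (simp add: algebra_simps)
   qed
  qed (use iV iD iA fi in auto)
  also have "... = 3 * \<epsilon> * (\<ointegral>x. f k x) + V0 * (\<ointegral>x. A x * f k x)" using fi iA by simp
  also have "... \<le> 3 * \<epsilon> * M + V0 * (2 * \<epsilon>)"
   using M0 AA e_nonneg pos B by (intro add_mono mult_left_mono) (auto simp: V0_def)
  finally show ?thesis .
 qed
 \<comment> \<open>The kernel is close to 1 when both points are in the inner ball and close to 0
   when one is inside and the other beyond \<open>r\<close>; pairs touching the annulus are absorbed
   by the bound 8.\<close>
 have k2b: "\<bar>k2 x y - D x * D y\<bar> \<le> \<epsilon> + 8 * (A x + A y)" if x: "x \<in> S2" and y: "y \<in> S2" and ne: "x \<noteq> y" for x y
 proof -
  note kb = bump_kernel_bounds[OF x0 r(1,2)]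
  have sym: "k2 x y = k2 y x"
  proof -
   have "(bump_field x0 r x - bump_field x0 r y) \<bullet> (x - y) = (bump_field x0 r y - bump_field x0 r x) \<bullet> (y - x)"
    by (simp add: inner_simps)
   then show ?thesis unfolding k2_def bump_kernel_def[OF x0 r(1,2)] by (simp add: dist_commute)
  qed
  have A0: "0 \<le> A x" "0 \<le> A y" by (auto simp: A_def)
  consider "d \<le> dist x x0 \<and> dist x x0 < r \<or> d \<le> dist y x0 \<and> dist y x0 < r"
   | "dist x x0 < d" "dist y x0 < d" | "dist x x0 < d" "r \<le> dist y x0" | "r \<le> dist x x0" "dist y x0 < d"
   | "r \<le> dist x x0" "r \<le> dist y x0" by linarith
  then show ?thesis
  proof cases
   case 1
   then have "D x * D y = 0" "1 \<le> A x + A y" by (auto simp: D_def A_def dist_commute indicator_def)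
   then show ?thesis using kb(1)[OF x y] e_nonneg unfolding k2_def by (smt (verit))
  next
   case 2
   then have "D x * D y = 1" by (auto simp: D_def dist_commute)
   then show ?thesis using kb(2)[OF x y ne, of d] 2 dr smalls(2) A0 unfolding k2_def by (smt (verit))
  next
   case 3
   then have "D x * D y = 0" using dr by (auto simp: D_def dist_commute)
   then show ?thesis using kb(4)[OF x y, of d] 3 d(2) smalls(3) A0 unfolding k2_def by (smt (verit))
  next
   case 4
   then have "D x * D y = 0" using dr by (auto simp: D_def dist_commute)
   then show ?thesis using kb(4)[OF y x, of d] 4 d(2) smalls(3) A0 unfolding sym unfolding k2_def by (smt (verit))
  next
   case 5
   then have "D x * D y = 0" using dr by (auto simp: D_def dist_commute)
   then show ?thesis using kb(3)[OF x y] 5 A0 e_nonneg unfolding k2_def by (smt (verit))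
  qed
 qed
 have R: "\<bar>(\<ointegral>x. (\<ointegral>y. f k x * f k y * k2 x y)) - a\<^sup>2\<bar> \<le> \<epsilon> * M\<^sup>2 + 32 * \<epsilon> * M"
 proof -
  have ik: "integrable (area_S2 \<Otimes>\<^sub>M area_S2) (\<lambda>(x, y). f k x * f k y * k2 x y)" unfolding k2_def by (rule vi(3))
  define H where "H x = (\<ointegral>y. f k x * f k y * k2 x y)" for x
  define F where "F = (\<ointegral>y. f k y)"
  define AI where "AI = (\<ointegral>y. A y * f k y)"
  have iH: "integrable area_S2 H" unfolding H_def by (rule area2.integrable_fst[OF ik])
  have F: "0 \<le> F" "F \<le> M" using M0 f0 by (auto simp: F_def intro!: integral_nonneg_AE AE_I2)
  have Hb: "AE x in area_S2. \<bar>H x - a * (D x * f k x)\<bar> \<le> (\<epsilon> * F + 8 * AI) * f k x + 8 * F * (A x * f k x)"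
   using area2.AE_integrable_fst[OF ik] AE_space
  proof eventually_elim
   case (elim x)
   then have x: "x \<in> S2" and ix: "integrable area_S2 (\<lambda>y. f k x * f k y * k2 x y)" by auto
   have "H x - a * (D x * f k x) = (\<ointegral>y. f k x * f k y * k2 x y - (f k x * D x) * (D y * f k y))"
    by (subst Bochner_Integration.integral_diff[OF ix integrable_mult_right[OF iD]]) (simp add: H_def aD)
   also have "\<bar>...\<bar> \<le> (\<ointegral>y. \<bar>f k x * f k y * k2 x y - (f k x * D x) * (D y * f k y)\<bar>)" by (rule integral_abs_bound)
   also have "... \<le> (\<ointegral>y. (f k x * (\<epsilon> + 8 * A x)) * f k y + (8 * f k x) * (A y * f k y))"
   proof (rule integral_mono_AE)
    show "AE y in area_S2. \<bar>f k x * f k y * k2 x y - (f k x * D x) * (D y * f k y)\<bar>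
     \<le> (f k x * (\<epsilon> + 8 * A x)) * f k y + (8 * f k x) * (A y * f k y)"
     using AE_area_neq[of x] AE_space
    proof eventually_elim
     case (elim y)
     then have y: "y \<in> S2" "x \<noteq> y" by auto
     have "f k x * f k y * k2 x y - (f k x * D x) * (D y * f k y) = f k x * f k y * (k2 x y - D x * D y)"
      by (simp add: algebra_simps)
     then have "\<bar>f k x * f k y * k2 x y - (f k x * D x) * (D y * f k y)\<bar> = f k x * f k y * \<bar>k2 x y - D x * D y\<bar>"
      using f0[OF x] f0[OF y(1)] by (simp add: abs_mult)
     also have "... \<le> f k x * f k y * (\<epsilon> + 8 * (A x + A y))"
      using f0[OF x] f0[OF y(1)] by (intro mult_left_mono k2b x y) auto
     finally show ?case by (simp add: algebra_simps)
    qed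
   qed (use ix iD iA fi in auto)
   also have "... = (f k x * (\<epsilon> + 8 * A x)) * F + (8 * f k x) * AI" using fi iA by (simp add: F_def AI_def)
   finally show ?case by (simp add: algebra_simps)
  qed
  have "(\<ointegral>x. H x) - a\<^sup>2 = (\<ointegral>x. H x - a * (D x * f k x))"
   using iH iD by (simp add: power2_eq_square aD[symmetric])
  also have "\<bar>...\<bar> \<le> (\<ointegral>x. \<bar>H x - a * (D x * f k x)\<bar>)" by (rule integral_abs_bound)
  also have "... \<le> (\<ointegral>x. (\<epsilon> * F + 8 * AI) * f k x + 8 * F * (A x * f k x))"
   by (rule integral_mono_AE[OF _ _ Hb]) (use iH iD iA fi in auto)
  also have "... = (\<epsilon> * F + 8 * AI) * F + 8 * F * AI" using fi iA by (simp add: F_def AI_def)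
  also have "... = \<epsilon> * (F * F) + 16 * (F * AI)" by (simp add: algebra_simps)
  also have "... \<le> \<epsilon> * (M * M) + 16 * (M * (2 * \<epsilon>))"
   using F AA Ann e_nonneg Mn unfolding AI_def by (intro add_mono mult_left_mono mult_mono) auto
  finally show ?thesis unfolding H_def by (simp add: power2_eq_square mult_ac)
 qed
 have eq: "(\<ointegral>x. f k x * V x) = (\<ointegral>x. (\<ointegral>y. f k x * f k y * k2 x y)) / (2 * pi)"
  unfolding V_def k2_def by (rule vi(1))
 define II where "II = (\<ointegral>x. (\<ointegral>y. f k x * f k y * k2 x y))"
 have R': "\<bar>II / (2 * pi) - a\<^sup>2 / (2 * pi)\<bar> \<le> \<epsilon> * M\<^sup>2 + 32 * \<epsilon> * M"
 proof -
  have "\<bar>II / (2 * pi) - a\<^sup>2 / (2 * pi)\<bar> = \<bar>II - a\<^sup>2\<bar> / (2 * pi)" by (simp add: diff_divide_distrib[symmetric] abs_divide)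
  also have "... \<le> \<bar>II - a\<^sup>2\<bar>" using pi_gt3 by (simp add: divide_le_eq mult_le_cancel_left1)
  finally show ?thesis using R unfolding II_def by linarith
 qed
 have "\<bar>(2 + 2 * e0) * a - a\<^sup>2 / (2 * pi)\<bar> \<le> (3 * \<epsilon> * M + V0 * (2 * \<epsilon>)) + (\<epsilon> * M\<^sup>2 + 32 * \<epsilon> * M)"
  using L R' unfolding eq II_def by linarith
 also have "... = \<epsilon> * (3 * M + 2 * (8 + C / c + 2 * B * real CARD('m) + 2 * B) + M\<^sup>2 + 32 * M)"
  by (simp add: V0_def N_def algebra_simps)
 finally show ?thesis .
qed

end

subsection \<open>Quantisation of atoms and collapse of the rest\<close>

text \<open>On the shell \<open>dist x x0 / d\<close> lies in [1, 2), which costs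
  \<open>2 powr (- (2 * B))\<close>; each other cone factor is at least
  \<open>(2 / r) powr (- (2 * B))\<close>. The exponent of \<open>d\<close> may be raised to
  \<open>E\<close> because \<open>d \<le> 1\<close>.\<close>

lemma conic_weight_local_lower:
 fixes p :: "'m::finite \<Rightarrow> real^3"
 assumes p: "inj p" "range p \<subseteq> S2" and x: "x \<in> S2" "d \<le> dist x x0" "dist x x0 < 2 * d"
  and r: "0 < r" "r \<le> 1" "\<And>i. p i \<noteq> x0 \<Longrightarrow> 2 * r \<le> dist (p i) x0" and d: "0 < d" "2 * d \<le> r"
  and B: "\<And>i. \<bar>\<beta> $ i\<bar> \<le> B" "\<bar>cone_exponent p \<beta> x0\<bar> \<le> B" and E: "2 * cone_exponent p \<beta> x0 \<le> E"
 shows "(2 powr (- (2 * B)) * ((2 / r) powr (- (2 * B))) ^ CARD('m)) * d powr E \<le> conic_weight p \<beta> x"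
proof -
 let ?t = "(2 / r) powr (- (2 * B))" and ?e = "cone_exponent p \<beta> x0"
 have B0: "B \<ge> 0" using B(2) by linarith
 have t: "0 \<le> ?t" "?t \<le> 1"
 proof -
  have "?t \<le> (2 / r) powr 0" using r B0 by (intro powr_mono) (auto simp: field_simps)
  then show "?t \<le> 1" using r by simp
 qed simp
 have "?t ^ CARD('m) \<le> ?t ^ card {i. p i \<noteq> x0}" using t by (intro power_decreasing) (auto intro!: card_mono)
 also have "... = (\<Prod>i | p i \<noteq> x0. ?t)" by simp
 also have "... \<le> (\<Prod>i | p i \<noteq> x0. dist x (p i) powr (2 * \<beta> $ i))"
 proof (rule prod_mono, intro conjI t)
  fix i assume "i \<in> {i. p i \<noteq> x0}"
  then have "r \<le> dist x (p i)" using r(3)[of i] x(3) d dist_triangle[of "p i" x0 x] by (simp add: dist_commute)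
  moreover have "dist x (p i) \<le> 2" using dist_S2(3)[OF x(1)] p(2) by blast
  ultimately have "dist x (p i) powr (- (2 * \<beta> $ i)) \<le> (2 / r) powr (2 * B)" "dist x (p i) > 0"
   using r B(1)[of i] by (auto intro!: powr_le_abs)
  then show "?t \<le> dist x (p i) powr (2 * \<beta> $ i)"
   using r by (simp add: powr_minus field_simps)
 qed
 finally have 1: "?t ^ CARD('m) \<le> (\<Prod>i | p i \<noteq> x0. dist x (p i) powr (2 * \<beta> $ i))" .
 have "(dist x x0 / d) powr (- (2 * ?e)) \<le> (2 / 1) powr (2 * B)"
  using x d B(2) by (intro powr_le_abs) (auto simp: field_simps)
 then have "inverse (2 powr (2 * B)) \<le> inverse ((dist x x0 / d) powr (- (2 * ?e)))"
  using x d by (intro le_imp_inverse_le) auto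
 then have "2 powr (- (2 * B)) \<le> (dist x x0 / d) powr (2 * ?e)" by (simp add: powr_minus)
 then have "2 powr (- (2 * B)) * d powr (2 * ?e) \<le> dist x x0 powr (2 * ?e)"
  using d by (simp add: powr_divide field_simps)
 moreover have "d powr E \<le> d powr (2 * ?e)" using d r E by (intro powr_mono') auto
 ultimately have 2: "2 powr (- (2 * B)) * d powr E \<le> dist x x0 powr (2 * ?e)"
  by (meson mult_left_mono order_trans powr_ge_zero)
 have "x \<noteq> x0" using x d by auto
 have "(2 powr (- (2 * B)) * d powr E) * ?t ^ CARD('m) \<le> conic_weight p \<beta> x"
  unfolding conic_weight_local_eq[OF p(1) \<open>x \<noteq> x0\<close>] using t by (intro mult_mono 1 2) auto
 then show ?thesis by (simp add: mult_ac)
qed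

lemma concentratesD:
 assumes "concentrates f x \<sigma>" "\<epsilon> > 0"
 shows "\<exists>R>0. \<forall>r. 0 < r \<and> r < R \<longrightarrow>
  (\<forall>\<^sub>F k in sequentially. \<bar>ball_mass (f k) x r - \<sigma>\<bar> < \<epsilon>)"
 using assms unfolding concentrates_def by (elim allE impE)

context liouville_sequence
begin

text \<open>For every \<open>\<epsilon>\<close> some ball mass within \<open>\<epsilon>\<close> of
  \<sigma> solves the quadratic equation up to a multiple of \<open>\<epsilon>\<close>. In the limit
  \<sigma> is one of its two roots.\<close>

theorem quantization:
 assumes x0: "x0 \<in> S2" and conc: "concentrates f x0 \<sigma>"
 shows "\<sigma> = 0 \<or> \<sigma> = 4 * pi * (1 + cone_exponent p b0 x0)"
proof -
 let ?e = "cone_exponent p b0 x0"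
 obtain B where B: "B \<ge> 0" "\<forall>\<^sub>F k in sequentially. \<forall>i. \<bar>b k $ i\<bar> \<le> B" using eventually_b_bounded by blast
 obtain c C where cC: "0 < c" "\<forall>\<^sub>F k in sequentially. \<forall>x\<in>S2. c \<le> K k x \<and> K k x \<le> C \<and> norm (grad_S2 (K k) x) \<le> C"
  using eventually_K_bounded by blast
 define M where "M = \<bar>total_mass b0\<bar> + 1"
 \<comment> \<open>The error factor of \<open>virial_estimate\<close>. It depends neither on the
   tolerance nor on the radii \<open>r\<close> and \<open>d\<close>, which are chosen after the
   tolerance.\<close>
 define Q where "Q = 3 * M + 2 * (8 + C / c + 2 * B * real CARD('m) + 2 * B) + M\<^sup>2 + 32 * M"
 obtain r2 where r2: "0 < r2" "r2 \<le> 1" "\<And>i. p i \<noteq> x0 \<Longrightarrow> 2 * r2 \<le> dist (p i) x0"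
  using isolating_radius[of p x0] by blast
 have *: "\<exists>a. \<bar>a - \<sigma>\<bar> \<le> \<epsilon> \<and> \<bar>(2 + 2 * ?e) * a - a\<^sup>2 / (2 * pi)\<bar> \<le> \<epsilon> * Q" if \<epsilon>: "\<epsilon> > 0" for \<epsilon>
 proof -
  obtain R where R: "R > 0" "\<And>r. 0 < r \<Longrightarrow> r < R \<Longrightarrow>
    \<forall>\<^sub>F k in sequentially. \<bar>ball_mass (f k) x0 r - \<sigma>\<bar> < \<epsilon>"
   using concentratesD[OF conc \<epsilon>] by auto
  define r where "r = min (R / 2) r2"
  have r: "0 < r" "r \<le> 1" "r < R" "\<And>i. p i \<noteq> x0 \<Longrightarrow> 2 * r \<le> dist (p i) x0"
  proof -
   have le: "r \<le> R / 2" "r \<le> r2" by (auto simp: r_def)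
   show "0 < r" using R(1) r2(1) by (simp add: r_def)
   show "r \<le> 1" "r < R" using le R(1) r2(2) by linarith+
   show "2 * r \<le> dist (p i) x0" if "p i \<noteq> x0" for i using le(2) r2(3)[OF that] by linarith
  qed
  \<comment> \<open>The errors of the inner scale \<open>d\<close> relative to the outer scale
    \<open>r\<close>: concentration and isolation fix \<open>r\<close> first, and then these tend to
    0 with \<open>d\<close>.\<close>
  let ?S = "\<lambda>d. 9 * (d\<^sup>2 / r\<^sup>2) + C / c * d + 6 * B * (d\<^sup>2 / r\<^sup>2) + 2 * B * real CARD('m) * (d / r) + 12 * (d / r\<^sup>2) + 2 * d / r"
  have "(?S \<longlongrightarrow> 0) (at_right 0)" using r(1) cC(1) by (auto intro!: tendsto_eq_intros)
  then have "\<forall>\<^sub>F d in at_right 0. ?S d < \<epsilon>" using \<epsilon> by (rule order_tendstoD)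
  moreover have "\<forall>\<^sub>F d in at_right 0. 0 < d \<and> d < r / 2"
   using r(1) eventually_at_right_less eventually_at_right_real[of 0 "r / 2"] by auto
  ultimately have "\<forall>\<^sub>F d in at_right 0. ?S d < \<epsilon> \<and> 0 < d \<and> d < r / 2" by eventually_elim simp
  then obtain d where d: "?S d < \<epsilon>" "0 < d" "d < r / 2"
   using eventually_happens[of _ "at_right (0::real)"] by auto
  have "(\<lambda>k. cone_exponent p (b k) x0) \<longlonglongrightarrow> ?e" by (rule tendsto_cone_exponent[OF b_lim])
  then have "\<forall>\<^sub>F k in sequentially. dist (cone_exponent p (b k) x0) ?e < \<epsilon>" using \<epsilon> by (rule tendstoD)
  moreover have "\<forall>\<^sub>F k in sequentially. \<bar>ball_mass (f k) x0 d - \<sigma>\<bar> < \<epsilon>"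
   using d r by (intro R) auto
  moreover have "\<forall>\<^sub>F k in sequentially. \<bar>ball_mass (f k) x0 r - \<sigma>\<bar> < \<epsilon>"
   using r by (intro R) auto
  ultimately have "\<forall>\<^sub>F k in sequentially. \<exists>a. \<bar>a - \<sigma>\<bar> \<le> \<epsilon> \<and> \<bar>(2 + 2 * ?e) * a - a\<^sup>2 / (2 * pi)\<bar> \<le> \<epsilon> * Q"
   using eventually_mass B(2) cC(2)
  proof eventually_elim
   case (elim k)
   have "\<bar>(2 + 2 * ?e) * ball_mass (f k) x0 d
     - (ball_mass (f k) x0 d)\<^sup>2 / (2 * pi)\<bar> \<le> \<epsilon> * Q"
    unfolding Q_def
   proof (rule virial_estimate[OF x0 r(1,2,4) d(2) _ _ _ cC(1) _ B(1)])
    show "total_mass (b k) \<le> M" using elim by (simp add: M_def f_mass)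
   qed (use elim d in \<open>auto simp: dist_real_def\<close>)
   then show ?case using elim(2) less_imp_le by blast
  qed
  then show ?thesis using eventually_happens[of _ sequentially] by auto
 qed
 then have "\<forall>n. \<exists>a. \<bar>a - \<sigma>\<bar> \<le> inverse (real (Suc n)) \<and> \<bar>(2 + 2 * ?e) * a - a\<^sup>2 / (2 * pi)\<bar> \<le> inverse (real (Suc n)) * Q" by simp
 then obtain a where a: "\<And>n. \<bar>a n - \<sigma>\<bar> \<le> inverse (real (Suc n))"
  "\<And>n. \<bar>(2 + 2 * ?e) * a n - (a n)\<^sup>2 / (2 * pi)\<bar> \<le> inverse (real (Suc n)) * Q" by metis
 have "(\<lambda>n. a n - \<sigma>) \<longlonglongrightarrow> 0"
  by (rule Lim_null_comparison[OF _ LIMSEQ_inverse_real_of_nat]) (use a(1) in auto)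
 then have "a \<longlonglongrightarrow> \<sigma>" by (simp add: LIM_zero_iff)
 then have "(\<lambda>n. (2 + 2 * ?e) * a n - (a n)\<^sup>2 / (2 * pi)) \<longlonglongrightarrow> (2 + 2 * ?e) * \<sigma> - \<sigma>\<^sup>2 / (2 * pi)"
  by (intro tendsto_intros) auto
 moreover have "(\<lambda>n. (2 + 2 * ?e) * a n - (a n)\<^sup>2 / (2 * pi)) \<longlonglongrightarrow> 0"
 proof (rule Lim_null_comparison)
  show "(\<lambda>n. inverse (real (Suc n)) * Q) \<longlonglongrightarrow> 0" by (rule tendsto_mult_left_zero[OF LIMSEQ_inverse_real_of_nat])
 qed (use a(2) in auto)
 ultimately have "(2 + 2 * ?e) * \<sigma> - \<sigma>\<^sup>2 / (2 * pi) = 0" by (rule LIMSEQ_unique)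
 then have "\<sigma> * (4 * pi * (1 + ?e) - \<sigma>) = 0" by (simp add: field_simps power2_eq_square)
 then show ?thesis by auto
qed

text \<open>Near an atom of mass \<open>4 \<pi> (1 + e)\<close> the density exceeds \<open>\<kappa> \<delta>\<^bsup>2e - 4(1 + e)\<^esup>\<close> on the shell of radius
 \<open>\<delta>\<close>, up to small errors in the exponent, so its mass there exceeds \<open>\<kappa> \<delta>\<^bsup>- 2(1 + e)\<^esup>\<close>.\<close>

lemma shell_mass_bound:
 assumes x0: "x0 \<in> S2" and r: "0 < r" "r \<le> 1" "\<And>i. p i \<noteq> x0 \<Longrightarrow> 2 * r \<le> dist (p i) x0" and d: "0 < d" "2 * d \<le> r"
  and Kb: "\<And>x. x \<in> S2 \<Longrightarrow> c \<le> K k x" and c: "0 < c" and B: "\<And>i. \<bar>b k $ i\<bar> \<le> B" "0 \<le> B"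
  and m: "total_mass (b k) \<le> M" and E: "2 * cone_exponent p (b k) x0 \<le> E"
  and A: "0 \<le> A" "A \<le> ball_mass (f k) x0 d"
 shows "\<kappa> k * (c * (2 powr (- (2 * B)) * ((2 / r) powr (- (2 * B))) ^ CARD('m)) * (2 / 3) powr (A / pi) * (3 * pi))
   \<le> M * d powr (A / pi - 2 - E)"
proof -
 define T where "T = {x. d \<le> dist x x0 \<and> dist x x0 < 2 * d}"
 have Tb: "T \<in> sets borel" unfolding T_def by measurable
 define t where "t = 2 powr (- (2 * B)) * ((2 / r) powr (- (2 * B))) ^ CARD('m)"
 have t: "t \<ge> 0" by (simp add: t_def)
 have d3: "3 * d \<le> 2" using d r by simp
 obtain W where W: "\<And>x. x \<in> S2 \<Longrightarrow> integrable area_S2 (\<lambda>y. f k y * log_pot_kernel x y)"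
  using potential_form_log_pot_bounded[OF inj_p range_p K_C1 b_gt pot] by blast
 define Lw where "Lw = c * (t * d powr E) * (2 / (3 * d)) powr (A / pi)"
 have low: "\<kappa> k * Lw \<le> f k x" if x: "x \<in> S2" "x \<in> T" for x
 proof -
  \<comment> \<open>A point of the shell lies within \<open>3 * d\<close> of every point of the ball
    of radius \<open>d\<close>, so the mass in this ball alone contributes at least
    \<open>A * ln (2 / (3 * d))\<close>; the logarithm is nonnegative because
    \<open>3 * d \<le> 2\<close>.\<close>
  have l: "ln (2 / (3 * d)) \<ge> 0" using d(1) d3 by (intro ln_ge_zero) simp
  have "A * ln (2 / (3 * d)) \<le> ball_mass (f k) x0 d * ln (2 / (3 * d))"
   by (rule mult_right_mono[OF A(2) l])
  also have "... = (\<ointegral>y. indicator (ball x0 d) y * f k y * ln (2 / (3 * d)))" by simp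
  also have "... \<le> (\<ointegral>y. f k y * log_pot_kernel x y)"
  proof (rule integral_mono)
   fix y assume "y \<in> space area_S2"
   then have y: "y \<in> S2" by simp
   show "indicator (ball x0 d) y * f k y * ln (2 / (3 * d)) \<le> f k y * log_pot_kernel x y"
   proof (cases "dist x0 y < d")
    case True
    have "dist x y < 3 * d" using x(2) True dist_triangle[of x y x0] by (simp add: T_def)
    moreover have "dist x y > 0" using x(2) True by (auto simp: T_def dist_commute)
    ultimately have "ln (2 / (3 * d)) \<le> log_pot_kernel x y"
     unfolding log_pot_kernel_def using d(1) by (subst ln_le_cancel_iff) (auto intro!: divide_left_mono)
    then show ?thesis using True f_nonneg[OF y, of k] by (simp add: mult_left_mono)
   qed (simp add: f_nonneg[OF y] log_pot_kernel_nonneg[OF x(1) y])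
  qed (use W[OF x(1)] integrable_indicator_ball[OF f_integrable] in auto)
  finally have "A / pi * ln (2 / (3 * d)) \<le> 2 * log_pot (f k) x" by (simp add: log_pot_def field_simps)
  then have "exp (A / pi * ln (2 / (3 * d))) \<le> exp (2 * log_pot (f k) x)" by simp
  then have e: "(2 / (3 * d)) powr (A / pi) \<le> exp (2 * log_pot (f k) x)" using d(1) by (simp add: powr_def)
  have w: "t * d powr E \<le> conic_weight p (b k) x"
   unfolding t_def using x(2) by (intro conic_weight_local_lower[OF inj_p range_p x(1) _ _ r d B(1) abs_cone_exponent_le[OF inj_p B] E]) (auto simp: T_def)
  have "c * (t * d powr E) * (2 / (3 * d)) powr (A / pi) \<le> K k x * conic_weight p (b k) x * exp (2 * log_pot (f k) x)"
   using Kb[OF x(1)] c t e w conic_weight_nonneg[of p "b k" x] by (intro mult_mono) auto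
  then show ?thesis using \<kappa>_pos[of k] by (simp add: Lw_def f_eq[OF x(1)] mult.assoc)
 qed
 have sh: "(\<ointegral>x. indicator T x) = 3 * pi * d\<^sup>2"
  unfolding T_def using d r by (intro measure_spherical_shell x0) auto
 have "\<kappa> k * Lw * (3 * pi * d\<^sup>2) = (\<ointegral>x. indicator T x * (\<kappa> k * Lw))"
  unfolding sh[symmetric] integral_mult_left_zero by (rule mult.commute)
 also have "... \<le> (\<ointegral>x. f k x)"
 proof (rule integral_mono)
  show "integrable area_S2 (\<lambda>x. indicator T x * (\<kappa> k * Lw))" by (intro integrable_indicator_borel Tb) simp
  show "indicator T x * (\<kappa> k * Lw) \<le> f k x" if "x \<in> space area_S2" for x
   using low[of x] f_nonneg[of x k] that by (cases "x \<in> T") auto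
 qed (rule f_integrable)
 also have "... \<le> M" using m by (simp add: f_mass)
 finally have 1: "\<kappa> k * Lw * (3 * pi * d\<^sup>2) \<le> M" .
 have "Lw = c * t * (2 / 3) powr (A / pi) * (d powr E * d powr (- (A / pi)))"
  using d(1) by (simp add: Lw_def powr_divide powr_mult powr_minus field_simps)
 moreover have "d\<^sup>2 = d powr 2" using d(1) by (simp add: powr_numeral)
 ultimately have "\<kappa> k * Lw * (3 * pi * d\<^sup>2) = \<kappa> k * (c * t * (2 / 3) powr (A / pi) * (3 * pi)) * (d powr E * d powr (- (A / pi)) * d powr 2)"
  by (simp add: mult_ac)
 also have "d powr E * d powr (- (A / pi)) * d powr 2 = d powr (- (A / pi - 2 - E))" by (simp add: powr_add[symmetric] algebra_simps)
 finally have "\<kappa> k * (c * t * (2 / 3) powr (A / pi) * (3 * pi)) * d powr (- (A / pi - 2 - E)) \<le> M" using 1 by (simp only:)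
 then have "\<kappa> k * (c * t * (2 / 3) powr (A / pi) * (3 * pi)) * d powr (- (A / pi - 2 - E)) * d powr (A / pi - 2 - E)
   \<le> M * d powr (A / pi - 2 - E)" by (rule mult_right_mono) simp
 moreover have "d powr (- (A / pi - 2 - E)) * d powr (A / pi - 2 - E) = 1" using d(1) by (simp add: powr_add[symmetric])
 ultimately show ?thesis by (simp only: t_def mult.assoc mult_1_right)
qed

theorem \<kappa>_tendsto_zero:
 assumes x0: "x0 \<in> S2" and conc: "concentrates f x0 \<sigma>" and \<sigma>: "\<sigma> \<noteq> 0"
 shows "\<kappa> \<longlonglongrightarrow> 0"
proof (rule tendstoI)
 fix \<eta> :: real assume \<eta>: "\<eta> > 0"
 define m where "m = 1 + cone_exponent p b0 x0"
 have m: "m > 0" using cone_exponent_gt[of p b0 x0, OF inj_p b0_gt] by (simp add: m_def)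
 have \<sigma>m: "\<sigma> = 4 * pi * m" using quantization[OF x0 conc] \<sigma> by (simp add: m_def)
 obtain B where B: "B \<ge> 0" "\<forall>\<^sub>F k in sequentially. \<forall>i. \<bar>b k $ i\<bar> \<le> B" using eventually_b_bounded by blast
 obtain c C where cC: "0 < c" "\<forall>\<^sub>F k in sequentially. \<forall>x\<in>S2. c \<le> K k x \<and> K k x \<le> C \<and> norm (grad_S2 (K k) x) \<le> C"
  using eventually_K_bounded by blast
 define M where "M = \<bar>total_mass b0\<bar> + 1"
 obtain r where r: "0 < r" "r \<le> 1" "\<And>i. p i \<noteq> x0 \<Longrightarrow> 2 * r \<le> dist (p i) x0"
  using isolating_radius[of p x0] by blast
 \<comment> \<open>\<open>A\<close> lies a little below the mass \<open>4 * pi * m\<close>, and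
   \<open>E\<close> a little above \<open>2 * m - 2\<close>, the limit of the weight exponents. Each
   concession costs m / 2 of the ideal exponent \<open>2 * m\<close>, leaving
   \<open>A / pi - 2 - E = m > 0\<close>.\<close>
 define A where "A = 7 / 2 * pi * m"
 define E where "E = 5 / 2 * m - 2"
 define Q where "Q = c * (2 powr (- (2 * B)) * ((2 / r) powr (- (2 * B))) ^ CARD('m)) * (2 / 3) powr (A / pi) * (3 * pi)"
 have Q: "Q > 0" unfolding Q_def using cC(1) r(1) by (intro mult_pos_pos zero_less_power) auto
 have A0: "A \<ge> 0" using m by (simp add: A_def)
 have Am: "A / pi - 2 - E = m" by (simp add: A_def E_def field_simps)
 have "pi * m / 2 > 0" using m by simp
 obtain R where R: "R > 0" "\<And>d. 0 < d \<Longrightarrow> d < R \<Longrightarrow>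
    \<forall>\<^sub>F k in sequentially. \<bar>ball_mass (f k) x0 d - \<sigma>\<bar> < pi * m / 2"
  using concentratesD[OF conc \<open>pi * m / 2 > 0\<close>] by auto
 have "((\<lambda>d. M * d powr m / Q) \<longlongrightarrow> M * 0 / Q) (at_right 0)"
  using m Q eventually_at_right_less[of "0::real"]
  by (intro tendsto_intros tendsto_zero_powrI[where b=m]) (auto elim!: eventually_mono)
 then have "\<forall>\<^sub>F d in at_right 0. M * d powr m / Q < \<eta>" using \<eta> by (auto dest: order_tendstoD)
 moreover have "\<forall>\<^sub>F d in at_right 0. 0 < d \<and> d < min R (r / 2)"
  using r(1) R(1) eventually_at_right_real[of 0 "min R (r / 2)"] by auto
 ultimately have "\<forall>\<^sub>F d in at_right 0. M * d powr m / Q < \<eta> \<and> 0 < d \<and> d < min R (r / 2)" by eventually_elim simp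
 from eventually_happens'[OF _ this] obtain d where d: "M * d powr m / Q < \<eta>" "0 < d" "d < R" "2 * d \<le> r" by auto
 have "(\<lambda>k. 2 * cone_exponent p (b k) x0) \<longlonglongrightarrow> 2 * (m - 1)"
  unfolding m_def by (intro tendsto_mult tendsto_const) (simp add: tendsto_cone_exponent b_lim)
 then have "\<forall>\<^sub>F k in sequentially. 2 * cone_exponent p (b k) x0 < E"
  by (rule order_tendstoD) (use m in \<open>simp add: E_def\<close>)
 with R(2)[OF d(2,3)] show "\<forall>\<^sub>F k in sequentially. dist (\<kappa> k) 0 < \<eta>"
  using eventually_mass B(2) cC(2)
 proof eventually_elim
  case (elim k)
  have "\<kappa> k * Q \<le> M * d powr (A / pi - 2 - E)"
   unfolding Q_def
  proof (rule shell_mass_bound[OF x0 r d(2,4) _ cC(1) _ B(1) _ _ A0])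
   show "total_mass (b k) \<le> M" using elim by (simp add: M_def f_mass)
   show "A \<le> ball_mass (f k) x0 d" using elim(1) unfolding A_def \<sigma>m by linarith
  qed (use elim in auto)
  then have "\<kappa> k \<le> M * d powr m / Q" using Q by (simp add: Am pos_le_divide_eq)
  then show ?case using d(1) \<kappa>_pos[of k] by simp
 qed
qed

end

section \<open>Atoms carry the whole mass\<close>

lemma concentrates_zero_small:
 assumes conc: "concentrates f x 0" and s: "s > 0"
 shows "\<exists>r>0. \<forall>\<^sub>F k in sequentially. ball_mass (f k) x r \<le> s"
proof -
 obtain R where R: "R > 0" "\<And>r. 0 < r \<and> r < R \<Longrightarrow>
  \<forall>\<^sub>F k in sequentially. \<bar>ball_mass (f k) x r - 0\<bar> < s"
  using concentratesD[OF conc s] by auto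
 have "\<forall>\<^sub>F k in sequentially. ball_mass (f k) x (R / 2) \<le> s"
  using R(2)[of "R / 2"] R(1) by (auto elim!: eventually_mono)
 then show ?thesis using R(1) by (intro exI[of _ "R / 2"]) auto
qed

context liouville_sequence
begin

text \<open>Near a point without atom \<open>f k / \<kappa> k\<close> is bounded in some Lq, hence
  in L1; multiplication by \<open>\<kappa> k\<close> sends the mass to 0.\<close>

lemma local_mass_vanishes:
 assumes \<kappa>: "\<kappa> \<longlonglongrightarrow> 0" and x0: "x0 \<in> S2" and conc: "concentrates f x0 0"
 shows "\<exists>r>0. (\<lambda>k. \<ointegral>y. indicator (ball x0 r) y * f k y) \<longlonglongrightarrow> 0"
proof -
 from local_Lq_bound[OF x0 concentrates_zero_small[OF conc]] obtain r q C where rqC: "r > 0" "q > 1" "C \<ge> 0"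
  and ev: "\<forall>\<^sub>F k in sequentially. (\<ointegral>\<^sup>+x. indicator (ball x0 r) x * ennreal ((f k x / \<kappa> k) powr q)) \<le> ennreal C"
  by blast
 have "\<forall>\<^sub>F k in sequentially. norm (ball_mass (f k) x0 r) \<le> \<kappa> k * (4 * pi + C)"
  using ev
 proof eventually_elim
  case (elim k)
  have im [measurable]: "(\<lambda>x. indicator (ball x0 r) x :: ennreal) \<in> borel_measurable area_S2"
   by (intro measurable_area1 borel_measurable_indicator) simp
  have k0: "\<kappa> k > 0" by (rule \<kappa>_pos)
  have nn: "0 \<le> ball_mass (f k) x0 r"
   using f_nonneg by (intro integral_nonneg_AE AE_I2) auto
  have "ennreal (ball_mass (f k) x0 r) = (\<ointegral>\<^sup>+y. ennreal (indicator (ball x0 r) y * f k y))"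
   using f_nonneg by (intro nn_integral_eq_integral[symmetric] integrable_indicator_ball f_integrable AE_I2) auto
  also have "... \<le> (\<ointegral>\<^sup>+y. ennreal (\<kappa> k) * (1 + indicator (ball x0 r) y * ennreal ((f k y / \<kappa> k) powr q)))"
  proof (rule nn_integral_mono)
   fix y assume "y \<in> space area_S2"
   then have y: "f k y \<ge> 0" using f_nonneg by simp
   define z where "z = f k y / \<kappa> k"
   have z: "z \<ge> 0" "f k y = \<kappa> k * z" using y k0 by (auto simp: z_def)
   have "z \<le> 1 + z powr q"
   proof (cases "z \<le> 1")
    case False
    then have "z powr 1 \<le> z powr q" using rqC(2) by (intro powr_mono) auto
    then show ?thesis using False by simp
   qed (simp add: add_increasing2)
   then have "ennreal (\<kappa> k * z) \<le> ennreal (\<kappa> k * (1 + z powr q))" using k0 by (intro ennreal_leI mult_left_mono) auto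
   also have "... = ennreal (\<kappa> k) * (1 + ennreal (z powr q))" using k0 by (simp add: ennreal_mult)
   finally show "ennreal (indicator (ball x0 r) y * f k y) \<le> ennreal (\<kappa> k) * (1 + indicator (ball x0 r) y * ennreal ((f k y / \<kappa> k) powr q))"
    unfolding z_def[symmetric] z(2) by (simp add: indicator_def)
  qed
  also have "... = ennreal (\<kappa> k) * (ennreal (4 * pi) + (\<ointegral>\<^sup>+y. indicator (ball x0 r) y * ennreal ((f k y / \<kappa> k) powr q)))"
   by (simp add: nn_integral_cmult nn_integral_add emeasure_area_S2)
  also have "... \<le> ennreal (\<kappa> k) * (ennreal (4 * pi) + ennreal C)" by (intro mult_left_mono add_left_mono elim) simp
  also have "... = ennreal (\<kappa> k * (4 * pi + C))" using rqC(3) k0 by (simp add: ennreal_mult)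
  finally show ?case using nn rqC(3) k0 by (simp add: ennreal_le_iff)
 qed
 moreover have "(\<lambda>k. \<kappa> k * (4 * pi + C)) \<longlonglongrightarrow> 0" by (rule tendsto_mult_left_zero[OF \<kappa>])
 ultimately have "(\<lambda>k. \<ointegral>y. indicator (ball x0 r) y * f k y) \<longlonglongrightarrow> 0" by (rule Lim_null_comparison)
 then show ?thesis using rqC(1) by blast
qed

lemma concentrates_simultaneously:
 assumes T: "finite T" "\<And>x. x \<in> T \<Longrightarrow> concentrates f x (\<sigma> x)" and \<epsilon>: "\<epsilon> > 0" and "R0 > 0"
 shows "\<exists>r>0. r < R0 \<and> (\<forall>\<^sub>F k in sequentially. \<forall>x\<in>T. \<bar>ball_mass (f k) x r - \<sigma> x\<bar> < \<epsilon>)"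
proof -
 have "\<forall>x\<in>T. \<exists>R>0. \<forall>r. 0 < r \<and> r < R \<longrightarrow>
  (\<forall>\<^sub>F k in sequentially. \<bar>ball_mass (f k) x r - \<sigma> x\<bar> < \<epsilon>)"
  by (intro ballI concentratesD[OF T(2) \<epsilon>])
 from bchoice[OF this] obtain R where R: "\<forall>x\<in>T. R x > 0 \<and> (\<forall>r. 0 < r \<and> r < R x \<longrightarrow>
  (\<forall>\<^sub>F k in sequentially. \<bar>ball_mass (f k) x r - \<sigma> x\<bar> < \<epsilon>))" by (elim exE)
 define r where "r = Min (insert R0 (R ` T)) / 2"
 have M: "0 < Min (insert R0 (R ` T))" using T(1) R \<open>R0 > 0\<close> by simp
 have "Min (insert R0 (R ` T)) \<le> R0" "\<And>x. x \<in> T \<Longrightarrow> Min (insert R0 (R ` T)) \<le> R x" using T(1) by auto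
 with M have r: "0 < r" "r < R0" "\<And>x. x \<in> T \<Longrightarrow> r < R x" unfolding r_def by force+
 have "\<forall>\<^sub>F k in sequentially. \<forall>x\<in>T. \<bar>ball_mass (f k) x r - \<sigma> x\<bar> < \<epsilon>"
  using R r by (intro eventually_ball_finite T(1)) simp
 then show ?thesis using r by blast
qed

text \<open>Balls of radius less than half the smallest distance between the points are disjoint, so
  their masses add up to at most the total mass.\<close>

lemma sum_atoms_le:
 assumes T: "finite T" "\<And>x. x \<in> T \<Longrightarrow> concentrates f x (\<sigma> x)"
 shows "sum \<sigma> T \<le> total_mass b0"
proof (rule field_le_epsilon)
 fix e :: real assume e: "e > 0"
 \<comment> \<open>One share of the error for each atom and one for the convergence of
   \<open>total_mass (b k)\<close>.\<close>
 define \<epsilon> where "\<epsilon> = e / (real (card T) + 1)"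
 have "(real (card T) + 1) * \<epsilon> = e" by (simp add: \<epsilon>_def)
 then have \<epsilon>: "\<epsilon> > 0" "real (card T) * \<epsilon> + \<epsilon> = e"
  using e by (simp add: \<epsilon>_def, simp add: distrib_right)
 obtain R0 where R0: "R0 > 0" "\<And>x y. x \<in> T \<Longrightarrow> y \<in> T \<Longrightarrow> x \<noteq> y \<Longrightarrow> 2 * R0 \<le> dist x y"
 proof -
  define D where "D = insert 1 ((\<lambda>(x, y). dist x y) ` {(x, y) \<in> T \<times> T. x \<noteq> y})"
  have "finite {(x, y) \<in> T \<times> T. x \<noteq> y}" using T(1) by (auto intro: finite_subset[of _ "T \<times> T"])
  then have D: "finite D" "D \<noteq> {}" "\<And>d. d \<in> D \<Longrightarrow> d > 0" by (auto simp: D_def)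
  show thesis
  proof (rule that[of "Min D / 2"])
   show "Min D / 2 > 0" using D by simp
   show "2 * (Min D / 2) \<le> dist x y" if "x \<in> T" "y \<in> T" "x \<noteq> y" for x y
    using D(1) that by (auto simp: D_def intro!: Min_le)
  qed
 qed
 obtain r where r: "0 < r" "r < R0"
  and ev: "\<forall>\<^sub>F k in sequentially. \<forall>x\<in>T. \<bar>ball_mass (f k) x r - \<sigma> x\<bar> < \<epsilon>"
  using concentrates_simultaneously[OF T \<epsilon>(1) R0(1)] by blast
 have "\<forall>\<^sub>F k in sequentially. total_mass (b k) < total_mass b0 + \<epsilon>"
  using mass_tendsto by (rule order_tendstoD) (use \<epsilon> in simp)
 with ev have "\<forall>\<^sub>F k::nat in sequentially. sum \<sigma> T \<le> total_mass b0 + e"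
 proof eventually_elim
  case (elim k)
  have one: "(\<Sum>x\<in>T. indicator (ball x r) y :: real) \<le> 1" for y
  proof (cases "\<exists>x\<in>T. dist x y < r")
   case True
   then obtain x where x: "x \<in> T" "dist x y < r" by blast
   have "indicator (ball x' r) y = (0::real)" if "x' \<in> T - {x}" for x'
    using R0(2)[of x x'] that x r dist_triangle[of x x' y] by (auto simp: indicator_def dist_commute)
   then have "(\<Sum>x\<in>T - {x}. indicator (ball x r) y :: real) = 0" by (intro sum.neutral) auto
   then show ?thesis using T(1) x by (simp add: sum.remove[of T x])
  qed (auto simp: indicator_def intro!: order_trans[OF eq_refl[OF sum.neutral]])
  have "sum \<sigma> T \<le> (\<Sum>x\<in>T. ball_mass (f k) x r + \<epsilon>)"
   using elim(1) by (intro sum_mono) (auto simp: abs_less_iff less_imp_le dest!: bspec)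
  also have "... = (\<Sum>x\<in>T. ball_mass (f k) x r) + real (card T) * \<epsilon>" by (simp add: sum.distrib)
  also have "(\<Sum>x\<in>T. ball_mass (f k) x r) = (\<ointegral>y. (\<Sum>x\<in>T. indicator (ball x r) y) * f k y)"
   unfolding sum_distrib_right by (rule Bochner_Integration.integral_sum[symmetric]) (rule integrable_indicator_ball[OF f_integrable])
  also have "... \<le> (\<ointegral>y. f k y)"
  proof (rule integral_mono)
   show "integrable area_S2 (\<lambda>y. (\<Sum>x\<in>T. indicator (ball x r) y) * f k y)"
    unfolding sum_distrib_right by (intro Bochner_Integration.integrable_sum integrable_indicator_ball f_integrable)
   show "(\<Sum>x\<in>T. indicator (ball x r) y) * f k y \<le> f k y" if "y \<in> space area_S2" for y
    using mult_right_mono[OF one[of y] f_nonneg[of y k]] that by simp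
  qed (rule f_integrable)
  finally show ?case using elim(2) \<epsilon>(2) by (simp add: f_mass)
 qed
 then show "sum \<sigma> T \<le> total_mass b0 + e" by simp
qed

text \<open>One atom drives \<open>\<kappa>\<close> to 0. The complement of small balls around the
  atoms is compact and covered by finitely many balls of vanishing mass, so the atoms account for
  everything. Their number is finite because outside the cone points each has the same mass 4
  pi.\<close>

theorem mass_of_atoms:
 assumes conc: "\<And>x. x \<in> S2 \<Longrightarrow> concentrates f x (\<sigma> x)" and nz: "\<exists>x\<in>S2. \<sigma> x \<noteq> 0"
 shows "\<exists>S. finite S \<and> total_mass b0 = (\<Sum>x\<in>S. 4 * pi * (1 + cone_exponent p b0 x))"
proof -
 define S where "S = {x \<in> S2. \<sigma> x \<noteq> 0}"
 have \<kappa>0: "\<kappa> \<longlonglongrightarrow> 0" using nz conc \<kappa>_tendsto_zero by blast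
 have \<sigma>: "\<sigma> x = 4 * pi * (1 + cone_exponent p b0 x)" if "x \<in> S" for x
  using quantization[OF _ conc, of x] that by (auto simp: S_def)
 have "finite (S - range p)"
 proof (rule ccontr)
  assume "infinite (S - range p)"
  \<comment> \<open>Each of these atoms has mass 4 pi, which exceeds 1, so a set of more than
    \<open>total_mass b0\<close> of them violates the bound on sums of atoms.\<close>
  then obtain T where T: "T \<subseteq> S - range p" "finite T" "card T = Suc (nat \<lceil>total_mass b0\<rceil>)"
   using infinite_arbitrarily_large[of "S - range p" "Suc (nat \<lceil>total_mass b0\<rceil>)"] by blast
  have "sum \<sigma> T = (\<Sum>x\<in>T. 4 * pi)"
   using T \<sigma> cone_exponent_off[of _ p b0] by (intro sum.cong) (auto simp: subset_iff)
  then have "real (card T) * (4 * pi) \<le> total_mass b0"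
   using sum_atoms_le[of T \<sigma>] T conc by (auto simp: S_def subset_iff)
  moreover have "real (card T) * 1 \<le> real (card T) * (4 * pi)" using pi_gt3 by (intro mult_left_mono) auto
  ultimately have "real (card T) \<le> total_mass b0" by simp
  then show False using T(3) by linarith
 qed
 moreover have "finite (S \<inter> range p)" by (auto intro: finite_subset[of _ "range p"])
 ultimately have "finite ((S - range p) \<union> (S \<inter> range p))" by simp
 then have fin: "finite S" by (rule rev_finite_subset) auto
 have le: "total_mass b0 \<le> sum \<sigma> S"
 proof (rule field_le_epsilon)
  fix e :: real assume e: "e > 0"
  \<comment> \<open>One share of the error for each atom, one for the mass of the covering balls and
    one for the convergence of the total mass.\<close>
  define \<epsilon> where "\<epsilon> = e / (real (card S) + 2)"
  have "(real (card S) + 2) * \<epsilon> = e" by (simp add: \<epsilon>_def)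
  then have \<epsilon>: "\<epsilon> > 0" "real (card S) * \<epsilon> + 2 * \<epsilon> = e" using e by (simp add: \<epsilon>_def, simp add: distrib_right)
  obtain r where r: "0 < r"
   and ev: "\<forall>\<^sub>F k in sequentially. \<forall>x\<in>S. \<bar>ball_mass (f k) x r - \<sigma> x\<bar> < \<epsilon>"
   using concentrates_simultaneously[of S \<sigma> \<epsilon> 1] fin conc \<epsilon>(1) by (auto simp: S_def)
  define C where "C = S2 - (\<Union>x\<in>S. ball x r)"
  have "\<forall>x\<in>C. \<exists>\<rho>>0. (\<lambda>k. \<ointegral>y. indicator (ball x \<rho>) y * f k y) \<longlonglongrightarrow> 0"
  proof
   fix x assume "x \<in> C"
   then have x: "x \<in> S2" "x \<notin> S" using r by (auto simp: C_def)
   then have "concentrates f x 0" using conc[OF x(1)] by (simp add: S_def)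
   then show "\<exists>\<rho>>0. (\<lambda>k. \<ointegral>y. indicator (ball x \<rho>) y * f k y) \<longlonglongrightarrow> 0"
    by (rule local_mass_vanishes[OF \<kappa>0 x(1)])
  qed
  then obtain \<rho> where \<rho>: "\<And>x. x \<in> C \<Longrightarrow> \<rho> x > 0"
   "\<And>x. x \<in> C \<Longrightarrow> (\<lambda>k. \<ointegral>y. indicator (ball x (\<rho> x)) y * f k y) \<longlonglongrightarrow> 0" by metis
  have "compact C" unfolding C_def by (intro compact_diff open_UN) auto
  then obtain F where F: "F \<subseteq> C" "finite F" "C \<subseteq> (\<Union>x\<in>F. ball x (\<rho> x))"
  proof (rule compactE_image[of C C "\<lambda>x. ball x (\<rho> x)"])
   show "C \<subseteq> (\<Union>x\<in>C. ball x (\<rho> x))" using \<rho>(1) by force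
  qed simp_all
  have "(\<lambda>k. \<Sum>x\<in>F. ball_mass (f k) x (\<rho> x)) \<longlonglongrightarrow> (\<Sum>x\<in>F. 0)"
   using F \<rho>(2) by (intro tendsto_sum) auto
  then have ev2: "\<forall>\<^sub>F k in sequentially. (\<Sum>x\<in>F. ball_mass (f k) x (\<rho> x)) < \<epsilon>"
   using \<epsilon>(1) by (auto dest: order_tendstoD)
  have "\<forall>\<^sub>F k in sequentially. total_mass b0 - \<epsilon> < total_mass (b k)"
   using mass_tendsto by (rule order_tendstoD) (use \<epsilon> in simp)
  with ev ev2 have "\<forall>\<^sub>F k::nat in sequentially. total_mass b0 \<le> sum \<sigma> S + e"
  proof eventually_elim
   case (elim k)
   let ?I = "\<lambda>y. (\<Sum>x\<in>S. indicator (ball x r) y * f k y) + (\<Sum>x\<in>F. indicator (ball x (\<rho> x)) y * f k y)"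
   have iI: "integrable area_S2 ?I"
    by (intro Bochner_Integration.integrable_add Bochner_Integration.integrable_sum integrable_indicator_ball f_integrable)
   have "total_mass (b k) = (\<ointegral>y. f k y)" by (simp add: f_mass)
   also have "... \<le> (\<ointegral>y. ?I y)"
   proof (rule integral_mono[OF f_integrable iI])
    fix y assume "y \<in> space area_S2"
    then have y: "y \<in> S2" by simp
    have nn: "0 \<le> indicator (ball x s) y * f k y" for x s using f_nonneg[OF y, of k] by simp
    have s0: "0 \<le> (\<Sum>x\<in>S. indicator (ball x r) y * f k y)" "0 \<le> (\<Sum>x\<in>F. indicator (ball x (\<rho> x)) y * f k y)"
     using nn by (auto intro!: sum_nonneg)
    show "f k y \<le> ?I y"
    proof (cases "y \<in> C")
     case True
     then obtain x where x: "x \<in> F" "y \<in> ball x (\<rho> x)" using F(3) by blast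
     have "indicator (ball x (\<rho> x)) y * f k y \<le> (\<Sum>x\<in>F. indicator (ball x (\<rho> x)) y * f k y)"
      by (rule member_le_sum[OF x(1) nn F(2)])
     then show ?thesis using x(2) s0 by simp
    next
     case False
     then obtain x where x: "x \<in> S" "y \<in> ball x r" using y by (auto simp: C_def)
     have "indicator (ball x r) y * f k y \<le> (\<Sum>x\<in>S. indicator (ball x r) y * f k y)"
      by (rule member_le_sum[OF x(1) nn fin])
     then show ?thesis using x(2) s0 by simp
    qed
   qed
   also have "... = (\<Sum>x\<in>S. ball_mass (f k) x r) + (\<Sum>x\<in>F. ball_mass (f k) x (\<rho> x))"
    by (simp add: Bochner_Integration.integral_sum integrable_indicator_ball f_integrable)
   also have "(\<Sum>x\<in>S. ball_mass (f k) x r) \<le> (\<Sum>x\<in>S. \<sigma> x + \<epsilon>)"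
    using elim(1) by (intro sum_mono) (auto simp: abs_less_iff less_imp_le dest!: bspec)
   also have "(\<Sum>x\<in>S. \<sigma> x + \<epsilon>) = sum \<sigma> S + real (card S) * \<epsilon>" by (simp add: sum.distrib)
   finally show ?case using elim(2,3) \<epsilon>(2) by linarith
  qed
  then show "total_mass b0 \<le> sum \<sigma> S + e" by simp
 qed
 have "sum \<sigma> S \<le> total_mass b0" using fin conc by (intro sum_atoms_le) (auto simp: S_def)
 with le have "total_mass b0 = sum \<sigma> S" by simp
 also have "... = (\<Sum>x\<in>S. 4 * pi * (1 + cone_exponent p b0 x))" using \<sigma> by (intro sum.cong) auto
 finally show ?thesis using fin by blast
qed

end

text \<open>Let \<open>J\<close> index the cone points among the atoms and let \<open>n\<close>
  count the other atoms. Then \<open>chi_S2 \<beta> / 2\<close> minus the sum of \<beta> over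
  \<open>J\<close> is \<open>card J + n\<close>. Each summand is positive, so
  \<open>1 + \<beta> $ j\<close> is at most half of \<open>chi_S2 \<beta>\<close>, which is
  membership in \<open>F_set \<beta>\<close>; in the same way \<open>n\<close> is at most its
  integer part. This is a forbidden value.\<close>

lemma A_set_not_atomic:
 fixes p :: "'m::finite \<Rightarrow> real^3" and \<beta> :: "real^'m"
 assumes p: "inj p" and \<beta>: "\<beta> \<in> A_set" and S: "finite S"
 shows "total_mass \<beta> \<noteq> (\<Sum>x\<in>S. 4 * pi * (1 + cone_exponent p \<beta> x))"
proof
 assume "total_mass \<beta> = (\<Sum>x\<in>S. 4 * pi * (1 + cone_exponent p \<beta> x))"
 also have "... = 4 * pi * (\<Sum>x\<in>S. 1 + cone_exponent p \<beta> x)" by (simp add: sum_distrib_left)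
 also have "total_mass \<beta> = 4 * pi * (chi_S2 \<beta> / 2)" by (simp add: total_mass_def chi_S2_def algebra_simps)
 finally have chi: "chi_S2 \<beta> / 2 = (\<Sum>x\<in>S. 1 + cone_exponent p \<beta> x)" by simp
 have bgt: "\<beta> $ i > -1" for i using \<beta> by (simp add: A_set_def)
 have pos: "1 + cone_exponent p \<beta> x > 0" for x using cone_exponent_gt[of p \<beta> x, OF p bgt] by simp
 define J where "J = {i. p i \<in> S}"
 define n where "n = card (S - range p)"
 have split: "(\<Sum>x\<in>S. 1 + cone_exponent p \<beta> x) = real n + (\<Sum>j\<in>J. 1 + \<beta> $ j)"
 proof -
  have "(\<Sum>x\<in>S. 1 + cone_exponent p \<beta> x) = (\<Sum>x\<in>S - range p. 1 + cone_exponent p \<beta> x) + (\<Sum>x\<in>p ` J. 1 + cone_exponent p \<beta> x)"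
   using S by (subst sum.union_disjoint[symmetric]) (auto simp: J_def intro!: sum.cong)
  also have "(\<Sum>x\<in>S - range p. 1 + cone_exponent p \<beta> x) = real n" by (simp add: cone_exponent_off n_def)
  also have "(\<Sum>x\<in>p ` J. 1 + cone_exponent p \<beta> x) = (\<Sum>j\<in>J. 1 + \<beta> $ j)"
   using p by (subst sum.reindex) (auto simp: cone_exponent_at inj_def inj_on_def)
  finally show ?thesis .
 qed
 have "J \<subseteq> F_set \<beta>"
 proof
  fix j assume "j \<in> J"
  then have "p j \<in> S" by (simp add: J_def)
  then have "1 + cone_exponent p \<beta> (p j) \<le> (\<Sum>x\<in>S. 1 + cone_exponent p \<beta> x)"
   using S pos by (intro member_le_sum) (auto intro: less_imp_le)
  then show "j \<in> F_set \<beta>" using p by (simp add: chi[symmetric] cone_exponent_at F_set_def chi_S2_def)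
 qed
 with \<beta> have no: "chi_S2 \<beta> / 2 - (\<Sum>j\<in>J. \<beta> $ j) \<notin> real ` {card J..card J + nat \<lfloor>chi_S2 \<beta> / 2\<rfloor>}" by (simp add: A_set_def)
 have "0 \<le> (\<Sum>j\<in>J. 1 + \<beta> $ j)" using bgt by (intro sum_nonneg) (smt (verit))
 then have "real n \<le> chi_S2 \<beta> / 2" unfolding chi split by simp
 then have "int n \<le> \<lfloor>chi_S2 \<beta> / 2\<rfloor>" by (simp add: le_floor_iff)
 then have "n \<le> nat \<lfloor>chi_S2 \<beta> / 2\<rfloor>" by linarith
 moreover have "chi_S2 \<beta> / 2 - (\<Sum>j\<in>J. \<beta> $ j) = real (card J + n)" unfolding chi split by (simp add: sum.distrib)
 ultimately show False using no by (metis add_left_mono atLeastAtMost_iff image_eqI le_add1)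
qed

subsection \<open>Compactness in the absence of atoms\<close>

text \<open>The subadditivity (1 + z)^\<theta> \<le> 1 + z^\<theta> gives ln (1 + z) \<le>
  z^\<theta> / \<theta>, applied with z the ratio of \<open>dist x x'\<close> to the distance from
  \<open>y\<close>.\<close>

lemma log_pot_kernel_holder:
 assumes ne: "y \<noteq> x" "y \<noteq> x'" and \<theta>: "0 < \<theta>" "\<theta> \<le> 1"
 shows "\<bar>log_pot_kernel x y - log_pot_kernel x' y\<bar>
   \<le> dist x x' powr \<theta> / \<theta> * (dist y x powr (- \<theta>) + dist y x' powr (- \<theta>))"
proof -
 have one: "ln (dist y b) - ln (dist y a) \<le> dist a b powr \<theta> / \<theta> * dist y a powr (- \<theta>)"
  if "y \<noteq> a" "y \<noteq> b" for a b
 proof -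
  define z where "z = dist a b / dist y a"
  have d: "dist y a > 0" "dist y b > 0" using that by auto
  have z: "z \<ge> 0" by (simp add: z_def)
  have "dist y b \<le> dist y a * (1 + z)" using dist_triangle[of y b a] d by (simp add: z_def distrib_left)
  then have "ln (dist y b) \<le> ln (dist y a * (1 + z))" using d z by (subst ln_le_cancel_iff) auto
  also have "... = ln (dist y a) + ln (1 + z)" using d z by (simp add: ln_mult)
  finally have 1: "ln (dist y b) - ln (dist y a) \<le> ln (1 + z)" by simp
  have "\<theta> * ln (1 + z) = ln ((1 + z) powr \<theta>)" using z by (simp add: ln_powr)
  also have "... \<le> ln (1 + z powr \<theta>)"
  proof -
   have "(1 + z) powr \<theta> \<le> 1 powr \<theta> + z powr \<theta>"
   proof (cases "z = 0")
    case False
    have "1 / (1 + z) \<le> (1 / (1 + z)) powr \<theta>" "z / (1 + z) \<le> (z / (1 + z)) powr \<theta>"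
     using powr_mono'[of \<theta> 1 "1 / (1 + z)"] powr_mono'[of \<theta> 1 "z / (1 + z)"] z \<theta> by auto
    then have "1 / (1 + z) + z / (1 + z) \<le> (1 powr \<theta> + z powr \<theta>) / (1 + z) powr \<theta>"
     using z by (simp add: powr_divide add_divide_distrib)
    moreover have "1 / (1 + z) + z / (1 + z) = 1" using z by (simp add: add_divide_distrib[symmetric])
    ultimately show ?thesis using z by (simp add: pos_le_divide_eq)
   qed simp
   then show ?thesis using z by (subst ln_le_cancel_iff) (auto intro: add_pos_nonneg)
  qed
  also have "... \<le> z powr \<theta>" using ln_add_one_self_le_self[of "z powr \<theta>"] by simp
  finally have "ln (1 + z) \<le> z powr \<theta> / \<theta>" using \<theta> by (simp add: pos_le_divide_eq mult.commute)
  also have "... = dist a b powr \<theta> / \<theta> * dist y a powr (- \<theta>)"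
   using d by (simp add: z_def powr_divide powr_minus_divide)
  finally show ?thesis using 1 by simp
 qed
 have nn: "0 \<le> dist x x' powr \<theta> / \<theta> * dist y x powr (- \<theta>)" "0 \<le> dist x x' powr \<theta> / \<theta> * dist y x' powr (- \<theta>)"
  using \<theta> by auto
 have "log_pot_kernel x y - log_pot_kernel x' y = ln (dist y x') - ln (dist y x)"
  using ne by (subst (1 2) log_pot_kernel_ln) (auto simp: dist_commute)
 then show ?thesis
  using one[OF ne] one[OF ne(2,1)] nn unfolding distrib_left dist_commute[of x' x] by linarith
qed

text \<open>A dominating function for conic weights whose exponents stay above \<open>- s\<close>. A
  sum replaces the product because at most one cone point can be close to a given point; it is
  integrable for \<open>s < 1\<close>.\<close>

definition cone_singularities :: "('m::finite \<Rightarrow> real^3) \<Rightarrow> real \<Rightarrow> real^3 \<Rightarrow> real" where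
 "cone_singularities p s x = (\<Sum>j\<in>UNIV. dist x (p j) powr (- (2 * s)))"

lemma cone_singularities_nonneg: "cone_singularities p s x \<ge> 0"
 by (simp add: cone_singularities_def sum_nonneg)

lemma integrable_cone_singularities:
 assumes p: "range p \<subseteq> S2" and s: "s < 1"
 shows "integrable area_S2 (cone_singularities p s)"
 unfolding cone_singularities_def[abs_def]
 using s by (intro Bochner_Integration.integrable_sum integrable_dist_powr subsetD[OF p rangeI]) auto

text \<open>With \<open>t\<close> an isolating radius common to all cone points, at most one factor
  sees a distance below \<open>t\<close>. That factor is a term of
  \<open>cone_singularities\<close>; the others are bounded by powers of \<open>t\<close>.\<close>

lemma conic_weight_dominated:
 fixes p :: "'m::finite \<Rightarrow> real^3"
 assumes p: "inj p" "range p \<subseteq> S2" and s: "0 \<le> s"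
 shows "\<exists>Q\<ge>0. \<forall>\<beta> x. (\<forall>i. - s \<le> \<beta> $ i \<and> \<beta> $ i \<le> B) \<and> x \<in> S2 \<longrightarrow>
   conic_weight p \<beta> x \<le> Q * cone_singularities p s x"
proof -
 have "\<forall>j. \<exists>r. 0 < r \<and> r \<le> 1 \<and> (\<forall>i. p i \<noteq> p j \<longrightarrow> 2 * r \<le> dist (p i) (p j))"
 proof
  fix j
  obtain r where "0 < r" "r \<le> 1" "\<And>i. p i \<noteq> p j \<Longrightarrow> 2 * r \<le> dist (p i) (p j)" using isolating_radius[of p "p j"] by blast
  then show "\<exists>r. 0 < r \<and> r \<le> 1 \<and> (\<forall>i. p i \<noteq> p j \<longrightarrow> 2 * r \<le> dist (p i) (p j))" by blast
 qed
 from choice[OF this] obtain r where r: "\<And>j. 0 < r j" "\<And>j. r j \<le> 1" "\<And>i j. p i \<noteq> p j \<Longrightarrow> 2 * r j \<le> dist (p i) (p j)"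
  by auto
 define t where "t = Min (range r)"
 have t0: "0 < t" and tr: "\<And>j. t \<le> r j" unfolding t_def using r(1) by (auto simp: Min_gr_iff)
 have t1: "t \<le> 1" using tr r(2) order_trans by blast
 have tp: "2 * t \<le> dist (p i) (p j)" if "i \<noteq> j" for i j
 proof -
  have "p i \<noteq> p j" using that p(1) by (auto simp: inj_def)
  from r(3)[OF this] tr[of j] show ?thesis by linarith
 qed
 define \<tau> where "\<tau> = t powr (- (2 * s))"
 have \<tau>: "1 \<le> \<tau>"
 proof -
  have "t powr 0 \<le> t powr (- (2 * s))" using t0 t1 s by (intro powr_mono') auto
  then show ?thesis using t0 by (simp add: \<tau>_def)
 qed
 define H where "H = (2::real) powr (2 * B) * 2 powr (2 * s)"
 have H: "H \<ge> 0" by (simp add: H_def)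
 have prod: "(\<Prod>i\<in>UNIV. dist x (p i) powr (- (2 * s))) \<le> \<tau> ^ CARD('m) * cone_singularities p s x" for x
 proof -
  have "\<exists>j. \<forall>i. i \<noteq> j \<longrightarrow> t \<le> dist x (p i)"
  proof (cases "\<exists>j. dist x (p j) < t")
   case True
   then obtain j where j: "dist x (p j) < t" by blast
   have "t \<le> dist x (p i)" if "i \<noteq> j" for i
    using tp[OF that] j dist_triangle[of "p i" "p j" x] by (simp add: dist_commute)
   then show ?thesis by blast
  next
   case False
   then show ?thesis by (auto simp: not_less)
  qed
  then obtain j where j: "\<And>i. i \<noteq> j \<Longrightarrow> t \<le> dist x (p i)" by blast
  have "(\<Prod>i\<in>UNIV. dist x (p i) powr (- (2 * s))) = dist x (p j) powr (- (2 * s)) * (\<Prod>i\<in>UNIV - {j}. dist x (p i) powr (- (2 * s)))"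
   by (rule prod.remove) auto
  also have "... \<le> dist x (p j) powr (- (2 * s)) * (\<Prod>i\<in>UNIV - {j}. \<tau>)"
   unfolding \<tau>_def using j t0 s by (intro mult_left_mono prod_mono conjI powr_mono2') auto
  also have "... \<le> cone_singularities p s x * \<tau> ^ CARD('m)"
  proof (rule mult_mono)
   show "dist x (p j) powr (- (2 * s)) \<le> cone_singularities p s x"
    unfolding cone_singularities_def by (rule member_le_sum) auto
   show "(\<Prod>i\<in>UNIV - {j}. \<tau>) \<le> \<tau> ^ CARD('m)" using \<tau> by (simp add: power_increasing)
  qed (use \<tau> in \<open>auto simp: cone_singularities_nonneg\<close>)
  finally show ?thesis by (simp add: mult.commute)
 qed
 show ?thesis
 proof (intro exI[of _ "H ^ CARD('m) * \<tau> ^ CARD('m)"] conjI allI impI)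
  show "0 \<le> H ^ CARD('m) * \<tau> ^ CARD('m)" using H \<tau> by auto
  fix \<beta> :: "real^'m" and x :: "real^3"
  assume a: "(\<forall>i. - s \<le> \<beta> $ i \<and> \<beta> $ i \<le> B) \<and> x \<in> S2"
  have "conic_weight p \<beta> x \<le> (\<Prod>i\<in>UNIV. H * dist x (p i) powr (- (2 * s)))"
   unfolding conic_weight_def
  proof (intro prod_mono conjI)
   fix i
   let ?d = "dist x (p i)"
   have d2: "?d \<le> 2" using a by (intro dist_S2(3) subsetD[OF p(2) rangeI]) auto
   have "?d powr (2 * \<beta> $ i) = 2 powr (2 * \<beta> $ i) * (?d / 2) powr (2 * \<beta> $ i)" by (simp add: powr_divide)
   also have "... \<le> 2 powr (2 * B) * (?d / 2) powr (- (2 * s))"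
   proof (rule mult_mono)
    show "2 powr (2 * \<beta> $ i) \<le> (2::real) powr (2 * B)" using a by (intro powr_mono) auto
    show "(?d / 2) powr (2 * \<beta> $ i) \<le> (?d / 2) powr (- (2 * s))"
     using a[THEN conjunct1, rule_format, of i] d2 by (intro powr_mono') auto
   qed auto
   also have "... = H * ?d powr (- (2 * s))" by (simp add: H_def powr_divide powr_minus field_simps)
   finally show "?d powr (2 * \<beta> $ i) \<le> H * ?d powr (- (2 * s))" .
  qed simp
  also have "... = H ^ CARD('m) * (\<Prod>i\<in>UNIV. dist x (p i) powr (- (2 * s)))" by (simp add: prod.distrib)
  also have "... \<le> H ^ CARD('m) * (\<tau> ^ CARD('m) * cone_singularities p s x)" by (rule mult_left_mono[OF prod]) (use H in simp)
  finally show "conic_weight p \<beta> x \<le> H ^ CARD('m) * \<tau> ^ CARD('m) * cone_singularities p s x" by (simp add: mult.assoc)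
 qed
qed

text \<open>Bounds \<open>cone_singularities p s y\<close> times
  \<open>dist y x powr (- (1 - s))\<close>: the orders \<open>2 * s\<close> and \<open>1 - s\<close>
  add up to \<open>1 + s\<close>, still below 2, and the integral in \<open>y\<close> does not
  depend on \<open>x\<close>.\<close>

definition cone_singularities2 :: "('m::finite \<Rightarrow> real^3) \<Rightarrow> real \<Rightarrow> real^3 \<Rightarrow> real^3 \<Rightarrow> real" where
 "cone_singularities2 p s x y = (\<Sum>j\<in>UNIV. dist y (p j) powr (- (1 + s)) + dist y x powr (- (1 + s)))"

lemma cone_singularities_mult_le:
 assumes s: "0 \<le> s" "s < 1"
 shows "cone_singularities p s y * dist y x powr (- (1 - s)) \<le> cone_singularities2 p s x y"
proof -
 have "2 * s + (1 - s) = 1 + s" by simp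
 then have "d powr (- (2 * s)) * e powr (- (1 - s)) \<le> d powr (- (1 + s)) + e powr (- (1 + s))"
  if "0 \<le> d" "0 \<le> e" for d e :: real
  using powr_mult_le_add[of "2 * s" "1 - s" d e] s that by (simp add: algebra_simps)
 then show ?thesis
  unfolding cone_singularities_def cone_singularities2_def sum_distrib_right by (intro sum_mono) simp
qed

lemma cone_singularities2_integral:
 fixes p :: "'m::finite \<Rightarrow> real^3"
 assumes p: "range p \<subseteq> S2" and x: "x \<in> S2" and s: "s < 1"
 shows "integrable area_S2 (cone_singularities2 p s x)"
  and "(\<ointegral>y. cone_singularities2 p s x y) = real CARD('m) * (2 * riesz_const (1 + s))"
proof -
 have i: "integrable area_S2 (\<lambda>y. dist y (p j) powr (- (1 + s)) + dist y x powr (- (1 + s)))" for j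
  using s by (intro Bochner_Integration.integrable_add integrable_dist_powr x subsetD[OF p rangeI]) auto
 show "integrable area_S2 (cone_singularities2 p s x)"
  unfolding cone_singularities2_def[abs_def] by (intro Bochner_Integration.integrable_sum i)
 have "(\<ointegral>y. dist y (p j) powr (- (1 + s)) + dist y x powr (- (1 + s))) = 2 * riesz_const (1 + s)" for j
  using s by (subst Bochner_Integration.integral_add)
   (simp_all only: integral_dist_powr[OF subsetD[OF p rangeI]] integral_dist_powr[OF x] integrable_dist_powr[OF subsetD[OF p rangeI]] integrable_dist_powr[OF x])
 then show "(\<ointegral>y. cone_singularities2 p s x y) = real CARD('m) * (2 * riesz_const (1 + s))"
  unfolding cone_singularities2_def by (subst Bochner_Integration.integral_sum[OF i]) simp
qed

lemma log_pot_kernel_cone_singularities: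
 fixes p :: "'m::finite \<Rightarrow> real^3"
 assumes s: "0 \<le> s" "s < 1" and x: "x \<in> S2" "y \<in> S2" and f: "0 \<le> f" "f \<le> G * cone_singularities p s y" and G: "0 \<le> G"
 shows "\<bar>f * log_pot_kernel x y\<bar> \<le> G * (2 powr (1 - s) / (1 - s)) * cone_singularities2 p s x y"
proof -
 have "\<bar>f * log_pot_kernel x y\<bar> = f * log_pot_kernel x y" using f log_pot_kernel_nonneg[OF x] by simp
 also have "... \<le> (G * cone_singularities p s y) * ((2 powr (1 - s) / (1 - s)) * dist y x powr (- (1 - s)))"
  using f log_pot_kernel_le[OF x, of "1 - s"] s log_pot_kernel_nonneg[OF x]
  by (intro mult_mono) (auto simp: dist_commute)
 also have "... = G * (2 powr (1 - s) / (1 - s)) * (cone_singularities p s y * dist y x powr (- (1 - s)))" by (simp add: mult_ac)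
 also have "... \<le> G * (2 powr (1 - s) / (1 - s)) * cone_singularities2 p s x y"
  using G s by (intro mult_left_mono cone_singularities_mult_le s) auto
 finally show ?thesis .
qed

text \<open>A Hoelder exponent \<open>1 - s\<close> for the kernel leaves a singularity that the
  density bound can absorb. The constant depends on \<open>f\<close> only through \<open>G\<close>,
  which supplies equicontinuity along the sequence.\<close>

lemma log_pot_holder:
 fixes p :: "'m::finite \<Rightarrow> real^3"
 assumes p: "range p \<subseteq> S2" and s: "0 \<le> s" "s < 1" and fm: "f \<in> borel_measurable area_S2"
  and f: "\<And>y. y \<in> S2 \<Longrightarrow> 0 \<le> f y" "\<And>y. y \<in> S2 \<Longrightarrow> f y \<le> G * cone_singularities p s y" and G: "0 \<le> G"
  and x: "x \<in> S2" "x' \<in> S2"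
 shows "\<bar>log_pot f x - log_pot f x'\<bar> \<le> G / (1 - s) * (real CARD('m) * (4 * riesz_const (1 + s))) * dist x x' powr (1 - s)"
proof -
 have i: "integrable area_S2 (\<lambda>y. f y * log_pot_kernel z y)" if z: "z \<in> S2" for z
 proof (rule Bochner_Integration.integrable_bound)
  show "integrable area_S2 (\<lambda>y. G * (2 powr (1 - s) / (1 - s)) * cone_singularities2 p s z y)"
   by (intro integrable_mult_right cone_singularities2_integral p z s)
  show "(\<lambda>y. f y * log_pot_kernel z y) \<in> borel_measurable area_S2" using fm by measurable
  show "AE y in area_S2. norm (f y * log_pot_kernel z y) \<le> norm (G * (2 powr (1 - s) / (1 - s)) * cone_singularities2 p s z y)"
  proof (rule AE_area_I)
   fix y assume y: "y \<in> S2"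
   show "norm (f y * log_pot_kernel z y) \<le> norm (G * (2 powr (1 - s) / (1 - s)) * cone_singularities2 p s z y)"
    using log_pot_kernel_cone_singularities[OF s z y f(1)[OF y] f(2)[OF y] G] by (simp only: real_norm_def order_trans[OF _ abs_ge_self])
  qed
 qed
 let ?R = "\<lambda>y. G * (dist x x' powr (1 - s) / (1 - s)) * (cone_singularities2 p s x y + cone_singularities2 p s x' y)"
 have iR: "integrable area_S2 ?R"
  by (intro integrable_mult_right Bochner_Integration.integrable_add cone_singularities2_integral p x s)
 have "\<bar>(\<ointegral>y. f y * log_pot_kernel x y) - (\<ointegral>y. f y * log_pot_kernel x' y)\<bar>
   = \<bar>(\<ointegral>y. f y * log_pot_kernel x y - f y * log_pot_kernel x' y)\<bar>" using i x by simp
 also have "... \<le> (\<ointegral>y. \<bar>f y * log_pot_kernel x y - f y * log_pot_kernel x' y\<bar>)" by (rule integral_abs_bound)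
 also have "... \<le> (\<ointegral>y. ?R y)"
 proof (rule integral_mono_AE)
  show "AE y in area_S2. \<bar>f y * log_pot_kernel x y - f y * log_pot_kernel x' y\<bar> \<le> ?R y"
   using AE_area_neq[of x] AE_area_neq[of x'] AE_space
  proof eventually_elim
   case (elim y)
   then have y: "y \<in> S2" by simp
   let ?C = "dist x x' powr (1 - s) / (1 - s)"
   have "\<bar>f y * log_pot_kernel x y - f y * log_pot_kernel x' y\<bar> = f y * \<bar>log_pot_kernel x y - log_pot_kernel x' y\<bar>"
    using f(1)[OF y] by (simp add: right_diff_distrib[symmetric] abs_mult)
   also have "... \<le> (G * cone_singularities p s y) * (?C * (dist y x powr (- (1 - s)) + dist y x' powr (- (1 - s))))"
    using f(1,2)[OF y] log_pot_kernel_holder[OF elim(1,2), of "1 - s"] s by (intro mult_mono) auto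
   also have "... = G * ?C * (cone_singularities p s y * dist y x powr (- (1 - s)) + cone_singularities p s y * dist y x' powr (- (1 - s)))"
    by (simp only: distrib_left mult_ac)
   also have "... \<le> ?R y"
    using G s by (intro mult_left_mono add_mono cone_singularities_mult_le s) auto
   finally show ?case .
  qed
 qed (use i x iR in auto)
 also have "... = G * (dist x x' powr (1 - s) / (1 - s)) * (real CARD('m) * (4 * riesz_const (1 + s)))"
  using cone_singularities2_integral[OF p x(1) s(2)] cone_singularities2_integral[OF p x(2) s(2)] by simp
 finally have 1: "\<bar>(\<ointegral>y. f y * log_pot_kernel x y) - (\<ointegral>y. f y * log_pot_kernel x' y)\<bar>
   \<le> G / (1 - s) * (real CARD('m) * (4 * riesz_const (1 + s))) * dist x x' powr (1 - s)" by (simp add: mult_ac)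
 have "\<bar>log_pot f x - log_pot f x'\<bar> = \<bar>(\<ointegral>y. f y * log_pot_kernel x y) - (\<ointegral>y. f y * log_pot_kernel x' y)\<bar> / (2 * pi)"
  by (simp add: log_pot_def diff_divide_distrib[symmetric] abs_divide)
 also have "... \<le> \<bar>(\<ointegral>y. f y * log_pot_kernel x y) - (\<ointegral>y. f y * log_pot_kernel x' y)\<bar> / 1"
  using pi_gt3 by (intro divide_left_mono) auto
 finally show ?thesis using 1 by simp
qed

context liouville_sequence
begin

text \<open>Compactness is applied to the potentials, not to the densities: bounded potentials
  dominate the densities by \<open>G * cone_singularities p s\<close>, and this yields both
  equicontinuity and dominated convergence. The limit density is defined through the equation and
  then shown to have the limit function as its potential.\<close>

theorem limit_potential_form:
 assumes conc: "\<And>x. x \<in> S2 \<Longrightarrow> concentrates f x 0" and mass: "total_mass b0 > 0"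
 shows "\<exists>\<kappa>0 f0. potential_form p K0 b0 \<kappa>0 f0"
proof -
 obtain W where W: "\<forall>\<^sub>F k in sequentially. \<forall>x\<in>S2. integrable area_S2 (\<lambda>y. f k y * log_pot_kernel x y) \<and> log_pot (f k) x \<le> W"
  using log_pot_bounded[OF concentrates_zero_small[OF conc]] by auto
 obtain A where A: "A > 0" "\<forall>\<^sub>F k in sequentially. \<kappa> k \<le> A" using \<kappa>_bounded by blast
 obtain B where B: "\<forall>\<^sub>F k in sequentially. \<forall>i. \<bar>b k $ i\<bar> \<le> B" using eventually_b_bounded by blast
 obtain c C where cC: "0 < c" "0 < C" "\<forall>\<^sub>F k in sequentially. \<forall>x\<in>S2. c \<le> K k x \<and> K k x \<le> C \<and> norm (grad_S2 (K k) x) \<le> C"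
  using eventually_K_bounded by blast
 define m where "m = Max (insert 0 (range (\<lambda>i. - b0 $ i)))"
 have m: "0 \<le> m" "\<And>i. - b0 $ i \<le> m" unfolding m_def by (auto intro!: Max_ge simp del: Max_insert)
 have m1: "m < 1" unfolding m_def using b0_gt by (subst Max_less_iff) (auto simp: minus_less_iff)
 \<comment> \<open>Midpoint between \<open>m\<close>, which bounds all \<open>- b0 $ i\<close>, and
   the threshold 1 for integrability; eventually all components of \<open>b k\<close> exceed
   \<open>- s\<close>.\<close>
 define s where "s = (1 + m) / 2"
 have s: "0 \<le> s" "s < 1" "m < s" using m m1 by (auto simp: s_def)
 have "\<forall>\<^sub>F k in sequentially. - s < b k $ i" for i
  using tendsto_vec_nth[OF b_lim, of i] by (rule order_tendstoD) (use m(2)[of i] s(3) in linarith)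
 then have bs: "\<forall>\<^sub>F k in sequentially. \<forall>i. - s < b k $ i" by (rule eventually_all_finite)
 obtain Q where Q: "Q \<ge> 0" "\<And>\<beta> x. (\<forall>i. - s \<le> \<beta> $ i \<and> \<beta> $ i \<le> B) \<and> x \<in> S2 \<Longrightarrow>
   conic_weight p \<beta> x \<le> Q * cone_singularities p s x"
  using conic_weight_dominated[OF inj_p range_p s(1), of B] by blast
 define G where "G = A * C * Q * exp (2 * W)"
 have G0: "G \<ge> 0" using A(1) cC(2) Q(1) by (simp add: G_def)
 have "\<forall>\<^sub>F k in sequentially. (\<forall>x\<in>S2. f k x \<le> G * cone_singularities p s x \<and> log_pot (f k) x \<le> W) \<and> \<kappa> k \<le> A"
  using W A(2) B cC(3) bs
 proof eventually_elim
  case (elim k)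
  have "f k x \<le> G * cone_singularities p s x" if x: "x \<in> S2" for x
  proof -
   have "(\<forall>i. - s \<le> b k $ i \<and> b k $ i \<le> B) \<and> x \<in> S2"
    using elim(3,5) x by (meson abs_le_iff less_imp_le)
   then have w: "conic_weight p (b k) x \<le> Q * cone_singularities p s x" by (rule Q(2))
   have "f k x \<le> A * C * (Q * cone_singularities p s x) * exp (2 * W)"
    unfolding f_eq[OF x] using elim(1,2,4) x w A(1) cC(1,2) Q(1) \<kappa>_pos[of k] K_pos[OF x, of k] conic_weight_nonneg[of p "b k" x]
     cone_singularities_nonneg[of p s x]
    by (intro mult_mono) (auto simp: less_imp_le)
   then show ?thesis by (simp add: G_def mult_ac)
  qed
  then show ?case using elim(1,2) by blast
 qed
 \<comment> \<open>The bounds hold only eventually, while the compactness theorem wants them at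
   every index; hence the shift of the sequence by \<open>N\<close>.\<close>
 then obtain N where N: "\<And>k. k \<ge> N \<Longrightarrow> (\<forall>x\<in>S2. f k x \<le> G * cone_singularities p s x \<and> log_pot (f k) x \<le> W) \<and> \<kappa> k \<le> A"
  unfolding eventually_sequentially by blast
 define D where "D = G / (1 - s) * (real CARD('m) * (4 * riesz_const (1 + s)))"
 have D0: "D \<ge> 0" using G0 s riesz_const_pos[of "1 + s"] by (simp add: D_def)
 have hol: "\<bar>log_pot (f k) x - log_pot (f k) x'\<bar> \<le> D * dist x x' powr (1 - s)" if "k \<ge> N" "x \<in> S2" "x' \<in> S2" for k x x'
  unfolding D_def by (rule log_pot_holder[OF range_p s(1,2) f_measurable f_nonneg _ G0 that(2,3)]) (use N[OF that(1)] in auto)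
 obtain w r where w: "continuous_on S2 w" and r: "strict_mono (r :: nat \<Rightarrow> nat)"
  and unif: "\<And>e. 0 < e \<Longrightarrow> \<exists>N'. \<forall>n x. n \<ge> N' \<and> x \<in> S2 \<longrightarrow> norm (log_pot (f (r n + N)) x - w x) < e"
 proof (rule Arzela_Ascoli[of S2 "\<lambda>k. log_pot (f (k + N))" W])
  show "norm (log_pot (f (n + N)) x) \<le> W" if "x \<in> S2" for n x
   using N[of "n + N"] pot_nonneg[OF that] that by simp
  show "\<exists>d>0. \<forall>n y. y \<in> S2 \<and> norm (x - y) < d \<longrightarrow> norm (log_pot (f (n + N)) x - log_pot (f (n + N)) y) < e"
   if x: "x \<in> S2" and e: "0 < e" for x e
  proof (intro exI[of _ "(e / (D + 1)) powr (1 / (1 - s))"] conjI allI impI)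
   show "0 < (e / (D + 1)) powr (1 / (1 - s))" using e D0 by simp
   fix n y assume y: "y \<in> S2 \<and> norm (x - y) < (e / (D + 1)) powr (1 / (1 - s))"
   then have "dist x y powr (1 - s) < ((e / (D + 1)) powr (1 / (1 - s))) powr (1 - s)"
    using s by (intro powr_less_mono2) (auto simp: dist_norm)
   also have "... = e / (D + 1)" using e D0 s by (simp add: powr_powr)
   finally have "dist x y powr (1 - s) * (D + 1) < e" using D0 by (simp add: pos_less_divide_eq)
   moreover have "D * dist x y powr (1 - s) \<le> dist x y powr (1 - s) * (D + 1)" by (simp add: algebra_simps)
   ultimately show "norm (log_pot (f (n + N)) x - log_pot (f (n + N)) y) < e"
    using hol[of "n + N" x y] x y by simp
  qed
 qed auto
 have "seq_compact {0..A}" by (intro compact_imp_seq_compact compact_Icc)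
 moreover have "\<forall>n. \<kappa> (r n + N) \<in> {0..A}" using N \<kappa>_pos by (auto simp: less_imp_le)
 ultimately obtain \<kappa>0 q where \<kappa>0: "\<kappa>0 \<in> {0..A}" and q: "strict_mono (q :: nat \<Rightarrow> nat)" and \<kappa>lim: "((\<lambda>n. \<kappa> (r n + N)) \<circ> q) \<longlonglongrightarrow> \<kappa>0"
  by (rule seq_compactE)
 define t where "t n = r (q n) + N" for n
 have "strict_mono t" using r q by (simp add: t_def strict_mono_def)
 then have ft: "filterlim t sequentially sequentially" by (rule filterlim_subseq)
 have tN: "t n \<ge> N" for n by (simp add: t_def)
 have \<kappa>t: "(\<lambda>n. \<kappa> (t n)) \<longlonglongrightarrow> \<kappa>0" using \<kappa>lim by (simp add: o_def t_def)
 have bt: "(\<lambda>n. b (t n)) \<longlonglongrightarrow> b0" by (rule filterlim_compose[OF b_lim ft])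
 have Kt: "(\<lambda>n. K (t n) x) \<longlonglongrightarrow> K0 x" if x: "x \<in> S2" for x
 proof -
  have "(\<lambda>n. K (t n) x - K0 x) \<longlonglongrightarrow> 0"
   by (rule Lim_null_comparison[OF _ filterlim_compose[OF K_lim ft]]) (use C1_dist_upper(1)[OF K_in_C1 x] in auto)
  then show ?thesis by (simp add: LIM_zero_iff)
 qed
 have wt: "(\<lambda>n. log_pot (f (t n)) x) \<longlonglongrightarrow> w x" if x: "x \<in> S2" for x
 proof (rule LIMSEQ_I)
  fix e :: real assume "0 < e"
  from unif[OF this] obtain N' where N': "\<And>n. n \<ge> N' \<Longrightarrow> norm (log_pot (f (r n + N)) x - w x) < e" using x by blast
  have "N' \<le> q n" if "n \<ge> N'" for n using seq_suble[OF q, of n] that by simp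
  then show "\<exists>no. \<forall>n\<ge>no. norm (log_pot (f (t n)) x - w x) < e" using N' by (auto simp: t_def)
 qed
 define f0 where "f0 x = \<kappa>0 * K0 x * conic_weight p b0 x * exp (2 * w x)" for x
 have f0m [measurable]: "f0 \<in> borel_measurable area_S2"
 proof -
  have [measurable]: "K0 \<in> borel_measurable area_S2" "w \<in> borel_measurable area_S2"
   using C1_pos_measurable[OF K0_C1] measurable_area_continuous[OF w] by auto
  show ?thesis unfolding f0_def[abs_def] by measurable
 qed
 have flim: "AE x in area_S2. (\<lambda>n. f (t n) x) \<longlonglongrightarrow> f0 x"
  using AE_area_notin_range[of p] AE_space
 proof eventually_elim
  case (elim x)
  then have x: "x \<in> S2" by simp
  have "(\<lambda>n. conic_weight p (b (t n)) x) \<longlonglongrightarrow> conic_weight p b0 x"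
   unfolding conic_weight_def using elim by (intro tendsto_intros tendsto_vec_nth bt) auto
  then show ?case unfolding f_eq[OF x] f0_def by (intro tendsto_intros \<kappa>t Kt wt x)
 qed
 have fb: "\<bar>f (t n) x\<bar> \<le> G * cone_singularities p s x" if "x \<in> S2" for n x
  using N[OF tN[of n]] f_nonneg[OF that, of "t n"] that by simp
 have iG: "integrable area_S2 (\<lambda>x. G * cone_singularities p s x)"
  by (intro integrable_mult_right integrable_cone_singularities range_p s)
 note dom = f0m f_measurable iG flim AE_I2
 have i0: "integrable area_S2 f0" by (rule integrable_dominated_convergence[OF dom]) (use fb in simp)
 have "(\<lambda>n. \<ointegral>x. f (t n) x) \<longlonglongrightarrow> (\<ointegral>x. f0 x)"
  by (rule integral_dominated_convergence[OF dom]) (use fb in simp)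
 moreover have "(\<lambda>n. \<ointegral>x. f (t n) x) \<longlonglongrightarrow> total_mass b0"
  unfolding f_mass by (rule filterlim_compose[OF mass_tendsto ft])
 ultimately have I0: "(\<ointegral>x. f0 x) = total_mass b0" by (rule LIMSEQ_unique)
 have wp: "log_pot f0 x = w x" if x: "x \<in> S2" for x
 proof -
  have "(\<lambda>n. \<ointegral>y. f (t n) y * log_pot_kernel x y) \<longlonglongrightarrow> (\<ointegral>y. f0 y * log_pot_kernel x y)"
  proof (rule integral_dominated_convergence)
   show "integrable area_S2 (\<lambda>y. G * (2 powr (1 - s) / (1 - s)) * cone_singularities2 p s x y)"
    by (intro integrable_mult_right cone_singularities2_integral range_p x s)
   show "AE y in area_S2. (\<lambda>n. f (t n) y * log_pot_kernel x y) \<longlonglongrightarrow> f0 y * log_pot_kernel x y"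
    using flim by eventually_elim (intro tendsto_intros)
   show "AE y in area_S2. norm (f (t n) y * log_pot_kernel x y) \<le> G * (2 powr (1 - s) / (1 - s)) * cone_singularities2 p s x y" for n
   proof (rule AE_area_I)
    fix y assume y: "y \<in> S2"
    show "norm (f (t n) y * log_pot_kernel x y) \<le> G * (2 powr (1 - s) / (1 - s)) * cone_singularities2 p s x y"
     using log_pot_kernel_cone_singularities[OF s(1,2) x y f_nonneg[OF y] _ G0] fb[OF y, of n] f_nonneg[OF y, of "t n"] by simp
   qed
  qed measurable
  then have "(\<lambda>n. log_pot (f (t n)) x) \<longlonglongrightarrow> log_pot f0 x" unfolding log_pot_def by (intro tendsto_intros) auto
  then show ?thesis using wt[OF x] LIMSEQ_unique by blast
 qed
 \<comment> \<open>Positivity of the constants survives the limit because a vanishing constant would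
   make \<open>f0\<close> zero, against its positive mass.\<close>
 have "\<kappa>0 \<noteq> 0"
 proof
  assume "\<kappa>0 = 0"
  then have "(\<ointegral>x. f0 x) = 0" by (simp add: f0_def)
  then show False using I0 mass by simp
 qed
 then have "potential_form p K0 b0 \<kappa>0 f0"
  using \<kappa>0 i0 I0 wp by (auto simp: potential_form_def f0_def)
 then show ?thesis by blast
qed

end

section \<open>Contradiction from solvable data converging to unsolvable data\<close>

theorem theorem1p2:
  fixes p :: "'m::finite \<Rightarrow> real^3" and K :: "real^3 \<Rightarrow> real" and \<beta> :: "real^'m"
  assumes "inj p" and "range p \<subseteq> S2"
    and "K \<in> C1_pos_S2"
    and "\<beta> \<in> A_set"
    and "\<not> (\<exists>u. liouville_solution p K \<beta> u)"
  shows "\<exists>U. openin (prod_topology C1_topology (top_of_set {\<gamma> :: real^'m. \<forall>i. \<gamma> $ i > -1})) U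
    \<and> (K, \<beta>) \<in> U
    \<and> (\<forall>(K', \<beta>') \<in> U. \<not> (\<exists>u. liouville_solution p K' \<beta>' u))"
proof (rule ccontr)
 assume neg: "\<not> ?thesis"
 note p = assms(1,2)
 have KC: "K \<in> C1_S2" and Kp: "\<And>x. x \<in> S2 \<Longrightarrow> K x > 0" using assms(3) by (auto simp: C1_pos_S2_def)
 have \<beta>gt: "\<beta> $ i > -1" for i using assms(4) by (simp add: A_set_def)
 have mass: "total_mass \<beta> > 0"
 proof -
  have "total_mass \<beta> = 2 * pi * chi_S2 \<beta>" by (simp add: total_mass_def chi_S2_def algebra_simps)
  moreover have "chi_S2 \<beta> > 0" using assms(4) by (simp add: A_set_def)
  ultimately show ?thesis by simp
 qed
 have nosol: "\<not> potential_form p K \<beta> \<kappa> f" for \<kappa> f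
 proof
  assume pf: "potential_form p K \<beta> \<kappa> f"
  from potential_form_log_pot_bounded[OF p assms(3) \<beta>gt pf]
  obtain W where W: "\<And>x. x \<in> S2 \<Longrightarrow> log_pot f x \<le> W" by blast
  have "\<exists>u. liouville_solution p K \<beta> u"
  proof (rule solution_of_potential_form[OF p(2) C1_pos_measurable[OF assms(3)] Kp pf])
   show "\<bar>log_pot f x\<bar> \<le> W" if "x \<in> S2" for x
    using W[OF that] log_pot_nonneg[OF potential_form_nonneg[OF pf Kp] that] by simp
  qed
  then show False using assms(5) by contradiction
 qed
 interpret M: Metric_space C1_S2 C1_dist by (rule Metric_space_C1_S2)
 obtain x1 where x1: "x1 \<in> S2" "\<And>x. x \<in> S2 \<Longrightarrow> K x1 \<le> K x"
  using continuous_attains_inf[OF _ S2_nonempty continuous_on_C1_S2(1)[OF KC]] by auto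
 have "\<exists>K' \<beta>' \<kappa> f. K' \<in> C1_pos_S2 \<and> C1_dist K' K < inverse (real (Suc n)) \<and> dist \<beta>' \<beta> < inverse (real (Suc n)) \<and> (\<forall>i. \<beta>' $ i > -1)
   \<and> potential_form p K' \<beta>' \<kappa> f" for n
 proof -
  \<comment> \<open>\<open>K x1\<close> is the minimum of \<open>K\<close>, so functions closer to
    \<open>K\<close> than this remain positive. The neighbourhood lives in the space of all C1
    functions, and its size alone secures positivity.\<close>
  define e where "e = min (inverse (real (Suc n))) (K x1)"
  have e: "e > 0" "e \<le> inverse (real (Suc n))" "e \<le> K x1" using Kp[OF x1(1)] by (auto simp: e_def)
  define U where "U = M.mball K e \<times> ({\<gamma> :: real^'m. \<forall>i. \<gamma> $ i > -1} \<inter> ball \<beta> e)"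
  have "openin (prod_topology C1_topology (top_of_set {\<gamma> :: real^'m. \<forall>i. \<gamma> $ i > -1})) U"
   unfolding U_def openin_prod_Times_iff C1_topology_def by (auto intro: openin_open_Int)
  moreover have "(K, \<beta>) \<in> U" using KC e(1) \<beta>gt by (simp add: U_def)
  ultimately obtain K' \<beta>' u where U: "(K', \<beta>') \<in> U" and u: "liouville_solution p K' \<beta>' u" using neg by blast
  have K': "K' \<in> C1_S2" "C1_dist K' K < e" using U by (auto simp: U_def M.commute)
  have b': "dist \<beta>' \<beta> < e" "\<forall>i. \<beta>' $ i > -1" using U by (auto simp: U_def dist_commute)
  have "K' x > 0" if x: "x \<in> S2" for x
   using C1_dist_upper(1)[OF K'(1) KC x] K'(2) e(3) x1(2)[OF x] by linarith
  then have K'p: "K' \<in> C1_pos_S2" using K'(1) by (simp add: C1_pos_S2_def)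
  from potential_form_of_solution[OF p(2) C1_pos_measurable[OF K'p] u]
  show ?thesis using K'p K'(2) b' e(2) by (meson less_le_trans)
 qed
 \<comment> \<open>Function, exponents, constant and density are packed into one tuple, so that a
   single choice produces all four sequences.\<close>
 then have "\<forall>n. \<exists>z. fst z \<in> C1_pos_S2 \<and> C1_dist (fst z) K < inverse (real (Suc n)) \<and> dist (fst (snd z)) \<beta> < inverse (real (Suc n))
   \<and> (\<forall>i. fst (snd z) $ i > -1) \<and> potential_form p (fst z) (fst (snd z)) (fst (snd (snd z))) (snd (snd (snd z)))" by simp
 from choice[OF this] obtain z where "\<forall>n. fst (z n) \<in> C1_pos_S2 \<and> C1_dist (fst (z n)) K < inverse (real (Suc n))
   \<and> dist (fst (snd (z n))) \<beta> < inverse (real (Suc n)) \<and> (\<forall>i. fst (snd (z n)) $ i > -1)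
   \<and> potential_form p (fst (z n)) (fst (snd (z n))) (fst (snd (snd (z n)))) (snd (snd (snd (z n))))" by (elim exE)
 then have z: "\<And>n. fst (z n) \<in> C1_pos_S2" "\<And>n. C1_dist (fst (z n)) K < inverse (real (Suc n))"
  "\<And>n. dist (fst (snd (z n))) \<beta> < inverse (real (Suc n))" "\<And>n i. fst (snd (z n)) $ i > -1"
  "\<And>n. potential_form p (fst (z n)) (fst (snd (z n))) (fst (snd (snd (z n)))) (snd (snd (snd (z n))))" by simp_all
 have Kl: "(\<lambda>n. C1_dist (fst (z n)) K) \<longlonglongrightarrow> 0"
  by (rule Lim_null_comparison[OF _ LIMSEQ_inverse_real_of_nat]) (use z(2) M.nonneg in \<open>auto simp: less_imp_le\<close>)
 have "(\<lambda>n. dist (fst (snd (z n))) \<beta>) \<longlonglongrightarrow> 0"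
  by (rule Lim_null_comparison[OF _ LIMSEQ_inverse_real_of_nat]) (use z(3) in \<open>auto simp: less_imp_le\<close>)
 then have bl: "(\<lambda>n. fst (snd (z n))) \<longlonglongrightarrow> \<beta>" by (rule iffD2[OF tendsto_dist_iff])
 interpret S: liouville_sequence p "\<lambda>n. fst (z n)" "\<lambda>n. fst (snd (z n))" "\<lambda>n. fst (snd (snd (z n)))" "\<lambda>n. snd (snd (snd (z n)))" K \<beta>
  by unfold_locales (use p assms(3) z(1,4,5) Kl bl \<beta>gt in auto)
 from S.subsequence_concentrates obtain s where s: "strict_mono s"
  and ex: "\<forall>x. \<exists>\<sigma>\<ge>0. concentrates (\<lambda>k. snd (snd (snd (z (s k))))) x \<sigma>" by (elim exE conjE)
 from choice[OF ex] obtain \<sigma> where \<sigma>: "concentrates (\<lambda>k. snd (snd (snd (z (s k))))) x (\<sigma> x)" for x by auto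
 interpret L: liouville_sequence p "\<lambda>n. fst (z (s n))" "\<lambda>n. fst (snd (z (s n)))" "\<lambda>n. fst (snd (snd (z (s n))))"
  "\<lambda>n. snd (snd (snd (z (s n))))" K \<beta> by (rule S.subsequence[OF s])
 show False
 proof (cases "\<exists>x\<in>S2. \<sigma> x \<noteq> 0")
  case True
  then show False using L.mass_of_atoms[OF \<sigma>] A_set_not_atomic[OF p(1) assms(4)] by blast
 next
  case False
  then have "concentrates (\<lambda>k. snd (snd (snd (z (s k))))) x 0" if "x \<in> S2" for x using \<sigma>[of x] that by simp
  from L.limit_potential_form[OF this mass] show False using nosol by blast
 qed
qed

end
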